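(* Let $M$ be a compact Riemannian manifold of dimension $k$ and let $W_r:M\times M\to[0,\infty)$ be the graphon $W_r(x,y)=r^{-k}K(\mathrm{dist}(x,y)/r)$ with kernel $K(t)=1$ for $0\le t\le1$ and $K(t)=0$ for $t>1$. Then, $$\lim_{r\to0^+}\frac{r_m(W_r)}{r^{k-1}}=r_m(M)\ \ (m\ge2)\qquad\text{and}\qquad\lim_{r\to0^+}r^{k-1}\lambda_m\big((W_r)_{\infty,\infty}\big)=\lambda_m(M_{\infty,\infty})\ \ (m\ge1).$$
   Context: $M$ is smooth and closed, with geodesic distance $\mathrm{dist}$ and Riemannian volume measure $\mathrm{vol}$. For a graphon $W$ on $(M,\mathrm{vol})$ put $\mathrm{dist}_W(x,y)=\mathrm{essinf}\sum_{i=0}^{n-1}\frac1{W(x_i,x_{i+1})}$ over $n\ge1$ and $x_0,\dots,x_n\in M$ with $x_0=x$, $x_n=y$ (essential infimum over the intermediate points for each $n$, then infimum over $n$; $1/0=\infty$), and for $m\ge2$ the $m$-th packing radius $$r_m(W)=\inf_{\mathrm{vol}(Z)=0}\sup\big\{\rho\ge0:\exists\,x_1,\dots,x_m\in M\setminus Z\text{ with }\mathrm{dist}_W(x_i,x_j)\ge2\rho\ \forall i\neq j\big\}.$$ $r_m(M)$ is the $m$-th sphere packing radius of $M$: the supremum of $\rho\ge0$ for which there are $x_1,\dots,x_m\in M$ with $\mathrm{dist}(x_i,x_j)\ge2\rho$ for all $i\ne j$. $\mathcal R_{\infty,W}(f)=\mathrm{esssup}_{x,y}W(x,y)|f(x)-f(y)|/\|f\|_\infty$,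 $\lambda_m(W_{\infty,\infty})=\inf_{S\subset L^\infty(M):\,\mathrm{genus}(S)\ge m}\sup_{f\in S}\mathcal R_{\infty,W}(f)$, and $\lambda_m(M_{\infty,\infty})=\inf_{S\subset W^{1,\infty}(M):\,\mathrm{genus}(S)\ge m}\sup_{f\in S}\|\nabla f\|_\infty/\|f\|_\infty$, where $S$ ranges over nonempty closed origin-symmetric subsets (not containing $0$) and $\mathrm{genus}(S)$ is the Krasnoselskii genus, the least $j\in\mathbb Z^+$ for which there is an odd continuous map $S\to\mathbb R^j\setminus\{0\}$. *)

theory Defs
  imports
    "HOL-Analysis.Analysis"
    "HOL-Probability.Essential_Supremum"
    "HOL-Library.Extended_Nat"
begin

section \<open>Closed Riemannian manifolds\<close>

fun Ck_on :: "nat \<Rightarrow> ('a::euclidean_space \<Rightarrow> 'b::real_normed_vector) \<Rightarrow> 'a set \<Rightarrow> bool" where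
  "Ck_on 0 f S \<longleftrightarrow> continuous_on S f"
| "Ck_on (Suc n) f S \<longleftrightarrow>
     f differentiable_on S \<and> (\<forall>b\<in>Basis. Ck_on n (\<lambda>x. frechet_derivative f (at x) b) S)"

text \<open>Only used for open \<open>S\<close>.\<close>

definition smooth_on :: "'a set \<Rightarrow> ('a::euclidean_space \<Rightarrow> 'b::real_normed_vector) \<Rightarrow> bool" where
  "smooth_on S f \<longleftrightarrow> (\<forall>n. Ck_on n f S)"

text \<open>A chart is a pair of its domain and its coordinate map; the values of the coordinate map
  off the domain are irrelevant.\<close>

type_synonym ('a, 'k) chart = "'a set \<times> ('a \<Rightarrow> real ^ 'k)"

definition chart_image :: "('a, 'k::finite) chart \<Rightarrow> (real ^ 'k) set" where
  "chart_image c = snd c ` fst c"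

definition chart_inv :: "('a, 'k::finite) chart \<Rightarrow> real ^ 'k \<Rightarrow> 'a" where
  "chart_inv c = inv_into (fst c) (snd c)"

definition transition :: "('a, 'k::finite) chart \<Rightarrow> ('a, 'k) chart \<Rightarrow> real ^ 'k \<Rightarrow> real ^ 'k" where
  "transition c d = snd d \<circ> chart_inv c"

definition transition_jacobian ::
    "('a, 'k::finite) chart \<Rightarrow> ('a, 'k) chart \<Rightarrow> 'a \<Rightarrow> real ^ 'k ^ 'k" where
  "transition_jacobian c d p = jacobian (transition c d) (at (snd c p))"

text \<open>The manifold is the whole type \<open>'a\<close>. The atlas need not be maximal.\<close>

definition smooth_atlas ::
    "('a::{t2_space, second_countable_topology}, 'k::finite) chart set \<Rightarrow> bool" where
  "smooth_atlas A \<longleftrightarrow>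
     (\<forall>c\<in>A. open (fst c) \<and> open (chart_image c) \<and>
        homeomorphism (fst c) (chart_image c) (snd c) (chart_inv c)) \<and>
     (\<Union>c\<in>A. fst c) = UNIV \<and>
     (\<forall>c\<in>A. \<forall>d\<in>A. smooth_on (snd c ` (fst c \<inter> fst d)) (transition c d))"

text \<open>A tensor field on the manifold is given by its components: \<open>g c p\<close> is the matrix of the
  inner product on the tangent space at \<open>p\<close> in the coordinate basis of the chart \<open>c\<close>.\<close>

type_synonym ('a, 'k) metric_tensor = "('a, 'k) chart \<Rightarrow> 'a \<Rightarrow> real ^ 'k ^ 'k"

definition riemannian_metric ::
    "('a, 'k::finite) chart set \<Rightarrow> ('a, 'k) metric_tensor \<Rightarrow> bool" where
  "riemannian_metric A g \<longleftrightarrow>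
     (\<forall>c\<in>A. smooth_on (chart_image c) (g c \<circ> chart_inv c)) \<and>
     (\<forall>c\<in>A. \<forall>p\<in>fst c. transpose (g c p) = g c p \<and> (\<forall>v. v \<noteq> 0 \<longrightarrow> v \<bullet> (g c p *v v) > 0)) \<and>
     (\<forall>c\<in>A. \<forall>d\<in>A. \<forall>p\<in>fst c \<inter> fst d.
        g c p = transpose (transition_jacobian c d p) ** g d p ** transition_jacobian c d p)"

definition closed_riemannian_manifold ::
    "('a::{t2_space, second_countable_topology}, 'k::finite) chart set
      \<Rightarrow> ('a, 'k) metric_tensor \<Rightarrow> bool" where
  "closed_riemannian_manifold A g \<longleftrightarrow>
     compact (UNIV :: 'a set) \<and> smooth_atlas A \<and> riemannian_metric A g"

text \<open>Norms of vectors and covectors at \<open>p\<close> do not depend on the chart in which they are computed,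
  so any chart around \<open>p\<close> will do.\<close>

definition chart_at :: "('a, 'k::finite) chart set \<Rightarrow> 'a \<Rightarrow> ('a, 'k) chart" where
  "chart_at A p = (SOME c. c \<in> A \<and> p \<in> fst c)"

text \<open>As in the library's \<^const>\<open>piecewise_C1_differentiable_on\<close>, the finite exceptional set may
  include the end points.\<close>

definition piecewise_C1_curve ::
    "('a::topological_space, 'k::finite) chart set \<Rightarrow> (real \<Rightarrow> 'a) \<Rightarrow> bool" where
  "piecewise_C1_curve A \<gamma> \<longleftrightarrow>
     continuous_on {0..1} \<gamma> \<and>
     (\<exists>T. finite T \<and>
        (\<forall>c\<in>A. (snd c \<circ> \<gamma>) C1_differentiable_on {t \<in> {0..1} - T. \<gamma> t \<in> fst c}))"

definition speed ::
    "('a, 'k::finite) chart set \<Rightarrow> ('a, 'k) metric_tensor \<Rightarrow> (real \<Rightarrow> 'a) \<Rightarrow> real \<Rightarrow> real" where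
  "speed A g \<gamma> t =
     (let c = chart_at A (\<gamma> t); v = vector_derivative (snd c \<circ> \<gamma>) (at t)
      in sqrt (v \<bullet> (g c (\<gamma> t) *v v)))"

definition curve_length ::
    "('a, 'k::finite) chart set \<Rightarrow> ('a, 'k) metric_tensor \<Rightarrow> (real \<Rightarrow> 'a) \<Rightarrow> ennreal" where
  "curve_length A g \<gamma> = (\<integral>\<^sup>+ t\<in>{0..1}. ennreal (speed A g \<gamma> t) \<partial>lborel)"

text \<open>Extended-valued: the distance between different connected components is \<open>\<infinity>\<close>.\<close>

definition geodesic_dist ::
    "('a::topological_space, 'k::finite) chart set \<Rightarrow> ('a, 'k) metric_tensor
      \<Rightarrow> 'a \<Rightarrow> 'a \<Rightarrow> ennreal" where
  "geodesic_dist A g x y =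
     (INF \<gamma>\<in>{\<gamma>. piecewise_C1_curve A \<gamma> \<and> \<gamma> 0 = x \<and> \<gamma> 1 = y}. curve_length A g \<gamma>)"

text \<open>The Riemannian volume is the unique Borel measure with density \<open>sqrt (det g)\<close>
  in every chart.\<close>

definition riemannian_volume ::
    "('a::topological_space, 'k::finite) chart set \<Rightarrow> ('a, 'k) metric_tensor
      \<Rightarrow> 'a measure \<Rightarrow> bool" where
  "riemannian_volume A g vol \<longleftrightarrow>
     sets vol = sets borel \<and>
     (\<forall>c\<in>A. \<forall>B\<in>sets borel. B \<subseteq> fst c \<longrightarrow>
        emeasure vol B =
          (\<integral>\<^sup>+ u\<in>snd c ` B. ennreal (sqrt (det (g c (chart_inv c u)))) \<partial>lborel))"


section \<open>The spaces \<open>L\<^sup>\<infinity>\<close> and \<open>W\<^sup>1\<^sup>,\<^sup>\<infinity>\<close>\<close>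

text \<open>Elements are functions rather than classes modulo equality almost everywhere; the topologies
  below do not separate almost everywhere equal functions. Hence closed sets are saturated, in
  particular a closed set without the zero function contains no function vanishing almost
  everywhere, and continuous maps into Hausdorff spaces factor through the classes.\<close>

definition Linf_norm :: "'a measure \<Rightarrow> ('a \<Rightarrow> real) \<Rightarrow> ennreal" where
  "Linf_norm M f = esssup M (\<lambda>x. ennreal \<bar>f x\<bar>)"

definition Linf :: "'a measure \<Rightarrow> ('a \<Rightarrow> real) set" where
  "Linf M = {f \<in> borel_measurable M. Linf_norm M f < \<infinity>}"

definition seminorm_topology ::
    "('a \<Rightarrow> real) set \<Rightarrow> (('a \<Rightarrow> real) \<Rightarrow> ennreal) \<Rightarrow> ('a \<Rightarrow> real) topology" where
  "seminorm_topology V N =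
     topology (\<lambda>U. U \<subseteq> V \<and>
       (\<forall>f\<in>U. \<exists>e>0. \<forall>h\<in>V. N (\<lambda>x. h x - f x) < ennreal e \<longrightarrow> h \<in> U))"

lemma openin_seminorm_topology:
  "openin (seminorm_topology V N) U \<longleftrightarrow>
     U \<subseteq> V \<and> (\<forall>f\<in>U. \<exists>e>0. \<forall>h\<in>V. N (\<lambda>x. h x - f x) < ennreal e \<longrightarrow> h \<in> U)"
proof -
  let ?P = "\<lambda>U. U \<subseteq> V \<and> (\<forall>f\<in>U. \<exists>e>0. \<forall>h\<in>V. N (\<lambda>x. h x - f x) < ennreal e \<longrightarrow> h \<in> U)"
  have "istopology ?P"
    unfolding istopology_def
  proof (intro conjI allI impI)
    fix S T assume S: "?P S" and T: "?P T"
    show "S \<inter> T \<subseteq> V" using S by blast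
    show "\<forall>f\<in>S \<inter> T. \<exists>e>0. \<forall>h\<in>V. N (\<lambda>x. h x - f x) < ennreal e \<longrightarrow> h \<in> S \<inter> T"
    proof
      fix f assume f: "f \<in> S \<inter> T"
      obtain d where d: "d > 0" "\<forall>h\<in>V. N (\<lambda>x. h x - f x) < ennreal d \<longrightarrow> h \<in> S"
        using S f by blast
      obtain e where e: "e > 0" "\<forall>h\<in>V. N (\<lambda>x. h x - f x) < ennreal e \<longrightarrow> h \<in> T"
        using T f by blast
      have "ennreal (min d e) \<le> ennreal d" "ennreal (min d e) \<le> ennreal e"
        by (auto intro: ennreal_leI)
      then have "\<forall>h\<in>V. N (\<lambda>x. h x - f x) < ennreal (min d e) \<longrightarrow> h \<in> S \<inter> T"
        using d(2) e(2) by (meson IntI order_less_le_trans)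
      then show "\<exists>e>0. \<forall>h\<in>V. N (\<lambda>x. h x - f x) < ennreal e \<longrightarrow> h \<in> S \<inter> T"
        using d(1) e(1) by (intro exI[of _ "min d e"]) auto
    qed
  next
    fix K assume K: "\<forall>U\<in>K. ?P U"
    show "\<Union>K \<subseteq> V" using K by blast
    show "\<forall>f\<in>\<Union>K. \<exists>e>0. \<forall>h\<in>V. N (\<lambda>x. h x - f x) < ennreal e \<longrightarrow> h \<in> \<Union>K"
      using K by (meson UnionE UnionI)
  qed
  then show ?thesis
    unfolding seminorm_topology_def by (simp add: topology_inverse')
qed

definition Linf_topology :: "'a measure \<Rightarrow> ('a \<Rightarrow> real) topology" where
  "Linf_topology M = seminorm_topology (Linf M) (Linf_norm M)"

definition test_function :: "'v set \<Rightarrow> ('v::euclidean_space \<Rightarrow> real) \<Rightarrow> bool" where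
  "test_function \<Omega> \<psi> \<longleftrightarrow>
     smooth_on UNIV \<psi> \<and> (\<exists>C. compact C \<and> C \<subseteq> \<Omega> \<and> (\<forall>u. u \<notin> C \<longrightarrow> \<psi> u = 0))"

definition weak_gradient_on ::
    "(real ^ 'k::finite) set \<Rightarrow> (real ^ 'k \<Rightarrow> real) \<Rightarrow> (real ^ 'k \<Rightarrow> real ^ 'k) \<Rightarrow> bool" where
  "weak_gradient_on \<Omega> F G \<longleftrightarrow>
     (\<forall>C. compact C \<longrightarrow> C \<subseteq> \<Omega> \<longrightarrow> set_integrable lborel C F \<and> set_integrable lborel C G) \<and>
     (\<forall>\<psi>. test_function \<Omega> \<psi> \<longrightarrow>
        (\<forall>i. (LINT u:\<Omega>|lborel. F u * frechet_derivative \<psi> (at u) (axis i 1)) =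
             - (LINT u:\<Omega>|lborel. G u $ i * \<psi> u)))"

text \<open>The weak differential is a covector field: \<open>D c p\<close> lists the components in the chart \<open>c\<close>,
  and they transform by the transposed Jacobian.\<close>

type_synonym ('a, 'k) covector_field = "('a, 'k) chart \<Rightarrow> 'a \<Rightarrow> real ^ 'k"

definition is_weak_differential ::
    "('a, 'k::finite) chart set \<Rightarrow> ('a \<Rightarrow> real) \<Rightarrow> ('a, 'k) covector_field \<Rightarrow> bool" where
  "is_weak_differential A f D \<longleftrightarrow>
     (\<forall>c\<in>A. weak_gradient_on (chart_image c) (f \<circ> chart_inv c) (D c \<circ> chart_inv c)) \<and>
     (\<forall>c\<in>A. \<forall>d\<in>A. \<forall>p\<in>fst c \<inter> fst d.
        D c p = transpose (transition_jacobian c d p) *v D d p)"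

definition weak_differential ::
    "('a, 'k::finite) chart set \<Rightarrow> ('a \<Rightarrow> real) \<Rightarrow> ('a, 'k) covector_field" where
  "weak_differential A f = (SOME D. is_weak_differential A f D)"

text \<open>The length of the gradient \<open>g\<^sup>-\<^sup>1 D\<close> with respect to \<open>g\<close> is the dual norm of \<open>D\<close>.\<close>

definition covector_norm ::
    "('a, 'k::finite) chart set \<Rightarrow> ('a, 'k) metric_tensor \<Rightarrow> ('a, 'k) covector_field
      \<Rightarrow> 'a \<Rightarrow> real" where
  "covector_norm A g D p =
     (let c = chart_at A p in sqrt (D c p \<bullet> (matrix_inv (g c p) *v D c p)))"

definition gradient_Linf_norm ::
    "('a, 'k::finite) chart set \<Rightarrow> ('a, 'k) metric_tensor \<Rightarrow> 'a measure \<Rightarrow> ('a \<Rightarrow> real)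
      \<Rightarrow> ennreal" where
  "gradient_Linf_norm A g vol f = Linf_norm vol (covector_norm A g (weak_differential A f))"

definition W1inf ::
    "('a, 'k::finite) chart set \<Rightarrow> ('a, 'k) metric_tensor \<Rightarrow> 'a measure \<Rightarrow> ('a \<Rightarrow> real) set" where
  "W1inf A g vol =
     {f \<in> Linf vol. (\<exists>D. is_weak_differential A f D) \<and> gradient_Linf_norm A g vol f < \<infinity>}"

definition W1inf_topology ::
    "('a, 'k::finite) chart set \<Rightarrow> ('a, 'k) metric_tensor \<Rightarrow> 'a measure
      \<Rightarrow> ('a \<Rightarrow> real) topology" where
  "W1inf_topology A g vol =
     seminorm_topology (W1inf A g vol) (\<lambda>f. Linf_norm vol f + gradient_Linf_norm A g vol f)"


section \<open>Krasnoselskii genus and variational eigenvalues\<close>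

text \<open>The genus is \<open>\<infinity>\<close> if there is no odd continuous map into any punctured Euclidean space.\<close>

definition genus :: "('a \<Rightarrow> real) topology \<Rightarrow> ('a \<Rightarrow> real) set \<Rightarrow> enat" where
  "genus X S =
     (INF j\<in>{j. 1 \<le> j \<and>
        (\<exists>\<phi>. continuous_map (subtopology X S) (subtopology (Euclidean_space j) (- {\<lambda>_. 0})) \<phi> \<and>
           (\<forall>f\<in>S. \<phi> (\<lambda>x. - f x) = (\<lambda>i. - \<phi> f i)))}. enat j)"

definition variational_eigenvalue ::
    "('a \<Rightarrow> real) topology \<Rightarrow> (('a \<Rightarrow> real) \<Rightarrow> ennreal) \<Rightarrow> nat \<Rightarrow> ennreal" where
  "variational_eigenvalue X R m =
     (INF S\<in>{S. S \<noteq> {} \<and> closedin X S \<and> (\<forall>f\<in>S. (\<lambda>x. - f x) \<in> S) \<and> (\<lambda>_. 0) \<notin> S \<and>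
        enat m \<le> genus X S}. SUP f\<in>S. R f)"

definition graphon_rayleigh ::
    "'a measure \<Rightarrow> ('a \<Rightarrow> 'a \<Rightarrow> real) \<Rightarrow> ('a \<Rightarrow> real) \<Rightarrow> ennreal" where
  "graphon_rayleigh vol W f =
     esssup (vol \<Otimes>\<^sub>M vol) (\<lambda>(x, y). ennreal (W x y * \<bar>f x - f y\<bar>)) / Linf_norm vol f"

definition graphon_eigenvalue :: "'a measure \<Rightarrow> ('a \<Rightarrow> 'a \<Rightarrow> real) \<Rightarrow> nat \<Rightarrow> ennreal" where
  "graphon_eigenvalue vol W m =
     variational_eigenvalue (Linf_topology vol) (graphon_rayleigh vol W) m"

definition manifold_eigenvalue ::
    "('a, 'k::finite) chart set \<Rightarrow> ('a, 'k) metric_tensor \<Rightarrow> 'a measure \<Rightarrow> nat \<Rightarrow> ennreal" where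
  "manifold_eigenvalue A g vol m =
     variational_eigenvalue (W1inf_topology A g vol)
       (\<lambda>f. gradient_Linf_norm A g vol f / Linf_norm vol f) m"


section \<open>Packing radii\<close>

text \<open>\<^term>\<open>Liminf (ae_filter M)\<close> is the essential infimum, just as \<^const>\<open>esssup\<close> is
  \<^term>\<open>Limsup (ae_filter M)\<close>. In \<^typ>\<open>ennreal\<close>, \<open>inverse 0 = \<infinity>\<close>. For \<open>n = 1\<close> there are no
  intermediate points, and the product measure is the unit point mass.\<close>

definition graphon_dist :: "'a measure \<Rightarrow> ('a \<Rightarrow> 'a \<Rightarrow> real) \<Rightarrow> 'a \<Rightarrow> 'a \<Rightarrow> ennreal" where
  "graphon_dist vol W x y =
     (INF n\<in>{1..}. Liminf (ae_filter (Pi\<^sub>M {1..<n} (\<lambda>_. vol)))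
        (\<lambda>z. let p = z(0 := x, n := y) in \<Sum>i<n. inverse (ennreal (W (p i) (p (Suc i))))))"

definition graphon_packing_radius ::
    "'a measure \<Rightarrow> ('a \<Rightarrow> 'a \<Rightarrow> real) \<Rightarrow> nat \<Rightarrow> ennreal" where
  "graphon_packing_radius vol W m =
     (INF Z\<in>null_sets vol. SUP \<rho>\<in>{\<rho>::real. 0 \<le> \<rho> \<and>
        (\<exists>x. (\<forall>i<m. x i \<notin> Z) \<and>
           (\<forall>i<m. \<forall>j<m. i \<noteq> j \<longrightarrow> ennreal (2 * \<rho>) \<le> graphon_dist vol W (x i) (x j)))}. ennreal \<rho>)"

definition sphere_packing_radius ::
    "('a::topological_space, 'k::finite) chart set \<Rightarrow> ('a, 'k) metric_tensor
      \<Rightarrow> nat \<Rightarrow> ennreal" where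
  "sphere_packing_radius A g m =
     (SUP \<rho>\<in>{\<rho>::real. 0 \<le> \<rho> \<and>
        (\<exists>x. \<forall>i<m. \<forall>j<m. i \<noteq> j \<longrightarrow> ennreal (2 * \<rho>) \<le> geodesic_dist A g (x i) (x j))}. ennreal \<rho>)"


section \<open>Geometric graphons\<close>

definition unit_kernel :: "ennreal \<Rightarrow> real" where
  "unit_kernel t = (if t \<le> 1 then 1 else 0)"

definition geometric_graphon ::
    "('a::topological_space, 'k::finite) chart set \<Rightarrow> ('a, 'k) metric_tensor
      \<Rightarrow> real \<Rightarrow> 'a \<Rightarrow> 'a \<Rightarrow> real" where
  "geometric_graphon A g r x y =
     1 / r ^ CARD('k) * unit_kernel (geodesic_dist A g x y / ennreal r)"

end

(* A path of n steps of the graphon W_r has cost n r^k if all its steps have length at most r, and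
   infinite cost otherwise; hence r^(k-1) dist <= dist_W <= r^(k-1) (dist + r), which settles the
   packing radii.  Null sets do no harm because balls have positive volume.

   For the eigenvalues, an L^infinity function has graphon Rayleigh quotient at most K / r^(k-1) iff,
   after normalisation, |f x - f y| <= K r for almost all x, y at distance at most r, whereas a
   W^{1,infinity} function has gradient bounded by K iff it is K-Lipschitz off a null set (mollified
   difference quotients in one direction, Rademacher's theorem in the other).  Normalisation thus
   maps competitors for lambda_m(M) to competitors for the graphon, for every r.  Conversely,
   chaining short steps shows that a competitor for the graphon is within O(K r) of a K-Lipschitz
   function; a partition of unity over a finite net turns this approximation into an odd continuous
   map into W^{1,infinity}, at the price of a factor 1 - O(r). *)

theory Submission
  imports Defs "HOL-Computational_Algebra.Polynomial"
begin

section \<open>Curves and the geodesic distance\<close>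

text \<open>Two obstacles shape the proof. As \<delta> is arbitrary, gradient bounds and Lipschitz
  bounds translate into each other with the same K; a merely comparable constant would spoil the
  limit. Topologically, the genus is transported only by odd maps that are continuous into
  W^{1,infinity}, and a Lipschitz extension need not depend on the function in such a way. Averages
  over a finite net lie in a finite-dimensional space, where continuity of the coefficients
  suffices, and antisymmetrising the coefficients makes the map odd. The error (6 K + 2) r consists
  of 2 K r for the Lipschitz approximation and of the support radius 4 K r + 2 r of the weights. In
  both directions the competitor is not the image of the given set but a whole closed sublevel set
  containing this image, so that no image has to be shown closed.\<close>

definition C1_at :: "('a::topological_space, 'k::finite) chart set \<Rightarrow> (real \<Rightarrow> 'a) \<Rightarrow> real \<Rightarrow> bool" where
  "C1_at A \<gamma> t \<longleftrightarrow> isCont \<gamma> t \<and>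
     (\<forall>c\<in>A. \<gamma> t \<in> fst c \<longrightarrow> (snd c \<circ> \<gamma>) differentiable (at t) \<and>
        isCont (\<lambda>s. vector_derivative (snd c \<circ> \<gamma>) (at s)) t)"

definition seglen ::
  "('a, 'k::finite) chart set \<Rightarrow> ('a, 'k) metric_tensor \<Rightarrow> (real \<Rightarrow> 'a) \<Rightarrow> real \<Rightarrow> real \<Rightarrow> ennreal" where
  "seglen A g \<gamma> a b = (\<integral>\<^sup>+ t\<in>{a..b}. ennreal (speed A g \<gamma> t) \<partial>lborel)"

lemma vector_derivative_cong_open:
  fixes f h :: "real \<Rightarrow> 'b::real_normed_vector"
  assumes "open I" "t \<in> I" "\<And>s. s \<in> I \<Longrightarrow> f s = h s"
  shows "vector_derivative f (at t) = vector_derivative h (at t)"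
    and "f differentiable (at t) \<longleftrightarrow> h differentiable (at t)"
proof -
  have *: "(f has_vector_derivative D) (at t) \<longleftrightarrow> (h has_vector_derivative D) (at t)" for D
    using has_vector_derivative_transform_within_open[OF _ assms(1,2), of f D h]
      has_vector_derivative_transform_within_open[OF _ assms(1,2), of h D f] assms(3) by metis
  then show "vector_derivative f (at t) = vector_derivative h (at t)"
    by (simp add: vector_derivative_def)
  from * show "f differentiable (at t) \<longleftrightarrow> h differentiable (at t)"
    by (metis differentiableI_vector vector_derivative_works)
qed

lemma isCont_cong_open:
  assumes "open I" "t \<in> I" "\<And>s. s \<in> I \<Longrightarrow> f s = h s"
  shows "isCont f t \<longleftrightarrow> isCont h t"
  by (rule isCont_cong) (use assms in \<open>auto simp: eventually_nhds\<close>)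

lemma C1_at_cong:
  assumes "open I" "t \<in> I" "\<And>s. s \<in> I \<Longrightarrow> \<gamma> s = \<sigma> s"
  shows "C1_at A \<gamma> t \<longleftrightarrow> C1_at A \<sigma> t"
proof -
  have "isCont \<gamma> t \<longleftrightarrow> isCont \<sigma> t" by (rule isCont_cong_open[OF assms(1,2)]) (rule assms(3))
  moreover have "(snd c \<circ> \<gamma>) differentiable (at t) \<longleftrightarrow> (snd c \<circ> \<sigma>) differentiable (at t)" for c :: "('a,'b) chart"
    by (rule vector_derivative_cong_open[OF assms(1,2)]) (simp add: assms(3))
  moreover have "isCont (\<lambda>s. vector_derivative (snd c \<circ> \<gamma>) (at s)) t \<longleftrightarrow>
      isCont (\<lambda>s. vector_derivative (snd c \<circ> \<sigma>) (at s)) t" for c :: "('a,'b) chart"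
    by (rule isCont_cong_open[OF assms(1,2)], rule vector_derivative_cong_open[OF assms(1)])
       (simp_all add: assms(3))
  ultimately show ?thesis
    using assms(2,3) by (simp add: C1_at_def)
qed

lemma speed_cong:
  assumes "open I" "t \<in> I" "\<And>s. s \<in> I \<Longrightarrow> \<gamma> s = \<sigma> s"
  shows "speed A g \<gamma> t = speed A g \<sigma> t"
proof -
  have "vector_derivative (snd c \<circ> \<gamma>) (at t) = vector_derivative (snd c \<circ> \<sigma>) (at t)" for c :: "('a,'b) chart"
    by (rule vector_derivative_cong_open[OF assms(1,2)]) (simp add: assms(3))
  then show ?thesis using assms by (simp add: speed_def Let_def)
qed

lemma vector_derivative_affine:
  fixes f :: "real \<Rightarrow> 'b::real_normed_vector"
  assumes "f differentiable (at (a + b * t))"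
  shows "(f \<circ> (\<lambda>t. a + b * t)) differentiable (at t)"
    "vector_derivative (f \<circ> (\<lambda>t. a + b * t)) (at t) = b *\<^sub>R vector_derivative f (at (a + b * t))"
proof -
  have "((\<lambda>t. a + b * t) has_vector_derivative b) (at t)"
    by (auto intro!: derivative_eq_intros simp: has_real_derivative_iff_has_vector_derivative[symmetric])
  from vector_diff_chain_at[OF this assms[unfolded vector_derivative_works]]
  show "(f \<circ> (\<lambda>t. a + b * t)) differentiable (at t)"
    "vector_derivative (f \<circ> (\<lambda>t. a + b * t)) (at t) = b *\<^sub>R vector_derivative f (at (a + b * t))"
    by (auto intro: differentiableI_vector vector_derivative_at)
qed

section \<open>Charts, transition maps, the metric tensor and the speed of a curve\<close>

locale closed_manifold =
  fixes A :: "('a::{t2_space, second_countable_topology}, 'k::finite) chart set"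
    and g :: "('a, 'k) metric_tensor"
    and vol :: "'a measure"
  assumes manifold: "closed_riemannian_manifold A g"
    and volume: "riemannian_volume A g vol"
begin

lemma compact_UNIV: "compact (UNIV :: 'a set)"
  and atlas: "smooth_atlas A"
  and metric: "riemannian_metric A g"
  using manifold by (auto simp: closed_riemannian_manifold_def)

lemma open_dom: "c \<in> A \<Longrightarrow> open (fst c)"
  and open_image: "c \<in> A \<Longrightarrow> open (chart_image c)"
  and chart_homeo: "c \<in> A \<Longrightarrow> homeomorphism (fst c) (chart_image c) (snd c) (chart_inv c)"
  and transition_smooth: "c \<in> A \<Longrightarrow> e \<in> A \<Longrightarrow> smooth_on (snd c ` (fst c \<inter> fst e)) (transition c e)"
  using atlas by (auto simp: smooth_atlas_def)

lemma ex_chart: obtains c where "c \<in> A" "p \<in> fst c"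
  using atlas unfolding smooth_atlas_def by blast

lemma chart_at: "chart_at A p \<in> A" "p \<in> fst (chart_at A p)"
  using ex_chart[of p] someI[of "\<lambda>c. c \<in> A \<and> p \<in> fst c"] unfolding chart_at_def by metis+

lemma inv_chart [simp]: "c \<in> A \<Longrightarrow> p \<in> fst c \<Longrightarrow> chart_inv c (snd c p) = p"
  and chart_inv [simp]: "c \<in> A \<Longrightarrow> u \<in> chart_image c \<Longrightarrow> snd c (chart_inv c u) = u"
  and chart_inv_in: "c \<in> A \<Longrightarrow> u \<in> chart_image c \<Longrightarrow> chart_inv c u \<in> fst c"
  and chart_in: "c \<in> A \<Longrightarrow> p \<in> fst c \<Longrightarrow> snd c p \<in> chart_image c"
  and cont_chart: "c \<in> A \<Longrightarrow> continuous_on (fst c) (snd c)"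
  and cont_chart_inv: "c \<in> A \<Longrightarrow> continuous_on (chart_image c) (chart_inv c)"
  using chart_homeo unfolding homeomorphism_def by (blast | metis imageI)+

lemma open_vimage_chart_inv:
  assumes "c \<in> A" "open U" shows "open {u \<in> chart_image c. chart_inv c u \<in> U}"
proof -
  have "open (chart_inv c -` U \<inter> chart_image c)"
    using continuous_on_open_vimage[OF open_image[OF assms(1)]] cont_chart_inv assms by blast
  then show ?thesis by (simp add: vimage_def Int_def conj_commute)
qed

lemma open_vimage_chart:
  assumes "c \<in> A" "open V" shows "open {p \<in> fst c. snd c p \<in> V}"
proof -
  have "open (snd c -` V \<inter> fst c)"
    using continuous_on_open_vimage[OF open_dom[OF assms(1)]] cont_chart assms by blast
  then show ?thesis by (simp add: vimage_def Int_def conj_commute)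
qed

lemma chart_image_eq:
  assumes "c \<in> A" "U \<subseteq> fst c" shows "snd c ` U = {u \<in> chart_image c. chart_inv c u \<in> U}"
proof
  show "snd c ` U \<subseteq> {u \<in> chart_image c. chart_inv c u \<in> U}"
  proof
    fix u assume "u \<in> snd c ` U"
    then obtain p where "p \<in> U" "u = snd c p" by blast
    then show "u \<in> {u \<in> chart_image c. chart_inv c u \<in> U}" using chart_in[OF assms(1), of p] assms by auto
  qed
  show "{u \<in> chart_image c. chart_inv c u \<in> U} \<subseteq> snd c ` U"
  proof
    fix u assume "u \<in> {u \<in> chart_image c. chart_inv c u \<in> U}"
    then show "u \<in> snd c ` U" using assms(1) by (intro image_eqI[of _ _ "chart_inv c u"]) auto
  qed
qed

lemma open_chart_image:
  assumes "c \<in> A" "open U" "U \<subseteq> fst c" shows "open (snd c ` U)"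
  unfolding chart_image_eq[OF assms(1,3)] using open_vimage_chart_inv assms by blast

lemma open_overlap: "c \<in> A \<Longrightarrow> e \<in> A \<Longrightarrow> open (snd c ` (fst c \<inter> fst e))"
  by (intro open_chart_image open_Int open_dom) auto

lemma transition_derivative:
  assumes "c \<in> A" "e \<in> A" "p \<in> fst c" "p \<in> fst e"
  shows "(transition c e has_derivative (*v) (transition_jacobian c e p)) (at (snd c p))"
proof -
  have "Ck_on 1 (transition c e) (snd c ` (fst c \<inter> fst e))"
    using transition_smooth[OF assms(1,2)] unfolding smooth_on_def by blast
  then have "transition c e differentiable_on (snd c ` (fst c \<inter> fst e))" by simp
  then have "transition c e differentiable at (snd c p)"
    using open_overlap assms by (auto simp: differentiable_on_eq_differentiable_at)
  then show ?thesis
    by (metis jacobian_works transition_jacobian_def)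
qed

text \<open>\<open>Ck_on\<close> provides continuity of the derivative only along basis vectors;
  linearity extends it to every direction \<open>h\<close>. This is what makes a coordinate segment
  a C1 curve in every other chart.\<close>

lemma transition_C1:
  assumes "c \<in> A" "e \<in> A" "p \<in> fst c" "p \<in> fst e"
  shows "isCont (\<lambda>u. frechet_derivative (transition c e) (at u) h) (snd c p)"
proof -
  let ?S = "snd c ` (fst c \<inter> fst e)"
  have C: "Ck_on 1 (transition c e) ?S"
    using transition_smooth[OF assms(1,2)] unfolding smooth_on_def by blast
  then have d: "transition c e differentiable (at u)" if "u \<in> ?S" for u
    using that open_overlap assms by (auto simp: differentiable_on_eq_differentiable_at)
  have "continuous_on ?S (\<lambda>u. \<Sum>b\<in>Basis. (h \<bullet> b) *\<^sub>R frechet_derivative (transition c e) (at u) b)"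
    using C by (intro continuous_intros) auto
  moreover have "(\<Sum>b\<in>Basis. (h \<bullet> b) *\<^sub>R frechet_derivative (transition c e) (at u) b)
      = frechet_derivative (transition c e) (at u) h" if "u \<in> ?S" for u
  proof -
    have "linear (frechet_derivative (transition c e) (at u))"
      using d[OF that] linear_frechet_derivative by blast
    then have "frechet_derivative (transition c e) (at u) (\<Sum>b\<in>Basis. (h \<bullet> b) *\<^sub>R b)
      = (\<Sum>b\<in>Basis. (h \<bullet> b) *\<^sub>R frechet_derivative (transition c e) (at u) b)"
      by (simp add: linear_sum linear_cmul)
    then show ?thesis by (simp add: euclidean_representation)
  qed
  ultimately have "continuous_on ?S (\<lambda>u. frechet_derivative (transition c e) (at u) h)"
    by (simp cong: continuous_on_cong_simp)
  then show ?thesis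
    using open_overlap assms by (auto simp: continuous_on_eq_continuous_at)
qed

lemma metric_sym: "c \<in> A \<Longrightarrow> p \<in> fst c \<Longrightarrow> transpose (g c p) = g c p"
  and metric_pos: "c \<in> A \<Longrightarrow> p \<in> fst c \<Longrightarrow> v \<noteq> 0 \<Longrightarrow> v \<bullet> (g c p *v v) > 0"
  and metric_transform: "c \<in> A \<Longrightarrow> e \<in> A \<Longrightarrow> p \<in> fst c \<Longrightarrow> p \<in> fst e \<Longrightarrow>
     g c p = transpose (transition_jacobian c e p) ** g e p ** transition_jacobian c e p"
  using metric unfolding riemannian_metric_def by blast+

lemma metric_nonneg: "c \<in> A \<Longrightarrow> p \<in> fst c \<Longrightarrow> v \<bullet> (g c p *v v) \<ge> 0"
  using metric_pos[of c p v] by (cases "v = 0") auto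

lemma metric_cont: "c \<in> A \<Longrightarrow> continuous_on (chart_image c) (\<lambda>u. g c (chart_inv c u))"
  using metric unfolding riemannian_metric_def smooth_on_def o_def
  by (metis Ck_on.simps(1))

lemma metric_form_transform:
  assumes "c \<in> A" "e \<in> A" "p \<in> fst c" "p \<in> fst e"
  shows "v \<bullet> (g c p *v w) =
    (transition_jacobian c e p *v v) \<bullet> (g e p *v (transition_jacobian c e p *v w))"
proof -
  have "v \<bullet> (g c p *v w) = v \<bullet> (transpose (transition_jacobian c e p) *v (g e p *v (transition_jacobian c e p *v w)))"
    by (simp add: metric_transform[OF assms] matrix_vector_mul_assoc matrix_mul_assoc)
  also have "\<dots> = (transition_jacobian c e p *v v) \<bullet> (g e p *v (transition_jacobian c e p *v w))"
    by (metis dot_lmul_matrix transpose_matrix_vector vector_transpose_matrix inner_commute)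
  finally show ?thesis .
qed

abbreviation d where "d \<equiv> geodesic_dist A g"

definition nrm :: "('a,'k) chart \<Rightarrow> 'a \<Rightarrow> real^'k \<Rightarrow> real" where
  "nrm c p v = sqrt (v \<bullet> (g c p *v v))"

lemma chart_change_curve:
  assumes "C1_at A \<gamma> t" "c \<in> A" "e \<in> A" "\<gamma> t \<in> fst c" "\<gamma> t \<in> fst e"
  shows "vector_derivative (snd e \<circ> \<gamma>) (at t) =
    transition_jacobian c e (\<gamma> t) *v vector_derivative (snd c \<circ> \<gamma>) (at t)"
proof -
  have diff: "((snd c \<circ> \<gamma>) has_vector_derivative vector_derivative (snd c \<circ> \<gamma>) (at t)) (at t)"
    using assms by (auto simp: C1_at_def vector_derivative_works)
  have "(transition c e \<circ> (snd c \<circ> \<gamma>) has_derivative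
      ((*v) (transition_jacobian c e (\<gamma> t)) \<circ> (\<lambda>x. x *\<^sub>R vector_derivative (snd c \<circ> \<gamma>) (at t)))) (at t)"
    using diff_chain_at[OF diff[unfolded has_vector_derivative_def]] transition_derivative[OF assms(2-5)]
    by (simp only: o_apply)
  then have 1: "(transition c e \<circ> (snd c \<circ> \<gamma>) has_vector_derivative
      transition_jacobian c e (\<gamma> t) *v vector_derivative (snd c \<circ> \<gamma>) (at t)) (at t)"
    unfolding has_vector_derivative_def by (simp only: o_def matrix_vector_mult_scaleR)
  have "isCont \<gamma> t" using assms by (simp add: C1_at_def)
  then have "\<forall>\<^sub>F s in nhds t. \<gamma> s \<in> fst c"
    using open_dom[OF assms(2)] assms(4) by (simp add: continuous_at_open eventually_nhds)
  then obtain I where I: "open I" "t \<in> I" "\<And>s. s \<in> I \<Longrightarrow> \<gamma> s \<in> fst c"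
    by (auto simp: eventually_nhds)
  have "(snd e \<circ> \<gamma> has_vector_derivative
      transition_jacobian c e (\<gamma> t) *v vector_derivative (snd c \<circ> \<gamma>) (at t)) (at t)"
    by (rule has_vector_derivative_transform_within_open[OF 1 I(1,2)])
       (use I(3) assms in \<open>simp add: transition_def\<close>)
  then show ?thesis by (rule vector_derivative_at)
qed

text \<open>The chart picked by \<open>chart_at\<close> may jump along the curve. Continuity and
  measurability of the speed become accessible only because a fixed chart may be used near a given
  time.\<close>

lemma speed_in_chart:
  assumes "C1_at A \<gamma> t" "c \<in> A" "\<gamma> t \<in> fst c"
  shows "speed A g \<gamma> t = nrm c (\<gamma> t) (vector_derivative (snd c \<circ> \<gamma>) (at t))"
proof -
  define e where "e = chart_at A (\<gamma> t)"
  have e: "e \<in> A" "\<gamma> t \<in> fst e" using chart_at[of "\<gamma> t"] by (auto simp: e_def)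
  show ?thesis
    unfolding speed_def Let_def e_def[symmetric] nrm_def
    by (simp add: chart_change_curve[OF assms(1,2) e(1) assms(3) e(2)]
       metric_form_transform[OF assms(2) e(1) assms(3) e(2)])
qed

lemma speed_nonneg: "speed A g \<gamma> t \<ge> 0"
  using chart_at[of "\<gamma> t"] metric_nonneg by (auto simp: speed_def Let_def)

lemma cont_metric_curve:
  assumes "c \<in> A" "continuous_on I \<gamma>" "\<And>t. t \<in> I \<Longrightarrow> \<gamma> t \<in> fst c"
  shows "continuous_on I (\<lambda>t. g c (\<gamma> t))"
proof -
  have "continuous_on I (\<lambda>t. snd c (\<gamma> t))"
    by (rule continuous_on_compose2[OF cont_chart[OF assms(1)] assms(2)]) (use assms in auto)
  then have "continuous_on I (\<lambda>t. g c (chart_inv c (snd c (\<gamma> t))))"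
    by (rule continuous_on_compose2[OF metric_cont[OF assms(1)]]) (use chart_in[OF assms(1)] assms(3) in blast)
  then show ?thesis
    by (rule continuous_on_eq) (simp add: assms)
qed

lemma speed_continuous:
  assumes I: "open I" and C: "\<And>t. t \<in> I \<Longrightarrow> C1_at A \<gamma> t"
  shows "continuous_on I (speed A g \<gamma>)"
  unfolding continuous_on_eq_continuous_at[OF I]
proof
  fix t assume t: "t \<in> I"
  obtain c where c: "c \<in> A" "\<gamma> t \<in> fst c" by (rule ex_chart)
  have cont: "continuous_on I \<gamma>"
    using C by (simp add: continuous_on_eq_continuous_at[OF I] C1_at_def)
  define J where "J = \<gamma> -` fst c \<inter> I"
  have J: "open J" "t \<in> J"
    using continuous_on_open_vimage[OF I] cont open_dom[OF c(1)] t c(2) by (auto simp: J_def)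
  have Jc: "\<gamma> s \<in> fst c" "C1_at A \<gamma> s" if "s \<in> J" for s using that C by (auto simp: J_def)
  have v: "continuous_on J (\<lambda>s. vector_derivative (snd c \<circ> \<gamma>) (at s))"
    unfolding continuous_on_eq_continuous_at[OF J(1)] using Jc c(1) by (auto simp: C1_at_def)
  have gc: "continuous_on J (\<lambda>s. g c (\<gamma> s))"
    by (rule cont_metric_curve) (use c Jc cont J_def in \<open>auto intro: continuous_on_subset\<close>)
  have "continuous_on J (\<lambda>s. nrm c (\<gamma> s) (vector_derivative (snd c \<circ> \<gamma>) (at s)))"
    unfolding nrm_def matrix_vector_mult_def inner_vec_def
    by (intro continuous_intros v gc)
  then have "isCont (\<lambda>s. nrm c (\<gamma> s) (vector_derivative (snd c \<circ> \<gamma>) (at s))) t"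
    using J by (simp add: continuous_on_eq_continuous_at)
  then show "isCont (speed A g \<gamma>) t"
    by (subst isCont_cong_open[OF J]) (use speed_in_chart c Jc in auto)
qed

text \<open>Off \<open>I\<close> the derivative of the curve may be an arbitrary default value, so
  measurability is claimed only for the truncated speed.\<close>

lemma speed_measurable:
  assumes I: "open I" and C: "\<And>t. t \<in> I \<Longrightarrow> C1_at A \<gamma> t"
  shows "(\<lambda>t. speed A g \<gamma> t * indicator I t) \<in> borel_measurable borel"
proof -
  have "(\<lambda>t. indicator I t *\<^sub>R speed A g \<gamma> t) \<in> borel_measurable borel"
    by (rule borel_measurable_continuous_on_indicator) (use I speed_continuous C in auto)
  then show ?thesis by (simp add: mult.commute)
qed


end

section \<open>Reparametrisation, length, and the metric properties of the geodesic distance\<close>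

context closed_manifold begin

lemma nrm_scaleR: "nrm c p (b *\<^sub>R v) = \<bar>b\<bar> * nrm c p v"
  by (simp add: nrm_def matrix_vector_mult_scaleR real_sqrt_mult mult.assoc[symmetric])

lemma affine_C1_at:
  assumes I: "open I" and C: "\<And>s. s \<in> I \<Longrightarrow> C1_at A \<gamma> s" and t: "a + b * t \<in> I"
  shows "C1_at A (\<lambda>t. \<gamma> (a + b * t)) t"
    and "speed A g (\<lambda>t. \<gamma> (a + b * t)) t = \<bar>b\<bar> * speed A g \<gamma> (a + b * t)"
proof -
  have comp: "snd c \<circ> (\<lambda>t. \<gamma> (a + b * t)) = (snd c \<circ> \<gamma>) \<circ> (\<lambda>t. a + b * t)" for c :: "('a,'k) chart"
    by auto
  have cont: "continuous_on I \<gamma>"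
    using C by (simp add: continuous_on_eq_continuous_at[OF I] C1_at_def)
  have aff: "isCont (\<lambda>s. a + b * s) s" for s by (intro continuous_intros)
  have iC: "isCont (\<lambda>t. \<gamma> (a + b * t)) t"
    by (rule isCont_o2[OF aff]) (use C[OF t] in \<open>simp add: C1_at_def\<close>)
  have main: "(snd c \<circ> (\<lambda>t. \<gamma> (a + b * t))) differentiable (at t) \<and>
      vector_derivative (snd c \<circ> (\<lambda>t. \<gamma> (a + b * t))) (at t)
        = b *\<^sub>R vector_derivative (snd c \<circ> \<gamma>) (at (a + b * t)) \<and>
      isCont (\<lambda>s. vector_derivative (snd c \<circ> (\<lambda>t. \<gamma> (a + b * t))) (at s)) t"
    if c: "c \<in> A" "\<gamma> (a + b * t) \<in> fst c" for c
  proof (intro conjI)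
    define J where "J = \<gamma> -` fst c \<inter> I"
    have J: "open J" "a + b * t \<in> J"
      using continuous_on_open_vimage[OF I] cont open_dom[OF c(1)] t c(2) by (auto simp: J_def)
    have "continuous_on UNIV (\<lambda>s. a + b * s)" by (intro continuous_intros)
    then have J': "open ((\<lambda>s. a + b * s) -` J)" by (rule open_vimage[OF J(1)])
    have dJ: "(snd c \<circ> \<gamma>) differentiable (at (a + b * s))" if "s \<in> (\<lambda>s. a + b * s) -` J" for s
    proof -
      have "C1_at A \<gamma> (a + b * s)" "\<gamma> (a + b * s) \<in> fst c" using that C by (auto simp: J_def)
      then show ?thesis using c(1) unfolding C1_at_def by blast
    qed
    have t': "t \<in> (\<lambda>s. a + b * s) -` J" using J(2) by simp
    show "(snd c \<circ> (\<lambda>t. \<gamma> (a + b * t))) differentiable (at t)"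
      "vector_derivative (snd c \<circ> (\<lambda>t. \<gamma> (a + b * t))) (at t)
        = b *\<^sub>R vector_derivative (snd c \<circ> \<gamma>) (at (a + b * t))"
      unfolding comp using vector_derivative_affine[OF dJ[OF t']] by blast+
    have "isCont (\<lambda>s. vector_derivative (snd c \<circ> \<gamma>) (at s)) (a + b * t)"
      using C[OF t] c unfolding C1_at_def by blast
    then have "isCont (\<lambda>s. b *\<^sub>R vector_derivative (snd c \<circ> \<gamma>) (at (a + b * s))) t"
      by (intro continuous_intros isCont_o2[OF aff])
    then show "isCont (\<lambda>s. vector_derivative (snd c \<circ> (\<lambda>t. \<gamma> (a + b * t))) (at s)) t"
      by (subst isCont_cong_open[OF J' t']) (use vector_derivative_affine(2)[OF dJ] in \<open>auto simp: comp\<close>)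
  qed
  then show C': "C1_at A (\<lambda>t. \<gamma> (a + b * t)) t"
    using iC unfolding C1_at_def by blast
  obtain c where c: "c \<in> A" "\<gamma> (a + b * t) \<in> fst c" by (rule ex_chart)
  show "speed A g (\<lambda>t. \<gamma> (a + b * t)) t = \<bar>b\<bar> * speed A g \<gamma> (a + b * t)"
    using speed_in_chart[OF C' c(1)] speed_in_chart[OF C[OF t] c] c main[OF c]
    by (simp add: nrm_scaleR)
qed

lemma open_interval_minus_finite: "finite T \<Longrightarrow> open ({a<..<b} - T)" for a b :: real
  by (intro open_Diff finite_imp_closed) auto

lemma AE_not_finite: "finite T \<Longrightarrow> AE t in lborel. t \<notin> T" for T :: "real set"
  by (rule AE_I'[of T]) (auto simp: finite_imp_null_set_lborel)

text \<open>Truncating to the open interval without \<open>T\<close> alters the integrand on a null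
  set and makes it measurable, as additivity and the change of variables require.\<close>

lemma seglen_alt:
  assumes "finite T" "{u..v} \<subseteq> {a..b}"
  shows "seglen A g \<gamma> u v =
    (\<integral>\<^sup>+ t\<in>{u..v}. ennreal (speed A g \<gamma> t * indicator ({a<..<b} - T) t) \<partial>lborel)"
  unfolding seglen_def
proof (rule nn_integral_cong_AE)
  show "AE t in lborel. ennreal (speed A g \<gamma> t) * indicator {u..v} t =
    ennreal (speed A g \<gamma> t * indicator ({a<..<b} - T) t) * indicator {u..v} t"
    using AE_not_finite[OF finite.insertI[OF finite.insertI[OF assms(1)]], of a b]
    by eventually_elim (use assms(2) in \<open>auto simp: indicator_def subset_iff\<close>)
qed

lemma seglen_split:
  assumes "finite T" "\<And>t. t \<in> {a<..<b} - T \<Longrightarrow> C1_at A \<gamma> t" "a \<le> m" "m \<le> b"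
  shows "seglen A g \<gamma> a b = seglen A g \<gamma> a m + seglen A g \<gamma> m b"
proof -
  define f where "f t = ennreal (speed A g \<gamma> t * indicator ({a<..<b} - T) t)" for t
  have [measurable]: "f \<in> borel_measurable borel"
    using speed_measurable[OF open_interval_minus_finite[OF assms(1)] assms(2)]
    unfolding f_def by measurable
  have "(\<integral>\<^sup>+ t\<in>{a..b}. f t \<partial>lborel) = (\<integral>\<^sup>+ t. f t * indicator {a..m} t + f t * indicator {m..b} t \<partial>lborel)"
    by (rule nn_integral_cong_AE, use AE_not_finite[of "{m}", OF finite.insertI[OF finite.emptyI]] in eventually_elim)
       (use assms in \<open>auto simp: indicator_def\<close>)
  also have "\<dots> = (\<integral>\<^sup>+ t\<in>{a..m}. f t \<partial>lborel) + (\<integral>\<^sup>+ t\<in>{m..b}. f t \<partial>lborel)"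
    by (rule nn_integral_add) auto
  finally show ?thesis
    using seglen_alt[OF assms(1), of a b a b \<gamma>] seglen_alt[OF assms(1), of a m a b \<gamma>]
      seglen_alt[OF assms(1), of m b a b \<gamma>] assms(3,4) by (simp add: f_def)
qed

text \<open>The parameter domain is written as a preimage, so that negative \<open>\<beta>\<close>
  is covered: one change of variables serves for shifting, rescaling and reversing a curve.\<close>

lemma seglen_reparam:
  assumes "finite T" "\<And>t. t \<in> {a<..<b} - T \<Longrightarrow> C1_at A \<gamma> t" "\<beta> \<noteq> 0"
  shows "(\<integral>\<^sup>+ t\<in>{t. \<alpha> + \<beta> * t \<in> {a..b}}. ennreal (speed A g (\<lambda>t. \<gamma> (\<alpha> + \<beta> * t)) t) \<partial>lborel)
    = seglen A g \<gamma> a b"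
proof -
  define I where "I = {a<..<b} - T"
  have I: "open I" using open_interval_minus_finite[OF assms(1)] by (simp add: I_def)
  define f where "f t = ennreal (speed A g \<gamma> t * indicator I t) * indicator {a..b} t" for t
  have [measurable]: "f \<in> borel_measurable borel"
    using speed_measurable[OF open_interval_minus_finite[OF assms(1)] assms(2)]
    unfolding f_def I_def by measurable
  have inj: "inj (\<lambda>t. \<alpha> + \<beta> * t)" using assms(3) by (auto simp: inj_on_def)
  have fin: "finite ((\<lambda>t. \<alpha> + \<beta> * t) -` (T \<union> {a, b}))"
    using assms(1) by (intro finite_vimageI inj) auto
  have "(\<integral>\<^sup>+ t. ennreal (speed A g (\<lambda>t. \<gamma> (\<alpha> + \<beta> * t)) t) * indicator {t. \<alpha> + \<beta> * t \<in> {a..b}} t \<partial>lborel)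
    = (\<integral>\<^sup>+ t. ennreal \<bar>\<beta>\<bar> * f (\<alpha> + \<beta> * t) \<partial>lborel)"
  proof (rule nn_integral_cong_AE, use AE_not_finite[OF fin] in eventually_elim)
    case (elim t)
    show ?case
    proof (cases "\<alpha> + \<beta> * t \<in> {a..b}")
      case True
      then have "\<alpha> + \<beta> * t \<in> I" using elim by (auto simp: I_def)
      then show ?thesis
        using affine_C1_at(2)[OF I, of \<gamma> \<alpha> \<beta> t] assms(2) True
        by (auto simp: f_def I_def ennreal_mult speed_nonneg)
    qed (auto simp: f_def)
  qed
  also have "\<dots> = ennreal \<bar>\<beta>\<bar> * (\<integral>\<^sup>+ t. f (\<alpha> + \<beta> * t) \<partial>lborel)"
    by (intro nn_integral_cmult) measurable
  also have "\<dots> = (\<integral>\<^sup>+ t. f t \<partial>lborel)"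
    using nn_integral_real_affine[of f \<beta> \<alpha>] assms(3) by simp
  also have "\<dots> = seglen A g \<gamma> a b"
    using seglen_alt[OF assms(1), of a b a b \<gamma>] by (simp add: f_def I_def)
  finally show ?thesis by simp
qed

text \<open>Curves competing in \<open>geodesic_dist\<close> are parametrised by {0..1}. The choice
  \<open>\<alpha> = a\<close>, \<open>\<beta> = b - a\<close> runs through the given curve forwards,
  \<open>\<alpha> = b\<close>, \<open>\<beta> = a - b\<close> backwards; the second one yields
  symmetry of the distance.\<close>

lemma dist_le_reparam:
  assumes "continuous_on {a..b} \<gamma>" "finite T" "\<And>t. t \<in> {a<..<b} - T \<Longrightarrow> C1_at A \<gamma> t" "\<beta> \<noteq> 0"
    and im: "\<And>t. \<alpha> + \<beta> * t \<in> {a..b} \<longleftrightarrow> t \<in> {0..1}"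
  shows "d (\<gamma> \<alpha>) (\<gamma> (\<alpha> + \<beta>)) \<le> seglen A g \<gamma> a b"
proof -
  define \<sigma> where "\<sigma> = (\<lambda>t. \<gamma> (\<alpha> + \<beta> * t))"
  define I where "I = {a<..<b} - T"
  have I: "open I" using open_interval_minus_finite[OF assms(2)] by (simp add: I_def)
  have inj: "inj (\<lambda>t. \<alpha> + \<beta> * t)" using assms(4) by (auto simp: inj_on_def)
  define T' where "T' = (\<lambda>t. \<alpha> + \<beta> * t) -` (T \<union> {a, b})"
  have fin: "finite T'"
    using assms(2) unfolding T'_def by (intro finite_vimageI inj) auto
  have C: "C1_at A \<sigma> t" if "t \<in> {0..1} - T'" for t
  proof -
    have "\<alpha> + \<beta> * t \<in> I" using that im[of t] by (auto simp: T'_def I_def)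
    then show ?thesis using affine_C1_at(1)[OF I, of \<gamma> \<alpha> \<beta> t] assms(3) by (auto simp: \<sigma>_def I_def)
  qed
  have "continuous_on {0..1} \<sigma>"
    unfolding \<sigma>_def
    by (rule continuous_on_compose2[OF assms(1)]) (use im in \<open>auto intro!: continuous_intros\<close>)
  moreover have "(snd c \<circ> \<sigma>) C1_differentiable_on {t \<in> {0..1} - T'. \<sigma> t \<in> fst c}" if "c \<in> A" for c
    unfolding C1_differentiable_on_eq
  proof (intro conjI ballI continuous_at_imp_continuous_on)
    fix t assume "t \<in> {t \<in> {0..1} - T'. \<sigma> t \<in> fst c}"
    then have "C1_at A \<sigma> t" "\<sigma> t \<in> fst c" using C by auto
    then show "snd c \<circ> \<sigma> differentiable at t" "isCont (\<lambda>x. vector_derivative (snd c \<circ> \<sigma>) (at x)) t"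
      using that unfolding C1_at_def by blast+
  qed
  ultimately have "piecewise_C1_curve A \<sigma>"
    using fin unfolding piecewise_C1_curve_def by blast
  then have "d (\<sigma> 0) (\<sigma> 1) \<le> curve_length A g \<sigma>"
    unfolding geodesic_dist_def by (intro INF_lower) auto
  also have "curve_length A g \<sigma> = seglen A g \<gamma> a b"
    using seglen_reparam[where \<alpha>=\<alpha> and \<gamma>=\<gamma> and a=a and b=b and T=T, OF assms(2-4)] unfolding curve_length_def \<sigma>_def im Collect_mem_eq .
  finally show ?thesis by (simp add: \<sigma>_def)
qed

lemma dist_le_seglen:
  assumes "a \<le> b" "continuous_on {a..b} \<gamma>" "finite T" "\<And>t. t \<in> {a<..<b} - T \<Longrightarrow> C1_at A \<gamma> t" 
  shows "a < b \<Longrightarrow> d (\<gamma> a) (\<gamma> b) \<le> seglen A g \<gamma> a b" "a < b \<Longrightarrow> d (\<gamma> b) (\<gamma> a) \<le> seglen A g \<gamma> a b"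
proof -
  assume ab: "a < b"
  have 1: "a + (b - a) * t \<in> {a..b} \<longleftrightarrow> t \<in> {0..1}" for t
  proof -
    have "a + (b - a) * t \<le> b \<longleftrightarrow> (b - a) * t \<le> (b - a) * 1" by (simp add: algebra_simps)
    then show ?thesis using ab by (auto simp: zero_le_mult_iff mult_le_cancel_left_pos)
  qed
  have 2: "b + (a - b) * t \<in> {a..b} \<longleftrightarrow> t \<in> {0..1}" for t
  proof -
    have "a \<le> b + (a - b) * t \<longleftrightarrow> (b - a) * t \<le> (b - a) * 1" by (simp add: algebra_simps)
    moreover have "b + (a - b) * t \<le> b \<longleftrightarrow> 0 \<le> (b - a) * t" by (simp add: algebra_simps)
    ultimately show ?thesis using ab by (auto simp: zero_le_mult_iff mult_le_cancel_left_pos)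
  qed
  show "d (\<gamma> a) (\<gamma> b) \<le> seglen A g \<gamma> a b"
    using dist_le_reparam[OF assms(2-4) _ 1] ab by simp
  show "d (\<gamma> b) (\<gamma> a) \<le> seglen A g \<gamma> a b"
    using dist_le_reparam[OF assms(2-4) _ 2] ab by simp
qed

text \<open>Continuity of the derivative relative to a set becomes continuity at \<open>t\<close>
  because the interior times outside \<open>T\<close> at which the curve lies in a given chart form
  an open set.\<close>

lemma short_curve:
  assumes "d x y < l"
  obtains \<gamma> T where "continuous_on {0..1} \<gamma>" "finite T" "\<And>t. t \<in> {0<..<1} - T \<Longrightarrow> C1_at A \<gamma> t"
    "\<gamma> 0 = x" "\<gamma> 1 = y" "seglen A g \<gamma> 0 1 < l"
proof -
  obtain \<gamma> where g: "piecewise_C1_curve A \<gamma>" "\<gamma> 0 = x" "\<gamma> 1 = y" "curve_length A g \<gamma> < l"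
    using assms unfolding geodesic_dist_def by (auto simp: INF_less_iff)
  obtain T where cont: "continuous_on {0..1} \<gamma>" and T: "finite T"
    "\<And>c. c \<in> A \<Longrightarrow> (snd c \<circ> \<gamma>) C1_differentiable_on {t \<in> {0..1} - T. \<gamma> t \<in> fst c}"
    using g(1) unfolding piecewise_C1_curve_def by blast
  have C: "C1_at A \<gamma> t" if t: "t \<in> {0<..<1} - T" for t
    unfolding C1_at_def
  proof (intro conjI ballI impI)
    have o: "open ({0<..<1} - T)" by (rule open_interval_minus_finite[OF T(1)])
    have co: "continuous_on ({0<..<1} - T) \<gamma>" by (rule continuous_on_subset[OF cont]) auto
    then show "isCont \<gamma> t" using t o continuous_on_eq_continuous_at by blast
    fix c assume c: "c \<in> A" "\<gamma> t \<in> fst c"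
    let ?J = "\<gamma> -` fst c \<inter> ({0<..<1} - T)"
    have J: "open ?J" using continuous_on_open_vimage[OF o] co open_dom[OF c(1)] by blast
    have tJ: "t \<in> ?J" using t c by simp
    have sub: "?J \<subseteq> {t \<in> {0..1} - T. \<gamma> t \<in> fst c}" by auto
    show "snd c \<circ> \<gamma> differentiable at t"
      using T(2)[OF c(1)] tJ sub unfolding C1_differentiable_on_eq by blast
    have "continuous_on ?J (\<lambda>s. vector_derivative (snd c \<circ> \<gamma>) (at s))"
      using T(2)[OF c(1)] continuous_on_subset[OF _ sub] unfolding C1_differentiable_on_eq by blast
    then show "isCont (\<lambda>s. vector_derivative (snd c \<circ> \<gamma>) (at s)) t"
      using J tJ continuous_on_eq_continuous_at by blast
  qed
  show ?thesis
    by (rule that[OF cont T(1) C g(2,3)]) (use g(4) in \<open>simp_all add: curve_length_def seglen_def\<close>)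
qed

lemma geo_sym: "d x y = d y x"
proof -
  have "d y x \<le> d x y" for x y
  proof (rule ccontr)
    assume "\<not> d y x \<le> d x y"
    then have "d x y < d y x" by simp
    from short_curve[OF this] obtain \<gamma> T where c: "continuous_on {0..1} \<gamma>" "finite T"
      "\<And>t. t \<in> {0<..<1} - T \<Longrightarrow> C1_at A \<gamma> t" "\<gamma> 0 = x" "\<gamma> 1 = y" "seglen A g \<gamma> 0 1 < d y x" by metis
    show False using dist_le_seglen(2)[OF _ c(1-3)] c(4-6) by simp
  qed
  then show ?thesis by (simp add: order_antisym)
qed

lemma geo_triangle: "d x z \<le> d x y + d y z"
proof (rule ennreal_le_epsilon)
  fix e :: real assume fin: "d x y + d y z < top" and e: "e > 0"
  have lt: "a < a + ennreal (e/2)" if "a < top" for a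
    using that e by (simp add: ennreal_add_left_cancel_less[of a 0, simplified] less_top)
  have "d x y < d x y + ennreal (e/2)" "d y z < d y z + ennreal (e/2)" using fin lt[of "d x y"] lt[of "d y z"] by auto
  from short_curve[OF this(1)] short_curve[OF this(2)]
  obtain \<gamma>1 T1 \<gamma>2 T2 where
    1: "continuous_on {0..1} \<gamma>1" "finite T1" "\<And>t. t \<in> {0<..<1} - T1 \<Longrightarrow> C1_at A \<gamma>1 t"
    "\<gamma>1 0 = x" "\<gamma>1 1 = y" "seglen A g \<gamma>1 0 1 < d x y + ennreal (e/2)" and
    2: "continuous_on {0..1} \<gamma>2" "finite T2" "\<And>t. t \<in> {0<..<1} - T2 \<Longrightarrow> C1_at A \<gamma>2 t"
    "\<gamma>2 0 = y" "\<gamma>2 1 = z" "seglen A g \<gamma>2 0 1 < d y z + ennreal (e/2)"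
    by metis
  \<comment> \<open>The concatenation stays on {0..2}, so only a shift has to be transported; it is
    spelled \<open>-1 + 1 * t\<close> to fit \<open>affine_C1_at\<close>. The junction 1 is put into
    \<open>T\<close> because the two one-sided derivatives may differ there.\<close>
  define \<sigma> where "\<sigma> t = (if t \<le> 1 then \<gamma>1 t else \<gamma>2 (-1 + 1 * t))" for t
  define T where "T = T1 \<union> {1} \<union> (\<lambda>t. -1 + 1 * t) -` T2"
  have T: "finite T" using 1(2) 2(2) unfolding T_def by (auto intro!: finite_vimageI simp: inj_on_def)
  have a1: "\<gamma>1 s = \<sigma> s" if "s \<in> {..<1}" for s using that by (simp add: \<sigma>_def)
  have a2: "\<gamma>2 (-1 + 1 * s) = \<sigma> s" if "s \<in> {1<..}" for s using that by (simp add: \<sigma>_def)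
  have sp1: "speed A g \<gamma>1 t = speed A g \<sigma> t" if "t < 1" for t
    by (rule speed_cong[of "{..<1}"]) (use that a1 in auto)
  have cg1: "C1_at A \<gamma>1 t \<longleftrightarrow> C1_at A \<sigma> t" if "t < 1" for t
    by (rule C1_at_cong[of "{..<1}"]) (use that a1 in auto)
  have sp2: "speed A g (\<lambda>t. \<gamma>2 (-1 + 1 * t)) t = speed A g \<sigma> t" if "1 < t" for t
    by (rule speed_cong[of "{1<..}"]) (use that in \<open>auto simp: \<sigma>_def\<close>)
  have cg2: "C1_at A (\<lambda>t. \<gamma>2 (-1 + 1 * t)) t \<longleftrightarrow> C1_at A \<sigma> t" if "1 < t" for t
    by (rule C1_at_cong[of "{1<..}"]) (use that in \<open>auto simp: \<sigma>_def\<close>)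
  have C: "C1_at A \<sigma> t" if t: "t \<in> {0<..<2} - T" for t
  proof (cases "t < 1")
    case True
    then have "C1_at A \<gamma>1 t" using t by (intro 1(3)) (auto simp: T_def)
    then show ?thesis using cg1 True by blast
  next
    case False
    then have "-1 + 1 * t \<in> {0<..<1} - T2" "1 < t" using t by (auto simp: T_def)
    then have "C1_at A (\<lambda>t. \<gamma>2 (-1 + 1 * t)) t"
      by (intro affine_C1_at(1)[OF open_interval_minus_finite[OF 2(2)] 2(3)]) auto
    then show ?thesis using cg2 \<open>1 < t\<close> by blast
  qed
  have cont: "continuous_on {0..2} \<sigma>"
  proof -
    have "continuous_on ({0..1} \<union> {1..2}) \<sigma>"
      unfolding \<sigma>_def
    proof (rule continuous_on_If)
      show "continuous_on {1..2} (\<lambda>t. \<gamma>2 (-1 + 1 * t))"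
        by (rule continuous_on_compose2[OF 2(1)]) (auto intro!: continuous_intros)
    qed (use 1 2 in auto)
    moreover have "{0..1} \<union> {1..2} = {0..2::real}" by auto
    ultimately show ?thesis by simp
  qed
  have s1: "seglen A g \<sigma> 0 1 = seglen A g \<gamma>1 0 1"
    unfolding seglen_def
    by (rule nn_integral_cong_AE, use AE_not_finite[of "{1}", OF finite.insertI[OF finite.emptyI]] in eventually_elim)
       (use sp1 in \<open>auto simp: indicator_def\<close>)
  have "seglen A g \<sigma> 1 2 = (\<integral>\<^sup>+ t\<in>{t. -1 + 1 * t \<in> {0..1}}. ennreal (speed A g (\<lambda>t. \<gamma>2 (-1 + 1 * t)) t) \<partial>lborel)"
    unfolding seglen_def
    by (rule nn_integral_cong_AE, use AE_not_finite[of "{1}", OF finite.insertI[OF finite.emptyI]] in eventually_elim)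
       (use sp2 in \<open>auto simp: indicator_def\<close>)
  also have "\<dots> = seglen A g \<gamma>2 0 1" by (rule seglen_reparam[OF 2(2,3)]) auto
  finally have s2: "seglen A g \<sigma> 1 2 = seglen A g \<gamma>2 0 1" .
  have "d x z = d (\<sigma> 0) (\<sigma> 2)" using 1 2 by (simp add: \<sigma>_def)
  also have "\<dots> \<le> seglen A g \<sigma> 0 2" using dist_le_seglen(1)[OF _ cont T C] by simp
  also have "\<dots> = seglen A g \<gamma>1 0 1 + seglen A g \<gamma>2 0 1"
    using seglen_split[where a=0 and b=2 and m=1 and T=T, OF T C] s1 s2 by simp
  also have "\<dots> \<le> (d x y + ennreal (e/2)) + (d y z + ennreal (e/2))"
    using 1(6) 2(6) by (intro add_mono) auto
  also have "\<dots> = d x y + d y z + (ennreal (e/2) + ennreal (e/2))" by (simp add: ac_simps)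
  also have "ennreal (e/2) + ennreal (e/2) = ennreal e" using e by (simp flip: ennreal_plus)
  finally show "d x z \<le> d x y + d y z + ennreal e" .
qed

lemma geo_refl [simp]: "d x x = 0"
proof -
  have C: "C1_at A (\<lambda>_. x) t" for t
    by (simp add: C1_at_def o_def)
  have sp: "speed A g (\<lambda>_. x) t = 0" for t
    by (simp add: speed_def o_def Let_def)
  have "d x x \<le> seglen A g (\<lambda>_. x) 0 1"
    using dist_le_seglen(1)[of 0 1 "\<lambda>_. x" "{}"] C by simp
  then show ?thesis by (simp add: seglen_def sp)
qed

text \<open>Once the length is finite, the speed can be replaced by an integrable real function, to
  which the fundamental theorem of calculus and continuity of the indefinite integral apply.\<close>

lemma seglen_integral:
  assumes "finite T" "\<And>t. t \<in> {a<..<b} - T \<Longrightarrow> C1_at A \<gamma> t" "seglen A g \<gamma> a b < top"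
  obtains f where "f integrable_on {a..b}" "\<And>t. t \<in> {a..b} - (T \<union> {a,b}) \<Longrightarrow> f t = speed A g \<gamma> t"
    "\<And>t. f t \<ge> 0" "\<And>u v. {u..v} \<subseteq> {a..b} \<Longrightarrow> seglen A g \<gamma> u v = ennreal (integral {u..v} f)"
proof -
  define f where "f t = speed A g \<gamma> t * indicator ({a<..<b} - T) t" for t
  have [measurable]: "f \<in> borel_measurable borel"
    using speed_measurable[OF open_interval_minus_finite[OF assms(1)] assms(2)]
    unfolding f_def by measurable
  have nn: "f t \<ge> 0" for t by (simp add: f_def speed_nonneg)
  have sl: "seglen A g \<gamma> u v = (\<integral>\<^sup>+ t. ennreal (indicator {u..v} t *\<^sub>R f t) \<partial>lborel)"
    if "{u..v} \<subseteq> {a..b}" for u v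
    using seglen_alt[OF assms(1) that, of \<gamma>] 
    by (simp add: f_def ennreal_mult' indicator_def cong: if_cong)
       (auto intro!: nn_integral_cong)
  have int: "set_integrable lborel {a..b} f"
    unfolding set_integrable_def
    by (rule integrableI_nonneg) (use nn sl[of a b] assms(3) in auto)
  have "ennreal (integral {u..v} f) = seglen A g \<gamma> u v" if "{u..v} \<subseteq> {a..b}" for u v
  proof -
    have i: "set_integrable lborel {u..v} f" by (rule set_integrable_subset[OF int]) (use that in auto)
    have "seglen A g \<gamma> u v = ennreal (LINT t:{u..v}|lborel. f t)"
      unfolding sl[OF that] set_lebesgue_integral_def
      by (rule nn_integral_eq_integral) (use i nn in \<open>auto simp: set_integrable_def\<close>)
    then show ?thesis using set_borel_integral_eq_integral(2)[OF i] by simp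
  qed
  then show ?thesis
    by (intro that[of f]) (use set_borel_integral_eq_integral(1)[OF int] nn in \<open>auto simp: f_def\<close>)
qed

text \<open>Takes the place of minimising geodesics: a curve of length below \<open>l1 + l2\<close>
  is cut, by the intermediate value theorem for its arc length, where the first part is shorter than
  \<open>l1\<close> and the rest shorter than \<open>l2\<close>.\<close>

lemma intermediate_point:
  assumes "d x y < ennreal (l1 + l2)" "l1 > 0" "l2 > 0"
  obtains z where "d x z < ennreal l1" "d z y < ennreal l2"
proof -
  from short_curve[OF assms(1)] obtain \<gamma> T where c: "continuous_on {0..1} \<gamma>" "finite T"
      "\<And>t. t \<in> {0<..<1} - T \<Longrightarrow> C1_at A \<gamma> t" "\<gamma> 0 = x" "\<gamma> 1 = y" "seglen A g \<gamma> 0 1 < ennreal (l1 + l2)"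
    by metis
  have "seglen A g \<gamma> 0 1 < top" using c(6) by (simp add: order_less_trans[OF _ ennreal_less_top])
  from seglen_integral[OF c(2,3) this] obtain f where f: "f integrable_on {0..1}" "\<And>t. f t \<ge> 0"
    "\<And>u v. {u..v} \<subseteq> {0..1} \<Longrightarrow> seglen A g \<gamma> u v = ennreal (integral {u..v} f)" by metis
  define F where "F t = integral {0..t} f" for t
  define L where "L = F 1"
  have L: "L \<ge> 0" "L < l1 + l2"
    using integral_nonneg[OF f(1)] f(2) c(6) f(3)[of 0 1] assms(2,3)
    by (auto simp: L_def F_def ennreal_less_iff simp del: ennreal_plus)
  have d1: "d x (\<gamma> t) \<le> ennreal (F t)" "d (\<gamma> t) y \<le> ennreal (L - F t)" if t: "t \<in> {0..1}" for t
  proof -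
    have s1: "seglen A g \<gamma> 0 t = ennreal (F t)" unfolding F_def using t by (intro f(3)) auto
    have "integral {0..t} f + integral {t..1} f = integral {0..1} f"
      using t by (intro Henstock_Kurzweil_Integration.integral_combine f(1)) auto
    then have "integral {t..1} f = L - F t" by (simp add: L_def F_def)
    then have s2: "seglen A g \<gamma> t 1 = ennreal (L - F t)"
      using f(3)[of t 1] t by simp
    show "d x (\<gamma> t) \<le> ennreal (F t)"
    proof (cases "t = 0")
      case False
      then show ?thesis
        using dist_le_seglen(1)[of 0 t \<gamma> T] continuous_on_subset[OF c(1), of "{0..t}"] c s1 t by auto
    qed (use c in simp)
    show "d (\<gamma> t) y \<le> ennreal (L - F t)"
    proof (cases "t = 1")
      case False
      then show ?thesis
        using dist_le_seglen(1)[of t 1 \<gamma> T] continuous_on_subset[OF c(1), of "{t..1}"] c s2 t by auto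
    qed (use c in simp)
  qed
  have cF: "continuous_on {0..1} F" unfolding F_def by (rule indefinite_integral_continuous_1[OF f(1)])
  show ?thesis
  proof (cases "L < l1")
    case True
    have "d x (\<gamma> 1) < ennreal l1" using d1(1)[of 1] True L assms
      by (auto simp: L_def intro!: order_le_less_trans[OF d1(1)[of 1]] ennreal_lessI)
    then show ?thesis using that[of "\<gamma> 1"] c(5) assms by simp
  next
    case False
    \<comment> \<open>The arc length \<open>m\<close> at the cut must satisfy
      \<open>L - l2 < m < l1\<close>; the midpoint of this interval is taken, raised to 0 if it is
      negative.\<close>
    define m where "m = max 0 ((l1 + L - l2) / 2)"
    have "(l1 + L - l2) / 2 < l1 \<and> (l1 + L - l2) / 2 \<le> L \<and> L - (l1 + L - l2) / 2 < l2"
      using False L assms(2,3) by argo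
    then have m: "0 \<le> m" "m \<le> L" "m < l1" "L - m < l2"
      unfolding m_def using L assms(2,3) by (auto simp: max_def)
  have "F 0 = 0" by (simp add: F_def)
    then obtain t where t: "0 \<le> t" "t \<le> 1" "F t = m"
      using IVT'[of F 0 m 1] m cF by (auto simp: L_def)
    have "d x (\<gamma> t) < ennreal l1"
      using t m by (intro order_le_less_trans[OF d1(1)[of t]] ennreal_lessI) auto
    moreover have "d (\<gamma> t) y < ennreal l2"
      using t m L assms by (intro order_le_less_trans[OF d1(2)[of t]] ennreal_lessI) auto
    ultimately show ?thesis by (rule that)
  qed
qed

end

section \<open>Comparison with the Euclidean metric in charts\<close>

lemma norm_matrix_vector_mult_le:
  fixes M :: "real^'n^'m" shows "norm (M *v x) \<le> norm M * norm x"
proof -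
  have "norm (M *v x) = L2_set (\<lambda>i. \<bar>(M $ i) \<bullet> x\<bar>) UNIV"
    by (simp add: norm_vec_def matrix_vector_mul_component)
  also have "\<dots> \<le> L2_set (\<lambda>i. norm (M $ i) * norm x) UNIV"
    by (intro L2_set_mono) (auto intro: Cauchy_Schwarz_ineq2)
  also have "\<dots> = norm M * norm x"
    by (subst norm_vec_def[of M], subst L2_set_left_distrib) auto
  finally show ?thesis .
qed

lemma quadratic_form_diff_le:
  fixes M N :: "real^'n^'n"
  shows "\<bar>v \<bullet> (M *v v) - v \<bullet> (N *v v)\<bar> \<le> norm (M - N) * (norm v)\<^sup>2"
proof -
  have "\<bar>v \<bullet> ((M - N) *v v)\<bar> \<le> norm v * norm ((M - N) *v v)" by (rule Cauchy_Schwarz_ineq2)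
  also have "\<dots> \<le> norm v * (norm (M - N) * norm v)"
    by (intro mult_left_mono norm_matrix_vector_mult_le) auto
  finally show ?thesis
    by (simp add: matrix_vector_mult_diff_rdistrib inner_diff_right power2_eq_square ac_simps)
qed

lemma ennreal_gap:
  fixes a b :: ennreal assumes "a < b" obtains e :: real where "e > 0" "a + ennreal e < b"
proof -
  obtain c where c: "a < c" "c < b" using dense[OF assms] by blast
  obtain a' c' where ac: "a = ennreal a'" "a' \<ge> 0" "c = ennreal c'" "c' \<ge> 0"
    using c by (cases a; cases c) auto
  have "a' < c'" using c ac by (simp add: ennreal_less_iff)
  then show ?thesis using that[of "c' - a'"] c ac by (simp flip: ennreal_plus)
qed

context closed_manifold begin

lemma nrm_nonneg: "c \<in> A \<Longrightarrow> p \<in> fst c \<Longrightarrow> nrm c p v \<ge> 0"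
  by (simp add: nrm_def metric_nonneg)

lemma nrm_square: "c \<in> A \<Longrightarrow> p \<in> fst c \<Longrightarrow> (nrm c p v)\<^sup>2 = v \<bullet> (g c p *v v)"
  by (simp add: nrm_def metric_nonneg)

lemma metric_swap: "c \<in> A \<Longrightarrow> p \<in> fst c \<Longrightarrow> v \<bullet> (g c p *v w) = w \<bullet> (g c p *v v)"
  by (metis dot_lmul_matrix inner_commute metric_sym transpose_matrix_vector)

lemma metric_Cauchy_Schwarz:
  assumes "c \<in> A" "p \<in> fst c" shows "\<bar>v \<bullet> (g c p *v w)\<bar> \<le> nrm c p v * nrm c p w"
proof (cases "w = 0")
  case False
  define q where "q v = v \<bullet> (g c p *v v)" for v
  define b where "b = v \<bullet> (g c p *v w)"
  have qw: "q w > 0" using metric_pos[OF assms False] by (simp add: q_def)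
  have "0 \<le> q (q w *\<^sub>R v - b *\<^sub>R w)" using metric_nonneg[OF assms] by (simp add: q_def)
  also have "\<dots> = q w * (q w * q v - b\<^sup>2)"
    using metric_swap[OF assms, of w v]
    by (simp add: q_def b_def matrix_vector_mult_diff_distrib matrix_vector_mult_scaleR inner_diff_left
       inner_diff_right power2_eq_square algebra_simps)
  finally have "b\<^sup>2 \<le> q w * q v" using qw by (simp add: zero_le_mult_iff)
  then have "sqrt (b\<^sup>2) \<le> sqrt (q w * q v)" by (rule real_sqrt_le_mono)
  then show ?thesis by (simp add: b_def q_def nrm_def real_sqrt_mult mult.commute)
qed (simp add: nrm_def)

lemma nrm_equiv:
  assumes "c \<in> A" "p \<in> fst c"
  obtains l L where "l > 0" "L > 0" "\<And>v. l * norm v \<le> nrm c p v" "\<And>v. nrm c p v \<le> L * norm v"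
proof -
  let ?q = "\<lambda>v. v \<bullet> (g c p *v v)"
  have "continuous_on (sphere 0 1) ?q"
    by (intro continuous_intros matrix_vector_mult_linear_continuous_on)
  moreover have "sphere (0::real^'k) 1 \<noteq> {}" by simp
  ultimately obtain w where w: "w \<in> sphere 0 1" "\<And>v. v \<in> sphere 0 1 \<Longrightarrow> ?q w \<le> ?q v"
    using continuous_attains_inf[OF compact_sphere] by blast
  define m where "m = ?q w"
  have m: "m > 0" using metric_pos[OF assms, of w] w(1) by (cases "w = 0") (auto simp: m_def)
  have lo: "m * (norm v)\<^sup>2 \<le> ?q v" for v
  proof (cases "v = 0")
    case False
    then have "m \<le> ?q (v /\<^sub>R norm v)" unfolding m_def by (intro w(2)) auto
    also have "\<dots> = ?q v / (norm v)\<^sup>2"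
      by (simp add: matrix_vector_mult_scaleR power2_eq_square field_simps)
    finally show ?thesis using False by (simp add: field_simps)
  qed simp
  show ?thesis
  \<comment> \<open>The summand 1 keeps the upper constant strictly positive.\<close>
  proof (rule that[of "sqrt m" "sqrt (norm (g c p)) + 1"])
    show "sqrt m * norm v \<le> nrm c p v" for v
      using real_sqrt_le_mono[OF lo[of v]] by (simp add: nrm_def real_sqrt_mult)
    show "nrm c p v \<le> (sqrt (norm (g c p)) + 1) * norm v" for v
    proof -
      have "?q v \<le> norm (g c p) * (norm v)\<^sup>2" using quadratic_form_diff_le[of v "g c p" 0] by simp
      from real_sqrt_le_mono[OF this] show ?thesis
        by (simp add: nrm_def real_sqrt_mult algebra_simps add_increasing)
    qed
  qed (use m in \<open>auto intro: add_nonneg_pos\<close>)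
qed

lemma metric_near:
  assumes c: "c \<in> A" "p \<in> fst c" and "\<delta> > 0"
  obtains R where "R > 0" "ball (snd c p) R \<subseteq> chart_image c"
    "\<And>u v. u \<in> ball (snd c p) R \<Longrightarrow> nrm c (chart_inv c u) v \<le> (1 + \<delta>) * nrm c p v"
    "\<And>u v. u \<in> ball (snd c p) R \<Longrightarrow> nrm c p v \<le> (1 + \<delta>) * nrm c (chart_inv c u) v"
proof -
  obtain l where l: "l > 0" "\<And>v. l * norm v \<le> nrm c p v" using nrm_equiv[OF c] by metis
  \<comment> \<open>Chosen so that 1 - \<epsilon> = 1 / (1 + \<delta>): a relative error \<epsilon>
    of the quadratic form then costs at most the factor 1 + \<delta> in either direction.\<close>
  define \<epsilon> where "\<epsilon> = \<delta> / (1 + \<delta>)"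
  have e: "\<epsilon> > 0" "\<epsilon> \<le> \<delta>" "1 - \<epsilon> = 1 / (1 + \<delta>)" using assms(3) by (auto simp: \<epsilon>_def field_simps)
  have "isCont (\<lambda>u. g c (chart_inv c u)) (snd c p)"
    using metric_cont[OF c(1)] open_image[OF c(1)] chart_in[OF c] continuous_on_eq_continuous_at by blast
  then obtain R1 where R1: "R1 > 0" "\<And>u. dist u (snd c p) < R1 \<Longrightarrow>
     dist (g c (chart_inv c u)) (g c (chart_inv c (snd c p))) < \<epsilon> * l\<^sup>2"
    unfolding continuous_at_eps_delta using e l by (metis mult_pos_pos zero_less_power)
  obtain R2 where R2: "R2 > 0" "ball (snd c p) R2 \<subseteq> chart_image c"
    using open_image[OF c(1)] chart_in[OF c] open_contains_ball by blast
  define R where "R = min R1 R2"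
  have main: "\<bar>v \<bullet> (g c (chart_inv c u) *v v) - v \<bullet> (g c p *v v)\<bar> \<le> \<epsilon> * (v \<bullet> (g c p *v v))"
    if "u \<in> ball (snd c p) R" for u v
  proof -
    have "norm (g c (chart_inv c u) - g c p) \<le> \<epsilon> * l\<^sup>2"
      using R1(2)[of u] that c by (simp add: R_def dist_norm norm_minus_commute)
    then have "norm (g c (chart_inv c u) - g c p) * (norm v)\<^sup>2 \<le> \<epsilon> * l\<^sup>2 * (norm v)\<^sup>2"
      by (rule mult_right_mono) auto
    also have "\<dots> = \<epsilon> * (l * norm v)\<^sup>2" by (simp add: power_mult_distrib)
    also have "\<dots> \<le> \<epsilon> * (nrm c p v)\<^sup>2"
      using e l by (intro mult_left_mono power_mono) auto
    finally show ?thesis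
      using quadratic_form_diff_le[of v "g c (chart_inv c u)" "g c p"] nrm_square[OF c, of v] by simp
  qed
  show ?thesis
  proof (rule that[of R])
    show "R > 0" "ball (snd c p) R \<subseteq> chart_image c" using R1 R2 by (auto simp: R_def)
    fix u v assume u: "u \<in> ball (snd c p) R"
    let ?q = "v \<bullet> (g c p *v v)" and ?q' = "v \<bullet> (g c (chart_inv c u) *v v)"
    have q: "?q \<ge> 0" by (rule metric_nonneg[OF c])
    have "?q' \<le> (1 + \<epsilon>) * ?q" using main[OF u, of v] by (simp add: algebra_simps abs_le_iff)
    also have "\<dots> \<le> (1 + \<delta>)\<^sup>2 * ?q"
    proof (intro mult_right_mono q)
      have "1 + \<epsilon> \<le> 1 + \<delta>" using e by simp
      also have "\<dots> \<le> (1 + \<delta>)\<^sup>2" using assms(3) by (simp add: power2_eq_square)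
      finally show "1 + \<epsilon> \<le> (1 + \<delta>)\<^sup>2" .
    qed
    finally have "sqrt ?q' \<le> sqrt ((1 + \<delta>)\<^sup>2 * ?q)" by (rule real_sqrt_le_mono)
    then show "nrm c (chart_inv c u) v \<le> (1 + \<delta>) * nrm c p v"
      using assms(3) by (simp add: nrm_def real_sqrt_mult)
    have "(1 - \<epsilon>) * ?q \<le> ?q'" using main[OF u, of v] by (simp add: algebra_simps abs_le_iff)
    then have "?q \<le> (1 + \<delta>) * ?q'" using e(3) assms(3) by (simp add: field_simps)
    also have "\<dots> \<le> (1 + \<delta>)\<^sup>2 * ?q'"
    proof (intro mult_right_mono)
      show "1 + \<delta> \<le> (1 + \<delta>)\<^sup>2" using assms(3) by (simp add: power2_eq_square)
      have "u \<in> chart_image c" using u R2 by (auto simp: R_def)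
      then show "0 \<le> ?q'" using metric_nonneg c chart_inv_in by blast
    qed
    finally have "sqrt ?q \<le> sqrt ((1 + \<delta>)\<^sup>2 * ?q')" by (rule real_sqrt_le_mono)
    then show "nrm c p v \<le> (1 + \<delta>) * nrm c (chart_inv c u) v"
      using assms(3) by (simp add: nrm_def real_sqrt_mult)
  qed
qed

text \<open>\<open>C1_at\<close> speaks of all charts of the atlas, not just of \<open>c\<close>;
  regularity in the others comes from the C1 dependence of the transition maps.\<close>

lemma segment_C1:
  assumes c: "c \<in> A" and t: "u + t *\<^sub>R h \<in> chart_image c"
  defines "\<gamma> \<equiv> \<lambda>t. chart_inv c (u + t *\<^sub>R h)"
  shows "C1_at A \<gamma> t" "speed A g \<gamma> t = nrm c (\<gamma> t) h"
proof -
  define I where "I = (\<lambda>t. u + t *\<^sub>R h) -` chart_image c"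
  have ca: "isCont (\<lambda>t. u + t *\<^sub>R h) s" "continuous_on S (\<lambda>t. u + t *\<^sub>R h)" for s S
    by (intro continuous_intros)+
  have I: "open I" "t \<in> I"
    unfolding I_def using t by (auto intro!: open_vimage ca open_image[OF c])
  have der: "((\<lambda>t. u + t *\<^sub>R h) has_vector_derivative h) (at s)" for s
    unfolding has_vector_derivative_def by (auto intro!: derivative_eq_intros)
  have isC: "isCont \<gamma> t"
    unfolding \<gamma>_def
    by (rule isCont_o2[OF ca(1)])
       (use cont_chart_inv[OF c] open_image[OF c] t continuous_on_eq_continuous_at in blast)
  have trans: "(snd e \<circ> \<gamma> has_vector_derivative
      frechet_derivative (transition c e) (at (u + s *\<^sub>R h)) h) (at s)"
    if e: "e \<in> A" and s: "s \<in> I" "\<gamma> s \<in> fst e" for e s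
  proof -
    have p: "\<gamma> s \<in> fst c" "snd c (\<gamma> s) = u + s *\<^sub>R h"
      using s chart_inv_in[OF c] chart_inv[OF c] by (auto simp: \<gamma>_def I_def)
    have D: "(transition c e has_derivative frechet_derivative (transition c e) (at (u + s *\<^sub>R h))) (at (u + s *\<^sub>R h))"
      using transition_derivative[OF c e p(1) s(2)] p(2)
      by (simp add: frechet_derivative_at[symmetric])
    have "(transition c e \<circ> (\<lambda>t. u + t *\<^sub>R h) has_derivative
        frechet_derivative (transition c e) (at (u + s *\<^sub>R h)) \<circ> (\<lambda>x. x *\<^sub>R h)) (at s)"
      by (rule diff_chain_at[OF der[unfolded has_vector_derivative_def] D])
    moreover have "frechet_derivative (transition c e) (at (u + s *\<^sub>R h)) \<circ> (\<lambda>x. x *\<^sub>R h)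
       = (\<lambda>x. x *\<^sub>R frechet_derivative (transition c e) (at (u + s *\<^sub>R h)) h)"
      using has_derivative_linear[OF D] by (auto simp: linear_cmul)
    ultimately show ?thesis
      by (simp add: has_vector_derivative_def transition_def \<gamma>_def comp_def)
  qed
  show C: "C1_at A \<gamma> t"
    unfolding C1_at_def
  proof (intro conjI ballI impI isC)
    fix e assume e: "e \<in> A" "\<gamma> t \<in> fst e"
    show "snd e \<circ> \<gamma> differentiable at t" using trans[OF e(1) I(2) e(2)] by (rule differentiableI_vector)
    let ?J = "(\<lambda>t. u + t *\<^sub>R h) -` {u \<in> chart_image c. chart_inv c u \<in> fst e}"
    have J: "open ?J" by (intro open_vimage ca open_vimage_chart_inv c open_dom e)
    have tJ: "t \<in> ?J" using t e by (simp add: \<gamma>_def)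
    have p: "\<gamma> t \<in> fst c" "snd c (\<gamma> t) = u + t *\<^sub>R h"
      using t chart_inv_in[OF c] chart_inv[OF c] by (auto simp: \<gamma>_def)
    have "isCont (\<lambda>s. frechet_derivative (transition c e) (at (u + s *\<^sub>R h)) h) t"
      by (rule isCont_o2[OF ca(1)]) (use transition_C1[OF c e(1) p(1) e(2), of h] p(2) in simp)
    then show "isCont (\<lambda>s. vector_derivative (snd e \<circ> \<gamma>) (at s)) t"
      by (subst isCont_cong_open[OF J tJ])
         (use vector_derivative_at[OF trans[OF e(1)]] in \<open>auto simp: I_def \<gamma>_def\<close>)
  qed
  have "(snd c \<circ> \<gamma> has_vector_derivative h) (at t)"
    by (rule has_vector_derivative_transform_within_open[OF der I])
       (use chart_inv[OF c] in \<open>auto simp: \<gamma>_def I_def\<close>)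
  then show "speed A g \<gamma> t = nrm c (\<gamma> t) h"
    using speed_in_chart[OF C c] chart_inv_in[OF c t] by (simp add: vector_derivative_at \<gamma>_def)
qed

lemma dist_le_segment:
  assumes c: "c \<in> A" and uv: "\<And>t. t \<in> {0..1} \<Longrightarrow> u + t *\<^sub>R (v - u) \<in> chart_image c"
    and K: "\<And>t. t \<in> {0..1} \<Longrightarrow> nrm c (chart_inv c (u + t *\<^sub>R (v - u))) (v - u) \<le> K"
  shows "d (chart_inv c u) (chart_inv c v) \<le> ennreal K"
proof -
  define \<gamma> where "\<gamma> = (\<lambda>t. chart_inv c (u + t *\<^sub>R (v - u)))"
  have "continuous_on {0..1} \<gamma>"
    unfolding \<gamma>_def
    by (rule continuous_on_compose2[OF cont_chart_inv[OF c]]) (use uv in \<open>auto intro!: continuous_intros\<close>)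
  then have "d (\<gamma> 0) (\<gamma> 1) \<le> seglen A g \<gamma> 0 1"
    using dist_le_seglen(1)[of 0 1 \<gamma> "{}"] segment_C1(1)[OF c uv] by (simp add: \<gamma>_def)
  also have "\<dots> \<le> (\<integral>\<^sup>+ t\<in>{0..1::real}. ennreal K \<partial>lborel)"
    unfolding seglen_def
    using segment_C1(2)[OF c uv] K by (intro nn_integral_mono) (auto simp: \<gamma>_def indicator_def intro!: ennreal_leI)
  also have "\<dots> = ennreal K" by (simp add: nn_integral_cmult_indicator)
  finally show ?thesis by (simp add: \<gamma>_def)
qed

lemma curve_displacement:
  assumes c: "c \<in> A" "p0 \<in> fst c" and "s \<ge> 0" "continuous_on {0..s} \<gamma>" "finite T"
    and C: "\<And>t. t \<in> {0<..<s} - T \<Longrightarrow> C1_at A \<gamma> t" and in_c: "\<And>t. t \<in> {0..s} \<Longrightarrow> \<gamma> t \<in> fst c"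
    and K: "\<And>t v. t \<in> {0..s} \<Longrightarrow> nrm c p0 v \<le> K * nrm c (\<gamma> t) v" and "K \<ge> 0"
  shows "ennreal (nrm c p0 (snd c (\<gamma> s) - snd c (\<gamma> 0))) \<le> ennreal K * seglen A g \<gamma> 0 s"
proof (cases "seglen A g \<gamma> 0 s < top")
  case False
  show ?thesis
  proof (cases "K = 0")
    case True
    then show ?thesis using K[of 0] \<open>s \<ge> 0\<close> nrm_nonneg[OF c] by (simp add: ennreal_neg)
  next
    case nz: False
    have "seglen A g \<gamma> 0 s = top" using False by (metis less_top)
    then show ?thesis using nz \<open>K \<ge> 0\<close> by (simp add: ennreal_mult_eq_top_iff top_unique)
  qed
next
  case True
  obtain f where f: "f integrable_on {0..s}" "\<And>t. t \<in> {0..s} - (T \<union> {0,s}) \<Longrightarrow> f t = speed A g \<gamma> t"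
    "\<And>t. f t \<ge> 0" "\<And>u v. {u..v} \<subseteq> {0..s} \<Longrightarrow> seglen A g \<gamma> u v = ennreal (integral {u..v} f)"
    using seglen_integral[OF assms(5) C True] by metis
  define w where "w = snd c (\<gamma> s) - snd c (\<gamma> 0)"
  define F where "F t = w \<bullet> (g c p0 *v snd c (\<gamma> t))" for t
  define F' where "F' t = (if t \<in> T \<union> {0,s} then 0 else w \<bullet> (g c p0 *v vector_derivative (snd c \<circ> \<gamma>) (at t)))" for t
  have cc: "continuous_on {0..s} (\<lambda>t. snd c (\<gamma> t))"
    by (rule continuous_on_compose2[OF cont_chart[OF c(1)] assms(4)]) (use in_c in auto)
  have bl: "bounded_linear (\<lambda>x. w \<bullet> (g c p0 *v x))"
    by (intro bounded_linear_compose[OF bounded_linear_inner_right matrix_vector_mul_bounded_linear])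
  have "(F' has_integral (F s - F 0)) {0..s}"
  proof (rule fundamental_theorem_of_calculus_interior_strong[OF assms(5) \<open>s \<ge> 0\<close>])
    show "continuous_on {0..s} F"
      unfolding F_def by (intro bounded_linear.continuous_on[OF bl] cc)
    fix t assume t: "t \<in> {0<..<s} - T"
    have "(snd c \<circ> \<gamma> has_vector_derivative vector_derivative (snd c \<circ> \<gamma>) (at t)) (at t)"
      using C[OF t] c(1) in_c[of t] t by (auto simp: C1_at_def vector_derivative_works)
    from bounded_linear.has_vector_derivative[OF bl this]
    show "(F has_vector_derivative F' t) (at t)" using t by (simp add: F_def[abs_def] F'_def o_def)
  qed
  then have F': "F' integrable_on {0..s}" "integral {0..s} F' = F s - F 0"
    by (auto simp: integral_unique)
  have "norm (F' t) \<le> nrm c p0 w * K * f t" if t: "t \<in> {0..s}" for t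
  proof (cases "t \<in> T \<union> {0, s}")
    case True
    then show ?thesis using f(3) nrm_nonneg[OF c] \<open>K \<ge> 0\<close> by (simp add: F'_def)
  next
    case False
    then have t': "t \<in> {0<..<s} - T" using t by auto
    let ?v = "vector_derivative (snd c \<circ> \<gamma>) (at t)"
    have "\<bar>w \<bullet> (g c p0 *v ?v)\<bar> \<le> nrm c p0 w * nrm c p0 ?v" by (rule metric_Cauchy_Schwarz[OF c])
    also have "\<dots> \<le> nrm c p0 w * (K * nrm c (\<gamma> t) ?v)"
      by (intro mult_left_mono K t nrm_nonneg[OF c])
    also have "nrm c (\<gamma> t) ?v = f t"
      using speed_in_chart[OF C[OF t'] c(1) in_c[OF t]] f(2)[of t] False t by simp
    finally show ?thesis using False by (simp add: F'_def o_def mult.assoc)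
  qed
  then have "norm (integral {0..s} F') \<le> integral {0..s} (\<lambda>t. nrm c p0 w * K * f t)"
    by (intro integral_norm_bound_integral F' integrable_on_mult_right f(1))
  also have "\<dots> = nrm c p0 w * K * integral {0..s} f" by simp
  also have "integral {0..s} F' = (nrm c p0 w)\<^sup>2"
    unfolding F'(2) nrm_square[OF c] F_def w_def
    by (simp add: matrix_vector_mult_diff_distrib inner_diff_right)
  finally have "nrm c p0 w * nrm c p0 w \<le> nrm c p0 w * (K * integral {0..s} f)"
    by (simp add: power2_eq_square mult.assoc)
  moreover have "0 \<le> integral {0..s} f" by (rule integral_nonneg[OF f(1)]) (rule f(3))
  ultimately have "nrm c p0 w \<le> K * integral {0..s} f"
    using nrm_nonneg[OF c, of w] \<open>K \<ge> 0\<close> by (cases "nrm c p0 w = 0") auto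
  then show ?thesis
    using f(4)[of 0 s] \<open>K \<ge> 0\<close> by (simp add: w_def ennreal_leI flip: ennreal_mult')
qed

text \<open>As long as a short curve remains in the coordinate ball of radius \<open>R\<close>, the
  displacement bound confines it to the closed ball of radius \<open>R / 2\<close>. At a first exit
  time it would still be in this closed ball, hence inside: a contradiction. Only after this does
  the lower bound for \<open>d\<close> hold for all competing curves, including those that might
  leave the chart.\<close>

lemma no_escape:
  assumes c: "c \<in> A" "p0 \<in> fst c" and B: "ball (snd c p0) R \<subseteq> chart_image c"
    and K: "\<And>u v. u \<in> ball (snd c p0) R \<Longrightarrow> nrm c p0 v \<le> K * nrm c (chart_inv c u) v" "K > 0"
    and l: "l > 0" "\<And>v. l * norm v \<le> nrm c p0 v"
    and r: "r > 0" "r < R / 2" and p: "p \<in> fst c" "snd c p \<in> ball (snd c p0) r"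
    and d: "d p q < ennreal (l * (R / 2 - r) / K)"
  shows "q \<in> fst c \<and> snd c q \<in> ball (snd c p0) R \<and>
     ennreal (nrm c p0 (snd c q - snd c p)) \<le> ennreal K * d p q"
proof -
  define U where "U = {q \<in> fst c. snd c q \<in> ball (snd c p0) R}"
  have U: "open U" unfolding U_def by (intro open_vimage_chart c open_ball)
  have main: "q \<in> U \<and> ennreal (nrm c p0 (snd c q - snd c p)) \<le> ennreal K * a"
    if a: "d p q < a" "a \<le> ennreal (l * (R / 2 - r) / K)" for a
  proof -
    from short_curve[OF a(1)] obtain \<gamma> T where \<gamma>: "continuous_on {0..1} \<gamma>" "finite T"
      "\<And>t. t \<in> {0<..<1} - T \<Longrightarrow> C1_at A \<gamma> t" "\<gamma> 0 = p" "\<gamma> 1 = q" "seglen A g \<gamma> 0 1 < a" by metis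
    have disp: "ennreal (nrm c p0 (snd c (\<gamma> s) - snd c p)) \<le> ennreal K * seglen A g \<gamma> 0 1"
      if s: "s \<in> {0..1}" "\<And>t. t \<in> {0..s} \<Longrightarrow> \<gamma> t \<in> U" for s
    proof -
      have "ennreal (nrm c p0 (snd c (\<gamma> s) - snd c (\<gamma> 0))) \<le> ennreal K * seglen A g \<gamma> 0 s"
      proof (rule curve_displacement[OF c _ _ \<gamma>(2)])
        show "continuous_on {0..s} \<gamma>" by (rule continuous_on_subset[OF \<gamma>(1)]) (use s in auto)
        fix t assume t: "t \<in> {0..s}"
        then have tU: "\<gamma> t \<in> U" using s by blast
        then show "\<gamma> t \<in> fst c" by (simp add: U_def)
        show "nrm c p0 v \<le> K * nrm c (\<gamma> t) v" for v
          using K(1)[of "snd c (\<gamma> t)" v] tU inv_chart[OF c(1), of "\<gamma> t"] by (auto simp: U_def)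
      qed (use s \<gamma>(3) K in auto)
      also have "seglen A g \<gamma> 0 s \<le> seglen A g \<gamma> 0 1"
        unfolding seglen_def using s by (intro nn_integral_mono) (auto simp: indicator_def)
      finally show ?thesis using \<gamma>(4) by (simp add: mult_left_mono)
    qed
    have close: "snd c (\<gamma> s) \<in> cball (snd c p0) (R/2)"
      if s: "s \<in> {0..1}" "\<And>t. t \<in> {0..s} \<Longrightarrow> \<gamma> t \<in> U" for s
    proof -
      have "ennreal (nrm c p0 (snd c (\<gamma> s) - snd c p)) \<le> ennreal K * ennreal (l * (R / 2 - r) / K)"
        using disp[OF s] \<gamma>(6) a(2) by (meson mult_left_mono order_less_imp_le order_trans zero_le)
      also have "\<dots> = ennreal (l * (R / 2 - r))" using K(2) by (simp flip: ennreal_mult')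
      finally have "nrm c p0 (snd c (\<gamma> s) - snd c p) \<le> l * (R / 2 - r)" using r l by simp
      then have "l * norm (snd c (\<gamma> s) - snd c p) \<le> l * (R / 2 - r)" using l(2) order_trans by blast
      then have "dist (snd c (\<gamma> s)) (snd c p) \<le> R / 2 - r" using l(1) by (simp add: dist_norm)
      moreover have "dist (snd c p0) (snd c p) < r" using p by simp
      ultimately show ?thesis using dist_triangle[of "snd c p0" "snd c (\<gamma> s)" "snd c p"]
        by (simp add: dist_commute)
    qed
    have inU: "\<gamma> t \<in> U" if "t \<in> {0..1}" for t
    proof (rule ccontr)
      assume "\<gamma> t \<notin> U"
      define E where "E = \<gamma> -` (- U) \<inter> {0..1}"
      have "closed E"
        unfolding E_def by (rule continuous_on_closed_vimage[OF closed_atLeastAtMost, THEN iffD1, rule_format]) (use \<gamma>(1) U in auto)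
      then have cE: "compact E" by (rule compact_eq_bounded_closed[THEN iffD2, OF conjI, rotated]) (auto simp: E_def intro: bounded_subset[of "{0..1::real}"])
      have neE: "E \<noteq> {}" using \<open>\<gamma> t \<notin> U\<close> that by (auto simp: E_def)
      obtain s where s: "s \<in> E" "\<And>t. t \<in> E \<Longrightarrow> s \<le> t" using compact_attains_inf[OF cE neE] by blast
      have "p \<in> U" using p r by (auto simp: U_def)
      then have s0: "0 < s" "s \<le> 1" using s(1) \<gamma>(4) by (auto simp: E_def less_le)
      have before: "\<gamma> t \<in> U" if "t \<in> {0..<s}" for t
        using s(2)[of t] that s0 by (force simp: E_def)
      \<comment> \<open>The preimage of a closed coordinate ball is compact, hence closed in the
        Hausdorff manifold, so the point at the exit time \<open>s\<close>, a limit of points of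
        \<open>Q\<close>, is in \<open>Q\<close> as well.\<close>
      define Q where "Q = chart_inv c ` cball (snd c p0) (R/2)"
      have sub: "cball (snd c p0) (R/2) \<subseteq> ball (snd c p0) R" using r by auto
      have "compact Q" unfolding Q_def
        by (intro compact_continuous_image continuous_on_subset[OF cont_chart_inv[OF c(1)]] compact_cball)
           (use sub B in blast)
      then have cQ: "closed Q" by (rule compact_imp_closed)
      have QU: "Q \<subseteq> U"
        using sub B chart_inv_in[OF c(1)] chart_inv[OF c(1)] by (force simp: Q_def U_def)
      have "\<gamma> t \<in> Q" if t: "t \<in> {0..<s}" for t
      proof -
        have "snd c (\<gamma> t) \<in> cball (snd c p0) (R/2)" using t s0 by (intro close before) auto
        then show ?thesis using before[OF t] inv_chart[OF c(1), of "\<gamma> t"]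
          unfolding Q_def U_def by (metis (mono_tags, lifting) image_eqI mem_Collect_eq)
      qed
      then have "{0..<s} \<subseteq> \<gamma> -` Q \<inter> {0..s}" by auto
      moreover have "closed (\<gamma> -` Q \<inter> {0..s})"
      proof (rule continuous_on_closed_vimage[OF closed_atLeastAtMost, THEN iffD1, rule_format])
        show "continuous_on {0..s} \<gamma>" by (rule continuous_on_subset[OF \<gamma>(1)]) (use s0 in auto)
      qed (use cQ in auto)
      ultimately have "closure {0..<s} \<subseteq> \<gamma> -` Q \<inter> {0..s}" by (rule closure_minimal)
      moreover have "s \<in> closure {0..<s}" using s0 by simp
      ultimately have "\<gamma> s \<in> Q" by blast
      then show False using s(1) QU by (auto simp: E_def)
    qed
    have "ennreal (nrm c p0 (snd c q - snd c p)) \<le> ennreal K * seglen A g \<gamma> 0 1"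
      using disp[of 1] inU \<gamma>(5) by auto
    also have "\<dots> \<le> ennreal K * a" using \<gamma>(6) by (intro mult_left_mono) auto
    finally show ?thesis using inU[of 1] \<gamma>(5) by auto
  qed
  have "ennreal (nrm c p0 (snd c q - snd c p)) / ennreal K \<le> d p q"
  proof (rule dense_ge_bounded[OF d])
    fix a assume "d p q < a" "a < ennreal (l * (R / 2 - r) / K)"
    then have "ennreal (nrm c p0 (snd c q - snd c p)) \<le> ennreal K * a" using main by simp
    then show "ennreal (nrm c p0 (snd c q - snd c p)) / ennreal K \<le> a"
      using K(2) by (simp add: divide_le_posI_ennreal mult.commute)
  qed
  then have "ennreal (nrm c p0 (snd c q - snd c p)) \<le> ennreal K * d p q"
    using K(2) nrm_nonneg[OF c] d
    by (cases "d p q") (auto simp: divide_ennreal pos_divide_le_eq mult.commute ennreal_leI simp flip: ennreal_mult')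
  then show ?thesis using main[OF d] unfolding U_def by blast
qed

text \<open>The bridge between geometry and coordinates: near \<open>p0\<close> the distance is, up
  to 1 + \<delta>, a norm with constant coefficients. The upper bound comes from straight segments,
  the lower one from \<open>no_escape\<close>; the last clause says that small distance balls do not
  leave the coordinate ball.\<close>

lemma local_comparison:
  assumes c: "c \<in> A" "p0 \<in> fst c" and "\<delta> > 0"
  obtains r \<sigma> where "r > 0" "\<sigma> > 0" "ball (snd c p0) r \<subseteq> chart_image c"
    "\<And>u v. u \<in> ball (snd c p0) r \<Longrightarrow> v \<in> ball (snd c p0) r \<Longrightarrow>
       d (chart_inv c u) (chart_inv c v) \<le> ennreal ((1 + \<delta>) * nrm c p0 (v - u))"
    "\<And>u v. u \<in> ball (snd c p0) r \<Longrightarrow> v \<in> ball (snd c p0) r \<Longrightarrow>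
       ennreal (nrm c p0 (v - u)) \<le> ennreal (1 + \<delta>) * d (chart_inv c u) (chart_inv c v)"
    "\<And>u v. u \<in> ball (snd c p0) r \<Longrightarrow> nrm c (chart_inv c u) v \<le> (1 + \<delta>) * nrm c p0 v"
    "\<And>u v. u \<in> ball (snd c p0) r \<Longrightarrow> nrm c p0 v \<le> (1 + \<delta>) * nrm c (chart_inv c u) v"
    "\<And>q. d p0 q < ennreal \<sigma> \<Longrightarrow> q \<in> fst c \<and> snd c q \<in> ball (snd c p0) r"
proof -
  obtain l L where l: "l > 0" "L > 0" "\<And>v. l * norm v \<le> nrm c p0 v" "\<And>v. nrm c p0 v \<le> L * norm v"
    using nrm_equiv[OF c] by metis
  obtain R where R: "R > 0" "ball (snd c p0) R \<subseteq> chart_image c"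
    "\<And>u v. u \<in> ball (snd c p0) R \<Longrightarrow> nrm c (chart_inv c u) v \<le> (1 + \<delta>) * nrm c p0 v"
    "\<And>u v. u \<in> ball (snd c p0) R \<Longrightarrow> nrm c p0 v \<le> (1 + \<delta>) * nrm c (chart_inv c u) v"
    using metric_near[OF c assms(3)] by metis
  define r where "r = l * R / (2 * (2 * L + l))"
  have r: "r > 0" using l R by (simp add: r_def)
  have rl: "r * (2 * L + l) = l * R / 2" using l by (simp add: r_def field_simps)
  have "r * l < r * (2 * L + l)" using r l by simp
  then have rR: "r < R / 2" using l by (simp add: rl mult.commute[of _ l])
  define \<kappa> where "\<kappa> = l * (R / 2 - r) / (1 + \<delta>)"
  have \<kappa>: "\<kappa> > 0" "(1 + \<delta>) * \<kappa> = l * (R / 2 - r)" using l rR assms(3) by (auto simp: \<kappa>_def)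
  have sub: "ball (snd c p0) r \<subseteq> ball (snd c p0) R" using rR r by auto
  have esc: "q \<in> fst c \<and> snd c q \<in> ball (snd c p0) R \<and>
     ennreal (nrm c p0 (snd c q - snd c p)) \<le> ennreal (1 + \<delta>) * d p q"
    if "p \<in> fst c" "snd c p \<in> ball (snd c p0) r" "d p q < ennreal \<kappa>" for p q
    by (rule no_escape[OF c R(2,4) _ l(1,3) r rR]) (use that assms(3) in \<open>auto simp: \<kappa>_def\<close>)
  show ?thesis
  proof (rule that[of r "min \<kappa> (l * r / (1 + \<delta>))"])
    show "ball (snd c p0) r \<subseteq> chart_image c" using sub R by blast
    fix q assume q: "d p0 q < ennreal (min \<kappa> (l * r / (1 + \<delta>)))"
    then have q1: "d p0 q < ennreal \<kappa>" "d p0 q < ennreal (l * r / (1 + \<delta>))"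
      by (meson ennreal_leI min.cobounded1 min.cobounded2 order_less_le_trans)+
    then have e: "q \<in> fst c" "ennreal (nrm c p0 (snd c q - snd c p0)) \<le> ennreal (1 + \<delta>) * d p0 q"
      using esc[of p0 q] c r by auto
    note e(2)
    also have "ennreal (1 + \<delta>) * d p0 q < ennreal (1 + \<delta>) * ennreal (l * r / (1 + \<delta>))"
      by (rule ennreal_mult_strict_left_mono[OF q1(2)]) (use assms(3) in \<open>simp_all del: ennreal_plus\<close>)
    also have "\<dots> = ennreal (l * r)" using assms(3) by (simp del: ennreal_plus flip: ennreal_mult')
    finally have "nrm c p0 (snd c q - snd c p0) < l * r"
      using nrm_nonneg[OF c] by (simp add: ennreal_less_iff)
    then have "l * norm (snd c q - snd c p0) < l * r" using l(3) order_le_less_trans by blast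
    then show "q \<in> fst c \<and> snd c q \<in> ball (snd c p0) r"
      using l e(1) by (simp add: dist_norm norm_minus_commute)
  next
    fix u v assume u: "u \<in> ball (snd c p0) r" and v: "v \<in> ball (snd c p0) r"
    have seg: "u + t *\<^sub>R (v - u) \<in> ball (snd c p0) R" if "t \<in> {0..1}" for t
      using convexD_alt[OF convex_ball, of u "snd c p0" R v t] u v sub that
      by (simp add: algebra_simps subset_iff)
    show "d (chart_inv c u) (chart_inv c v) \<le> ennreal ((1 + \<delta>) * nrm c p0 (v - u))"
      using seg R(2,3) by (intro dist_le_segment[OF c(1)]) blast+
    have uc: "u \<in> chart_image c" "v \<in> chart_image c" using u v sub R(2) by blast+
    show "ennreal (nrm c p0 (v - u)) \<le> ennreal (1 + \<delta>) * d (chart_inv c u) (chart_inv c v)"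
    proof (cases "d (chart_inv c u) (chart_inv c v) < ennreal \<kappa>")
      case True
      then show ?thesis using esc[of "chart_inv c u" "chart_inv c v"] uc u chart_inv_in[OF c(1)] chart_inv[OF c(1)]
        by simp
    next
      case False
      have "norm (v - u) \<le> 2 * r" using u v dist_triangle_less_add[of u "snd c p0" r v r]
        by (simp add: dist_norm norm_minus_commute)
      then have "nrm c p0 (v - u) \<le> L * (2 * r)" using l(2) l(4)[of "v - u"]
        by (meson mult_le_cancel_left_pos order_trans)
      also have "\<dots> = (1 + \<delta>) * \<kappa>" unfolding \<kappa>(2) using rl by (simp add: algebra_simps)
      finally have "ennreal (nrm c p0 (v - u)) \<le> ennreal (1 + \<delta>) * ennreal \<kappa>"
        using assms(3) \<kappa>(1) by (simp add: ennreal_leI del: ennreal_plus flip: ennreal_mult')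
      also have "\<dots> \<le> ennreal (1 + \<delta>) * d (chart_inv c u) (chart_inv c v)"
        using False by (intro mult_left_mono) auto
      finally show ?thesis .
    qed
  qed (use r \<kappa> l R assms(3) sub in auto)
qed

section \<open>Distance balls and the manifold topology\<close>

lemma small_neighbourhood:
  assumes "e > 0" obtains U where "open U" "p \<in> U" "\<And>q. q \<in> U \<Longrightarrow> d p q < ennreal e"
proof -
  obtain c where c: "c \<in> A" "p \<in> fst c" by (rule ex_chart)
  obtain r where r: "r > 0" "ball (snd c p) r \<subseteq> chart_image c"
    "\<And>u v. u \<in> ball (snd c p) r \<Longrightarrow> v \<in> ball (snd c p) r \<Longrightarrow>
       d (chart_inv c u) (chart_inv c v) \<le> ennreal ((1 + 1) * nrm c p (v - u))"
    using local_comparison[OF c zero_less_one] by metis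
  obtain L where L: "L > 0" "\<And>v. nrm c p v \<le> L * norm v" using nrm_equiv[OF c] by metis
  define s where "s = min r (e / (2 * L))"
  have s: "s > 0" "s \<le> r" "2 * (L * s) \<le> e" using r L assms by (auto simp: s_def min_def field_simps)
  show ?thesis
  proof (rule that[of "{q \<in> fst c. snd c q \<in> ball (snd c p) s}"])
    show "open {q \<in> fst c. snd c q \<in> ball (snd c p) s}" by (rule open_vimage_chart[OF c(1) open_ball])
    show "p \<in> {q \<in> fst c. snd c q \<in> ball (snd c p) s}" using c s by auto
    fix q assume q: "q \<in> {q \<in> fst c. snd c q \<in> ball (snd c p) s}"
    then have "d p q \<le> ennreal (2 * nrm c p (snd c q - snd c p))"
      using r(3)[of "snd c p" "snd c q"] r(1) s(2) inv_chart[OF c(1), of q] inv_chart[OF c] by auto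
    also have "\<dots> < ennreal e"
    proof (rule ennreal_lessI[OF assms])
      have "norm (snd c q - snd c p) < s" using q by (simp add: dist_norm norm_minus_commute)
      then have "2 * (L * norm (snd c q - snd c p)) < 2 * (L * s)" using L by simp
      then show "2 * nrm c p (snd c q - snd c p) < e" using L(2)[of "snd c q - snd c p"] s by linarith
    qed
    finally show "d p q < ennreal e" .
  qed
qed

lemma open_dist_less: "open {(x, y). d x y < a}"
proof (subst open_subopen, rule ballI)
  fix z assume "z \<in> {(x, y). d x y < a}"
  then obtain x y where z: "z = (x, y)" "d x y < a" by auto
  obtain e where e: "e > 0" "d x y + ennreal e < a" using ennreal_gap[OF z(2)] by blast
  obtain U V where U: "open U" "x \<in> U" "\<And>q. q \<in> U \<Longrightarrow> d x q < ennreal (e/2)"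
    and V: "open V" "y \<in> V" "\<And>q. q \<in> V \<Longrightarrow> d y q < ennreal (e/2)"
    using small_neighbourhood[of "e/2" x] small_neighbourhood[of "e/2" y] e by (metis half_gt_zero)
  have "d x' y' < a" if "x' \<in> U" "y' \<in> V" for x' y'
  proof -
    have "d x' y' \<le> d x' x + (d x y + d y y')"
      using geo_triangle[of x' y' x] geo_triangle[of x y' y] by (meson add_left_mono order_trans)
    also have "\<dots> \<le> ennreal (e/2) + (d x y + ennreal (e/2))"
      using U(3)[OF that(1)] V(3)[OF that(2)] by (intro add_mono) (auto simp: geo_sym[of x' x])
    also have "\<dots> = d x y + (ennreal (e/2) + ennreal (e/2))" by (simp add: ac_simps)
    also have "ennreal (e/2) + ennreal (e/2) = ennreal e" using e by (simp flip: ennreal_plus)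
    finally show ?thesis using e(2) by simp
  qed
  then show "\<exists>T. open T \<and> z \<in> T \<and> T \<subseteq> {(x, y). d x y < a}"
    using U V z by (intro exI[of _ "U \<times> V"]) (auto intro: open_Times)
qed

lemma open_geo_ball: "open {y. d x y < a}"
proof -
  have "continuous_on UNIV (\<lambda>y. (x, y))" by (intro continuous_intros)
  from open_vimage[OF open_dist_less[of a] this] show ?thesis by (simp add: vimage_def)
qed

lemma measurable_dist: "(\<lambda>(x, y). d x y) \<in> borel_measurable (borel \<Otimes>\<^sub>M borel)"
  unfolding borel_prod
  by (rule borel_measurableI_less) (use open_dist_less in \<open>auto simp: case_prod_unfold\<close>)

end

section \<open>The volume measure\<close>

text \<open>The segment from the identity to \<open>M\<close> consists of positive definite, hence
  invertible matrices; the determinant starts at 1 and cannot pass through 0.\<close>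

lemma det_pos_definite:
  fixes M :: "real^'n^'n" assumes "\<And>v. v \<noteq> 0 \<Longrightarrow> v \<bullet> (M *v v) > 0"
  shows "det M > 0"
proof (rule ccontr)
  assume neg: "\<not> det M > 0"
  define P where "P t = (1 - t) *\<^sub>R mat 1 + t *\<^sub>R M" for t :: real
  have pos: "v \<bullet> (P t *v v) > 0" if "t \<in> {0..1}" "v \<noteq> 0" for t v
  proof -
    have "v \<bullet> (P t *v v) = (1 - t) * (v \<bullet> v) + t * (v \<bullet> (M *v v))"
      by (simp add: P_def matrix_vector_mult_add_rdistrib inner_add_right scaleR_matrix_vector_assoc[symmetric])
    then show ?thesis using that assms[of v]
      by (cases "t = 0") (auto intro!: add_nonneg_pos)
  qed
  have nz: "det (P t) \<noteq> 0" if t: "t \<in> {0..1}" for t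
  proof
    assume "det (P t) = 0"
    then have "\<not> invertible (P t)" by (simp add: invertible_det_nz)
    then have "\<not> inj ((*v) (P t))"
      using matrix_left_invertible_injective[of "P t"] invertible_left_inverse[of "P t"] by blast
    then obtain v where "v \<noteq> 0" "P t *v v = 0"
      using linear_injective_0[of "(*v) (P t)"] by auto
    then show False using pos[OF t, of v] by simp
  qed
  have "continuous_on {0..1} (\<lambda>t. det (P t))"
    unfolding det_def P_def by (intro continuous_intros) 
  moreover have "det (P 0) = 1" "det (P 1) = det M" by (simp_all add: P_def det_I)
  ultimately obtain t where "t \<in> {0..1}" "det (P t) = 0"
    using IVT2'[of "\<lambda>t. det (P t)" 1 0 0] neg by auto
  then show False using nz by blast
qed

context closed_manifold begin

lemma sets_vol [simp]: "sets vol = sets borel"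
  using volume by (simp add: riemannian_volume_def)

lemma space_vol [simp]: "space vol = UNIV"
  using sets_eq_imp_space_eq[OF sets_vol] by simp

lemma measurable_vol [simp]: "borel_measurable vol = borel_measurable borel"
  by (rule measurable_cong_sets) simp_all

definition dens :: "('a,'k) chart \<Rightarrow> real^'k \<Rightarrow> real" where
  "dens c u = sqrt (det (g c (chart_inv c u)))"

lemma vol_eq: "c \<in> A \<Longrightarrow> B \<in> sets borel \<Longrightarrow> B \<subseteq> fst c \<Longrightarrow>
    emeasure vol B = (\<integral>\<^sup>+ u\<in>snd c ` B. ennreal (dens c u) \<partial>lborel)"
  using volume by (simp add: riemannian_volume_def dens_def)

lemma dens_pos: "c \<in> A \<Longrightarrow> u \<in> chart_image c \<Longrightarrow> dens c u > 0"
  unfolding dens_def real_sqrt_gt_0_iff using metric_pos chart_inv_in by (intro det_pos_definite) blast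

lemma dens_cont: "c \<in> A \<Longrightarrow> continuous_on (chart_image c) (dens c)"
  unfolding dens_def det_def by (intro continuous_intros metric_cont)

lemma chart_image_sets:
  assumes c: "c \<in> A" and "B \<in> sets borel" "B \<subseteq> fst c" shows "snd c ` B \<in> sets borel"
proof -
  have "chart_inv c \<in> borel_measurable (restrict_space borel (chart_image c))"
    by (rule borel_measurable_continuous_on_restrict[OF cont_chart_inv[OF c]])
  then have "chart_inv c -` B \<inter> space (restrict_space borel (chart_image c))
      \<in> sets (restrict_space borel (chart_image c))"
    using assms(2) by (rule measurable_sets)
  moreover have "chart_inv c -` B \<inter> space (restrict_space borel (chart_image c)) = snd c ` B"
    unfolding chart_image_eq[OF c assms(3)] by (auto simp: space_restrict_space)
  ultimately show ?thesis
    using open_image[OF c] by (auto simp: sets_restrict_space_iff)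
qed

lemma chart_vimage_sets:
  assumes c: "c \<in> A" and "N \<in> sets borel" shows "{p \<in> fst c. snd c p \<in> N} \<in> sets borel"
proof -
  have "snd c \<in> borel_measurable (restrict_space borel (fst c))"
    by (rule borel_measurable_continuous_on_restrict[OF cont_chart[OF c]])
  then have "snd c -` N \<inter> space (restrict_space borel (fst c)) \<in> sets (restrict_space borel (fst c))"
    using assms(2) by (rule measurable_sets)
  moreover have "snd c -` N \<inter> space (restrict_space borel (fst c)) = {p \<in> fst c. snd c p \<in> N}"
    by (auto simp: space_restrict_space)
  ultimately show ?thesis
    using open_dom[OF c] by (auto simp: sets_restrict_space_iff)
qed

text \<open>Since the volume density is positive, a chart identifies volume null sets with Lebesgue
  null sets. Almost-everywhere statements can therefore be moved through charts in both
  directions.\<close>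

lemma vol_null_iff:
  assumes c: "c \<in> A" and B: "B \<in> sets borel" "B \<subseteq> fst c"
  shows "emeasure vol B = 0 \<longleftrightarrow> emeasure lborel (snd c ` B) = 0"
proof -
  have cB: "snd c ` B \<in> sets borel" by (rule chart_image_sets[OF assms])
  have sub: "snd c ` B \<subseteq> chart_image c" using B(2) by (auto simp: chart_image_def)
  have "(\<lambda>u. indicator (snd c ` B) u *\<^sub>R dens c u) \<in> borel_measurable borel"
    by (rule borel_measurable_continuous_on_indicator[OF cB continuous_on_subset[OF dens_cont[OF c] sub]])
  then have m: "(\<lambda>u. ennreal (indicator (snd c ` B) u *\<^sub>R dens c u)) \<in> borel_measurable lborel"
    by simp
  have "emeasure vol B = (\<integral>\<^sup>+ u. ennreal (indicator (snd c ` B) u *\<^sub>R dens c u) \<partial>lborel)"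
    unfolding vol_eq[OF assms] by (intro nn_integral_cong) (auto simp: indicator_def)
  also have "\<dots> = 0 \<longleftrightarrow> (AE u in lborel. ennreal (indicator (snd c ` B) u *\<^sub>R dens c u) = 0)"
    by (rule nn_integral_0_iff_AE[OF m])
  also have "\<dots> \<longleftrightarrow> (AE u in lborel. u \<notin> snd c ` B)"
    by (rule AE_cong) (use dens_pos[OF c] sub in \<open>force simp: indicator_def ennreal_eq_0_iff not_le\<close>)
  also have "\<dots> \<longleftrightarrow> snd c ` B \<in> null_sets lborel"
    using AE_iff_null_sets[of "snd c ` B" lborel] cB by simp
  finally show ?thesis using cB by (auto simp: null_sets_def)
qed

lemma AE_chart:
  assumes c: "c \<in> A" and "AE p in vol. P p"
  shows "AE u in lborel. u \<in> chart_image c \<longrightarrow> P (chart_inv c u)"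
proof -
  obtain N where N: "{p \<in> space vol. \<not> P p} \<subseteq> N" "emeasure vol N = 0" "N \<in> sets vol"
    by (rule AE_E[OF assms(2)])
  let ?B = "N \<inter> fst c"
  have B: "?B \<in> sets borel" using N(3) open_dom[OF c] by auto
  have "emeasure vol ?B \<le> emeasure vol N" using N(3) by (intro emeasure_mono) auto
  then have "emeasure lborel (snd c ` ?B) = 0"
    using vol_null_iff[OF c B] N(2) by auto
  then have "snd c ` ?B \<in> null_sets lborel" using chart_image_sets[OF c B] by auto
  then show ?thesis
    by (rule AE_I') (use N(1) chart_image_eq[OF c, of ?B] chart_inv_in[OF c] in auto)
qed

lemma AE_chart_inv:
  assumes c: "c \<in> A" and "AE u in lborel. u \<in> chart_image c \<longrightarrow> P (chart_inv c u)"
  shows "AE p in vol. p \<in> fst c \<longrightarrow> P p"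
proof -
  obtain N where N: "{u \<in> space lborel. \<not> (u \<in> chart_image c \<longrightarrow> P (chart_inv c u))} \<subseteq> N"
    "emeasure lborel N = 0" "N \<in> sets lborel"
    by (rule AE_E[OF assms(2)])
  let ?B = "{p \<in> fst c. snd c p \<in> N}"
  have B: "?B \<in> sets borel" using chart_vimage_sets[OF c] N(3) by simp
  have "emeasure lborel (snd c ` ?B) \<le> emeasure lborel N" using N(3) by (intro emeasure_mono) auto
  then have "?B \<in> null_sets vol"
    using vol_null_iff[OF c B] N(2) B by (auto simp: null_sets_def)
  then show ?thesis
    by (rule AE_I') (use N(1) chart_in[OF c] inv_chart[OF c] in force)
qed

lemma vol_open_pos:
  assumes "open U" "U \<noteq> {}" shows "emeasure vol U > 0"
proof -
  obtain p where p: "p \<in> U" using assms by blast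
  obtain c where c: "c \<in> A" "p \<in> fst c" by (rule ex_chart)
  let ?B = "U \<inter> fst c"
  have oB: "open ?B" "?B \<in> sets borel" using assms(1) open_dom[OF c(1)] by auto
  have "open (snd c ` ?B)" by (rule open_chart_image[OF c(1) oB(1)]) auto
  then have "\<not> negligible (snd c ` ?B)" using open_not_negligible p c by blast
  then have "emeasure lborel (snd c ` ?B) \<noteq> 0"
    using chart_image_sets[OF c(1) oB(2)] by (auto simp: negligible_iff_null_sets null_sets_def)
  then have "emeasure vol ?B \<noteq> 0" using vol_null_iff[OF c(1) oB(2)] by auto
  moreover have "emeasure vol ?B \<le> emeasure vol U" using assms by (intro emeasure_mono) auto
  ultimately show ?thesis by (metis le_zero_eq zero_less_iff_neq_zero)
qed

text \<open>Every choice of a point outside an exceptional set goes through here: such points are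
  always sought in a nonempty open set.\<close>

lemma open_avoid_null:
  assumes "open U" "U \<noteq> {}" "N \<in> null_sets vol" obtains p where "p \<in> U" "p \<notin> N"
proof -
  have "\<not> U \<subseteq> N"
  proof
    assume "U \<subseteq> N"
    then have "emeasure vol U \<le> emeasure vol N" using assms(3) by (intro emeasure_mono) auto
    then show False using vol_open_pos[OF assms(1,2)] assms(3) by (auto simp: null_sets_def)
  qed
  then show ?thesis using that by blast
qed

lemma finite_atlas:
  obtains B where "finite B" "B \<subseteq> A" "(\<Union>c\<in>B. fst c) = UNIV"
proof -
  obtain C where "C \<subseteq> A" "finite C" "UNIV \<subseteq> (\<Union>c\<in>C. fst c)"
    using compactE_image[OF compact_UNIV, of A fst] open_dom atlas unfolding smooth_atlas_def
    by (metis UNIV_I subsetI)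
  then show ?thesis using that by blast
qed

text \<open>Compactness reduces this to local finiteness, where the continuous density is bounded on
  a closed coordinate ball. Finiteness gives access to product measures and to slicing of null
  sets.\<close>

lemma finite_volume: "finite_measure vol"
proof
  have "\<exists>U. open U \<and> p \<in> U \<and> emeasure vol U < top" for p
  proof -
    obtain c where c: "c \<in> A" "p \<in> fst c" by (rule ex_chart)
    obtain r where r: "r > 0" "cball (snd c p) r \<subseteq> chart_image c"
      using open_image[OF c(1)] chart_in[OF c] open_contains_cball by blast
    have "compact (dens c ` cball (snd c p) r)"
      by (intro compact_continuous_image continuous_on_subset[OF dens_cont[OF c(1)] r(2)] compact_cball)
    then obtain K where K: "\<And>u. u \<in> cball (snd c p) r \<Longrightarrow> norm (dens c u) \<le> K"
      using compact_imp_bounded bounded_iff by (metis imageI)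
    let ?U = "{q \<in> fst c. snd c q \<in> ball (snd c p) r}"
    have U: "open ?U" by (rule open_vimage_chart[OF c(1) open_ball])
    have "emeasure vol ?U = (\<integral>\<^sup>+ u\<in>snd c ` ?U. ennreal (dens c u) \<partial>lborel)"
      using U by (intro vol_eq c) auto
    also have "\<dots> \<le> (\<integral>\<^sup>+ u. ennreal K * indicator (ball (snd c p) r) u \<partial>lborel)"
      by (intro nn_integral_mono) (use K in \<open>auto simp: indicator_def abs_le_iff intro!: ennreal_leI\<close>)
    also have "\<dots> = ennreal K * emeasure lborel (ball (snd c p) r)" by (simp add: nn_integral_cmult_indicator)
    also have "\<dots> < top" using emeasure_bounded_finite[of "ball (snd c p) r"]
      by (simp add: ennreal_mult_less_top)
    finally show ?thesis using U c r(1) by (intro exI[of _ ?U]) auto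
  qed
  then obtain U where U: "\<And>p. open (U p)" "\<And>p. p \<in> U p" "\<And>p. emeasure vol (U p) < top" by metis
  obtain F where F: "finite F" "UNIV \<subseteq> (\<Union>p\<in>F. U p)"
    using compactE_image[OF compact_UNIV, of UNIV U] U by (metis UNIV_I UN_I subsetI)
  have "emeasure vol (\<Union>p\<in>F. U p) \<le> (\<Sum>p\<in>F. emeasure vol (U p))"
    using F U(1) by (intro emeasure_subadditive_finite) auto
  also have "\<dots> < top" using F(1) by (induction F rule: finite_induct) (simp_all add: U(3))
  moreover have "(\<Union>p\<in>F. U p) = UNIV" using F(2) by blast
  ultimately show "emeasure vol (space vol) \<noteq> \<infinity>" by simp
qed

text \<open>With strict inequalities the admissible intermediate points form an open set, so a null
  set can be avoided at no cost in length.\<close>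

lemma intermediate_point_avoiding:
  assumes "d x y < ennreal (l1 + l2)" "l1 > 0" "l2 > 0" "N \<in> null_sets vol"
  obtains z where "d x z < ennreal l1" "d z y < ennreal l2" "z \<notin> N"
proof -
  let ?U = "{z. d x z < ennreal l1} \<inter> {z. d y z < ennreal l2}"
  have "open ?U" by (intro open_Int open_geo_ball)
  moreover obtain z where "d x z < ennreal l1" "d z y < ennreal l2"
    by (rule intermediate_point[OF assms(1-3)])
  then have "?U \<noteq> {}" by (auto simp: geo_sym[of z y])
  ultimately obtain w where "w \<in> ?U" "w \<notin> N" using open_avoid_null assms(4) by blast
  then show ?thesis using that[of w] by (auto simp: geo_sym[of w y])
qed

section \<open>The graphon distance compared with the geodesic distance\<close>

lemma graphon_eq: "r > 0 \<Longrightarrow>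
    geometric_graphon A g r x y = (if d x y \<le> ennreal r then 1 / r ^ CARD('k) else 0)"
proof -
  assume r: "r > 0"
  have "d x y / ennreal r \<le> 1 \<longleftrightarrow> d x y \<le> ennreal r"
    by (cases "d x y") (use r in \<open>auto simp: divide_ennreal pos_divide_le_eq ennreal_top_divide top_unique\<close>)
  then show ?thesis by (simp add: geometric_graphon_def unit_kernel_def)
qed

definition weight :: "real \<Rightarrow> 'a \<Rightarrow> 'a \<Rightarrow> ennreal" where
  "weight r x y = inverse (ennreal (geometric_graphon A g r x y))"

lemma weight_eq: "r > 0 \<Longrightarrow> weight r x y = (if d x y \<le> ennreal r then ennreal (r ^ CARD('k)) else top)"
  by (simp add: weight_def graphon_eq inverse_ennreal)

text \<open>A step of finite cost has length at most \<open>r\<close> and cost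
  \<open>r ^ CARD('k)\<close>, thus at least \<open>r ^ (CARD('k) - 1)\<close> per unit of length.
  The bound holds for every choice of intermediate points, so it survives the essential
  infimum.\<close>

lemma graphon_dist_ge:
  assumes r: "r > 0"
  shows "ennreal (r ^ (CARD('k) - 1)) * d x y \<le> graphon_dist vol (geometric_graphon A g r) x y"
  unfolding graphon_dist_def Let_def weight_def[symmetric]
proof (intro INF_greatest Liminf_bounded always_eventually allI)
  fix n z assume "n \<in> {1::nat..}"
  have r1: "r ^ CARD('k) = r ^ (CARD('k) - 1) * r" by (rule power_minus_mult[symmetric]) simp
  have step: "ennreal (r ^ (CARD('k) - 1)) * d x y \<le> weight r x y" for x y
  proof (cases "d x y \<le> ennreal r")
    case True
    then have "ennreal (r ^ (CARD('k) - 1)) * d x y \<le> ennreal (r ^ (CARD('k) - 1)) * ennreal r"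
      by (rule mult_left_mono) simp
    then show ?thesis using True r by (simp add: weight_eq r1 ennreal_mult)
  qed (simp add: weight_eq r)
  have chain: "ennreal (r ^ (CARD('k) - 1)) * d (p 0) (p m) \<le> (\<Sum>i<m. weight r (p i) (p (Suc i)))" for p m
  proof (induction m)
    case (Suc m)
    have "ennreal (r ^ (CARD('k) - 1)) * d (p 0) (p (Suc m)) \<le>
      ennreal (r ^ (CARD('k) - 1)) * d (p 0) (p m) + ennreal (r ^ (CARD('k) - 1)) * d (p m) (p (Suc m))"
      unfolding distrib_left[symmetric] by (intro mult_left_mono geo_triangle) simp
    also have "\<dots> \<le> (\<Sum>i<m. weight r (p i) (p (Suc i))) + weight r (p m) (p (Suc m))"
      by (intro add_mono Suc step)
    finally show ?case by simp
  qed simp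
  show "ennreal (r ^ (CARD('k) - 1)) * d x y
     \<le> (\<Sum>i<n. weight r ((z(0 := x, n := y)) i) ((z(0 := x, n := y)) (Suc i)))"
    using chain[of "z(0 := x, n := y)" n] \<open>n \<in> {1..}\<close> by simp
qed

lemma chain_points:
  assumes "r > 0" "n \<ge> 1" "d x y < ennreal (real n * r)"
  obtains z where "z 0 = x" "z n = y" "\<And>i. i < n \<Longrightarrow> d (z i) (z (Suc i)) < ennreal r"
proof -
  have "\<exists>z. z 0 = x \<and> z n = y \<and> (\<forall>i<n. d (z i) (z (Suc i)) < ennreal r)"
    using assms(2,3)
  proof (induction n arbitrary: x rule: dec_induct)
    case base
    then show ?case by (intro exI[of _ "\<lambda>i. if i = 0 then x else y"]) auto
  next
    case (step n)
    have "d x y < ennreal (r + real n * r)" using step.prems by (simp add: algebra_simps)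
    then obtain w where w: "d x w < ennreal r" "d w y < ennreal (real n * r)"
      using intermediate_point assms(1) step.hyps(1) by (metis mult_pos_pos of_nat_0_less_iff less_le_trans zero_less_one)
    obtain z where z: "z 0 = w" "z n = y" "\<forall>i<n. d (z i) (z (Suc i)) < ennreal r"
      using step.IH[OF w(2)] by blast
    show ?case
      by (rule exI[of _ "\<lambda>i. case i of 0 \<Rightarrow> x | Suc j \<Rightarrow> z j"])
         (use w z in \<open>auto split: nat.splits\<close>)
  qed
  then show ?thesis using that by blast
qed

text \<open>A single chain is invisible to an essential infimum. The slack in the strict
  inequalities lets every intermediate point range over a small ball without changing the cost, and
  a product of balls has positive measure.\<close>

lemma graphon_dist_le_steps:
  assumes r: "r > 0" and n: "n \<ge> 1" and dxy: "d x y < ennreal (real n * r)"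
  shows "graphon_dist vol (geometric_graphon A g r) x y \<le> ennreal (real n * r ^ CARD('k))"
proof -
  obtain z where z: "z 0 = x" "z n = y" "\<And>i. i < n \<Longrightarrow> d (z i) (z (Suc i)) < ennreal r"
    using chain_points[OF assms] by metis
  have "\<exists>e>0. d (z i) (z (Suc i)) + ennreal e < ennreal r" if "i < n" for i
    using ennreal_gap[OF z(3)[OF that]] by metis
  then obtain e where e: "\<And>i. i < n \<Longrightarrow> e i > 0 \<and> d (z i) (z (Suc i)) + ennreal (e i) < ennreal r" by metis
  \<comment> \<open>Half of the smallest slack, because both end points of a step may move.\<close>
  define \<epsilon> where "\<epsilon> = Min (e ` {..<n}) / 2"
  have \<epsilon>: "\<epsilon> > 0" "\<And>i. i < n \<Longrightarrow> 2 * \<epsilon> \<le> e i" using e n by (auto simp: \<epsilon>_def lessThan_empty_iff)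
  define U where "U i = {q. d (z i) q < ennreal \<epsilon>}" for i
  have U: "open (U i)" "z i \<in> U i" for i using \<epsilon> by (auto simp: U_def open_geo_ball)
  interpret finite_measure vol by (rule finite_volume)
  interpret product_sigma_finite "\<lambda>_::nat. vol" by standard
  let ?M = "Pi\<^sub>M {1..<n} (\<lambda>_. vol)" and ?G = "Pi\<^sub>E {1..<n} U"
  let ?F = "\<lambda>w. \<Sum>i<n. weight r ((w(0 := x, n := y)) i) ((w(0 := x, n := y)) (Suc i))"
  have G: "emeasure ?M ?G > 0"
  proof -
    have "emeasure ?M ?G = (\<Prod>i\<in>{1..<n}. emeasure vol (U i))"
      using U by (intro emeasure_PiM) auto
    moreover have "emeasure vol (U i) \<noteq> 0" for i using vol_open_pos[OF U(1)[of i]] U(2)[of i] by (metis empty_iff order_less_irrefl)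
    ultimately show ?thesis by (simp add: zero_less_iff_neq_zero)
  qed
  have val: "?F w = ennreal (real n * r ^ CARD('k))" if w: "w \<in> ?G" for w
  proof -
    let ?p = "w(0 := x, n := y)"
    have near: "d (z i) (?p i) \<le> ennreal \<epsilon>" if "i \<le> n" for i
    proof (cases "i = 0 \<or> i = n")
      case False
      then have "w i \<in> U i" using w that by (intro PiE_mem[OF w]) auto
      then show ?thesis using False by (simp add: U_def)
    qed (use z n in auto)
    have "weight r (?p i) (?p (Suc i)) = ennreal (r ^ CARD('k))" if i: "i < n" for i
    proof -
      have "d (?p i) (?p (Suc i)) \<le> d (?p i) (z i) + (d (z i) (z (Suc i)) + d (z (Suc i)) (?p (Suc i)))"
        by (meson add_left_mono geo_triangle order_trans)
      also have "\<dots> \<le> ennreal \<epsilon> + (d (z i) (z (Suc i)) + ennreal \<epsilon>)"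
        using near[of i] near[of "Suc i"] i by (intro add_mono) (simp_all add: geo_sym[of _ "z i"])
      also have "\<dots> = d (z i) (z (Suc i)) + (ennreal \<epsilon> + ennreal \<epsilon>)" by (simp add: ac_simps)
      also have "\<dots> \<le> d (z i) (z (Suc i)) + ennreal (e i)"
        using \<epsilon> i by (intro add_mono) (auto simp flip: ennreal_plus intro!: ennreal_leI)
      finally have "d (?p i) (?p (Suc i)) \<le> ennreal r" using e[OF i] by (meson order_le_less_trans order_less_imp_le)
      then show ?thesis by (simp add: weight_eq r)
    qed
    then show ?thesis using r by (simp add: ennreal_mult ennreal_of_nat_eq_real_of_nat)
  qed
  have "Liminf (ae_filter ?M) ?F \<le> ennreal (real n * r ^ CARD('k))"
  proof (rule ccontr)
    assume "\<not> ?thesis"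
    then have "eventually (\<lambda>w. ?F w > ennreal (real n * r ^ CARD('k))) (ae_filter ?M)"
      by (intro less_LiminfD) simp
    then obtain N where N: "{w \<in> space ?M. \<not> ?F w > ennreal (real n * r ^ CARD('k))} \<subseteq> N"
      "emeasure ?M N = 0" "N \<in> sets ?M" by (rule AE_E)
    have "?G \<subseteq> N" using N(1) val by (fastforce simp: space_PiM PiE_iff)
    then have "emeasure ?M ?G \<le> emeasure ?M N" using N(3) by (rule emeasure_mono)
    then show False using G N(2) by simp
  qed
  then show ?thesis
    unfolding graphon_dist_def Let_def weight_def[symmetric] using n by (intro INF_lower2[of n]) auto
qed

lemma graphon_dist_le:
  assumes r: "r > 0"
  shows "graphon_dist vol (geometric_graphon A g r) x y \<le> ennreal (r ^ (CARD('k) - 1)) * (d x y + ennreal r)"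
proof (cases "d x y")
  case top
  then show ?thesis using r by (simp add: ennreal_mult_eq_top_iff top_unique)
next
  case (real t)
  \<comment> \<open>The least number of steps with \<open>t < n * r\<close>. The inequality must be
    strict for \<open>chain_points\<close>, and rounding up costs at most one extra
    \<open>r\<close>.\<close>
  define n where "n = nat \<lfloor>t / r\<rfloor> + 1"
  have fl: "t / r < real n" "real n \<le> t / r + 1"
    using real r by (auto simp: n_def) linarith+
  then have n: "t < real n * r" "real n * r \<le> t + r" using r by (auto simp: field_simps)
  have "n \<ge> 1" by (simp add: n_def)
  have "graphon_dist vol (geometric_graphon A g r) x y \<le> ennreal (real n * r ^ CARD('k))"
    using graphon_dist_le_steps[OF r \<open>n \<ge> 1\<close>] real n by (simp add: ennreal_lessI)
  also have "r ^ CARD('k) = r ^ (CARD('k) - 1) * r" by (rule power_minus_mult[symmetric]) simp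
  also have "real n * (r ^ (CARD('k) - 1) * r) \<le> r ^ (CARD('k) - 1) * (t + r)"
    using n r by (simp add: mult.left_commute mult_left_mono)
  finally show ?thesis using real r by (simp add: ennreal_mult ennreal_leI)
qed

end

section \<open>Packing radii\<close>

context closed_manifold begin

text \<open>A packing configuration may meet \<open>Z\<close>. Moving each point off
  \<open>Z\<close> by less than \<open>\<rho> - \<rho>'\<close> changes a mutual distance by at most
  twice this amount, so separation \<open>2 * \<rho>'\<close> remains, for \<open>\<rho>'\<close>
  arbitrarily close to \<open>\<rho>\<close>.\<close>

lemma packing_lower:
  assumes r: "r > 0"
  shows "ennreal (r ^ (CARD('k) - 1)) * sphere_packing_radius A g m
    \<le> graphon_packing_radius vol (geometric_graphon A g r) m"
  unfolding graphon_packing_radius_def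
proof (rule INF_greatest)
  fix Z assume Z: "Z \<in> null_sets vol"
  define s where "s = r ^ (CARD('k) - 1)"
  have s: "s > 0" using r by (simp add: s_def)
  let ?R = "{\<rho>::real. 0 \<le> \<rho> \<and> (\<exists>x. (\<forall>i<m. x i \<notin> Z) \<and> (\<forall>i<m. \<forall>j<m. i \<noteq> j \<longrightarrow>
     ennreal (2 * \<rho>) \<le> graphon_dist vol (geometric_graphon A g r) (x i) (x j)))}"
  have "ennreal (s * \<rho>) \<le> (SUP \<rho>\<in>?R. ennreal \<rho>)"
    if \<rho>: "0 \<le> \<rho>" and x: "\<forall>i<m. \<forall>j<m. i \<noteq> j \<longrightarrow> ennreal (2 * \<rho>) \<le> d (x i) (x j)" for \<rho> x
  proof (rule ccontr)
    assume less: "\<not> ennreal (s * \<rho>) \<le> (SUP \<rho>\<in>?R. ennreal \<rho>)"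
    then obtain q where q: "(SUP \<rho>\<in>?R. ennreal \<rho>) = ennreal q" "q \<ge> 0"
      by (cases "SUP \<rho>\<in>?R. ennreal \<rho>") auto
    then have qs: "q < s * \<rho>" using less by (auto simp: not_le ennreal_less_iff)
    then have q2: "q / s < \<rho>" using s by (simp add: field_simps)
    \<comment> \<open>\<open>q\<close> is the graphon supremum, assumed too small. The rescaled
      radius \<open>s * \<rho>'\<close> exceeds it and yet will be attained off
      \<open>Z\<close>.\<close>
    obtain \<rho>' where "q / s < \<rho>'" "\<rho>' < \<rho>" using dense[OF q2] by blast
    moreover have "0 \<le> q / s" using q(2) s by simp
    ultimately have \<rho>': "0 \<le> \<rho>'" "\<rho>' < \<rho>" "q / s < \<rho>'" by auto
    have "\<exists>y. d (x i) y < ennreal (\<rho> - \<rho>') \<and> y \<notin> Z" for i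
    proof -
      have "x i \<in> {y. d (x i) y < ennreal (\<rho> - \<rho>')}" using \<rho>' by simp
      then show ?thesis using open_avoid_null[OF open_geo_ball _ Z, of "x i" "ennreal (\<rho> - \<rho>')"] by blast
    qed
    then obtain y where y: "\<And>i. d (x i) (y i) < ennreal (\<rho> - \<rho>')" "\<And>i. y i \<notin> Z" by metis
    have "ennreal (2 * (s * \<rho>')) \<le> graphon_dist vol (geometric_graphon A g r) (y i) (y j)"
      if ij: "i < m" "j < m" "i \<noteq> j" for i j
    proof -
      have "ennreal (2 * \<rho>) \<le> d (x i) (x j)" using x ij by blast
      also have "\<dots> \<le> d (x i) (y i) + (d (y i) (y j) + d (y j) (x j))"
        by (meson add_left_mono geo_triangle order_trans)
      also have "\<dots> \<le> ennreal (\<rho> - \<rho>') + (d (y i) (y j) + ennreal (\<rho> - \<rho>'))"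
        using y(1)[of i] y(1)[of j] by (intro add_mono) (auto simp: geo_sym[of "y j"])
      finally have le: "ennreal (2 * \<rho>) \<le> ennreal (\<rho> - \<rho>') + (d (y i) (y j) + ennreal (\<rho> - \<rho>'))" .
      have "ennreal (2 * \<rho>') \<le> d (y i) (y j)"
      proof (cases "d (y i) (y j)")
        case (real t)
        then show ?thesis using le \<rho>' by (simp flip: ennreal_plus)
      qed simp
      then have "ennreal s * ennreal (2 * \<rho>') \<le> ennreal s * d (y i) (y j)" by (rule mult_left_mono) simp
      also have "\<dots> \<le> graphon_dist vol (geometric_graphon A g r) (y i) (y j)"
        using graphon_dist_ge[OF r] by (simp add: s_def)
      finally show ?thesis using s by (simp add: mult.left_commute flip: ennreal_mult')
    qed
    then have "s * \<rho>' \<in> ?R" using y(2) \<rho>' s by auto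
    then have "ennreal (s * \<rho>') \<le> ennreal q" unfolding q(1)[symmetric] by (rule SUP_upper)
    then have "s * \<rho>' \<le> q" using q(2) by simp
    then show False using \<rho>'(3) s by (simp add: field_simps)
  qed
  then show "ennreal (r ^ (CARD('k) - 1)) * sphere_packing_radius A g m \<le> (SUP \<rho>\<in>?R. ennreal \<rho>)"
    unfolding sphere_packing_radius_def SUP_mult_left_ennreal s_def[symmetric]
    using s by (intro SUP_least) (auto simp: ennreal_mult'[symmetric])
qed

lemma packing_upper:
  assumes r: "r > 0"
  shows "graphon_packing_radius vol (geometric_graphon A g r) m
    \<le> ennreal (r ^ (CARD('k) - 1)) * (sphere_packing_radius A g m + ennreal (r / 2))"
  unfolding graphon_packing_radius_def
proof (rule INF_lower2[of "{}"])
  define s where "s = r ^ (CARD('k) - 1)"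
  have s: "s > 0" using r by (simp add: s_def)
  let ?R = "{\<rho>::real. 0 \<le> \<rho> \<and> (\<exists>x. (\<forall>i<m. x i \<notin> {}) \<and> (\<forall>i<m. \<forall>j<m. i \<noteq> j \<longrightarrow>
     ennreal (2 * \<rho>) \<le> graphon_dist vol (geometric_graphon A g r) (x i) (x j)))}"
  have "ennreal \<rho> \<le> ennreal s * (sphere_packing_radius A g m + ennreal (r / 2))"
    if \<rho>: "0 \<le> \<rho>" and x: "\<forall>i<m. \<forall>j<m. i \<noteq> j \<longrightarrow>
      ennreal (2 * \<rho>) \<le> graphon_dist vol (geometric_graphon A g r) (x i) (x j)" for \<rho> x
  proof -
    \<comment> \<open>The graphon distance exceeds the rescaled geodesic one by up to
      \<open>s * r\<close>; since radii are half distances, the radius loses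
      \<open>r / 2\<close>.\<close>
    define \<rho>' where "\<rho>' = \<rho> / s - r / 2"
    have "ennreal \<rho>' \<le> sphere_packing_radius A g m"
    proof (cases "\<rho>' \<le> 0")
      case False
      have "ennreal (2 * \<rho>') \<le> d (x i) (x j)" if "i < m" "j < m" "i \<noteq> j" for i j
      proof -
        have le: "ennreal (2 * \<rho>) \<le> ennreal s * (d (x i) (x j) + ennreal r)"
          using x that graphon_dist_le[OF r, of "x i" "x j"] order_trans unfolding s_def by blast
        show ?thesis
        proof (cases "d (x i) (x j)")
          case (real t)
          then have "ennreal (2 * \<rho>) \<le> ennreal (s * (t + r))"
            using le r s by (simp add: ennreal_mult)
          then have "2 * \<rho> \<le> s * (t + r)" using real r s by simp
          then have "2 * \<rho>' \<le> t" using s by (simp add: \<rho>'_def field_simps)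
          then show ?thesis using real by (simp add: ennreal_leI)
        qed simp
      qed
      then show ?thesis using False unfolding sphere_packing_radius_def by (intro SUP_upper) auto
    qed (simp add: ennreal_neg)
    then have "ennreal s * (ennreal \<rho>' + ennreal (r / 2)) \<le>
        ennreal s * (sphere_packing_radius A g m + ennreal (r / 2))"
      by (intro mult_left_mono add_right_mono) auto
    moreover have "ennreal \<rho> \<le> ennreal s * (ennreal \<rho>' + ennreal (r / 2))"
    proof -
      have "\<rho> = s * (\<rho>' + r / 2)" using s by (simp add: \<rho>'_def)
      also have "ennreal \<dots> = ennreal s * ennreal (\<rho>' + r / 2)" using s by (intro ennreal_mult') simp
      \<comment> \<open>\<open>\<rho>'\<close> can be negative, and then \<open>ennreal\<close>
        truncates it to 0; the maximum makes both summands nonnegative so that they can be added as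
        reals.\<close>
      also have "\<dots> \<le> ennreal s * (ennreal (max 0 \<rho>') + ennreal (r / 2))"
        using r by (intro mult_left_mono) (auto simp flip: ennreal_plus intro!: ennreal_leI)
      finally show ?thesis by (simp add: max_def ennreal_neg split: if_splits)
    qed
    ultimately show ?thesis by (rule order_trans[rotated])
  qed
  then show "(SUP \<rho>\<in>?R. ennreal \<rho>) \<le> ennreal (r ^ (CARD('k) - 1)) * (sphere_packing_radius A g m + ennreal (r / 2))"
    unfolding s_def[symmetric] by (intro SUP_least) auto
qed auto

theorem packing_limit:
  "((\<lambda>r. graphon_packing_radius vol (geometric_graphon A g r) m / ennreal (r ^ (CARD('k) - 1)))
     \<longlongrightarrow> sphere_packing_radius A g m) (at_right 0)"
proof (rule tendsto_sandwich)
  have eq: "ennreal s * a / ennreal s = a" if "s > 0" for s a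
    using that by (simp add: ennreal_mult_divide_eq mult.commute[of "ennreal s"])
  show "\<forall>\<^sub>F r in at_right 0. sphere_packing_radius A g m
      \<le> graphon_packing_radius vol (geometric_graphon A g r) m / ennreal (r ^ (CARD('k) - 1))"
    using eventually_at_right_less[of 0]
  proof eventually_elim
    case (elim r)
    then have "ennreal (r ^ (CARD('k) - 1)) * sphere_packing_radius A g m / ennreal (r ^ (CARD('k) - 1))
      \<le> graphon_packing_radius vol (geometric_graphon A g r) m / ennreal (r ^ (CARD('k) - 1))"
      by (intro divide_right_mono_ennreal packing_lower)
    then show ?case using eq[of "r ^ (CARD('k) - 1)"] elim by simp
  qed
  show "\<forall>\<^sub>F r in at_right 0. graphon_packing_radius vol (geometric_graphon A g r) m / ennreal (r ^ (CARD('k) - 1))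
      \<le> sphere_packing_radius A g m + ennreal (r / 2)"
    using eventually_at_right_less[of 0]
  proof eventually_elim
    case (elim r)
    then have "graphon_packing_radius vol (geometric_graphon A g r) m / ennreal (r ^ (CARD('k) - 1))
      \<le> ennreal (r ^ (CARD('k) - 1)) * (sphere_packing_radius A g m + ennreal (r / 2)) / ennreal (r ^ (CARD('k) - 1))"
      by (intro divide_right_mono_ennreal packing_upper)
    then show ?case using eq[of "r ^ (CARD('k) - 1)"] elim by simp
  qed
  have "((\<lambda>r. sphere_packing_radius A g m + ennreal (r / 2)) \<longlongrightarrow> sphere_packing_radius A g m + ennreal (0 / 2)) (at_right 0)"
    by (intro tendsto_intros tendsto_ennrealI) simp_all
  then show "((\<lambda>r. sphere_packing_radius A g m + ennreal (r / 2)) \<longlongrightarrow> sphere_packing_radius A g m) (at_right 0)"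
    by simp
qed simp

section \<open>Coarsely Lipschitz functions and their Lipschitz approximation\<close>

abbreviation dr where "dr x y \<equiv> enn2real (d x y)"

lemma dr_triangle:
  assumes "d x y < top" "d y z < top" shows "d x z < top" "dr x z \<le> dr x y + dr y z"
proof -
  have s: "d x y + d y z < top" using assms by simp
  then show "d x z < top" using geo_triangle[of x z y] by (rule order_le_less_trans[rotated])
  have "dr x z \<le> enn2real (d x y + d y z)" using s by (intro enn2real_mono geo_triangle)
  then show "dr x z \<le> dr x y + dr y z" using assms by (simp add: enn2real_plus)
qed

lemma d_less_iff: "d x y < top \<Longrightarrow> d x y < ennreal a \<longleftrightarrow> dr x y < a"
  by (cases "d x y") (auto simp: ennreal_less_iff)

text \<open>The guard \<open>d x y < top\<close> restricts the condition to points of one component: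
  \<open>dr\<close> is 0 between components, where the bare inequality would force equal values. The
  set \<open>N\<close> allows for functions known only almost everywhere.\<close>

definition geo_lipschitz :: "'a set \<Rightarrow> real \<Rightarrow> ('a \<Rightarrow> real) \<Rightarrow> bool" where
  "geo_lipschitz N L f \<longleftrightarrow> (\<forall>x y. x \<notin> N \<longrightarrow> y \<notin> N \<longrightarrow> d x y < top \<longrightarrow> \<bar>f x - f y\<bar> \<le> L * dr x y)"

text \<open>By Fubini, almost every \<open>x\<close> has a null set \<open>Q x\<close> outside which
  a single step is controlled. Chains of steps are then built so that each new point avoids the
  exceptional set of its predecessor.\<close>

lemma coarse_lipschitz:
  assumes "AE (x, y) in vol \<Otimes>\<^sub>M vol. d x y \<le> ennreal r \<longrightarrow> \<bar>f x - f y\<bar> \<le> K * r" and r: "r > 0" and K: "K \<ge> 0"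
  obtains N where "N \<in> null_sets vol"
    "\<And>x y. x \<notin> N \<Longrightarrow> y \<notin> N \<Longrightarrow> d x y < top \<Longrightarrow> \<bar>f x - f y\<bar> \<le> K * (dr x y + 2 * r)"
proof -
  interpret finite_measure vol by (rule finite_volume)
  interpret pair_sigma_finite vol vol by standard
  have "AE x in vol. AE y in vol. d x y \<le> ennreal r \<longrightarrow> \<bar>f x - f y\<bar> \<le> K * r"
    using AE_pair[OF assms(1)] by simp
  then obtain N where N: "{x \<in> space vol. \<not> (AE y in vol. d x y \<le> ennreal r \<longrightarrow> \<bar>f x - f y\<bar> \<le> K * r)} \<subseteq> N"
    "emeasure vol N = 0" "N \<in> sets vol" by (rule AE_E)
  then have N': "N \<in> null_sets vol" by (auto simp: null_sets_def)
  have "\<exists>Q\<in>null_sets vol. \<forall>y. y \<notin> Q \<longrightarrow> d x y \<le> ennreal r \<longrightarrow> \<bar>f x - f y\<bar> \<le> K * r" if "x \<notin> N" for x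
  proof -
    have "AE y in vol. d x y \<le> ennreal r \<longrightarrow> \<bar>f x - f y\<bar> \<le> K * r" using N(1) that by auto
    then obtain Q where "{y \<in> space vol. \<not> (d x y \<le> ennreal r \<longrightarrow> \<bar>f x - f y\<bar> \<le> K * r)} \<subseteq> Q"
      "emeasure vol Q = 0" "Q \<in> sets vol" by (rule AE_E)
    then show ?thesis by (intro bexI[of _ Q]) (auto simp: null_sets_def)
  qed
  then obtain Q where Q: "\<And>x. x \<notin> N \<Longrightarrow> Q x \<in> null_sets vol"
    "\<And>x y. x \<notin> N \<Longrightarrow> y \<notin> Q x \<Longrightarrow> d x y \<le> ennreal r \<Longrightarrow> \<bar>f x - f y\<bar> \<le> K * r" by metis
  have steps: "\<bar>f x - f y\<bar> \<le> real n * (K * r)"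
    if "n \<ge> 2" "x \<notin> N" "y \<notin> N" "d x y < ennreal (real n * r)" for n x y
    using that(1,2,4)
  proof (induction n arbitrary: x rule: dec_induct)
    \<comment> \<open>Two steps are the shortest possible chain: nothing says that \<open>y\<close>
      avoids \<open>Q x\<close>, but a midpoint can be chosen outside both \<open>Q x\<close> and
      \<open>Q y\<close>.\<close>
    case base
    have "d x y < ennreal (r + r)" using base by (simp only: of_nat_numeral mult_2)
    from intermediate_point_avoiding[OF this r r, of "Q x \<union> Q y"] Q(1)[OF base(1)] Q(1)[OF that(3)]
    obtain z where z: "d x z < ennreal r" "d z y < ennreal r" "z \<notin> Q x" "z \<notin> Q y" by auto
    have "\<bar>f x - f z\<bar> \<le> K * r" using Q(2)[OF base(1) z(3)] z(1) by simp
    moreover have "\<bar>f y - f z\<bar> \<le> K * r" using Q(2)[OF that(3) z(4)] z(2) by (simp add: geo_sym[of y z])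
    ultimately show ?case by simp
  next
    case (step n)
    have "d x y < ennreal (r + real n * r)" using step.prems by (simp add: algebra_simps)
    moreover have "real n * r > 0" using r step.hyps by simp
    ultimately obtain z where z: "d x z < ennreal r" "d z y < ennreal (real n * r)" "z \<notin> N \<union> Q x"
      using intermediate_point_avoiding[of x y r "real n * r" "N \<union> Q x"] r N' Q(1)[OF step.prems(1)] by auto
    have "\<bar>f x - f z\<bar> \<le> K * r" using Q(2)[OF step.prems(1), of z] z by simp
    moreover have "\<bar>f z - f y\<bar> \<le> real n * (K * r)" using step.IH[of z] z by simp
    ultimately show ?case by (simp add: algebra_simps)
  qed
  show ?thesis
  proof (rule that[OF N'])
    fix x y assume xy: "x \<notin> N" "y \<notin> N" "d x y < top"
    \<comment> \<open>Adding 2 rather than 1 guarantees \<open>n \<ge> 2\<close>, and leads to the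
      defect \<open>2 * r\<close> in the conclusion.\<close>
    define n where "n = nat \<lfloor>dr x y / r\<rfloor> + 2"
    have "dr x y / r \<ge> 0" using r by simp
    then have "real n = of_int \<lfloor>dr x y / r\<rfloor> + 2" by (simp add: n_def)
    then have fl: "dr x y / r < real n" "real n \<le> dr x y / r + 2"
      using floor_correct[of "dr x y / r"] by linarith+
    then have n: "dr x y < real n * r" "real n * r \<le> dr x y + 2 * r" using r by (auto simp: field_simps)
    have "\<bar>f x - f y\<bar> \<le> real n * (K * r)"
    proof (rule steps[OF _ xy(1,2)])
      show "n \<ge> 2" by (simp add: n_def)
      show "d x y < ennreal (real n * r)" using n(1) d_less_iff[OF xy(3)] by blast
    qed
    also have "\<dots> = K * (real n * r)" by simp
    also have "\<dots> \<le> K * (dr x y + 2 * r)" using n(2) K by (intro mult_left_mono)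
    finally show "\<bar>f x - f y\<bar> \<le> K * (dr x y + 2 * r)" .
  qed
qed

text \<open>McShane's formula, the infimum of \<open>f y + L * dr x y\<close>, taken over the points
  \<open>y\<close> off \<open>N\<close> in the component of \<open>x\<close>; such points exist near
  \<open>x\<close>, and \<open>B\<close> bounds the infimum from below. The additive defect
  \<open>s\<close> of \<open>f\<close> reappears as the error \<open>L * s\<close>; for
  \<open>s = 0\<close> it is an extension from the complement of \<open>N\<close>.\<close>

lemma lipschitz_extension:
  assumes N: "N \<in> null_sets vol" and B: "\<And>x. x \<notin> N \<Longrightarrow> \<bar>f x\<bar> \<le> B"
    and f: "\<And>x y. x \<notin> N \<Longrightarrow> y \<notin> N \<Longrightarrow> d x y < top \<Longrightarrow> \<bar>f x - f y\<bar> \<le> L * (dr x y + s)"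
    and L: "L \<ge> 0" and s: "s \<ge> 0"
  obtains F where "geo_lipschitz {} L F" "\<And>x. x \<notin> N \<Longrightarrow> \<bar>F x - f x\<bar> \<le> L * s"
proof -
  define S where "S x = (\<lambda>y. f y + L * dr x y) ` {y. y \<notin> N \<and> d x y < top}" for x
  define F where "F x = Inf (S x)" for x
  have ne: "S x \<noteq> {}" for x
  proof -
    have "x \<in> {y. d x y < top}" by simp
    then obtain y where "y \<in> {y. d x y < top}" "y \<notin> N" using open_avoid_null[OF open_geo_ball _ N] by blast
    then show ?thesis by (auto simp: S_def)
  qed
  have bdd: "bdd_below (S x)" for x
  proof (rule bdd_belowI[of _ "- B"])
    fix a assume "a \<in> S x"
    then obtain y where y: "a = f y + L * dr x y" "y \<notin> N" by (auto simp: S_def)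
    have "- B \<le> f y" using B[OF y(2)] by (simp add: abs_le_iff)
    moreover have "0 \<le> L * dr x y" using L by simp
    ultimately show "- B \<le> a" using y(1) by linarith
  qed
  have half: "F x \<le> F x' + L * dr x x'" if "d x x' < top" for x x'
  proof -
    have "F x - L * dr x x' \<le> a" if a: "a \<in> S x'" for a
    proof -
      obtain y where y: "a = f y + L * dr x' y" "y \<notin> N" "d x' y < top" using a by (auto simp: S_def)
      note t = dr_triangle[OF \<open>d x x' < top\<close> y(3)]
      have "F x \<le> f y + L * dr x y" unfolding F_def
        by (rule cInf_lower[OF _ bdd]) (use t y in \<open>auto simp: S_def\<close>)
      moreover have "L * dr x y \<le> L * (dr x x' + dr x' y)" using t L by (intro mult_left_mono)
      ultimately show ?thesis using y(1) by (simp add: algebra_simps)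
    qed
    then have "F x - L * dr x x' \<le> F x'" unfolding F_def[of x'] by (intro cInf_greatest ne)
    then show ?thesis by simp
  qed
  show ?thesis
  proof (rule that[of F])
    show "geo_lipschitz {} L F"
      unfolding geo_lipschitz_def
    proof (intro allI impI)
      fix x y assume "d x y < top"
      then show "\<bar>F x - F y\<bar> \<le> L * dr x y" using half[of x y] half[of y x] by (simp add: geo_sym[of y x])
    qed
    fix x assume x: "x \<notin> N"
    have "F x \<le> f x" unfolding F_def
      by (rule cInf_lower[OF _ bdd]) (use x in \<open>auto simp: S_def intro!: image_eqI[of _ _ x]\<close>)
    moreover have "f x - L * s \<le> F x"
      unfolding F_def
    proof (rule cInf_greatest[OF ne])
      fix a assume "a \<in> S x"
      then obtain y where y: "a = f y + L * dr x y" "y \<notin> N" "d x y < top" by (auto simp: S_def)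
      then show "f x - L * s \<le> a" using f[OF x y(2,3)] by (simp add: algebra_simps)
    qed
    ultimately show "\<bar>F x - f x\<bar> \<le> L * s" using L s by (simp add: abs_le_iff)
  qed
qed

end

section \<open>Test functions and weak gradients\<close>

text \<open>A family closed under differentiation witnesses smoothness without a formula for higher derivatives.\<close>

definition smooth1 :: "(real \<Rightarrow> real) \<Rightarrow> bool" where
  "smooth1 f \<longleftrightarrow> (\<exists>F. f \<in> F \<and> (\<forall>h\<in>F. \<exists>h'\<in>F. \<forall>x. (h has_real_derivative h' x) (at x)))"

lemma smooth1_deriv:
  assumes "smooth1 f" obtains f' where "smooth1 f'" "\<And>x. (f has_real_derivative f' x) (at x)"
  using assms unfolding smooth1_def by metis

lemma smooth1_affine:
  assumes "smooth1 f" shows "smooth1 (\<lambda>t. f (\<alpha> + \<beta> * t))"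
  unfolding smooth1_def
proof (intro exI[of _ "{\<lambda>t. \<kappa> * h (\<alpha> + \<beta> * t) | \<kappa> h. smooth1 h}"] conjI ballI)
  show "(\<lambda>t. f (\<alpha> + \<beta> * t)) \<in> {\<lambda>t. \<kappa> * h (\<alpha> + \<beta> * t) | \<kappa> h. smooth1 h}"
    using assms by (auto intro!: exI[of _ 1] exI[of _ f])
  fix w assume "w \<in> {\<lambda>t. \<kappa> * h (\<alpha> + \<beta> * t) | \<kappa> h. smooth1 h}"
  then obtain \<kappa> h where w: "w = (\<lambda>t. \<kappa> * h (\<alpha> + \<beta> * t))" "smooth1 h" by blast
  obtain h' where h': "smooth1 h'" "\<And>x. (h has_real_derivative h' x) (at x)"
    using smooth1_deriv[OF w(2)] by metis
  have "(w has_real_derivative (\<kappa> * \<beta>) * h' (\<alpha> + \<beta> * x)) (at x)" for x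
    unfolding w by (auto intro!: derivative_eq_intros DERIV_chain2[OF h'(2)])
  then show "\<exists>w'\<in>{\<lambda>t. \<kappa> * h (\<alpha> + \<beta> * t) | \<kappa> h. smooth1 h}. \<forall>x. (w has_real_derivative w' x) (at x)"
    using h'(1) by (intro bexI[of _ "\<lambda>x. (\<kappa> * \<beta>) * h' (\<alpha> + \<beta> * x)"]) auto
qed

text \<open>By the Leibniz rule, finite sums of products of two smooth functions are closed under
  differentiation; lists of pairs encode these sums.\<close>

lemma smooth1_mult:
  assumes "smooth1 f" "smooth1 h" shows "smooth1 (\<lambda>t. f t * h t)"
proof -
  define S where "S l = (\<lambda>t. \<Sum>(u, v)\<leftarrow>l. u t * v t)" for l :: "((real \<Rightarrow> real) \<times> (real \<Rightarrow> real)) list"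
  define F where "F = {S l | l. \<forall>(u, v)\<in>set l. smooth1 u \<and> smooth1 v}"
  have "\<exists>m. (\<forall>(u, v)\<in>set m. smooth1 u \<and> smooth1 v) \<and> (\<forall>x. (S l has_real_derivative S m x) (at x))"
    if "\<forall>(u, v)\<in>set l. smooth1 u \<and> smooth1 v" for l
    using that
  proof (induction l)
    case Nil
    show ?case by (rule exI[of _ "[]"]) (simp add: S_def)
  next
    case (Cons p l)
    obtain u v where p: "p = (u, v)" by (cases p)
    obtain m where m: "\<forall>(u, v)\<in>set m. smooth1 u \<and> smooth1 v" "\<And>x. (S l has_real_derivative S m x) (at x)"
      using Cons by auto
    have uv: "smooth1 u" "smooth1 v" using Cons.prems p by auto
    obtain u' where u': "smooth1 u'" "\<And>x. (u has_real_derivative u' x) (at x)" using smooth1_deriv[OF uv(1)] by metis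
    obtain v' where v': "smooth1 v'" "\<And>x. (v has_real_derivative v' x) (at x)" using smooth1_deriv[OF uv(2)] by metis
    have "(S (p # l) has_real_derivative S ((u', v) # (u, v') # m) x) (at x)" for x
    proof -
      have "((\<lambda>t. u t * v t + S l t) has_real_derivative u' x * v x + v' x * u x + S m x) (at x)"
        by (intro DERIV_add DERIV_mult u' v' m)
      then show ?thesis by (simp add: S_def p algebra_simps)
    qed
    then show ?case using m(1) u' v' uv by (intro exI[of _ "(u', v) # (u, v') # m"]) auto
  qed
  then have "\<forall>w\<in>F. \<exists>w'\<in>F. \<forall>x. (w has_real_derivative w' x) (at x)"
    unfolding F_def by blast
  moreover have "(\<lambda>t. f t * h t) \<in> F"
    unfolding F_def using assms by (auto intro!: exI[of _ "[(f, h)]"] simp: S_def)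
  ultimately show ?thesis unfolding smooth1_def by blast
qed

text \<open>Applied to products of \<open>exp (-1/t)\<close>, whose derivatives are polynomials in \<open>1/t\<close> times \<open>exp (-1/t)\<close>.\<close>

definition exp_poly :: "real poly \<Rightarrow> real \<Rightarrow> real" where
  "exp_poly P t = (if t \<le> 0 then 0 else poly P (inverse t) * exp (- inverse t))"

lemma poly_exp_tendsto_0: "((\<lambda>x. poly P x * exp (- x)) \<longlongrightarrow> 0) at_top" for P :: "real poly"
proof (induction P rule: pCons_induct)
  case (pCons a P)
  have "((\<lambda>x. (\<Sum>i\<le>degree (pCons a P). coeff (pCons a P) i * (x ^ i / exp x))) \<longlongrightarrow>
      (\<Sum>i\<le>degree (pCons a P). coeff (pCons a P) i * 0)) at_top"
    by (intro tendsto_sum tendsto_mult tendsto_const tendsto_power_div_exp_0)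
  then show ?case
    by (simp add: poly_altdef sum_distrib_right exp_minus divide_inverse mult.assoc)
qed simp

text \<open>In the variable s = 1/t differentiation is -s^2 d/ds, and the derivative of P(s) exp(-s)
  in s is (P'(s) - P(s)) exp(-s), whence the polynomial s^2 (P - P'). At 0 the right difference
  quotient is s P(s) exp(-s), which tends to 0 as s grows.\<close>

lemma exp_poly_deriv: "(exp_poly P has_real_derivative exp_poly (monom 1 2 * (P - pderiv P)) t) (at t)"
proof (cases t "0 :: real" rule: linorder_cases)
  case less
  have "((\<lambda>_. 0) has_real_derivative 0) (at t)" by simp
  then have "(exp_poly P has_real_derivative 0) (at t)"
    by (rule has_field_derivative_transform_within_open[of _ _ _ "{..<0}"]) (use less in \<open>auto simp: exp_poly_def\<close>)
  then show ?thesis using less by (simp add: exp_poly_def)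
next
  case greater
  have "((\<lambda>t. poly P (inverse t) * exp (- inverse t)) has_real_derivative
      exp_poly (monom 1 2 * (P - pderiv P)) t) (at t)"
    using greater
    by (auto intro!: derivative_eq_intros simp: exp_poly_def poly_monom power2_eq_square algebra_simps)
  then show ?thesis
    by (rule has_field_derivative_transform_within_open[of _ _ _ "{0<..}"]) (use greater in \<open>auto simp: exp_poly_def\<close>)
next
  case equal
  have "((\<lambda>h. (exp_poly P (0 + h) - exp_poly P 0) / h) \<longlongrightarrow> 0) (at 0)"
  proof (rule filterlim_split_at)
    have "\<forall>\<^sub>F h in at_left 0. (exp_poly P (0 + h) - exp_poly P 0) / h = 0"
      by (auto simp: eventually_at_filter exp_poly_def)
    then show "((\<lambda>h. (exp_poly P (0 + h) - exp_poly P 0) / h) \<longlongrightarrow> 0) (at_left 0)"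
      by (rule tendsto_eventually)
    have "((\<lambda>h. poly (pCons 0 P) (inverse h) * exp (- inverse h)) \<longlongrightarrow> 0) (at_right 0)"
      by (rule filterlim_compose[OF poly_exp_tendsto_0 filterlim_inverse_at_top_right])
    moreover have "\<forall>\<^sub>F h in at_right 0. poly (pCons 0 P) (inverse h) * exp (- inverse h) =
        (exp_poly P (0 + h) - exp_poly P 0) / h"
      using eventually_at_right_less[of 0] by eventually_elim (simp add: exp_poly_def field_simps)
    ultimately show "((\<lambda>h. (exp_poly P (0 + h) - exp_poly P 0) / h) \<longlongrightarrow> 0) (at_right 0)"
      by (rule Lim_transform_eventually)
  qed
  then show ?thesis using equal by (simp add: DERIV_def exp_poly_def)
qed

lemma smooth1_exp_poly: "smooth1 (exp_poly P)"
  unfolding smooth1_def by (rule exI[of _ "range exp_poly"]) (use exp_poly_deriv in blast)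

text \<open>Inside the box, every factor exp(-1/(n x)) tends to 1 with \<open>n\<close>, so these
  smooth functions approximate the indicator of the box from below. The product form makes
  derivatives and translations easy to track.\<close>

definition box_bump :: "nat \<Rightarrow> real^'k \<Rightarrow> real^'k \<Rightarrow> real^'k \<Rightarrow> real" where
  "box_bump n a b u = (\<Prod>i\<in>UNIV. exp_poly 1 (real n * (u $ i - a $ i)) * exp_poly 1 (real n * (b $ i - u $ i)))"

text \<open>A partial derivative replaces one factor by its derivative and leaves a product of the
  same kind; hence the induction is over all families \<open>f\<close> at once.\<close>

lemma Ck_on_prod:
  fixes f :: "'k::finite \<Rightarrow> real \<Rightarrow> real"
  assumes "\<And>i. smooth1 (f i)"
  shows "Ck_on n (\<lambda>u::real^'k. \<Prod>i\<in>UNIV. f i (u $ i)) UNIV"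
  using assms
proof (induction n arbitrary: f)
  case (0 f)
  have "\<exists>f'. \<forall>x. (f i has_real_derivative f' x) (at x)" for i using smooth1_deriv[OF 0] by metis
  then have cf: "continuous_on UNIV (f i)" for i
    by (metis DERIV_isCont continuous_at_imp_continuous_on)
  have "continuous_on UNIV (\<lambda>u::real^'k. f i (u $ i))" for i
    by (rule continuous_on_compose2[OF cf]) (auto intro!: continuous_intros)
  then show ?case by (simp add: continuous_on_prod)
next
  case (Suc n f)
  have "\<forall>i. \<exists>f'. smooth1 f' \<and> (\<forall>x. (f i has_real_derivative f' x) (at x))" using smooth1_deriv[OF Suc.prems] by metis
  then obtain f' where f': "\<And>i. smooth1 (f' i)" "\<And>i x. (f i has_real_derivative f' i x) (at x)" by metis
  have D: "((\<lambda>u::real^'k. \<Prod>i\<in>UNIV. f i (u $ i)) has_derivative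
      (\<lambda>h. \<Sum>i\<in>UNIV. (f' i (u $ i) * h $ i) * (\<Prod>j\<in>UNIV - {i}. f j (u $ j)))) (at u)" for u
  proof (rule has_derivative_prod)
    fix i
    have "((\<lambda>u. u $ i) has_derivative (\<lambda>h. h $ i)) (at u)"
      by (rule bounded_linear_imp_has_derivative[OF bounded_linear_vec_nth])
    from has_derivative_compose[OF this, of "f i" "(*) (f' i (u $ i))"]
    show "((\<lambda>u. f i (u $ i)) has_derivative (\<lambda>h. f' i (u $ i) * h $ i)) (at u)"
      using f'(2)[of i "u $ i"] by (simp add: has_field_derivative_def)
  qed
  have "Ck_on n (\<lambda>u. frechet_derivative (\<lambda>u::real^'k. \<Prod>i\<in>UNIV. f i (u $ i)) (at u) e) UNIV"
    if e: "e \<in> Basis" for e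
  proof -
    obtain j where j: "e = axis j 1" using e by (auto simp: Basis_vec_def)
    have "frechet_derivative (\<lambda>u::real^'k. \<Prod>i\<in>UNIV. f i (u $ i)) (at u) e =
      (\<Prod>i\<in>UNIV. (f(j := f' j)) i (u $ i))" for u
    proof -
      have "frechet_derivative (\<lambda>u::real^'k. \<Prod>i\<in>UNIV. f i (u $ i)) (at u) e =
        (\<Sum>i\<in>UNIV. (if i = j then f' j (u $ j) * (\<Prod>i\<in>UNIV - {j}. f i (u $ i)) else 0))"
        unfolding frechet_derivative_at[OF D, symmetric] j
        by (intro sum.cong) (auto simp: axis_def)
      also have "\<dots> = (f(j := f' j)) j (u $ j) * (\<Prod>i\<in>UNIV - {j}. (f(j := f' j)) i (u $ i))"
        by simp
      finally show ?thesis by (subst prod.remove[of _ j]) auto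
    qed
    then show ?thesis using Suc.IH[of "f(j := f' j)"] Suc.prems f'(1) by simp
  qed
  moreover have "(\<lambda>u::real^'k. \<Prod>i\<in>UNIV. f i (u $ i)) differentiable_on UNIV"
    using D by (auto simp: differentiable_on_def differentiable_def)
  ultimately show ?case by simp
qed

lemma box_bump_smooth: "smooth_on UNIV (box_bump n a b)" 
proof -
  have "smooth1 (\<lambda>t. exp_poly 1 (real n * (t - a $ i)) * exp_poly 1 (real n * (b $ i - t)))" for i
  proof (rule smooth1_mult)
    show "smooth1 (\<lambda>t. exp_poly 1 (real n * (t - a $ i)))"
      using smooth1_affine[OF smooth1_exp_poly, of 1 "- real n * a $ i" "real n"] by (simp add: algebra_simps)
    show "smooth1 (\<lambda>t. exp_poly 1 (real n * (b $ i - t)))"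
      using smooth1_affine[OF smooth1_exp_poly, of 1 "real n * b $ i" "- real n"] by (simp add: algebra_simps)
  qed
  then have "Ck_on m (\<lambda>u. \<Prod>i\<in>UNIV. (\<lambda>i t. exp_poly 1 (real n * (t - a $ i)) * exp_poly 1 (real n * (b $ i - t))) i (u $ i)) UNIV" for m
    by (intro Ck_on_prod)
  then show ?thesis by (simp add: smooth_on_def box_bump_def[abs_def])
qed

lemma exp_poly_1: "0 \<le> exp_poly 1 t" "exp_poly 1 t \<le> 1"
  by (auto simp: exp_poly_def)

lemma box_bump_range: "0 \<le> box_bump n a b u" "box_bump n a b u \<le> 1"
  unfolding box_bump_def by (auto intro!: prod_nonneg prod_le_1 mult_le_one exp_poly_1 mult_nonneg_nonneg)

lemma box_bump_outside: "u \<notin> box a b \<Longrightarrow> box_bump n a b u = 0"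
proof -
  assume "u \<notin> box a b"
  then obtain i where "u $ i \<le> a $ i \<or> b $ i \<le> u $ i" by (auto simp: mem_box_cart not_less)
  then have "exp_poly 1 (real n * (u $ i - a $ i)) * exp_poly 1 (real n * (b $ i - u $ i)) = 0"
    by (auto simp: exp_poly_def mult_le_0_iff)
  then show ?thesis unfolding box_bump_def by (intro prod_zero) auto
qed

lemma box_bump_tendsto: "(\<lambda>n. box_bump n a b u) \<longlonglongrightarrow> indicator (box a b) u"
proof (cases "u \<in> box a b")
  case True
  have lim: "(\<lambda>n. exp_poly 1 (real n * t)) \<longlonglongrightarrow> 1" if t: "t > 0" for t
  proof -
    have "(\<lambda>n. - (inverse (real n) * inverse t)) \<longlonglongrightarrow> - (0 * inverse t)"
      by (intro tendsto_intros lim_inverse_n)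
    then have "(\<lambda>n. exp (- (inverse (real n) * inverse t))) \<longlonglongrightarrow> exp (- (0 * inverse t))"
      by (rule tendsto_exp)
    moreover have "\<forall>\<^sub>F n in sequentially. exp (- (inverse (real n) * inverse t)) = exp_poly 1 (real n * t)"
      using eventually_gt_at_top[of 0] by eventually_elim (use t in \<open>auto simp: exp_poly_def mult_le_0_iff\<close>)
    ultimately show ?thesis by (simp add: Lim_transform_eventually)
  qed
  have "(\<lambda>n. box_bump n a b u) \<longlonglongrightarrow> (\<Prod>i\<in>(UNIV::'a set). 1 * 1)"
    unfolding box_bump_def using True by (intro tendsto_prod tendsto_mult lim) (auto simp: mem_box_cart)
  then show ?thesis using True by simp
qed (simp add: box_bump_outside)

lemma box_bump_shift: "box_bump n (a + h) (b + h) u = box_bump n a b (u - h)"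
  by (simp add: box_bump_def algebra_simps)

section \<open>Averages over boxes, test functions and weak gradients\<close>

text \<open>\<open>F\<close> is only locally integrable, so the global differentiation theorem is
  applied to its truncations to closed boxes inside \<Omega>. Boxes with rational corners are
  countably many and still cover \<Omega>, so their exceptional sets add up to a null set.\<close>

lemma Lebesgue_differentiation:
  fixes F :: "real^'k \<Rightarrow> real"
  assumes "open \<Omega>" and F: "\<And>C. compact C \<Longrightarrow> C \<subseteq> \<Omega> \<Longrightarrow> set_integrable lborel C F"
  shows "AE u in lborel. u \<in> \<Omega> \<longrightarrow>
    ((\<lambda>h. (LINT w:cbox u (u + h *\<^sub>R One)|lborel. F w) / h ^ CARD('k)) \<longlongrightarrow> F u) (at_right 0)"
proof -
  have one: "AE u in lborel. u \<in> box a b \<longrightarrow>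
    ((\<lambda>h. (LINT w:cbox u (u + h *\<^sub>R One)|lborel. F w) / h ^ CARD('k)) \<longlongrightarrow> F u) (at_right 0)"
    if ab: "cbox a b \<subseteq> \<Omega>" for a b
  proof -
    let ?F = "\<lambda>u. indicator (cbox a b) u *\<^sub>R F u"
    have int: "integrable lborel ?F" using F[OF compact_cbox ab] by (simp add: set_integrable_def)
    have int2: "set_integrable lborel (cbox c e) ?F" for c e
      unfolding set_integrable_def by (rule integrable_mult_indicator) (use int in auto)
    have int3: "?F integrable_on cbox c e" for c e
      by (rule set_borel_integral_eq_integral(1)[OF int2])
    obtain N where N: "negligible N"
      "\<And>x e. x \<notin> N \<Longrightarrow> 0 < e \<Longrightarrow> \<exists>d>0. \<forall>h. 0 < h \<and> h < d \<longrightarrow>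
        norm (integral (cbox x (x + h *\<^sub>R One)) ?F /\<^sub>R h ^ DIM(real^'k) - ?F x) < e"
      by (rule integrable_ccontinuous_explicit[OF int3]) (rule that)
    have "N \<in> null_sets (completion lborel)" using N(1) by (simp add: negligible_iff_null_sets)
    then have "AE u in completion lborel. u \<notin> N" by (rule AE_not_in)
    then have AE: "AE u in lborel. u \<notin> N" by (simp add: AE_completion_iff)
    show ?thesis
      using AE
    proof eventually_elim
      case (elim u)
      show ?case
      proof
        assume u: "u \<in> box a b"
        obtain \<epsilon> where \<epsilon>: "\<epsilon> > 0" "ball u \<epsilon> \<subseteq> box a b" using u open_box open_contains_ball by blast
        have sub: "cbox u (u + h *\<^sub>R One) \<subseteq> cbox a b" if "0 < h" "h * norm (One::real^'k) < \<epsilon>" for h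
        proof -
          have "u + h *\<^sub>R One \<in> ball u \<epsilon>" using that by (simp add: dist_norm)
          then have "u + h *\<^sub>R One \<in> cbox a b" "u \<in> cbox a b" using \<epsilon> u box_subset_cbox[of a b] by blast+
          then show ?thesis unfolding subset_iff mem_box by (meson order_trans)
        qed
        have eq: "(LINT w:cbox u (u + h *\<^sub>R One)|lborel. F w) / h ^ CARD('k) =
            integral (cbox u (u + h *\<^sub>R One)) ?F /\<^sub>R h ^ DIM(real^'k)"
          if "0 < h" "h * norm (One::real^'k) < \<epsilon>" for h
        proof -
          have "(LINT w:cbox u (u + h *\<^sub>R One)|lborel. F w) = (LINT w:cbox u (u + h *\<^sub>R One)|lborel. ?F w)"
            unfolding set_lebesgue_integral_def
            by (intro Bochner_Integration.integral_cong) (use sub[OF that] in \<open>auto simp: indicator_def\<close>)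
          then show ?thesis using set_borel_integral_eq_integral(2)[OF int2] by (simp add: field_simps)
        qed
        have Fu: "?F u = F u" using u box_subset_cbox[of a b] by auto
        show "((\<lambda>h. (LINT w:cbox u (u + h *\<^sub>R One)|lborel. F w) / h ^ CARD('k)) \<longlongrightarrow> F u) (at_right 0)"
        proof (rule tendstoI)
          fix e :: real assume "e > 0"
          from N(2)[OF elim this] obtain d where d: "d > 0"
            "\<And>h. 0 < h \<Longrightarrow> h < d \<Longrightarrow> norm (integral (cbox u (u + h *\<^sub>R One)) ?F /\<^sub>R h ^ DIM(real^'k) - ?F u) < e" by blast
          have "0 < \<epsilon> / norm (One::real^'k)" using \<epsilon> by simp
          have "\<forall>\<^sub>F h in at_right 0. h < min d (\<epsilon> / norm (One::real^'k))"
            using d(1) \<open>0 < \<epsilon> / norm (One::real^'k)\<close> by (intro eventually_at_rightI[of 0 "min d (\<epsilon> / norm (One::real^'k))"]) auto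
          then show "\<forall>\<^sub>F h in at_right 0. dist ((LINT w:cbox u (u + h *\<^sub>R One)|lborel. F w) / h ^ CARD('k)) (F u) < e"
            using eventually_at_right_less[of 0]
          proof eventually_elim
            case (elim h)
            have "norm (One::real^'k) > 0" by simp
            then have "h * norm (One::real^'k) < \<epsilon>" using elim by (simp add: pos_less_divide_eq)
            then show ?case
              unfolding dist_norm eq[OF elim(2) \<open>h * norm (One::real^'k) < \<epsilon>\<close>]
              using d(2)[OF elim(2)] elim(1) unfolding Fu by simp
          qed
        qed
      qed
    qed
  qed
  let ?I = "{f\<in>Basis \<rightarrow>\<^sub>E \<rat> \<times> \<rat>. cbox (\<Sum>i\<in>Basis. fst (f i) *\<^sub>R i) (\<Sum>i\<in>Basis. snd (f i) *\<^sub>R i) \<subseteq> \<Omega>} :: ((real^'k) \<Rightarrow> real \<times> real) set"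
  have "countable ?I"
    by (rule countable_subset[of _ "Basis \<rightarrow>\<^sub>E \<rat> \<times> \<rat>"]) (auto intro!: countable_PiE countable_SIGMA countable_rat)
  then have "AE u in lborel. \<forall>f\<in>?I. u \<in> box (\<Sum>i\<in>Basis. fst (f i) *\<^sub>R i) (\<Sum>i\<in>Basis. snd (f i) *\<^sub>R i) \<longrightarrow>
    ((\<lambda>h. (LINT w:cbox u (u + h *\<^sub>R One)|lborel. F w) / h ^ CARD('k)) \<longlongrightarrow> F u) (at_right 0)"
    using one by (subst AE_ball_countable) auto
  moreover have "\<exists>f\<in>?I. u \<in> box (\<Sum>i\<in>Basis. fst (f i) *\<^sub>R i) (\<Sum>i\<in>Basis. snd (f i) *\<^sub>R i)" if u: "u \<in> \<Omega>" for u
  proof -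
    obtain e where e: "e > 0" "cball u e \<subseteq> \<Omega>" using assms(1) u open_contains_cball by blast
    obtain a b where ab: "\<forall>i\<in>Basis. a \<bullet> i \<in> \<rat> \<and> b \<bullet> i \<in> \<rat>" "u \<in> box a b" "box a b \<subseteq> ball u e"
      using rational_boxes[OF e(1)] by metis
    define f where "f = restrict (\<lambda>i. (a \<bullet> i, b \<bullet> i)) Basis"
    have f: "(\<Sum>i\<in>Basis. fst (f i) *\<^sub>R i) = a" "(\<Sum>i\<in>Basis. snd (f i) *\<^sub>R i) = b"
      by (simp_all add: f_def euclidean_representation)
    have "cbox a b = closure (box a b)" using ab(2) by (subst closure_box) auto
    also have "\<dots> \<subseteq> cball u e" using ab(3) ball_subset_cball by (intro closure_minimal) auto
    finally have "cbox a b \<subseteq> \<Omega>" using e(2) by blast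
    then show ?thesis using ab f by (intro bexI[of _ f]) (auto simp: f_def)
  qed
  ultimately show ?thesis by (auto elim!: eventually_mono)
qed

lemma smooth_on_UNIV:
  assumes "smooth_on UNIV \<psi>"
  shows "\<psi> differentiable (at u)" "continuous_on UNIV \<psi>"
    "continuous_on UNIV (\<lambda>u. frechet_derivative \<psi> (at u) h)"
proof -
  have C: "Ck_on 1 \<psi> UNIV" "Ck_on 0 \<psi> UNIV" using assms by (auto simp: smooth_on_def)
  then show d: "\<psi> differentiable (at u)" "continuous_on UNIV \<psi>" for u
    by (auto simp: differentiable_on_eq_differentiable_at)
  have "frechet_derivative \<psi> (at u) h = (\<Sum>b\<in>Basis. (h \<bullet> b) *\<^sub>R frechet_derivative \<psi> (at u) b)" for u
  proof -
    have "linear (frechet_derivative \<psi> (at u))" using d linear_frechet_derivative by blast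
    then have "frechet_derivative \<psi> (at u) (\<Sum>b\<in>Basis. (h \<bullet> b) *\<^sub>R b)
      = (\<Sum>b\<in>Basis. (h \<bullet> b) *\<^sub>R frechet_derivative \<psi> (at u) b)"
      by (simp add: linear_sum linear_cmul)
    then show ?thesis by (simp add: euclidean_representation)
  qed
  moreover have "continuous_on UNIV (\<lambda>u. \<Sum>b\<in>Basis. (h \<bullet> b) *\<^sub>R frechet_derivative \<psi> (at u) b)"
    using C(1) by (intro continuous_intros) auto
  ultimately show "continuous_on UNIV (\<lambda>u. frechet_derivative \<psi> (at u) h)" by simp
qed

lemma test_function_deriv_outside:
  fixes \<psi> :: "'v::euclidean_space \<Rightarrow> real"
  assumes "compact C" "\<And>u. u \<notin> C \<Longrightarrow> \<psi> u = 0" "u \<notin> C"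
  shows "frechet_derivative \<psi> (at u) h = 0"
proof -
  have "((\<lambda>_. 0) has_derivative (\<lambda>_. 0)) (at u)" by simp
  then have "(\<psi> has_derivative (\<lambda>_. 0)) (at u)"
    by (rule has_derivative_transform_within_open[of _ _ _ _ "- C"])
       (use assms compact_imp_closed in \<open>auto simp: open_Compl\<close>)
  then show ?thesis by (simp add: frechet_derivative_at[symmetric])
qed

lemma test_function_deriv_bounded:
  fixes \<psi> :: "'v::euclidean_space \<Rightarrow> real"
  assumes "smooth_on UNIV \<psi>" "compact C" "\<And>u. u \<notin> C \<Longrightarrow> \<psi> u = 0"
  obtains M where "M \<ge> 0" "\<And>u. \<bar>frechet_derivative \<psi> (at u) h\<bar> \<le> M"
proof -
  obtain M where M: "\<And>u. u \<in> C \<Longrightarrow> norm (frechet_derivative \<psi> (at u) h) \<le> M"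
    by (rule continuous_on_compact_bound[OF assms(2) continuous_on_subset[OF smooth_on_UNIV(3)[OF assms(1)] subset_UNIV]]) blast
  show ?thesis
  proof (rule that[of "max 0 M"])
    show "\<bar>frechet_derivative \<psi> (at u) h\<bar> \<le> max 0 M" for u
    proof (cases "u \<in> C")
      case False
      then show ?thesis using test_function_deriv_outside[where \<psi>=\<psi> and h=h, OF assms(2,3) False] by simp
    qed (use M[of u] in \<open>simp add: max.coboundedI2\<close>)
  qed auto
qed

lemma DERIV_integral_param:
  fixes f :: "'v::euclidean_space \<Rightarrow> real" and \<phi> :: "real \<Rightarrow> 'v \<Rightarrow> real"
  assumes f: "integrable lborel f"
    and k: "\<And>s u. ((\<lambda>s. \<phi> s u) has_real_derivative \<phi>' s u) (at s)"
    and M: "\<And>s u. \<bar>\<phi>' s u\<bar> \<le> M"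
    and B: "\<And>s u. \<bar>\<phi> s u\<bar> \<le> B"
    and [measurable]: "\<And>s. \<phi> s \<in> borel_measurable borel" "\<And>s. \<phi>' s \<in> borel_measurable borel"
  shows "((\<lambda>s. LINT u|lborel. f u * \<phi> s u) has_real_derivative (LINT u|lborel. f u * \<phi>' s u)) (at s)"
  unfolding has_field_derivative_iff tendsto_at_iff_sequentially
proof (intro allI impI)
  fix X :: "nat \<Rightarrow> real" assume X: "\<forall>i. X i \<in> UNIV - {s}" "X \<longlonglongrightarrow> s"
  have [measurable]: "f \<in> borel_measurable borel" using f by auto
  have int: "integrable lborel (\<lambda>u. f u * \<phi> t u)" for t
  proof (rule Bochner_Integration.integrable_bound[OF integrable_mult_right[OF integrable_abs[OF f], of B]])
    have "\<bar>f u\<bar> * \<bar>\<phi> t u\<bar> \<le> \<bar>f u\<bar> * B" for u by (intro mult_left_mono B) simp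
    moreover have "0 \<le> B" using B[of 0 0] by linarith
    ultimately show "AE u in lborel. norm (f u * \<phi> t u) \<le> norm (B * \<bar>f u\<bar>)"
      by (intro AE_I2) (simp add: abs_mult mult.commute)
  qed measurable
  have quot: "((LINT u|lborel. f u * \<phi> (X n) u) - (LINT u|lborel. f u * \<phi> s u)) / (X n - s) =
      (LINT u|lborel. f u * ((\<phi> (X n) u - \<phi> s u) / (X n - s)))" for n
    by (subst Bochner_Integration.integral_diff[OF int int, symmetric], subst integral_divide_zero[symmetric])
       (simp add: right_diff_distrib[symmetric])
  have "(\<lambda>n. LINT u|lborel. f u * ((\<phi> (X n) u - \<phi> s u) / (X n - s))) \<longlonglongrightarrow> (LINT u|lborel. f u * \<phi>' s u)"
  proof (rule integral_dominated_convergence)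
    show "integrable lborel (\<lambda>u. M * \<bar>f u\<bar>)" using f by simp
    show "AE u in lborel. (\<lambda>n. f u * ((\<phi> (X n) u - \<phi> s u) / (X n - s))) \<longlonglongrightarrow> f u * \<phi>' s u"
    proof (rule AE_I2, rule tendsto_mult_left)
      fix u
      have "((\<lambda>y. (\<phi> y u - \<phi> s u) / (y - s)) \<longlongrightarrow> \<phi>' s u) (at s)"
        using k[of u s] by (simp add: has_field_derivative_iff)
      then show "(\<lambda>n. (\<phi> (X n) u - \<phi> s u) / (X n - s)) \<longlonglongrightarrow> \<phi>' s u"
        unfolding tendsto_at_iff_sequentially using X by (auto simp: o_def)
    qed
    fix n
    show "AE u in lborel. norm (f u * ((\<phi> (X n) u - \<phi> s u) / (X n - s))) \<le> M * \<bar>f u\<bar>"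
    proof (rule AE_I2)
      fix u
      have "norm (\<phi> (X n) u - \<phi> s u) \<le> M * norm (X n - s)"
        by (rule field_differentiable_bound[of UNIV "\<lambda>s. \<phi> s u" "\<lambda>s. \<phi>' s u"])
           (use k M in auto)
      then have "\<bar>(\<phi> (X n) u - \<phi> s u) / (X n - s)\<bar> \<le> M" using X(1)[rule_format, of n] by (simp add: abs_divide pos_divide_le_eq)
      then have "\<bar>f u\<bar> * \<bar>(\<phi> (X n) u - \<phi> s u) / (X n - s)\<bar> \<le> \<bar>f u\<bar> * M" by (rule mult_left_mono) simp
      then show "norm (f u * ((\<phi> (X n) u - \<phi> s u) / (X n - s))) \<le> M * \<bar>f u\<bar>"
        by (simp add: abs_mult mult.commute)
    qed
  qed measurable
  then show "((\<lambda>y. ((LINT u|lborel. f u * \<phi> y u) - (LINT u|lborel. f u * \<phi> s u)) / (y - s)) \<circ> X)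
     \<longlonglongrightarrow> (LINT u|lborel. f u * \<phi>' s u)"
    by (simp add: o_def quot)
qed

lemma set_integrable_mult_bounded:
  fixes F \<psi> :: "'v::euclidean_space \<Rightarrow> real"
  assumes "set_integrable lborel C F" "\<psi> \<in> borel_measurable borel" "\<And>u. \<bar>\<psi> u\<bar> \<le> M"
  shows "integrable lborel (\<lambda>u. indicator C u * F u * \<psi> u)"
proof (rule Bochner_Integration.integrable_bound)
  show "integrable lborel (\<lambda>u. M * \<bar>indicator C u * F u\<bar>)"
    using assms(1) by (intro integrable_mult_right integrable_abs) (simp add: set_integrable_def)
  have "(\<lambda>u. indicator C u * F u) \<in> borel_measurable borel"
    using assms(1) by (simp add: set_integrable_def)
  then show "(\<lambda>u. indicator C u * F u * \<psi> u) \<in> borel_measurable lborel" using assms(2) by simp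
  have "\<bar>indicator C u * F u\<bar> * \<bar>\<psi> u\<bar> \<le> \<bar>indicator C u * F u\<bar> * M" for u
    by (intro mult_left_mono assms(3)) simp
  moreover have "M \<ge> 0" using assms(3)[of 0] by linarith
  ultimately show "AE u in lborel. norm (indicator C u * F u * \<psi> u) \<le> norm (M * \<bar>indicator C u * F u\<bar>)"
    by (auto simp: abs_mult mult.commute)
qed

text \<open>The definition tests coordinate directions; linearity of the derivative of \<psi>
  reaches every \<open>h\<close>. Restricting to a compact set carrying \<psi> supplies the
  integrability needed to exchange sum and integral.\<close>

lemma weak_gradient_test:
  assumes w: "weak_gradient_on \<Omega> F G" and \<psi>: "smooth_on UNIV \<psi>"
    and C: "compact C" "C \<subseteq> \<Omega>" "\<And>u. u \<notin> C \<Longrightarrow> \<psi> u = 0"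
  shows "(LINT u|lborel. indicator C u * F u * frechet_derivative \<psi> (at u) h) =
    - (LINT u|lborel. indicator C u * (G u \<bullet> h) * \<psi> u)"
proof -
  have int: "set_integrable lborel C F" "set_integrable lborel C G" using w C by (auto simp: weak_gradient_on_def)
  have intG: "set_integrable lborel C (\<lambda>u. G u $ i)" for i
    using integrable_bounded_linear[OF bounded_linear_vec_nth int(2)[unfolded set_integrable_def]]
    by (simp add: set_integrable_def)
  have m: "\<psi> \<in> borel_measurable borel" "(\<lambda>u. frechet_derivative \<psi> (at u) h) \<in> borel_measurable borel" for h
    using smooth_on_UNIV[OF \<psi>] by (auto intro: borel_measurable_continuous_onI)
  obtain B where "\<And>u. u \<in> C \<Longrightarrow> norm (\<psi> u) \<le> B"
    by (rule continuous_on_compact_bound[OF C(1) continuous_on_subset[OF smooth_on_UNIV(2)[OF \<psi>] subset_UNIV]]) blast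
  then have B: "\<bar>\<psi> u\<bar> \<le> max 0 B" for u using C(3)[of u]
    by (cases "u \<in> C") (simp_all add: max.coboundedI2)
  have t: "test_function \<Omega> \<psi>" using \<psi> C by (auto simp: test_function_def)
  have comp: "(LINT u|lborel. indicator C u * F u * frechet_derivative \<psi> (at u) (axis i 1)) =
     - (LINT u|lborel. indicator C u * (G u $ i) * \<psi> u)" for i
  proof -
    have "(LINT u:\<Omega>|lborel. F u * frechet_derivative \<psi> (at u) (axis i 1)) =
             - (LINT u:\<Omega>|lborel. G u $ i * \<psi> u)"
      using w t by (auto simp: weak_gradient_on_def)
    moreover have "(LINT u:\<Omega>|lborel. F u * frechet_derivative \<psi> (at u) (axis i 1)) =
      (LINT u|lborel. indicator C u * F u * frechet_derivative \<psi> (at u) (axis i 1))"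
      unfolding set_lebesgue_integral_def using C(2) test_function_deriv_outside[where \<psi>=\<psi>, OF C(1,3)]
      by (intro Bochner_Integration.integral_cong) (auto simp: indicator_def)
    moreover have "(LINT u:\<Omega>|lborel. G u $ i * \<psi> u) = (LINT u|lborel. indicator C u * (G u $ i) * \<psi> u)"
      unfolding set_lebesgue_integral_def using C(2,3)
      by (intro Bochner_Integration.integral_cong) (auto simp: indicator_def)
    ultimately show ?thesis by simp
  qed
  have int1: "integrable lborel (\<lambda>u. indicator C u * F u * frechet_derivative \<psi> (at u) h)" for h
  proof -
    obtain M where "\<And>u. \<bar>frechet_derivative \<psi> (at u) h\<bar> \<le> M"
      using test_function_deriv_bounded[OF \<psi> C(1,3)] by metis
    then show ?thesis by (rule set_integrable_mult_bounded[OF int(1) m(2)])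
  qed
  have int2: "integrable lborel (\<lambda>u. indicator C u * (G u $ i) * \<psi> u)" for i
    by (rule set_integrable_mult_bounded[OF intG m(1) B])
  have D: "frechet_derivative \<psi> (at u) h = (\<Sum>i\<in>UNIV. h $ i * frechet_derivative \<psi> (at u) (axis i 1))" for u
  proof -
    have "linear (frechet_derivative \<psi> (at u))" using smooth_on_UNIV(1)[OF \<psi>] linear_frechet_derivative by blast
    then have "frechet_derivative \<psi> (at u) (\<Sum>i\<in>UNIV. h $ i *s axis i 1) = (\<Sum>i\<in>UNIV. h $ i * frechet_derivative \<psi> (at u) (axis i 1))"
      by (simp add: linear_sum linear_cmul scalar_mult_eq_scaleR)
    then show ?thesis by (simp add: basis_expansion)
  qed
  have "(LINT u|lborel. indicator C u * F u * frechet_derivative \<psi> (at u) h) =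
    (LINT u|lborel. (\<Sum>i\<in>UNIV. h $ i * (indicator C u * F u * frechet_derivative \<psi> (at u) (axis i 1))))"
    by (subst D) (simp add: sum_distrib_left mult_ac)
  also have "\<dots> = (\<Sum>i\<in>UNIV. h $ i * (LINT u|lborel. indicator C u * F u * frechet_derivative \<psi> (at u) (axis i 1)))"
    using int1 by (subst Bochner_Integration.integral_sum) auto
  also have "\<dots> = - (\<Sum>i\<in>UNIV. h $ i * (LINT u|lborel. indicator C u * (G u $ i) * \<psi> u))"
    by (simp add: comp sum_negf)
  also have "(\<Sum>i\<in>UNIV. h $ i * (LINT u|lborel. indicator C u * (G u $ i) * \<psi> u)) =
    (LINT u|lborel. (\<Sum>i\<in>UNIV. h $ i * (indicator C u * (G u $ i) * \<psi> u)))"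
    using int2 by (subst Bochner_Integration.integral_sum) auto
  also have "\<dots> = (LINT u|lborel. indicator C u * (G u \<bullet> h) * \<psi> u)"
    by (intro Bochner_Integration.integral_cong) (simp_all add: inner_vec_def sum_distrib_left sum_distrib_right mult_ac)
  finally show ?thesis .
qed

lemma AE_box_cbox: "AE u::real^'k in lborel. u \<in> box a b \<longleftrightarrow> u \<in> cbox a b"
proof -
  have "cbox a b - box a b \<in> null_sets lborel"
    using negligible_frontier_interval[of a b] by (auto simp: negligible_iff_null_sets null_sets_completion_iff)
  then have "AE u in lborel. u \<notin> cbox a b - box a b" by (rule AE_not_in)
  then show ?thesis by eventually_elim (use box_subset_cbox[of a b] in auto)
qed

lemma box_bump_integral_tendsto:
  fixes F :: "real^'k \<Rightarrow> real"
  assumes "set_integrable lborel C F" "cbox a b \<subseteq> C"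
  shows "(\<lambda>n. LINT u|lborel. indicator C u * F u * box_bump n a b u) \<longlonglongrightarrow> (LINT u:cbox a b|lborel. F u)"
proof -
  have [measurable]: "box_bump n a b \<in> borel_measurable borel" for n
    using smooth_on_UNIV(2)[OF box_bump_smooth] by (auto intro: borel_measurable_continuous_onI)
  have FI: "integrable lborel (\<lambda>u. indicator C u * F u)" using assms(1) by (simp add: set_integrable_def)
  then have [measurable]: "(\<lambda>u. indicator C u * F u) \<in> borel_measurable borel" by auto
  have "(\<lambda>n. LINT u|lborel. indicator C u * F u * box_bump n a b u) \<longlonglongrightarrow>
     (LINT u|lborel. indicator C u * F u * indicator (box a b) u)"
  proof (rule integral_dominated_convergence)
    show "integrable lborel (\<lambda>u. \<bar>indicator C u * F u\<bar>)" using FI by (rule integrable_abs)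
    show "AE u in lborel. (\<lambda>n. indicator C u * F u * box_bump n a b u) \<longlonglongrightarrow> indicator C u * F u * indicator (box a b) u"
      by (intro AE_I2 tendsto_mult_left box_bump_tendsto)
    show "AE u in lborel. norm (indicator C u * F u * box_bump n a b u) \<le> \<bar>indicator C u * F u\<bar>" for n
      using box_bump_range[of n a b] by (intro AE_I2) (simp add: abs_mult mult_left_le)
  qed measurable
  also have "(LINT u|lborel. indicator C u * F u * indicator (box a b) u) = (LINT u:cbox a b|lborel. F u)"
    unfolding set_lebesgue_integral_def
  proof (rule integral_cong_AE)
    have "(\<lambda>u. (indicator C u * F u) * indicator (cbox a b) u) \<in> borel_measurable borel" by measurable
    moreover have "(\<lambda>u. (indicator C u * F u) * indicator (cbox a b) u) = (\<lambda>u. indicator (cbox a b) u *\<^sub>R F u)"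
      using assms(2) by (auto simp: indicator_def fun_eq_iff)
    ultimately show "(\<lambda>u. indicator (cbox a b) u *\<^sub>R F u) \<in> borel_measurable lborel" by simp
    show "AE u in lborel. indicator C u * F u * indicator (box a b) u = indicator (cbox a b) u *\<^sub>R F u"
      using AE_box_cbox[of a b] by eventually_elim (use assms(2) in \<open>auto simp: indicator_def\<close>)
  qed measurable
  finally show ?thesis .
qed

lemma small_box:
  fixes u :: "'v::euclidean_space"
  assumes "open \<Omega>" "u \<in> \<Omega>"
  shows "\<forall>\<^sub>F h in at_right 0. cbox u (u + h *\<^sub>R One) \<subseteq> \<Omega>"
proof -
  obtain e where e: "e > 0" "ball u e \<subseteq> \<Omega>" using assms open_contains_ball by blast
  have pos: "0 < e / real DIM('v)" using e by simp
  have "cbox u (u + h *\<^sub>R One) \<subseteq> \<Omega>" if h: "0 < h" "h < e / real DIM('v)" for h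
  proof -
    have "w \<in> ball u e" if w: "w \<in> cbox u (u + h *\<^sub>R One)" for w
    proof -
      have "norm (w - u) \<le> (\<Sum>b\<in>Basis. \<bar>(w - u) \<bullet> b\<bar>)" by (rule norm_le_l1)
      also have "\<dots> \<le> (\<Sum>b\<in>(Basis::'v set). h)"
        using w by (intro sum_mono) (auto simp: mem_box inner_diff_left inner_add_left)
      also have "\<dots> < e" using h by (simp add: pos_less_divide_eq mult.commute)
      finally show ?thesis by (simp add: dist_norm norm_minus_commute)
    qed
    then show ?thesis using e by blast
  qed
  then show ?thesis using pos by (intro eventually_at_rightI[of 0 "e / real DIM('v)"]) auto
qed

text \<open>The bumps determine the integrals over boxes by dominated convergence, and these
  determine the function at its Lebesgue points: the fundamental lemma of the calculus of variations
  for one family of test functions.\<close>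

lemma AE_eq_of_box_bumps:
  fixes F H :: "real^'k \<Rightarrow> real"
  assumes "open \<Omega>" and F: "\<And>C. compact C \<Longrightarrow> C \<subseteq> \<Omega> \<Longrightarrow> set_integrable lborel C F"
    and H: "\<And>C. compact C \<Longrightarrow> C \<subseteq> \<Omega> \<Longrightarrow> set_integrable lborel C H"
    and eq: "\<And>a b n. cbox a b \<subseteq> \<Omega> \<Longrightarrow>
      (LINT u|lborel. indicator (cbox a b) u * F u * box_bump n a b u) =
      (LINT u|lborel. indicator (cbox a b) u * H u * box_bump n a b u)"
  shows "AE u in lborel. u \<in> \<Omega> \<longrightarrow> F u = H u"
proof -
  have box_eq: "(LINT u:cbox a b|lborel. F u) = (LINT u:cbox a b|lborel. H u)" if ab: "cbox a b \<subseteq> \<Omega>" for a b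
    using box_bump_integral_tendsto[OF F[OF compact_cbox ab] order_refl]
      box_bump_integral_tendsto[OF H[OF compact_cbox ab] order_refl] eq[OF ab]
    by (simp add: LIMSEQ_unique)
  have L: "AE u in lborel. u \<in> \<Omega> \<longrightarrow>
      ((\<lambda>h. (LINT w:cbox u (u + h *\<^sub>R One)|lborel. F w) / h ^ CARD('k)) \<longlongrightarrow> F u) (at_right 0)"
    "AE u in lborel. u \<in> \<Omega> \<longrightarrow>
      ((\<lambda>h. (LINT w:cbox u (u + h *\<^sub>R One)|lborel. H w) / h ^ CARD('k)) \<longlongrightarrow> H u) (at_right 0)"
    by (rule Lebesgue_differentiation[OF assms(1)]; fact)+
  show ?thesis
    using L
  proof eventually_elim
    case (elim u)
    show ?case
    proof
      assume u: "u \<in> \<Omega>"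
      have ev: "\<forall>\<^sub>F h in at_right 0. cbox u (u + h *\<^sub>R One) \<subseteq> \<Omega>" by (rule small_box[OF assms(1) u])
      have "((\<lambda>h. (LINT w:cbox u (u + h *\<^sub>R One)|lborel. H w) / h ^ CARD('k)) \<longlongrightarrow> F u) (at_right 0)"
        by (rule Lim_transform_eventually[OF elim(1)[rule_format, OF u]])
           (use ev in eventually_elim, simp add: box_eq)
      then show "F u = H u"
        using elim(2) u tendsto_unique[OF trivial_limit_at_right_real] by blast
    qed
  qed
qed

lemma set_integrable_component:
  fixes G :: "real^'k \<Rightarrow> real^'k"
  assumes "set_integrable lborel C G" shows "set_integrable lborel C (\<lambda>u. G u $ i)"
  using integrable_bounded_linear[OF bounded_linear_vec_nth assms[unfolded set_integrable_def]]
  by (simp add: set_integrable_def)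

text \<open>\<open>weak_differential\<close> is picked by choice; an estimate for a concrete
  gradient reaches the chosen one only through uniqueness almost everywhere.\<close>

lemma weak_gradient_unique:
  fixes F :: "real^'k \<Rightarrow> real"
  assumes "open \<Omega>" "weak_gradient_on \<Omega> F G" "weak_gradient_on \<Omega> F G'"
  shows "AE u in lborel. u \<in> \<Omega> \<longrightarrow> G u = G' u"
proof -
  have "AE u in lborel. u \<in> \<Omega> \<longrightarrow> G u $ i = G' u $ i" for i
  proof (rule AE_eq_of_box_bumps[OF assms(1)])
    fix a b :: "real^'k" and n assume ab: "cbox a b \<subseteq> \<Omega>"
    have out: "box_bump n a b u = 0" if "u \<notin> cbox a b" for u
      using box_bump_outside[of u a b n] box_subset_cbox[of a b] that by blast
    show "(LINT u|lborel. indicator (cbox a b) u * (G u $ i) * box_bump n a b u) =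
      (LINT u|lborel. indicator (cbox a b) u * (G' u $ i) * box_bump n a b u)"
      using weak_gradient_test[OF assms(2) box_bump_smooth compact_cbox ab out, where h="axis i 1"]
        weak_gradient_test[OF assms(3) box_bump_smooth compact_cbox ab out, where h="axis i 1"]
      by (simp add: inner_axis)
  qed (use assms(2,3) in \<open>auto simp: weak_gradient_on_def intro: set_integrable_component\<close>)
  then have "AE u in lborel. \<forall>i\<in>UNIV. u \<in> \<Omega> \<longrightarrow> G u $ i = G' u $ i"
    by (intro AE_finite_allI) auto
  then show ?thesis by eventually_elim (auto simp: vec_eq_iff)
qed

lemma cbox_translate: "w \<in> cbox (a + t) (b + t) \<longleftrightarrow> w - t \<in> cbox a b" for w :: "'v::euclidean_space"
  by (simp add: mem_box inner_add_left inner_diff_left algebra_simps)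

lemma measure_cbox_translate: "measure lborel (cbox (a + t) (b + t)) = measure lborel (cbox a b)"
  for a :: "'v::euclidean_space"
  unfolding measure_lborel_cbox_eq inner_add_left add_diff_cancel_right add_le_cancel_right ..

text \<open>\<open>\<phi> n s\<close> pairs \<open>F\<close> with a bump translated by
  \<open>s *\<^sub>R h\<close>. Its derivative in \<open>s\<close> falls on the bump, and the weak
  gradient turns it into the integral of \<open>G u \<bullet> h\<close> against the bump, at most
  \<open>\<bar>K\<bar>\<close> times the volume of the box. As \<open>n\<close> grows, the pairings
  become integrals over boxes.\<close>

lemma weak_gradient_shift:
  fixes F :: "real^'k \<Rightarrow> real"
  assumes w: "weak_gradient_on \<Omega> F G" and B: "B \<subseteq> \<Omega>" "convex B"
    and box: "cbox a b \<subseteq> B" "cbox (a + h) (b + h) \<subseteq> B"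
    and K: "AE u in lborel. u \<in> B \<longrightarrow> \<bar>G u \<bullet> h\<bar> \<le> K"
  shows "\<bar>(LINT u:cbox (a + h) (b + h)|lborel. F u) - (LINT u:cbox a b|lborel. F u)\<bar>
    \<le> \<bar>K\<bar> * measure lborel (cbox a b)"
proof -
  \<comment> \<open>The compact set swept out by the moving box: it carries all the test functions
    at once, and convexity of \<open>B\<close> keeps it inside \<open>B\<close>.\<close>
  define C where "C = (\<lambda>(s, u). u + s *\<^sub>R h) ` ({0..1} \<times> cbox a b)"
  have C: "compact C"
    unfolding C_def case_prod_unfold
    by (intro compact_continuous_image compact_Times continuous_intros) auto
  have CB: "C \<subseteq> B"
  proof
    fix x assume "x \<in> C"
    then obtain s u where x: "x = u + s *\<^sub>R h" "s \<in> {0..1}" "u \<in> cbox a b" by (auto simp: C_def)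
    have "u + h \<in> cbox (a + h) (b + h)" using x(3) by (simp add: cbox_translate)
    then have "(1 - s) *\<^sub>R u + s *\<^sub>R (u + h) \<in> B"
      using box x by (intro convexD_alt[OF B(2)]) auto
    then show "x \<in> B" using x(1) by (simp add: algebra_simps)
  qed
  then have CO: "C \<subseteq> \<Omega>" using B by blast
  have sub: "cbox (a + s *\<^sub>R h) (b + s *\<^sub>R h) \<subseteq> C" if "s \<in> {0..1}" for s
  proof
    fix x assume "x \<in> cbox (a + s *\<^sub>R h) (b + s *\<^sub>R h)"
    then show "x \<in> C" unfolding C_def cbox_translate using that
      by (intro image_eqI[of _ _ "(s, x - s *\<^sub>R h)"]) auto
  qed
  have intF: "set_integrable lborel C F" using w C CO by (auto simp: weak_gradient_on_def)
  then have intF': "integrable lborel (\<lambda>u. indicator C u * F u)" by (simp add: set_integrable_def)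
  have intG: "set_integrable lborel C G" using w C CO by (auto simp: weak_gradient_on_def)
  define \<phi> where "\<phi> n s = (LINT u|lborel. indicator C u * F u * box_bump n a b (u - s *\<^sub>R h))" for n s
  have main: "\<bar>\<phi> n 1 - \<phi> n 0\<bar> \<le> \<bar>K\<bar> * measure lborel (cbox a b)" for n
  proof -
    let ?\<psi> = "box_bump n a b"
    have sm: "smooth_on UNIV ?\<psi>" by (rule box_bump_smooth)
    have D: "(?\<psi> has_derivative frechet_derivative ?\<psi> (at u)) (at u)" for u
      using smooth_on_UNIV(1)[OF sm] frechet_derivative_works by blast
    have out: "?\<psi> u = 0" if "u \<notin> cbox a b" for u
      using box_bump_outside[of u a b n] box_subset_cbox[of a b] that by blast
    obtain M where M: "\<And>u. \<bar>frechet_derivative ?\<psi> (at u) h\<bar> \<le> M"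
      using test_function_deriv_bounded[OF sm compact_cbox out, of a b h] by metis
    have frechet_shift: "frechet_derivative (box_bump n (a + t) (b + t)) (at u) = frechet_derivative ?\<psi> (at (u - t))" for t u
    proof -
      have "((\<lambda>u. ?\<psi> (u - t)) has_derivative frechet_derivative ?\<psi> (at (u - t))) (at u)"
        by (rule has_derivative_compose[of "\<lambda>u. u - t" "\<lambda>x. x" u UNIV ?\<psi>, OF _ D]) (auto intro!: derivative_eq_intros)
      then show ?thesis by (simp add: frechet_derivative_at[symmetric] box_bump_shift[abs_def])
    qed
    have DER: "(\<phi> n has_real_derivative
        (LINT u|lborel. indicator C u * F u * (- frechet_derivative ?\<psi> (at (u - s *\<^sub>R h)) h))) (at s)" for s
      unfolding \<phi>_def
    proof (rule DERIV_integral_param[OF intF', where M = M and B = 1])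
      fix s u
      have "((\<lambda>s. ?\<psi> (u - s *\<^sub>R h)) has_derivative (\<lambda>x. frechet_derivative ?\<psi> (at (u - s *\<^sub>R h)) (- (x *\<^sub>R h)))) (at s)"
        by (rule has_derivative_compose[of "\<lambda>s. u - s *\<^sub>R h" "\<lambda>x. - (x *\<^sub>R h)" s UNIV ?\<psi>, OF _ D])
           (auto intro!: derivative_eq_intros)
      moreover have "frechet_derivative ?\<psi> (at (u - s *\<^sub>R h)) (- (x *\<^sub>R h)) =
          - frechet_derivative ?\<psi> (at (u - s *\<^sub>R h)) h * x" for x
      proof -
        have "linear (frechet_derivative ?\<psi> (at (u - s *\<^sub>R h)))" using D has_derivative_linear by blast
        then show ?thesis using linear_cmul[of "frechet_derivative ?\<psi> (at (u - s *\<^sub>R h))" "- x" h] by simp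
      qed
      then have "(\<lambda>x. frechet_derivative ?\<psi> (at (u - s *\<^sub>R h)) (- (x *\<^sub>R h))) =
          (*) (- frechet_derivative ?\<psi> (at (u - s *\<^sub>R h)) h)" by (rule ext)
      ultimately show "((\<lambda>s. ?\<psi> (u - s *\<^sub>R h)) has_real_derivative - frechet_derivative ?\<psi> (at (u - s *\<^sub>R h)) h) (at s)"
        by (simp only: has_field_derivative_def)
      show "\<bar>- frechet_derivative ?\<psi> (at (u - s *\<^sub>R h)) h\<bar> \<le> M" using M by simp
      show "\<bar>?\<psi> (u - s *\<^sub>R h)\<bar> \<le> 1" using box_bump_range[of n a b "u - s *\<^sub>R h"] by simp
      show "(\<lambda>u. ?\<psi> (u - s *\<^sub>R h)) \<in> borel_measurable borel"
        by (intro borel_measurable_continuous_onI continuous_on_compose2[OF smooth_on_UNIV(2)[OF sm]] continuous_intros) auto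
      show "(\<lambda>u. - frechet_derivative ?\<psi> (at (u - s *\<^sub>R h)) h) \<in> borel_measurable borel"
        by (intro borel_measurable_continuous_onI continuous_on_minus
            continuous_on_compose2[OF smooth_on_UNIV(3)[OF sm, of h]] continuous_intros) auto
    qed
    have bound: "norm (LINT u|lborel. indicator C u * F u * (- frechet_derivative ?\<psi> (at (u - s *\<^sub>R h)) h))
       \<le> \<bar>K\<bar> * measure lborel (cbox a b)" if s: "s \<in> {0..1}" for s
    proof -
      let ?a = "a + s *\<^sub>R h" and ?b = "b + s *\<^sub>R h"
      have out': "box_bump n ?a ?b u = 0" if "u \<notin> C" for u
      proof -
        have "u - s *\<^sub>R h \<notin> cbox a b" using sub[OF s] that cbox_translate[of u a "s *\<^sub>R h" b] by blast
        then show ?thesis using out by (simp add: box_bump_shift)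
      qed
      have "(LINT u|lborel. indicator C u * F u * (- frechet_derivative ?\<psi> (at (u - s *\<^sub>R h)) h)) =
         - (LINT u|lborel. indicator C u * F u * frechet_derivative (box_bump n ?a ?b) (at u) h)"
        by (simp add: frechet_shift)
      also have "\<dots> = (LINT u|lborel. indicator C u * (G u \<bullet> h) * box_bump n ?a ?b u)"
        using weak_gradient_test[OF w box_bump_smooth C CO out', where h=h] by simp
      also have "norm \<dots> \<le> (LINT u|lborel. norm (indicator C u * (G u \<bullet> h) * box_bump n ?a ?b u))"
        by (rule integral_norm_bound)
      also have "\<dots> \<le> (LINT u|lborel. \<bar>K\<bar> * indicator (cbox ?a ?b) u)"
      proof (rule integral_mono_AE)
        have "set_integrable lborel C (\<lambda>u. G u \<bullet> h)"
          using integrable_bounded_linear[OF bounded_linear_inner_left intG[unfolded set_integrable_def]]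
          by (simp add: set_integrable_def)
        then have "integrable lborel (\<lambda>u. indicator C u * (G u \<bullet> h) * box_bump n ?a ?b u)"
          by (rule set_integrable_mult_bounded[where M=1])
             (auto intro!: borel_measurable_continuous_onI smooth_on_UNIV(2)[OF box_bump_smooth] simp: box_bump_range)
        then show "integrable lborel (\<lambda>u. norm (indicator C u * (G u \<bullet> h) * box_bump n ?a ?b u))"
          by (rule integrable_norm)
        show "AE u in lborel. norm (indicator C u * (G u \<bullet> h) * box_bump n ?a ?b u) \<le> \<bar>K\<bar> * indicator (cbox ?a ?b) u"
          using K
        proof eventually_elim
          case (elim u)
          show ?case
          proof (cases "u \<in> cbox ?a ?b")
            case True
            then have "u \<in> C" "\<bar>G u \<bullet> h\<bar> \<le> \<bar>K\<bar>" using sub[OF s] elim CB by auto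
            then have "\<bar>G u \<bullet> h\<bar> * \<bar>box_bump n ?a ?b u\<bar> \<le> \<bar>K\<bar> * 1"
              using box_bump_range[of n ?a ?b u] by (intro mult_mono) auto
            then show ?thesis using True \<open>u \<in> C\<close> by (simp add: abs_mult)
          next
            case False
            then have "box_bump n ?a ?b u = 0" using out[of "u - s *\<^sub>R h"] by (simp add: box_bump_shift cbox_translate)
            then show ?thesis by simp
          qed
        qed
        show "integrable lborel (\<lambda>u. \<bar>K\<bar> * indicator (cbox ?a ?b) u)"
          using emeasure_bounded_finite[OF bounded_cbox, of ?a ?b]
          by (intro integrable_mult_right integrable_real_indicator) simp_all
      qed
      also have "\<dots> = \<bar>K\<bar> * measure lborel (cbox ?a ?b)" by simp
      finally show ?thesis by (simp only: measure_cbox_translate)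
    qed
    have "norm (\<phi> n 1 - \<phi> n 0) \<le> \<bar>K\<bar> * measure lborel (cbox a b) * norm (1 - 0 :: real)"
      by (rule field_differentiable_bound[of "{0..1}" "\<phi> n"])
         (use DER bound in \<open>auto intro: has_field_derivative_at_within\<close>)
    then show ?thesis by simp
  qed
  have "(\<lambda>n. \<phi> n 1) \<longlonglongrightarrow> (LINT u:cbox (a + h) (b + h)|lborel. F u)"
    using box_bump_integral_tendsto[OF intF, of "a + h" "b + h"] sub[of 1] by (simp add: \<phi>_def box_bump_shift)
  moreover have "(\<lambda>n. \<phi> n 0) \<longlonglongrightarrow> (LINT u:cbox a b|lborel. F u)"
    using box_bump_integral_tendsto[OF intF, of a b] sub[of 0] by (simp add: \<phi>_def)
  ultimately have "(\<lambda>n. \<bar>\<phi> n 1 - \<phi> n 0\<bar>) \<longlonglongrightarrow>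
    \<bar>(LINT u:cbox (a + h) (b + h)|lborel. F u) - (LINT u:cbox a b|lborel. F u)\<bar>"
    by (intro tendsto_intros)
  then show ?thesis by (rule LIMSEQ_le_const2) (use main in auto)
qed

lemma weak_gradient_lipschitz:
  fixes F :: "real^'k \<Rightarrow> real"
  assumes "open \<Omega>" and w: "weak_gradient_on \<Omega> F G" and B: "B \<subseteq> \<Omega>" "convex B" "open B"
    and K: "\<And>h. AE u in lborel. u \<in> B \<longrightarrow> \<bar>G u \<bullet> h\<bar> \<le> K h" "\<And>h. K h \<ge> 0"
  obtains N where "N \<in> null_sets lborel" "\<And>u v. u \<in> B - N \<Longrightarrow> v \<in> B - N \<Longrightarrow> \<bar>F v - F u\<bar> \<le> K (v - u)"
proof -
  let ?m = "\<lambda>u h. (LINT w:cbox u (u + h *\<^sub>R One)|lborel. F w) / h ^ CARD('k)"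
  have "AE u in lborel. u \<in> \<Omega> \<longrightarrow> (?m u \<longlongrightarrow> F u) (at_right 0)"
    by (rule Lebesgue_differentiation[OF assms(1)]) (use w in \<open>auto simp: weak_gradient_on_def\<close>)
  then obtain N where N: "{u \<in> space lborel. \<not> (u \<in> \<Omega> \<longrightarrow> (?m u \<longlongrightarrow> F u) (at_right 0))} \<subseteq> N"
    "emeasure lborel N = 0" "N \<in> sets lborel" by (rule AE_E)
  show ?thesis
  proof (rule that[of N])
    show "N \<in> null_sets lborel" using N by auto
    fix u v assume uv: "u \<in> B - N" "v \<in> B - N"
    have lim: "(?m u \<longlongrightarrow> F u) (at_right 0)" "(?m v \<longlongrightarrow> F v) (at_right 0)"
      using N(1) uv B(1) by auto
    have uB: "u \<in> B" "v \<in> B" using uv by auto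
    have ev: "\<forall>\<^sub>F h in at_right 0. \<bar>?m v h - ?m u h\<bar> \<le> K (v - u)"
      using small_box[OF B(3) uB(1)] small_box[OF B(3) uB(2)] eventually_at_right_less[of 0]
    proof eventually_elim
      case (elim h)
      have eqv: "u + (v - u) = v" "u + h *\<^sub>R One + (v - u) = v + h *\<^sub>R One" by simp_all
      have "\<bar>(LINT w:cbox v (v + h *\<^sub>R One)|lborel. F w) - (LINT w:cbox u (u + h *\<^sub>R One)|lborel. F w)\<bar>
        \<le> \<bar>K (v - u)\<bar> * measure lborel (cbox u (u + h *\<^sub>R One))"
        using weak_gradient_shift[OF w B(1,2), of u "u + h *\<^sub>R One" "v - u" "K (v - u)"] elim K(1)[of "v - u"]
        unfolding eqv by blast
      also have "measure lborel (cbox u (u + h *\<^sub>R One)) = h ^ CARD('k)"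
        using elim by (simp add: measure_lborel_cbox_eq inner_add_left)
      finally have "\<bar>(LINT w:cbox v (v + h *\<^sub>R One)|lborel. F w) - (LINT w:cbox u (u + h *\<^sub>R One)|lborel. F w)\<bar>
        / h ^ CARD('k) \<le> K (v - u)" using elim K(2)[of "v - u"] by (simp add: pos_divide_le_eq)
      then show ?case using elim by (simp add: diff_divide_distrib[symmetric] abs_divide)
    qed
    show "\<bar>F v - F u\<bar> \<le> K (v - u)"
      by (rule tendsto_upperbound[OF _ ev]) (intro tendsto_intros lim trivial_limit_at_right_real)+
  qed
qed

section \<open>Functions with bounded weak differential are Lipschitz off a null set\<close>

context closed_manifold begin

text \<open>Cauchy-Schwarz for the metric, applied to \<open>v\<close> and the vector dual to \<xi>,
  whose metric norm is the square root on the right.\<close>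

lemma covector_form_bound:
  assumes c: "c \<in> A" "p \<in> fst c"
  shows "\<bar>\<xi> \<bullet> v\<bar> \<le> sqrt (\<xi> \<bullet> (matrix_inv (g c p) *v \<xi>)) * nrm c p v"
proof -
  have "det (g c p) > 0" using metric_pos[OF c] by (intro det_pos_definite)
  then have inv: "invertible (g c p)" by (simp add: invertible_det_nz)
  define w where "w = matrix_inv (g c p) *v \<xi>"
  have gw: "g c p *v w = \<xi>"
    using someI_ex[OF inv[unfolded invertible_def]] by (simp add: w_def matrix_vector_mul_assoc matrix_inv_def)
  have "\<xi> \<bullet> v = v \<bullet> (g c p *v w)" by (simp add: gw inner_commute)
  moreover have "nrm c p w = sqrt (\<xi> \<bullet> (matrix_inv (g c p) *v \<xi>))"
    unfolding nrm_def gw by (simp add: w_def inner_commute)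
  ultimately show ?thesis using metric_Cauchy_Schwarz[OF c, of v w] by (simp add: mult.commute)
qed

lemma covector_norm_bound:
  assumes D: "is_weak_differential A f D" and c: "c \<in> A" "p \<in> fst c"
  shows "\<bar>D c p \<bullet> h\<bar> \<le> covector_norm A g D p * nrm c p h"
proof -
  define e where "e = chart_at A p"
  have e: "e \<in> A" "p \<in> fst e" using chart_at[of p] by (auto simp: e_def)
  let ?J = "transition_jacobian c e p"
  have "D c p = transpose ?J *v D e p"
    using D c e unfolding is_weak_differential_def by blast
  then have "D c p \<bullet> h = D e p \<bullet> (?J *v h)"
    by (metis dot_lmul_matrix transpose_matrix_vector vector_transpose_matrix)
  moreover have "nrm c p h = nrm e p (?J *v h)"
    by (simp add: nrm_def metric_form_transform[OF c(1) e(1) c(2) e(2)])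
  moreover have "covector_norm A g D p = sqrt (D e p \<bullet> (matrix_inv (g e p) *v D e p))"
    by (simp add: covector_norm_def e_def[symmetric])
  ultimately show ?thesis using covector_form_bound[OF e, of "D e p" "?J *v h"] by simp
qed

text \<open>The distance is an infimum of lengths, so points can be joined by chains of short steps
  whose total length is nearly \<open>dr x y\<close>; a local Lipschitz bound adds up along the
  chain without loss in \<open>K\<close>.\<close>

lemma chain_lipschitz:
  assumes N: "N \<in> null_sets vol" and "\<sigma> > 0" "K \<ge> 0"
    and loc: "\<And>x y. x \<notin> N \<Longrightarrow> y \<notin> N \<Longrightarrow> d x y < ennreal \<sigma> \<Longrightarrow> \<bar>f x - f y\<bar> \<le> K * dr x y"
  shows "geo_lipschitz N K f"
  unfolding geo_lipschitz_def
proof (intro allI impI)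
  fix x y assume xy: "x \<notin> N" "y \<notin> N" "d x y < top"
  have steps: "\<bar>f x - f y\<bar> \<le> real n * (K * r)"
    if "n \<ge> 1" "x \<notin> N" "y \<notin> N" "d x y < ennreal (real n * r)" "0 < r" "r < \<sigma>" for n x y r
  proof -
    note r01 = that(5,6) and yN = that(3)
    show ?thesis
    using that(1,2,4)
  proof (induction n arbitrary: x rule: dec_induct)
    case base
    then have "d x y < ennreal r" by simp
    then have "d x y < ennreal \<sigma>" "dr x y \<le> r"
      using r01 by (auto simp: enn2real_leI order_less_imp_le intro: order_less_trans ennreal_lessI)
    then show ?case using loc[OF base(1) yN] assms(3) mult_left_mono[of "dr x y" r K] by simp
  next
    case (step n)
    have "d x y < ennreal (r + real n * r)" using step.prems by (simp add: algebra_simps)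
    moreover have "real n * r > 0" using r01(1) step.hyps by simp
    ultimately obtain z where z: "d x z < ennreal r" "d z y < ennreal (real n * r)" "z \<notin> N"
      using intermediate_point_avoiding[of x y r "real n * r" N] r01(1) N by auto
    have "d x z < ennreal \<sigma>" "dr x z \<le> r"
      using r01 z(1) by (auto simp: enn2real_leI order_less_imp_le intro: order_less_trans ennreal_lessI)
    then have "\<bar>f x - f z\<bar> \<le> K * r" using loc[OF step.prems(1) z(3)] assms(3) mult_left_mono[of "dr x z" r K] by simp
    moreover have "\<bar>f z - f y\<bar> \<le> real n * (K * r)" using step.IH[OF z(3,2)] .
    ultimately show ?case by (simp add: algebra_simps)
  qed
  qed
  have "\<bar>f x - f y\<bar> \<le> K * dr x y + \<eta>" if \<eta>: "\<eta> > 0" for \<eta>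
  proof -
    \<comment> \<open>Slightly more than \<open>dr x y\<close>, as chains need a strict inequality.
      The excess costs \<open>K * \<eta> / (K + 1)\<close>, below \<eta>; the summand 1 admits
      \<open>K = 0\<close>.\<close>
    define t where "t = dr x y + \<eta> / (K + 1)"
    have t: "dr x y < t" "t > 0" using \<eta> assms(3) by (auto simp: t_def intro: add_nonneg_pos)
    obtain n where n: "real n > t / \<sigma>" using reals_Archimedean2 by blast
    have "t / \<sigma> > 0" using t assms(2) by simp
    then have "real n > 0" using n by linarith
    then have n1: "n \<ge> 1" "real n > 0" by simp_all
    have r: "0 < t / real n" "t / real n < \<sigma>" using n n1 t assms(2) by (auto simp: field_simps)
    have "\<bar>f x - f y\<bar> \<le> real n * (K * (t / real n))"
    proof (rule steps[OF n1(1) xy(1,2) _ r])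
      have "real n * (t / real n) = t" using n1 by simp
      then show "d x y < ennreal (real n * (t / real n))" using d_less_iff[OF xy(3)] t(1) by metis
    qed
    also have "\<dots> = K * t" using n1 by simp
    also have "\<dots> = K * dr x y + \<eta> * (K / (K + 1))" by (simp add: t_def algebra_simps)
    also have "\<dots> \<le> K * dr x y + \<eta> * 1" using \<eta> assms(3) by (intro add_left_mono mult_left_mono) auto
    finally show ?thesis by simp
  qed
  then show "\<bar>f x - f y\<bar> \<le> K * dr x y" by (rule field_le_epsilon)
qed

text \<open>A Lebesgue number argument: finitely many balls of half the local radius cover, and two
  points closer than every half radius lie in a common full ball. Only finitely many null sets are
  joined.\<close>

lemma local_to_global_lipschitz:
  assumes "K \<ge> 0"
    and loc: "\<And>p. \<exists>\<sigma>>0. \<exists>N\<in>null_sets vol. \<forall>x y. d p x < ennreal \<sigma> \<longrightarrow> d p y < ennreal \<sigma> \<longrightarrow>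
        x \<notin> N \<longrightarrow> y \<notin> N \<longrightarrow> \<bar>f x - f y\<bar> \<le> K * dr x y"
  obtains N where "N \<in> null_sets vol" "geo_lipschitz N K f"
proof -
  obtain \<sigma> N where \<sigma>: "\<And>p. \<sigma> p > 0" and N: "\<And>p. N p \<in> null_sets vol" and
    lip: "\<And>p x y. d p x < ennreal (\<sigma> p) \<Longrightarrow> d p y < ennreal (\<sigma> p) \<Longrightarrow> x \<notin> N p \<Longrightarrow> y \<notin> N p \<Longrightarrow>
       \<bar>f x - f y\<bar> \<le> K * dr x y"
    using loc by metis
  have "UNIV \<subseteq> (\<Union>p. {y. d p y < ennreal (\<sigma> p / 2)})" using \<sigma> by (auto intro!: exI)
  then obtain P where P: "finite P" "UNIV \<subseteq> (\<Union>p\<in>P. {y. d p y < ennreal (\<sigma> p / 2)})"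
    by (rule compactE_image[OF compact_UNIV, rotated 1]) (use open_geo_ball in auto)
  have Pne: "P \<noteq> {}" using P by auto
  define s where "s = Min (\<sigma> ` P) / 2"
  have s: "s > 0" "\<And>p. p \<in> P \<Longrightarrow> s \<le> \<sigma> p / 2" using P Pne \<sigma> by (auto simp: s_def)
  define N' where "N' = (\<Union>p\<in>P. N p)"
  have N': "N' \<in> null_sets vol" unfolding N'_def using P(1) N by (intro null_sets_UN') (auto simp: countable_finite)
  have "geo_lipschitz N' K f"
  proof (rule chain_lipschitz[OF N' s(1) assms(1)])
    fix x y assume xy: "x \<notin> N'" "y \<notin> N'" "d x y < ennreal s"
    obtain p where p: "p \<in> P" "d p x < ennreal (\<sigma> p / 2)" using P(2) by blast
    have "d p y \<le> d p x + d x y" by (rule geo_triangle)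
    also have "\<dots> < ennreal (\<sigma> p / 2) + ennreal (\<sigma> p / 2)"
      by (rule add_strict_mono[OF p(2) order_less_le_trans[OF xy(3) ennreal_leI[OF s(2)[OF p(1)]]]])
    also have "\<dots> = ennreal (\<sigma> p)" using \<sigma>[of p] by (simp flip: ennreal_plus)
    finally have "d p y < ennreal (\<sigma> p)" .
    moreover have "d p x < ennreal (\<sigma> p)" using p(2) \<sigma>[of p] by (auto intro: order_less_le_trans ennreal_leI)
    ultimately show "\<bar>f x - f y\<bar> \<le> K * dr x y" using lip xy p(1) by (auto simp: N'_def)
  qed
  then show ?thesis using that N' by blast
qed

lemma weak_differential_lipschitz:
  assumes D: "is_weak_differential A f D" and L: "AE p in vol. covector_norm A g D p \<le> L" "L \<ge> 0"
  obtains N where "N \<in> null_sets vol" "geo_lipschitz N L f"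
proof -
  have approx: "\<exists>N\<in>null_sets vol. geo_lipschitz N (L * (1 + \<delta>)\<^sup>2) f" if \<delta>: "\<delta> > 0" for \<delta>
  proof -
    have "\<exists>\<sigma>>0. \<exists>N\<in>null_sets vol. \<forall>x y. d p x < ennreal \<sigma> \<longrightarrow> d p y < ennreal \<sigma> \<longrightarrow>
        x \<notin> N \<longrightarrow> y \<notin> N \<longrightarrow> \<bar>f x - f y\<bar> \<le> (L * (1 + \<delta>)\<^sup>2) * dr x y" for p
    proof -
      obtain c where c: "c \<in> A" "p \<in> fst c" by (rule ex_chart)
      obtain r \<sigma> where r: "r > 0" "\<sigma> > 0" "ball (snd c p) r \<subseteq> chart_image c"
        and cmp: "\<And>u v. u \<in> ball (snd c p) r \<Longrightarrow> v \<in> ball (snd c p) r \<Longrightarrow>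
           ennreal (nrm c p (v - u)) \<le> ennreal (1 + \<delta>) * d (chart_inv c u) (chart_inv c v)"
          "\<And>u v. u \<in> ball (snd c p) r \<Longrightarrow> nrm c (chart_inv c u) v \<le> (1 + \<delta>) * nrm c p v"
          "\<And>q. d p q < ennreal \<sigma> \<Longrightarrow> q \<in> fst c \<and> snd c q \<in> ball (snd c p) r"
        by (rule local_comparison[OF c \<delta>]) (rule that)
      let ?B = "ball (snd c p) r" and ?F = "f \<circ> chart_inv c" and ?G = "D c \<circ> chart_inv c"
      have w: "weak_gradient_on (chart_image c) ?F ?G" using D c(1) by (auto simp: is_weak_differential_def)
      have K: "AE u in lborel. u \<in> ?B \<longrightarrow> \<bar>?G u \<bullet> h\<bar> \<le> L * ((1 + \<delta>) * nrm c p h)" for h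
        using AE_chart[OF c(1) L(1)]
      proof eventually_elim
        case (elim u)
        show ?case
        proof
          assume u: "u \<in> ?B"
          then have uc: "u \<in> chart_image c" using r(3) by blast
          note q = chart_inv_in[OF c(1) uc]
          have "\<bar>?G u \<bullet> h\<bar> \<le> covector_norm A g D (chart_inv c u) * nrm c (chart_inv c u) h"
            using covector_norm_bound[OF D c(1) q] by simp
          also have "\<dots> \<le> L * ((1 + \<delta>) * nrm c p h)"
            using elim uc cmp(2)[OF u, of h] L(2) nrm_nonneg[OF c(1) q] by (intro mult_mono) auto
          finally show "\<bar>?G u \<bullet> h\<bar> \<le> L * ((1 + \<delta>) * nrm c p h)" .
        qed
      qed
      obtain N where N: "N \<in> null_sets lborel" "\<And>u v. u \<in> ?B - N \<Longrightarrow> v \<in> ?B - N \<Longrightarrow>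
          \<bar>?F v - ?F u\<bar> \<le> L * ((1 + \<delta>) * nrm c p (v - u))"
        using weak_gradient_lipschitz[OF open_image[OF c(1)] w r(3) convex_ball open_ball, of "\<lambda>h. L * ((1 + \<delta>) * nrm c p h)"]
          K L(2) \<delta> nrm_nonneg[OF c] by (metis (no_types, lifting) add_nonneg_nonneg less_eq_real_def mult_nonneg_nonneg zero_le_one)
      have "AE u in lborel. u \<notin> N" using N(1) by (rule AE_not_in)
      then have "AE u in lborel. u \<in> chart_image c \<longrightarrow> snd c (chart_inv c u) \<notin> N"
        by eventually_elim (simp add: chart_inv[OF c(1)])
      from AE_chart_inv[OF c(1) this] obtain N' where N': "{q \<in> space vol. \<not> (q \<in> fst c \<longrightarrow> snd c q \<notin> N)} \<subseteq> N'"
        "emeasure vol N' = 0" "N' \<in> sets vol" by (rule AE_E)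
      have "\<bar>f x - f y\<bar> \<le> (L * (1 + \<delta>)\<^sup>2) * dr x y"
        if xy: "d p x < ennreal \<sigma>" "d p y < ennreal \<sigma>" "x \<notin> N'" "y \<notin> N'" for x y
      proof -
        have x: "x \<in> fst c" "snd c x \<in> ?B - N" and y: "y \<in> fst c" "snd c y \<in> ?B - N"
          using cmp(3) xy N'(1) by auto
        have "d x p < top" "d p y < top" using xy(1,2) by (auto simp: geo_sym[of x p] intro: order_less_trans)
        then have fin: "d x y < top" by (rule dr_triangle)
        have "ennreal (nrm c p (snd c x - snd c y)) \<le> ennreal (1 + \<delta>) * d x y"
          using cmp(1)[of "snd c y" "snd c x"] x y by (simp add: inv_chart[OF c(1)] geo_sym[of y x])
        also have "d x y = ennreal (dr x y)" using fin by simp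
        finally have n: "nrm c p (snd c x - snd c y) \<le> (1 + \<delta>) * dr x y"
          using \<delta> by (simp del: ennreal_plus flip: ennreal_mult')
        have "\<bar>f x - f y\<bar> \<le> L * ((1 + \<delta>) * nrm c p (snd c x - snd c y))"
          using N(2)[OF y(2) x(2)] x y by (simp add: inv_chart[OF c(1)])
        also have "\<dots> \<le> L * ((1 + \<delta>) * ((1 + \<delta>) * dr x y))"
          using n L(2) \<delta> by (intro mult_left_mono) auto
        finally show ?thesis by (simp add: power2_eq_square mult.assoc)
      qed
      then show ?thesis using r(2) N' by (intro exI[of _ \<sigma>] conjI bexI[of _ N']) auto
    qed
    from local_to_global_lipschitz[OF _ this] show ?thesis using L(2) by (metis mult_nonneg_nonneg zero_le_power2)
  qed
  have "\<forall>n::nat. \<exists>N\<in>null_sets vol. geo_lipschitz N (L * (1 + 1 / real (Suc n))\<^sup>2) f"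
    using approx by (simp del: of_nat_Suc)
  then obtain N where N: "\<And>n. N n \<in> null_sets vol" "\<And>n::nat. geo_lipschitz (N n) (L * (1 + 1 / real (Suc n))\<^sup>2) f" by metis
  show ?thesis
  proof (rule that[of "\<Union>n. N n"])
    show "(\<Union>n. N n) \<in> null_sets vol" using N(1) by (rule null_sets_UN)
    show "geo_lipschitz (\<Union>n. N n) L f"
      unfolding geo_lipschitz_def
    proof (intro allI impI)
      fix x y assume xy: "x \<notin> (\<Union>n. N n)" "y \<notin> (\<Union>n. N n)" "d x y < top"
      have "(\<lambda>n. 1 / real (Suc n)) \<longlonglongrightarrow> 0" using LIMSEQ_inverse_real_of_nat by (simp add: inverse_eq_divide)
      then have "(\<lambda>n. L * (1 + 1 / real (Suc n))\<^sup>2 * dr x y) \<longlonglongrightarrow> L * (1 + 0)\<^sup>2 * dr x y"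
        by (intro tendsto_intros)
      moreover have "\<bar>f x - f y\<bar> \<le> L * (1 + 1 / real (Suc n))\<^sup>2 * dr x y" for n
        using N(2)[of n] xy by (auto simp: geo_lipschitz_def)
      ultimately have "\<bar>f x - f y\<bar> \<le> L * (1 + 0)\<^sup>2 * dr x y" by (intro LIMSEQ_le_const) auto
      then show "\<bar>f x - f y\<bar> \<le> L * dr x y" by simp
    qed
  qed
qed

end

section \<open>Rademacher's theorem\<close>

text \<open>Integration by parts for difference quotients: translation invariance of Lebesgue
  measure moves the shift from \<psi> to \<open>F\<close>. One side converges by dominated
  convergence, thanks to the Lipschitz bound, the other by differentiating under the
  integral.\<close>

lemma difference_quotient_weak:
  fixes F \<psi> :: "'v::euclidean_space \<Rightarrow> real"
  assumes sm: "smooth_on UNIV \<psi>" and C: "compact C" "\<And>u. u \<notin> C \<Longrightarrow> \<psi> u = 0"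
    and "\<delta> > 0" and int: "\<And>Q. compact Q \<Longrightarrow> Q \<subseteq> (\<Union>u\<in>C. cball u \<delta>) \<Longrightarrow> set_integrable lborel Q F"
    and lip: "\<And>u h. u \<in> C \<Longrightarrow> norm h \<le> \<delta> \<Longrightarrow> \<bar>F (u + h) - F u\<bar> \<le> K * norm h"
    and lim: "AE u in lborel. u \<in> C \<longrightarrow>
       (\<lambda>n. real (Suc n) * (F (u + (1 / real (Suc n)) *\<^sub>R v) - F u)) \<longlonglongrightarrow> H u"
    and H: "(\<lambda>u. indicator C u * H u) \<in> borel_measurable borel"
  shows "(LINT u|lborel. indicator C u * H u * \<psi> u) =
    - (LINT u|lborel. indicator C u * F u * frechet_derivative \<psi> (at u) v)"
proof -
  \<comment> \<open>\<open>C\<close> thickened by \<delta>: it contains every shifted point that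
    occurs, so that \<Phi> is an integral of one fixed integrable function against moving test
    functions.\<close>
  define Q where "Q = (\<lambda>(u, h). u + h) ` (C \<times> cball 0 \<delta>)"
  have Q: "compact Q"
    unfolding Q_def case_prod_unfold
    by (intro compact_continuous_image compact_Times continuous_intros C) auto
  have QU: "Q \<subseteq> (\<Union>u\<in>C. cball u \<delta>)" by (force simp: Q_def dist_norm)
  have CQ: "C \<subseteq> Q" using assms(4) by (force simp: Q_def intro: image_eqI[of _ _ "(u, 0)" for u])
  have intQ: "set_integrable lborel Q F" by (rule int[OF Q QU])
  then have intQ': "integrable lborel (\<lambda>u. indicator Q u * F u)" by (simp add: set_integrable_def)
  then have mQ: "(\<lambda>u. indicator Q u * F u) \<in> borel_measurable borel" by auto
  obtain M where M: "M \<ge> 0" "\<And>u. \<bar>frechet_derivative \<psi> (at u) v\<bar> \<le> M"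
    using test_function_deriv_bounded[OF sm C, of v] by metis
  obtain B0 where B0: "B0 \<ge> 0" "\<And>u. u \<in> C \<Longrightarrow> norm (\<psi> u) \<le> B0"
    by (rule continuous_on_compact_bound[OF C(1) continuous_on_subset[OF smooth_on_UNIV(2)[OF sm] subset_UNIV]]) (rule that)
  have B: "\<bar>\<psi> u\<bar> \<le> B0" for u using B0 C(2)[of u] by (cases "u \<in> C") auto
  have m\<psi>: "\<psi> \<in> borel_measurable borel" "(\<lambda>u. \<psi> (u - w)) \<in> borel_measurable borel" for w
    using smooth_on_UNIV(2)[OF sm]
    by (auto intro!: borel_measurable_continuous_onI continuous_on_compose2[OF smooth_on_UNIV(2)[OF sm]] continuous_intros)
  define \<Phi> where "\<Phi> s = (LINT u|lborel. indicator Q u * F u * \<psi> (u - s *\<^sub>R v))" for s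
  have D: "(\<psi> has_derivative frechet_derivative \<psi> (at u)) (at u)" for u
    using smooth_on_UNIV(1)[OF sm] frechet_derivative_works by blast
  have "(\<Phi> has_real_derivative
      (LINT u|lborel. indicator Q u * F u * (- frechet_derivative \<psi> (at (u - 0 *\<^sub>R v)) v))) (at 0)"
    unfolding \<Phi>_def
  proof (rule DERIV_integral_param[OF intQ', where M = M and B = B0])
    fix s u
    have "((\<lambda>s. \<psi> (u - s *\<^sub>R v)) has_derivative (\<lambda>x. frechet_derivative \<psi> (at (u - s *\<^sub>R v)) (- (x *\<^sub>R v)))) (at s)"
      by (rule has_derivative_compose[of "\<lambda>s. u - s *\<^sub>R v" "\<lambda>x. - (x *\<^sub>R v)" s UNIV \<psi>, OF _ D])
         (auto intro!: derivative_eq_intros)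
    moreover have "frechet_derivative \<psi> (at (u - s *\<^sub>R v)) (- (x *\<^sub>R v)) =
        - frechet_derivative \<psi> (at (u - s *\<^sub>R v)) v * x" for x
    proof -
      have "linear (frechet_derivative \<psi> (at (u - s *\<^sub>R v)))" using D has_derivative_linear by blast
      then show ?thesis using linear_cmul[of "frechet_derivative \<psi> (at (u - s *\<^sub>R v))" "- x" v] by simp
    qed
    then have "(\<lambda>x. frechet_derivative \<psi> (at (u - s *\<^sub>R v)) (- (x *\<^sub>R v))) =
        (*) (- frechet_derivative \<psi> (at (u - s *\<^sub>R v)) v)" by (rule ext)
    ultimately show "((\<lambda>s. \<psi> (u - s *\<^sub>R v)) has_real_derivative - frechet_derivative \<psi> (at (u - s *\<^sub>R v)) v) (at s)"
      by (simp only: has_field_derivative_def)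
    show "\<bar>- frechet_derivative \<psi> (at (u - s *\<^sub>R v)) v\<bar> \<le> M" using M by simp
    show "\<bar>\<psi> (u - s *\<^sub>R v)\<bar> \<le> B0" by (rule B)
    show "(\<lambda>u. \<psi> (u - s *\<^sub>R v)) \<in> borel_measurable borel" by (rule m\<psi>)
    show "(\<lambda>u. - frechet_derivative \<psi> (at (u - s *\<^sub>R v)) v) \<in> borel_measurable borel"
      by (intro borel_measurable_continuous_onI continuous_on_minus
          continuous_on_compose2[OF smooth_on_UNIV(3)[OF sm, of v]] continuous_intros) auto
  qed
  moreover have "(LINT u|lborel. indicator Q u * F u * (- frechet_derivative \<psi> (at (u - 0 *\<^sub>R v)) v)) =
     - (LINT u|lborel. indicator C u * F u * frechet_derivative \<psi> (at u) v)"
    unfolding Bochner_Integration.integral_minus[symmetric]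
    using CQ test_function_deriv_outside[where \<psi>=\<psi> and h=v, OF C]
    by (intro Bochner_Integration.integral_cong) (auto simp: indicator_def)
  ultimately have DER: "((\<lambda>s. (\<Phi> s - \<Phi> 0) / s) \<longlongrightarrow>
     - (LINT u|lborel. indicator C u * F u * frechet_derivative \<psi> (at u) v)) (at 0)"
    by (simp add: has_field_derivative_iff)
  have seq: "(\<lambda>n. (\<Phi> (1 / real (Suc n)) - \<Phi> 0) / (1 / real (Suc n))) \<longlonglongrightarrow>
     - (LINT u|lborel. indicator C u * F u * frechet_derivative \<psi> (at u) v)"
    using DER[unfolded tendsto_at_iff_sequentially, rule_format, of "\<lambda>n. 1 / real (Suc n)"] LIMSEQ_inverse_real_of_nat
    by (simp add: o_def inverse_eq_divide del: of_nat_Suc)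
  have zero: "(\<lambda>n. 1 / real (Suc n) * norm v) \<longlonglongrightarrow> 0"
    using tendsto_mult[OF LIMSEQ_inverse_real_of_nat tendsto_const[of "norm v"]] by (simp add: inverse_eq_divide)
  \<comment> \<open>The first terms of the sequence are dropped so that all shifts stay below
    \<delta>.\<close>
  obtain n0 where n0: "\<And>n. n \<ge> n0 \<Longrightarrow> 1 / real (Suc n) * norm v < \<delta>"
    using order_tendstoD(2)[OF zero \<open>\<delta> > 0\<close>] by (auto simp: eventually_sequentially)
  have intC: "set_integrable lborel C F" by (rule int[OF C(1)]) (use \<open>\<delta> > 0\<close> in force)
  have key: "(\<Phi> s - \<Phi> 0) / s = (LINT u|lborel. indicator C u * ((F (u + s *\<^sub>R v) - F u) / s) * \<psi> u)"
    "(\<lambda>u. indicator C u * ((F (u + s *\<^sub>R v) - F u) / s) * \<psi> u) \<in> borel_measurable borel"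
    if s: "norm (s *\<^sub>R v) \<le> \<delta>" for s
  proof -
    have eq: "indicator Q (u + s *\<^sub>R v) * F (u + s *\<^sub>R v) * \<psi> u = indicator C u * F (u + s *\<^sub>R v) * \<psi> u" for u
    proof (cases "u \<in> C")
      case True
      then have "u + s *\<^sub>R v \<in> Q" using s by (auto simp: Q_def intro!: image_eqI[of _ _ "(u, s *\<^sub>R v)"])
      then show ?thesis using True by simp
    qed (simp add: C(2))
    have i1: "integrable lborel (\<lambda>u. indicator Q u * F u * \<psi> (u - s *\<^sub>R v))"
      by (rule set_integrable_mult_bounded[OF intQ m\<psi>(2) B])
    have tr: "\<Phi> s = (LINT u|lborel. indicator C u * F (u + s *\<^sub>R v) * \<psi> u)"
      "integrable lborel (\<lambda>u. indicator C u * F (u + s *\<^sub>R v) * \<psi> u)"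
    proof -
      have "\<Phi> s = (LINT u|lborel. indicator Q (s *\<^sub>R v + u) * F (s *\<^sub>R v + u) * \<psi> ((s *\<^sub>R v + u) - s *\<^sub>R v))"
        unfolding \<Phi>_def
        by (subst lborel_distr_plus[of "s *\<^sub>R v", symmetric], subst integral_distr) (use i1 in auto)
      then show "\<Phi> s = (LINT u|lborel. indicator C u * F (u + s *\<^sub>R v) * \<psi> u)"
        using eq by (simp add: add.commute)
      have "integrable (distr lborel borel ((+) (s *\<^sub>R v))) (\<lambda>u. indicator Q u * F u * \<psi> (u - s *\<^sub>R v))"
        using i1 by (simp add: lborel_distr_plus)
      then have "integrable lborel (\<lambda>u. indicator Q (s *\<^sub>R v + u) * F (s *\<^sub>R v + u) * \<psi> ((s *\<^sub>R v + u) - s *\<^sub>R v))"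
        by (subst (asm) integrable_distr_eq) (use i1 in auto)
      then show "integrable lborel (\<lambda>u. indicator C u * F (u + s *\<^sub>R v) * \<psi> u)"
        using eq by (simp add: add.commute)
    qed
    have i0: "integrable lborel (\<lambda>u. indicator C u * F u * \<psi> u)"
      by (rule set_integrable_mult_bounded[OF intC m\<psi>(1) B])
    have "\<Phi> 0 = (LINT u|lborel. indicator C u * F u * \<psi> u)"
      unfolding \<Phi>_def using C(2) CQ
      by (intro Bochner_Integration.integral_cong) (auto simp: indicator_def)
    then have d: "\<Phi> s - \<Phi> 0 = (LINT u|lborel. indicator C u * F (u + s *\<^sub>R v) * \<psi> u - indicator C u * F u * \<psi> u)"
      unfolding tr(1) by (simp add: Bochner_Integration.integral_diff[OF tr(2) i0])
    have e: "(indicator C u * F (u + s *\<^sub>R v) * \<psi> u - indicator C u * F u * \<psi> u) / s =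
        indicator C u * ((F (u + s *\<^sub>R v) - F u) / s) * \<psi> u" for u
      by (simp add: algebra_simps diff_divide_distrib)
    show "(\<Phi> s - \<Phi> 0) / s = (LINT u|lborel. indicator C u * ((F (u + s *\<^sub>R v) - F u) / s) * \<psi> u)"
      unfolding e[symmetric] integral_divide_zero d ..
    have "(\<lambda>u. (indicator C u * F (u + s *\<^sub>R v) * \<psi> u - indicator C u * F u * \<psi> u) / s) \<in> borel_measurable borel"
      using tr(2) i0 by (intro borel_measurable_divide borel_measurable_diff) auto
    then show "(\<lambda>u. indicator C u * ((F (u + s *\<^sub>R v) - F u) / s) * \<psi> u) \<in> borel_measurable borel"
      unfolding e .
  qed
  have sn: "norm ((1 / real (Suc (n + n0))) *\<^sub>R v) \<le> \<delta>" for n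
    using n0[of "n + n0"] by (simp del: of_nat_Suc)
  have "(\<lambda>n. LINT u|lborel. indicator C u * ((F (u + (1 / real (Suc (n + n0))) *\<^sub>R v) - F u) / (1 / real (Suc (n + n0)))) * \<psi> u)
     \<longlonglongrightarrow> (LINT u|lborel. indicator C u * H u * \<psi> u)"
  proof (rule integral_dominated_convergence)
    show "(\<lambda>u. indicator C u * H u * \<psi> u) \<in> borel_measurable lborel" using H m\<psi>(1) by simp
    show "(\<lambda>u. indicator C u * ((F (u + (1 / real (Suc (n + n0))) *\<^sub>R v) - F u) / (1 / real (Suc (n + n0)))) * \<psi> u)
      \<in> borel_measurable lborel" for n using key(2)[OF sn] by simp
    show "integrable lborel (\<lambda>u. \<bar>K\<bar> * norm v * B0 * indicator C u)"
      using emeasure_compact_finite[OF C(1)] compact_imp_closed[OF C(1)]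
      by (intro integrable_mult_right integrable_real_indicator) simp_all
    show "AE u in lborel. (\<lambda>n. indicator C u * ((F (u + (1 / real (Suc (n + n0))) *\<^sub>R v) - F u) / (1 / real (Suc (n + n0)))) * \<psi> u)
       \<longlonglongrightarrow> indicator C u * H u * \<psi> u"
      using lim
    proof eventually_elim
      case (elim u)
      show ?case
      proof (cases "u \<in> C")
        case True
        from LIMSEQ_ignore_initial_segment[OF elim[rule_format, OF True], of n0]
        show ?thesis by (intro tendsto_mult_right tendsto_mult_left) (simp add: divide_inverse mult.commute del: of_nat_Suc)
      qed simp
    qed
    fix n
    show "AE u in lborel. norm (indicator C u * ((F (u + (1 / real (Suc (n + n0))) *\<^sub>R v) - F u) / (1 / real (Suc (n + n0)))) * \<psi> u)
        \<le> \<bar>K\<bar> * norm v * B0 * indicator C u"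
    proof (rule AE_I2)
      fix u
      show "norm (indicator C u * ((F (u + (1 / real (Suc (n + n0))) *\<^sub>R v) - F u) / (1 / real (Suc (n + n0)))) * \<psi> u)
        \<le> \<bar>K\<bar> * norm v * B0 * indicator C u"
      proof (cases "u \<in> C")
        case True
        define s where "s = 1 / real (Suc (n + n0))"
        have s: "s > 0" "norm (s *\<^sub>R v) \<le> \<delta>" using sn[of n] by (simp_all add: s_def del: of_nat_Suc)
        have "\<bar>F (u + s *\<^sub>R v) - F u\<bar> \<le> K * norm (s *\<^sub>R v)" by (rule lip[OF True s(2)])
        also have "\<dots> \<le> \<bar>K\<bar> * norm v * s" using s mult_right_mono[OF abs_ge_self, of "norm v * s" K]
          by (simp add: mult.assoc mult.commute[of s])
        finally have "\<bar>(F (u + s *\<^sub>R v) - F u) / s\<bar> \<le> \<bar>K\<bar> * norm v" using s by (simp add: abs_divide pos_divide_le_eq)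
        then have "\<bar>(F (u + s *\<^sub>R v) - F u) / s\<bar> * \<bar>\<psi> u\<bar> \<le> (\<bar>K\<bar> * norm v) * B0"
          using B by (intro mult_mono) auto
        then show ?thesis unfolding s_def[symmetric] using True by (simp add: abs_mult)
      qed simp
    qed
  qed
  moreover have "(\<lambda>n. LINT u|lborel. indicator C u * ((F (u + (1 / real (Suc (n + n0))) *\<^sub>R v) - F u) / (1 / real (Suc (n + n0)))) * \<psi> u)
    \<longlonglongrightarrow> - (LINT u|lborel. indicator C u * F u * frechet_derivative \<psi> (at u) v)"
    unfolding key(1)[OF sn, symmetric] by (rule LIMSEQ_ignore_initial_segment[OF seq])
  ultimately show ?thesis by (rule LIMSEQ_unique)
qed

text \<open>Adding \<open>2 L t\<close> makes \<open>\<phi>\<close> an increasing bi-Lipschitz function, whose measure has a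
  Radon-Nikodym density to which the Lebesgue differentiation theorem applies. Limits along \<open>1/n\<close>
  suffice for Lipschitz functions.\<close>

lemma lipschitz_right_derivative_AE:
  fixes \<phi> :: "real \<Rightarrow> real"
  assumes lip: "\<And>s t. \<bar>\<phi> s - \<phi> t\<bar> \<le> K * \<bar>s - t\<bar>"
  shows "AE t in lborel. convergent (\<lambda>n. real (Suc n) * (\<phi> (t + 1 / real (Suc n)) - \<phi> t))"
proof -
  define L where "L = K + 1"
  have K0: "K \<ge> 0" using lip[of 1 0] by simp
  then have L: "L > 0" "K \<le> L" by (auto simp: L_def)
  define h where "h t = \<phi> t + 2 * L * t" for t
  have h: "L * (t - s) \<le> h t - h s" "h t - h s \<le> 3 * L * (t - s)" if "s \<le> t" for s t
  proof -
    have "\<bar>\<phi> t - \<phi> s\<bar> \<le> L * (t - s)"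
      using lip[of t s] that L(2) mult_right_mono[of K L "t - s"] by simp
    then show "L * (t - s) \<le> h t - h s" "h t - h s \<le> 3 * L * (t - s)"
      by (auto simp: h_def abs_le_iff algebra_simps)
  qed
  have less: "h s < h t" if "s < t" for s t
  proof -
    have "0 < L * (t - s)" using L that by simp
    then show ?thesis using h(1)[of s t] that by linarith
  qed
  have le_iff: "h s \<le> h t \<longleftrightarrow> s \<le> t" and less_iff: "h s < h t \<longleftrightarrow> s < t" for s t
    using less[of s t] less[of t s] by (cases s t rule: linorder_cases; auto)+
  have hlip: "\<bar>h s - h t\<bar> \<le> 3 * L * \<bar>s - t\<bar>" for s t
    using h[of s t] h[of t s] L by (cases "s \<le> t") (auto simp: abs_if)
  have cont: "continuous_on UNIV h"
    by (rule lipschitz_on_continuous_on[of "3 * L"], rule lipschitz_onI) (use hlip L in \<open>auto simp: dist_real_def\<close>)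
  have surj: "\<exists>t. h t = y" for y
  proof -
    define m where "m = \<bar>y - h 0\<bar> / L"
    have m: "m \<ge> 0" "L * m = \<bar>y - h 0\<bar>" using L by (auto simp: m_def)
    have "h (- m) \<le> y" "y \<le> h m" using h(1)[of "-m" 0] h(1)[of 0 m] m by (auto simp: abs_if split: if_splits)
    then have "\<exists>t. - m \<le> t \<and> t \<le> m \<and> h t = y"
      by (intro IVT') (use m in \<open>auto intro: continuous_on_subset[OF cont]\<close>)
    then show ?thesis by blast
  qed
  define k where "k = inv h"
  have hk: "h (k y) = y" for y unfolding k_def using surj by (metis f_inv_into_f rangeI)
  have kh: "k (h t) = t" for t
    using le_iff[of "k (h t)" t] le_iff[of t "k (h t)"] hk[of "h t"] by simp
  have kmono: "mono k"
  proof (rule monoI)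
    show "k x \<le> k y" if "x \<le> y" for x y using le_iff[of "k x" "k y"] that by (simp add: hk)
  qed
  have [measurable]: "k \<in> borel_measurable borel" by (rule borel_measurable_mono[OF kmono])
  \<comment> \<open>Pushing Lebesgue measure forward along the inverse of \<open>h\<close> assigns
    to a set the Lebesgue measure of its image under \<open>h\<close>; a half-open interval gets the
    increment of \<open>h\<close>.\<close>
  define \<mu> where "\<mu> = distr lborel borel k"
  have vim: "k -` B = h ` B" for B
  proof (intro set_eqI iffI)
    show "y \<in> h ` B" if "y \<in> k -` B" for y using that hk[of y] by (intro image_eqI[of y h "k y"]) auto
    show "y \<in> k -` B" if "y \<in> h ` B" for y using that by (auto simp: kh)
  qed
  have \<mu>_int: "emeasure \<mu> {a<..b} = ennreal (h b - h a)" if "a \<le> b" for a b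
  proof -
    have "y \<in> k -` {a<..b} \<longleftrightarrow> y \<in> {h a<..h b}" for y
      using less_iff[of a "k y"] le_iff[of "k y" b] by (simp add: hk)
    then have "k -` {a<..b} = {h a<..h b}" by blast
    then show ?thesis using le_iff[of a b] that by (simp add: \<mu>_def emeasure_distr)
  qed
  \<comment> \<open>A Lipschitz map sends null sets to null sets, and \<mu> measures images under
    \<open>h\<close>.\<close>
  have "absolutely_continuous lborel \<mu>"
    unfolding absolutely_continuous_def
  proof
    fix N :: "real set" assume N: "N \<in> null_sets lborel"
    then have "negligible N" by (auto simp: negligible_iff_null_sets intro: null_sets_completionI)
    then have "negligible (h ` N)"
      by (rule negligible_locally_Lipschitz_image[OF order_refl])
         (use hlip in \<open>auto intro!: exI[of _ UNIV] exI[of _ "3 * L"]\<close>)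
    moreover have "h ` N \<in> sets borel" unfolding vim[symmetric]
      using measurable_sets[OF \<open>k \<in> borel_measurable borel\<close>, of N] N by auto
    ultimately have "emeasure lborel (k -` N) = 0"
      unfolding vim by (simp add: negligible_iff_null_sets null_sets_completion_iff null_sets_def)
    then show "N \<in> null_sets \<mu>" using N by (auto simp: null_sets_def \<mu>_def emeasure_distr)
  qed
  then obtain f where f: "f \<in> borel_measurable lborel" "density lborel f = \<mu>"
    using sigma_finite_measure.Radon_Nikodym[OF sigma_finite_lborel, of \<mu>] by (auto simp: \<mu>_def)
  note f(1)[measurable]
  have f_int: "(\<integral>\<^sup>+ t\<in>{a<..b}. f t \<partial>lborel) = ennreal (h b - h a)" if "a \<le> b" for a b
  proof -
    have "emeasure (density lborel f) {a<..b} = (\<integral>\<^sup>+ t\<in>{a<..b}. f t \<partial>lborel)"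
      by (rule emeasure_density[OF f(1)]) simp
    then show ?thesis using \<mu>_int[OF that] f(2) by simp
  qed
  have f_fin: "AE t in lborel. f t \<noteq> top"
  proof -
    have "AE t in lborel. f t * indicator {- real n<..real n} t \<noteq> \<infinity>" for n
      by (rule nn_integral_PInf_AE) (use f_int[of "- real n" "real n"] in auto)
    then have "AE t in lborel. \<forall>n. f t * indicator {- real n<..real n} t \<noteq> \<infinity>" by (simp add: AE_all_countable)
    then show ?thesis
    proof eventually_elim
      case (elim t)
      obtain n where "real n > \<bar>t\<bar>" using reals_Archimedean2 by blast
      then have "t \<in> {- real n<..real n}" by (simp add: abs_less_iff less_imp_le minus_less_iff)
      then show ?case using elim[rule_format, of n] by auto
    qed
  qed
  define G where "G t = enn2real (f t)" for t
  have [measurable]: "G \<in> borel_measurable borel" unfolding G_def by measurable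
  have G: "set_integrable lborel {a..b} G" "integral {a..b} G = h b - h a" if ab: "a \<le> b" for a b
  proof -
    have n: "(\<integral>\<^sup>+ t. ennreal (indicator {a..b} t *\<^sub>R G t) \<partial>lborel) = ennreal (h b - h a)"
    proof -
      have "(\<integral>\<^sup>+ t. ennreal (indicator {a..b} t *\<^sub>R G t) \<partial>lborel) = (\<integral>\<^sup>+ t\<in>{a<..b}. f t \<partial>lborel)"
        by (rule nn_integral_cong_AE, use f_fin AE_lborel_singleton[of a] in eventually_elim)
           (auto simp: indicator_def G_def less_top)
      then show ?thesis using f_int[OF ab] by simp
    qed
    have nn: "G t \<ge> 0" for t by (simp add: G_def)
    show i: "set_integrable lborel {a..b} G"
      unfolding set_integrable_def by (rule integrableI_nonneg) (use n nn in auto)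
    have "ennreal (LINT t:{a..b}|lborel. G t) = ennreal (h b - h a)"
      unfolding n[symmetric] set_lebesgue_integral_def
      by (rule nn_integral_eq_integral[symmetric]) (use i nn in \<open>auto simp: set_integrable_def\<close>)
    moreover have "(LINT t:{a..b}|lborel. G t) \<ge> 0"
      unfolding set_lebesgue_integral_def using nn by (intro Bochner_Integration.integral_nonneg) auto
    ultimately show "integral {a..b} G = h b - h a"
      using set_borel_integral_eq_integral(2)[OF i] le_iff[of a b] ab by simp
  qed
  have "G integrable_on cbox a b" for a b
    by (cases "a \<le> b") (use set_borel_integral_eq_integral(1)[OF G(1)] in auto)
  then obtain N where N: "negligible N"
      "\<And>x e. x \<notin> N \<Longrightarrow> 0 < e \<Longrightarrow> \<exists>d>0. \<forall>h. 0 < h \<and> h < d \<longrightarrow>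
        norm (integral (cbox x (x + h *\<^sub>R One)) G /\<^sub>R h ^ DIM(real) - G x) < e"
    by (rule integrable_ccontinuous_explicit) (rule that)
  have "AE t in completion lborel. t \<notin> N" by (rule AE_not_in) (use N(1) in \<open>simp add: negligible_iff_null_sets\<close>)
  then have "AE t in lborel. t \<notin> N" by (simp add: AE_completion_iff)
  then show ?thesis
  proof eventually_elim
    case (elim t)
    have "(\<lambda>n. real (Suc n) * (\<phi> (t + 1 / real (Suc n)) - \<phi> t)) \<longlonglongrightarrow> G t - 2 * L"
    proof (rule LIMSEQ_I)
      fix e :: real assume "e > 0"
      from N(2)[OF elim this] obtain d where d: "d > 0"
        "\<And>\<tau>. 0 < \<tau> \<Longrightarrow> \<tau> < d \<Longrightarrow> norm (integral (cbox t (t + \<tau> *\<^sub>R One)) G /\<^sub>R \<tau> ^ DIM(real) - G t) < e" by blast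
      obtain n0 where n0: "inverse (real (Suc n0)) < d" using reals_Archimedean[OF d(1)] by blast
      have "norm (real (Suc n) * (\<phi> (t + 1 / real (Suc n)) - \<phi> t) - (G t - 2 * L)) < e" if n: "n \<ge> n0" for n
      proof -
        define \<tau> where "\<tau> = 1 / real (Suc n)"
        have "\<tau> \<le> inverse (real (Suc n0))" unfolding \<tau>_def inverse_eq_divide using n by (intro divide_left_mono) auto
        then have \<tau>: "0 < \<tau>" "\<tau> < d" "real (Suc n) = 1 / \<tau>" using n0 by (auto simp: \<tau>_def)
        have "integral (cbox t (t + \<tau> *\<^sub>R One)) G = h (t + \<tau>) - h t" using G(2)[of t "t + \<tau>"] \<tau>(1) by simp
        then have "integral (cbox t (t + \<tau> *\<^sub>R One)) G /\<^sub>R \<tau> ^ DIM(real) = (\<phi> (t + \<tau>) - \<phi> t) / \<tau> + 2 * L"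
          using \<tau>(1) by (simp add: h_def field_simps)
        then show ?thesis using d(2)[OF \<tau>(1,2)] unfolding \<tau>_def[symmetric] \<tau>(3) by (simp add: algebra_simps diff_divide_distrib)
      qed
      then show "\<exists>no. \<forall>n\<ge>no. norm (real (Suc n) * (\<phi> (t + 1 / real (Suc n)) - \<phi> t) - (G t - 2 * L)) < e" by blast
    qed
    then show ?case by (rule convergentI)
  qed
qed

lemma lipschitz_imp_continuous:
  fixes F :: "'v::real_normed_vector \<Rightarrow> real"
  assumes "\<And>u w. u \<in> S \<Longrightarrow> w \<in> S \<Longrightarrow> \<bar>F u - F w\<bar> \<le> K * norm (u - w)"
  shows "continuous_on S F"
proof -
  have "(max K 0)-lipschitz_on S F"
  proof (rule lipschitz_onI)
    fix x y assume "x \<in> S" "y \<in> S"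
    then have "\<bar>F x - F y\<bar> \<le> K * norm (x - y)" by (rule assms)
    also have "\<dots> \<le> max K 0 * norm (x - y)" by (intro mult_right_mono) auto
    finally show "dist (F x) (F y) \<le> max K 0 * dist x y" by (simp add: dist_norm)
  qed simp
  then show ?thesis by (rule lipschitz_on_continuous_on)
qed

text \<open>On every line parallel to \<open>v\<close> the one-dimensional result applies. Instead
  of coordinates adapted to \<open>v\<close>, Fubini is applied to the pairs (t, u): integrating
  over t first gives 0, integrating over u first gives the measure of the bad set for each t in
  {0..1} by translation invariance.\<close>

lemma directional_quotient_AE:
  fixes F :: "'v::euclidean_space \<Rightarrow> real"
  assumes lip: "\<And>u w. \<bar>F u - F w\<bar> \<le> K * norm (u - w)"
  shows "AE u in lborel. convergent (\<lambda>n. real (Suc n) * (F (u + (1 / real (Suc n)) *\<^sub>R v) - F u))"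
proof -
  have cont: "continuous_on UNIV F" by (rule lipschitz_imp_continuous[of UNIV F K]) (use lip in auto)
  define q where "q n u = real (Suc n) * (F (u + (1 / real (Suc n)) *\<^sub>R v) - F u)" for n u
  have [measurable]: "q n \<in> borel_measurable borel" for n
    unfolding q_def
    by (intro borel_measurable_continuous_onI continuous_intros continuous_on_compose2[OF cont]) auto
  define E where "E = {u. \<not> Cauchy (\<lambda>n. q n u)}"
  have E[measurable]: "E \<in> sets borel"
  proof -
    have "{u \<in> space borel. Cauchy (\<lambda>n. q n u)} \<in> sets borel" by measurable
    then have "space borel - {u \<in> space borel. Cauchy (\<lambda>n. q n u)} \<in> sets borel" by (rule sets.compl_sets)
    then show ?thesis by (simp add: E_def set_diff_eq)
  qed
  have line: "AE t in lborel. u + t *\<^sub>R v \<notin> E" for u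
  proof -
    have "AE t in lborel. convergent (\<lambda>n. real (Suc n) * (F (u + (t + 1 / real (Suc n)) *\<^sub>R v) - F (u + t *\<^sub>R v)))"
    proof (rule lipschitz_right_derivative_AE)
      fix s t
      have "\<bar>F (u + s *\<^sub>R v) - F (u + t *\<^sub>R v)\<bar> \<le> K * norm ((u + s *\<^sub>R v) - (u + t *\<^sub>R v))" by (rule lip)
      also have "(u + s *\<^sub>R v) - (u + t *\<^sub>R v) = (s - t) *\<^sub>R v" by (simp add: algebra_simps)
      finally show "\<bar>F (u + s *\<^sub>R v) - F (u + t *\<^sub>R v)\<bar> \<le> K * norm v * \<bar>s - t\<bar>" by (simp add: mult_ac)
    qed
    then show ?thesis
    proof eventually_elim
      case (elim t)
      then have "convergent (\<lambda>n. q n (u + t *\<^sub>R v))" by (simp add: q_def scaleR_left_distrib add.assoc)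
      then show ?case by (simp add: E_def Cauchy_convergent_iff)
    qed
  qed
  have m: "(\<lambda>(t, u). indicator {0..1} t * indicator E (u + t *\<^sub>R v) :: ennreal) \<in> borel_measurable (lborel \<Otimes>\<^sub>M lborel)"
  proof -
    have "(\<lambda>x. snd x + fst x *\<^sub>R v) \<in> borel_measurable ((borel :: real measure) \<Otimes>\<^sub>M (borel :: 'v measure))"
      unfolding borel_prod by (intro borel_measurable_continuous_onI continuous_intros)
    then have "(\<lambda>x. indicator {0..1} (fst x) * indicator E (snd x + fst x *\<^sub>R v) :: ennreal) \<in> borel_measurable ((borel :: real measure) \<Otimes>\<^sub>M (borel :: 'v measure))"
      using E by measurable
    then show ?thesis by (simp add: case_prod_unfold)
  qed
  have "(\<integral>\<^sup>+ t. (\<integral>\<^sup>+ u. indicator {0..1} t * indicator E (u + t *\<^sub>R v) \<partial>lborel) \<partial>lborel) =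
    (\<integral>\<^sup>+ u. (\<integral>\<^sup>+ t. indicator {0..1} t * indicator E (u + t *\<^sub>R v) \<partial>lborel) \<partial>(lborel :: 'v measure))"
    using pair_sigma_finite.Fubini'[OF pair_sigma_finite.intro[OF sigma_finite_lborel sigma_finite_lborel] m] by simp
  also have "\<dots> = (\<integral>\<^sup>+ u. (\<integral>\<^sup>+ t. (0::ennreal) \<partial>(lborel :: real measure)) \<partial>(lborel :: 'v measure))"
  proof (rule nn_integral_cong)
    show "(\<integral>\<^sup>+ t. indicator {0..1} t * indicator E (u + t *\<^sub>R v) \<partial>lborel) = (\<integral>\<^sup>+ t. (0::ennreal) \<partial>(lborel :: real measure))" for u
      by (rule nn_integral_cong_AE, use line[of u] in eventually_elim) auto
  qed
  finally have zero: "(\<integral>\<^sup>+ t. (\<integral>\<^sup>+ u. indicator {0..1} t * indicator E (u + t *\<^sub>R v) \<partial>lborel) \<partial>lborel) = 0" by simp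
  have "(\<integral>\<^sup>+ u. indicator E (u + t *\<^sub>R v) \<partial>lborel) = emeasure lborel E" for t
  proof -
    have "emeasure lborel E = (\<integral>\<^sup>+ u. indicator E u \<partial>distr lborel borel ((+) (t *\<^sub>R v)))"
      by (simp add: lborel_distr_plus)
    also have "\<dots> = (\<integral>\<^sup>+ u. indicator E (u + t *\<^sub>R v) \<partial>lborel)"
      by (subst nn_integral_distr) (auto simp: add.commute)
    finally show ?thesis by simp
  qed
  then have "(\<integral>\<^sup>+ t. (\<integral>\<^sup>+ u. indicator {0..1} t * indicator E (u + t *\<^sub>R v) \<partial>lborel) \<partial>lborel) =
     (\<integral>\<^sup>+ t. emeasure lborel E * indicator {0..1::real} t \<partial>lborel)"
    by (intro nn_integral_cong) (auto simp: indicator_def)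
  also have "\<dots> = emeasure lborel E" by (simp add: nn_integral_cmult_indicator)
  finally have "emeasure lborel E = 0" using zero by simp
  then have "AE u in lborel. u \<notin> E" using E by (intro AE_not_in) (auto simp: null_sets_def)
  then show ?thesis unfolding q_def[symmetric] by eventually_elim (simp add: E_def Cauchy_convergent_iff)
qed

text \<open>The Lipschitz bound makes all difference quotients equicontinuous in the direction.
  Hence finitely many directions from \<open>V\<close> control the whole unit sphere, and the step
  sizes 1/n control all small step sizes.\<close>

lemma derivative_from_directions:
  fixes F :: "'v::euclidean_space \<Rightarrow> real"
  assumes lip: "\<And>u w. \<bar>F u - F w\<bar> \<le> K * norm (u - w)"
    and V: "\<And>U. open U \<Longrightarrow> U \<noteq> {} \<Longrightarrow> \<exists>v\<in>V. v \<in> U"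
    and lim: "\<And>v. v \<in> V \<Longrightarrow> (\<lambda>n. real (Suc n) * (F (u + (1 / real (Suc n)) *\<^sub>R v) - F u)) \<longlonglongrightarrow> G \<bullet> v"
  shows "(F has_derivative (\<lambda>h. G \<bullet> h)) (at u)"
  unfolding has_derivative_at_alt
proof (intro conjI allI impI)
  show "bounded_linear (\<lambda>h. G \<bullet> h)" by (rule bounded_linear_inner_right)
  fix e :: real assume "e > 0"
  have K: "K \<ge> 0"
  proof -
    obtain b :: 'v where "b \<in> Basis" using nonempty_Basis by blast
    then have "0 \<le> K * 1" using lip[of b 0] abs_ge_zero order_trans by (metis diff_zero norm_Basis)
    then show ?thesis by simp
  qed
  define M where "M = K + norm G"
  \<comment> \<open>The final error is at most \<open>t * \<epsilon> * (2 + 5 * M)\<close>: the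
    quotient along \<open>v\<close> contributes \<open>s * \<epsilon>\<close> with
    \<open>s \<le> 2 * t\<close>, and replacing the increment by \<open>s *\<^sub>R v\<close>
    contributes \<open>M\<close> times at most \<open>5 * t * \<epsilon>\<close>.\<close>
  define \<epsilon> where "\<epsilon> = min 1 (e / (2 + 5 * M))"
  have M: "M \<ge> 0" using K by (simp add: M_def)
  have \<epsilon>: "\<epsilon> > 0" "\<epsilon> \<le> 1" "\<epsilon> * (2 + 5 * M) \<le> e"
  proof -
    have "0 < 2 + 5 * M" using M by simp
    then show "\<epsilon> > 0" "\<epsilon> \<le> 1" using \<open>e > 0\<close> by (auto simp: \<epsilon>_def)
    have "\<epsilon> \<le> e / (2 + 5 * M)" by (simp add: \<epsilon>_def)
    then show "\<epsilon> * (2 + 5 * M) \<le> e" using \<open>0 < 2 + 5 * M\<close> by (simp only: pos_le_divide_eq)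
  qed
  have "sphere 0 1 \<subseteq> (\<Union>v\<in>V. ball v \<epsilon>)"
  proof
    fix w :: 'v
    obtain v where "v \<in> V" "v \<in> ball w \<epsilon>" using V[OF open_ball, of w \<epsilon>] \<epsilon>(1) by auto
    then show "w \<in> (\<Union>v\<in>V. ball v \<epsilon>)" by (auto simp: dist_commute)
  qed
  then obtain W where W: "W \<subseteq> V" "finite W" "sphere 0 1 \<subseteq> (\<Union>v\<in>W. ball v \<epsilon>)"
    by (rule compactE_image[OF compact_sphere, rotated]) auto
  have "\<forall>v\<in>W. \<exists>n0. \<forall>n\<ge>n0. \<bar>real (Suc n) * (F (u + (1 / real (Suc n)) *\<^sub>R v) - F u) - G \<bullet> v\<bar> < \<epsilon>"
    using lim W(1) \<epsilon>(1) by (auto simp: LIMSEQ_iff subset_iff)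
  then obtain n0 where n0: "\<And>v n. v \<in> W \<Longrightarrow> n \<ge> n0 v \<Longrightarrow>
     \<bar>real (Suc n) * (F (u + (1 / real (Suc n)) *\<^sub>R v) - F u) - G \<bullet> v\<bar> < \<epsilon>" by metis
  obtain n1 where n1: "inverse (real (Suc n1)) < \<epsilon>" using reals_Archimedean[OF \<epsilon>(1)] by blast
  define N where "N = Max (insert n1 (n0 ` W))"
  have N: "n1 \<le> N" "\<And>v. v \<in> W \<Longrightarrow> n0 v \<le> N" using W(2) by (auto simp: N_def)
  show "\<exists>r>0. \<forall>y. norm (y - u) < r \<longrightarrow> norm (F y - F u - G \<bullet> (y - u)) \<le> e * norm (y - u)"
  proof (intro exI[of _ "1 / real (Suc N)"] conjI allI impI)
    fix y assume y: "norm (y - u) < 1 / real (Suc N)"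
    show "norm (F y - F u - G \<bullet> (y - u)) \<le> e * norm (y - u)"
    proof (cases "y = u")
      case False
      define t where "t = norm (y - u)"
      have t: "t > 0" "t < 1 / real (Suc N)" using y False by (auto simp: t_def)
      \<comment> \<open>The step size \<open>t\<close> is replaced by the next reciprocal
        \<open>s = 1 / m\<close> above it; then \<open>s - t \<le> t * s\<close>, a relative error
        as small as \<open>s\<close>.\<close>
      define m where "m = nat \<lfloor>1 / t\<rfloor>"
      have "real (Suc N) < 1 / t" using t by (simp add: field_simps del: of_nat_Suc)
      have "0 \<le> 1 / t" using t by simp
      then have rm: "real m = of_int \<lfloor>1 / t\<rfloor>" by (simp add: m_def)
      have m: "real m \<le> 1 / t" "1 / t < real m + 1" using floor_correct[of "1 / t"] unfolding rm by auto
      have "Suc N \<le> m" using m(2) \<open>real (Suc N) < 1 / t\<close> by linarith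
      then obtain n where n: "m = Suc n" "N \<le> n" by (metis Suc_le_D Suc_le_mono)
      define s where "s = 1 / real (Suc n)"
      have s: "s > 0" "t \<le> s" using m(1) t n by (auto simp: s_def field_simps)
      have rs: "real (Suc n) = 1 / s" by (simp add: s_def)
      have "1 / t < 1 / s + 1" using m(2) unfolding n(1) rs .
      then have ts: "s - t \<le> t * s" using t(1) s(1) by (simp add: field_simps)
      have "s \<le> inverse (real (Suc n1))"
        unfolding s_def inverse_eq_divide using N(1) n(2) by (intro divide_left_mono) auto
      then have s\<epsilon>: "s < \<epsilon>" using n1 by linarith
      have s2: "s \<le> 2 * t"
      proof -
        have "t * s \<le> t * 1" using t s\<epsilon> \<epsilon>(2) by (intro mult_left_mono) auto
        then show ?thesis using ts by linarith
      qed
      define w where "w = (y - u) /\<^sub>R t"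
      have w: "norm w = 1" "y - u = t *\<^sub>R w" using t by (auto simp: w_def t_def)
      then have "w \<in> sphere 0 1" by simp
      then obtain v where v: "v \<in> W" "norm (w - v) < \<epsilon>" using W(3) by (auto simp: dist_norm norm_minus_commute)
      have nv: "norm v \<le> 2" using norm_triangle_ineq3[of w v] v(2) w(1) \<epsilon>(2) by linarith
      have q: "\<bar>F (u + s *\<^sub>R v) - F u - s * (G \<bullet> v)\<bar> \<le> s * \<epsilon>"
      proof -
        have "\<bar>real (Suc n) * (F (u + s *\<^sub>R v) - F u) - G \<bullet> v\<bar> < \<epsilon>"
          using n0[OF v(1), of n] N(2)[OF v(1)] n(2) by (simp add: s_def)
        then have "s * \<bar>(1 / s) * (F (u + s *\<^sub>R v) - F u) - G \<bullet> v\<bar> \<le> s * \<epsilon>"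
          unfolding rs using s(1) by (intro mult_left_mono) auto
        also have "s * \<bar>(1 / s) * (F (u + s *\<^sub>R v) - F u) - G \<bullet> v\<bar> = \<bar>s * ((1 / s) * (F (u + s *\<^sub>R v) - F u) - G \<bullet> v)\<bar>"
          using s(1) by (simp add: abs_mult)
        also have "s * ((1 / s) * (F (u + s *\<^sub>R v) - F u) - G \<bullet> v) = F (u + s *\<^sub>R v) - F u - s * (G \<bullet> v)"
          using s(1) by (simp add: right_diff_distrib)
        finally show ?thesis .
      qed
      have diff: "norm ((y - u) - s *\<^sub>R v) \<le> t * \<epsilon> + 2 * (t * \<epsilon>) * 2"
      proof -
        have "(y - u) - s *\<^sub>R v = t *\<^sub>R (w - v) - (s - t) *\<^sub>R v" unfolding w(2) by (simp add: algebra_simps)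
        then have "norm ((y - u) - s *\<^sub>R v) \<le> norm (t *\<^sub>R (w - v)) + norm ((s - t) *\<^sub>R v)"
          by (metis norm_triangle_ineq4)
        also have "\<dots> = t * norm (w - v) + (s - t) * norm v" using t s by simp
        also have "\<dots> \<le> t * \<epsilon> + (t * \<epsilon>) * 2"
        proof (intro add_mono mult_mono)
          show "s - t \<le> t * \<epsilon>" using ts t s\<epsilon> mult_left_mono[of s \<epsilon> t] by linarith
        qed (use v t nv \<epsilon> in auto)
        also have "\<dots> \<le> t * \<epsilon> + 2 * (t * \<epsilon>) * 2" using t \<epsilon> by simp
        finally show ?thesis .
      qed
      have "F y - F u - G \<bullet> (y - u) = (F (u + s *\<^sub>R v) - F u - s * (G \<bullet> v)) + (F y - F (u + s *\<^sub>R v))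
          - G \<bullet> ((y - u) - s *\<^sub>R v)"
        by (simp add: inner_diff_right)
      then have "\<bar>F y - F u - G \<bullet> (y - u)\<bar> \<le> \<bar>F (u + s *\<^sub>R v) - F u - s * (G \<bullet> v)\<bar> + \<bar>F y - F (u + s *\<^sub>R v)\<bar>
          + \<bar>G \<bullet> ((y - u) - s *\<^sub>R v)\<bar>" by linarith
      also have "\<dots> \<le> s * \<epsilon> + K * norm ((y - u) - s *\<^sub>R v) + norm G * norm ((y - u) - s *\<^sub>R v)"
        using lip[of y "u + s *\<^sub>R v"] Cauchy_Schwarz_ineq2[of G "(y - u) - s *\<^sub>R v"]
        by (intro add_mono q) (simp_all add: algebra_simps)
      also have "\<dots> = s * \<epsilon> + M * norm ((y - u) - s *\<^sub>R v)" by (simp add: M_def algebra_simps)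
      also have "\<dots> \<le> (2 * t) * \<epsilon> + M * (t * \<epsilon> + 2 * (t * \<epsilon>) * 2)"
        using s2 \<epsilon>(1) M diff by (intro add_mono mult_right_mono mult_left_mono) auto
      also have "\<dots> = t * (\<epsilon> * (2 + 5 * M))" by (simp add: algebra_simps)
      also have "\<dots> \<le> t * e" using \<epsilon>(3) t by (intro mult_left_mono) auto
      finally show ?thesis by (simp add: t_def mult.commute)
    qed simp
  qed simp
qed

lemma derivative_imp_quotient:
  fixes F :: "'v::euclidean_space \<Rightarrow> real"
  assumes "(F has_derivative (\<lambda>h. G \<bullet> h)) (at u)"
  shows "(\<lambda>n. real (Suc n) * (F (u + (1 / real (Suc n)) *\<^sub>R v) - F u)) \<longlonglongrightarrow> G \<bullet> v"
proof -
  have "((\<lambda>t. F (u + t *\<^sub>R v)) has_derivative (\<lambda>t. G \<bullet> (t *\<^sub>R v))) (at 0)"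
    by (rule has_derivative_compose[of "\<lambda>t. u + t *\<^sub>R v" "\<lambda>t. t *\<^sub>R v" 0 UNIV F "\<lambda>h. G \<bullet> h"])
       (use assms in \<open>auto intro!: derivative_eq_intros\<close>)
  moreover have "(\<lambda>t. G \<bullet> (t *\<^sub>R v)) = (*) (G \<bullet> v)" by (auto simp: mult.commute)
  ultimately have "((\<lambda>t. F (u + t *\<^sub>R v)) has_real_derivative G \<bullet> v) (at 0)"
    by (simp add: has_field_derivative_def)
  then have "((\<lambda>t. (F (u + t *\<^sub>R v) - F u) / t) \<longlongrightarrow> G \<bullet> v) (at 0)"
    by (simp add: has_field_derivative_iff)
  from this[unfolded tendsto_at_iff_sequentially, rule_format, of "\<lambda>n. 1 / real (Suc n)"]
  show ?thesis using LIMSEQ_inverse_real_of_nat by (simp add: o_def inverse_eq_divide mult.commute del: of_nat_Suc)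
qed

text \<open>For each fixed \<open>v\<close> the limit \<open>H v\<close> of the quotients exists
  almost everywhere. Its pairing with a bump is minus the pairing of \<open>F\<close> with the
  derivative of the bump, which is linear in \<open>v\<close>, so
  \<open>H v u = G u \<bullet> v\<close> for almost every \<open>u\<close>. A countable dense set of
  directions makes the null set independent of \<open>v\<close>.\<close>

theorem Rademacher:
  fixes F :: "real^'k \<Rightarrow> real"
  assumes lip: "\<And>u w. \<bar>F u - F w\<bar> \<le> K * norm (u - w)"
  shows "AE u in lborel. F differentiable (at u)"
proof -
  define q where "q n v u = real (Suc n) * (F (u + (1 / real (Suc n)) *\<^sub>R v) - F u)" for n v u
  define H where "H v u = lim (\<lambda>n. q n v u)" for v u
  have cont: "continuous_on UNIV F" by (rule lipschitz_imp_continuous[of UNIV F K]) (use lip in auto)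
  have qm[measurable]: "q n v \<in> borel_measurable borel" for n v
    unfolding q_def
    by (intro borel_measurable_continuous_onI continuous_intros continuous_on_compose2[OF cont]) auto
  have Hm[measurable]: "H v \<in> borel_measurable borel" for v
    unfolding H_def by measurable
  have conv: "AE u in lborel. (\<lambda>n. q n v u) \<longlonglongrightarrow> H v u" for v
    using directional_quotient_AE[OF lip, of v] unfolding q_def[symmetric] H_def
    by eventually_elim (simp add: convergent_LIMSEQ_iff)
  have qb: "\<bar>q n v u\<bar> \<le> K * norm v" for n v u
  proof -
    have "\<bar>F (u + (1 / real (Suc n)) *\<^sub>R v) - F u\<bar> \<le> K * norm ((1 / real (Suc n)) *\<^sub>R v)" using lip[of "u + (1 / real (Suc n)) *\<^sub>R v" u] by simp
    then have "real (Suc n) * \<bar>F (u + (1 / real (Suc n)) *\<^sub>R v) - F u\<bar> \<le> real (Suc n) * (K * norm ((1 / real (Suc n)) *\<^sub>R v))"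
      by (intro mult_left_mono) auto
    then show ?thesis by (simp add: q_def abs_mult del: of_nat_Suc)
  qed
  have Hb: "AE u in lborel. \<bar>H v u\<bar> \<le> K * norm v" for v
    using conv[of v] by eventually_elim (rule LIMSEQ_le_const2[OF tendsto_rabs], assumption, use qb in blast)
  have Hint: "set_integrable lborel C (H v)" if "compact C" for C v
    unfolding set_integrable_def
  proof (rule Bochner_Integration.integrable_bound)
    show "integrable lborel (\<lambda>u. K * norm v * indicator C u)"
      using emeasure_compact_finite[OF that] compact_imp_closed[OF that]
      by (intro integrable_mult_right integrable_real_indicator) simp_all
    show "(\<lambda>u. indicator C u *\<^sub>R H v u) \<in> borel_measurable lborel"
      using compact_imp_closed[OF that] by simp
    show "AE u in lborel. norm (indicator C u *\<^sub>R H v u) \<le> norm (K * norm v * indicator C u)"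
      using Hb[of v] by eventually_elim (auto simp: indicator_def intro: order_trans[OF _ abs_ge_self])
  qed
  define G where "G u = (\<chi> i. H (axis i 1) u)" for u
  have weak: "(LINT u|lborel. indicator (cbox a b) u * H v u * box_bump n a b u) =
      - (LINT u|lborel. indicator (cbox a b) u * F u * frechet_derivative (box_bump n a b) (at u) v)" for a b n v
  proof (rule difference_quotient_weak[where \<delta>=1 and K=K, OF box_bump_smooth compact_cbox])
    show "box_bump n a b u = 0" if "u \<notin> cbox a b" for u
      using box_bump_outside[of u a b n] box_subset_cbox[of a b] that by blast
    show "set_integrable lborel Q F" if "compact Q" for Q
      unfolding set_integrable_def by (rule borel_integrable_compact[OF that continuous_on_subset[OF cont subset_UNIV]])
    show "\<bar>F (u + h) - F u\<bar> \<le> K * norm h" for u h using lip[of "u + h" u] by simp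
    show "AE u in lborel. u \<in> cbox a b \<longrightarrow> (\<lambda>n. real (Suc n) * (F (u + (1 / real (Suc n)) *\<^sub>R v) - F u)) \<longlonglongrightarrow> H v u"
      using conv[of v] by eventually_elim (simp add: q_def)
    show "(\<lambda>u. indicator (cbox a b) u * H v u) \<in> borel_measurable borel" by measurable
  qed simp
  have lin: "AE u in lborel. H v u = G u \<bullet> v" for v
  proof -
    have Gv: "G u \<bullet> v = (\<Sum>i\<in>UNIV. H (axis i 1) u * v $ i)" for u by (simp add: G_def inner_vec_def)
    have "AE u in lborel. u \<in> UNIV \<longrightarrow> H v u = G u \<bullet> v"
    proof (rule AE_eq_of_box_bumps[OF open_UNIV])
      show "set_integrable lborel C (H v)" if "compact C" for C by (rule Hint[OF that])
      show "set_integrable lborel C (\<lambda>u. G u \<bullet> v)" if "compact C" for C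
        unfolding Gv set_integrable_def scaleR_sum_right
        by (intro Bochner_Integration.integrable_sum)
           (use integrable_mult_left[OF Hint[OF that, unfolded set_integrable_def]] in \<open>simp add: mult.assoc\<close>)
      fix a b :: "real^'k" and n
      let ?\<psi> = "box_bump n a b" and ?I = "indicator (cbox a b) :: real^'k \<Rightarrow> real"
      have int: "integrable lborel (\<lambda>u. ?I u * H w u * ?\<psi> u)" for w
        by (rule set_integrable_mult_bounded[where M=1, OF Hint[OF compact_cbox]])
           (auto intro!: borel_measurable_continuous_onI smooth_on_UNIV(2)[OF box_bump_smooth] simp: box_bump_range)
      have intF: "integrable lborel (\<lambda>u. ?I u * F u * frechet_derivative ?\<psi> (at u) w)" for w
      proof -
        have out: "?\<psi> u = 0" if "u \<notin> cbox a b" for u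
          using box_bump_outside[of u a b n] box_subset_cbox[of a b] that by blast
        obtain M where "\<And>u. \<bar>frechet_derivative ?\<psi> (at u) w\<bar> \<le> M"
          using test_function_deriv_bounded[where \<psi>="?\<psi>" and h=w, OF box_bump_smooth compact_cbox out] by metis
        moreover have "set_integrable lborel (cbox a b) F"
          unfolding set_integrable_def
          by (rule borel_integrable_compact[OF compact_cbox continuous_on_subset[OF cont subset_UNIV]])
        moreover have "(\<lambda>u. frechet_derivative ?\<psi> (at u) w) \<in> borel_measurable borel"
          by (intro borel_measurable_continuous_onI smooth_on_UNIV(3)[OF box_bump_smooth])
        ultimately show ?thesis by (intro set_integrable_mult_bounded)
      qed
      have D: "frechet_derivative ?\<psi> (at u) v = (\<Sum>i\<in>UNIV. v $ i * frechet_derivative ?\<psi> (at u) (axis i 1))" for u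
      proof -
        have "linear (frechet_derivative ?\<psi> (at u))" using smooth_on_UNIV(1)[OF box_bump_smooth] linear_frechet_derivative by blast
        then have "frechet_derivative ?\<psi> (at u) (\<Sum>i\<in>UNIV. v $ i *s axis i 1) = (\<Sum>i\<in>UNIV. v $ i * frechet_derivative ?\<psi> (at u) (axis i 1))"
          by (simp add: linear_sum linear_cmul scalar_mult_eq_scaleR)
        then show ?thesis by (simp add: basis_expansion)
      qed
      have "(LINT u|lborel. ?I u * (G u \<bullet> v) * ?\<psi> u) = (LINT u|lborel. (\<Sum>i\<in>UNIV. v $ i * (?I u * H (axis i 1) u * ?\<psi> u)))"
        unfolding Gv by (intro Bochner_Integration.integral_cong) (simp_all add: sum_distrib_left sum_distrib_right mult_ac)
      also have "\<dots> = (\<Sum>i\<in>UNIV. v $ i * (LINT u|lborel. ?I u * H (axis i 1) u * ?\<psi> u))"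
        using int by (subst Bochner_Integration.integral_sum) auto
      also have "\<dots> = - (\<Sum>i\<in>UNIV. v $ i * (LINT u|lborel. ?I u * F u * frechet_derivative ?\<psi> (at u) (axis i 1)))"
        by (simp add: weak sum_negf)
      also have "(\<Sum>i\<in>UNIV. v $ i * (LINT u|lborel. ?I u * F u * frechet_derivative ?\<psi> (at u) (axis i 1))) =
          (LINT u|lborel. (\<Sum>i\<in>UNIV. v $ i * (?I u * F u * frechet_derivative ?\<psi> (at u) (axis i 1))))"
        using intF by (subst Bochner_Integration.integral_sum) auto
      also have "\<dots> = (LINT u|lborel. ?I u * F u * frechet_derivative ?\<psi> (at u) v)"
        by (subst D) (simp add: sum_distrib_left mult_ac)
      finally show "(LINT u|lborel. ?I u * H v u * ?\<psi> u) = (LINT u|lborel. ?I u * (G u \<bullet> v) * ?\<psi> u)"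
        by (simp add: weak)
    qed
    then show ?thesis by simp
  qed
  obtain V :: "(real^'k) set" where V: "countable V" "\<And>U. open U \<Longrightarrow> U \<noteq> {} \<Longrightarrow> \<exists>v\<in>V. v \<in> U"
    using countable_dense_setE by blast
  have "AE u in lborel. \<forall>v\<in>V. (\<lambda>n. q n v u) \<longlonglongrightarrow> H v u \<and> H v u = G u \<bullet> v"
    using conv lin by (subst AE_ball_countable[OF V(1)]) auto
  then show ?thesis
  proof eventually_elim
    case (elim u)
    have "(F has_derivative (\<lambda>h. G u \<bullet> h)) (at u)"
      by (rule derivative_from_directions[OF lip V(2)]) (use elim in \<open>auto simp: q_def\<close>)
    then show ?case by (auto simp: differentiable_def)
  qed
qed

section \<open>Locally Lipschitz functions on open sets and their weak gradients\<close>

definition locally_lipschitz :: "('v::euclidean_space) set \<Rightarrow> ('v \<Rightarrow> real) \<Rightarrow> bool" where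
  "locally_lipschitz \<Omega> F \<longleftrightarrow> (\<forall>u\<in>\<Omega>. \<exists>r>0. \<exists>K. cball u r \<subseteq> \<Omega> \<and>
     (\<forall>x\<in>cball u r. \<forall>y\<in>cball u r. \<bar>F x - F y\<bar> \<le> K * norm (x - y)))"

lemma locally_lipschitz_continuous:
  assumes "open \<Omega>" "locally_lipschitz \<Omega> F" shows "continuous_on \<Omega> F"
  unfolding continuous_on_eq_continuous_at[OF assms(1)]
proof
  fix u assume "u \<in> \<Omega>"
  then obtain r K where r: "r > 0" "\<forall>x\<in>cball u r. \<forall>y\<in>cball u r. \<bar>F x - F y\<bar> \<le> K * norm (x - y)"
    using assms(2) unfolding locally_lipschitz_def by blast
  have "continuous_on (ball u r) F"
    by (rule lipschitz_imp_continuous[of _ F K]) (use r(2) in auto)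
  then show "isCont F u" using r(1) continuous_on_eq_continuous_at[OF open_ball] by (metis centre_in_ball)
qed

text \<open>Composition with the nearest-point projection onto a closed ball gives a globally
  Lipschitz function that agrees with \<open>F\<close> on the open ball; countably many such balls
  cover \<Omega> by the Lindelof property.\<close>

lemma Rademacher_local:
  fixes F :: "real^'k \<Rightarrow> real"
  assumes "open \<Omega>" "locally_lipschitz \<Omega> F"
  shows "AE u in lborel. u \<in> \<Omega> \<longrightarrow> F differentiable (at u)"
proof -
  have ball_AE: "AE w in lborel. w \<in> ball u r \<longrightarrow> F differentiable (at w)"
    if r: "r > 0" "\<forall>x\<in>cball u r. \<forall>y\<in>cball u r. \<bar>F x - F y\<bar> \<le> K * norm (x - y)" for u r K
  proof -
    define F' where "F' w = F (closest_point (cball u r) w)" for w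
    have ne: "cball u r \<noteq> {}" using r(1) by auto
    have "\<bar>F' w - F' z\<bar> \<le> \<bar>K\<bar> * norm (w - z)" for w z
    proof -
      have in_c: "closest_point (cball u r) x \<in> cball u r" for x
        by (rule closest_point_in_set[OF closed_cball ne])
      have "\<bar>F' w - F' z\<bar> \<le> K * norm (closest_point (cball u r) w - closest_point (cball u r) z)"
        unfolding F'_def using r(2) in_c by blast
      also have "\<dots> \<le> \<bar>K\<bar> * norm (w - z)"
        using closest_point_lipschitz[OF convex_cball closed_cball ne, of w z]
        by (intro mult_mono) (auto simp: dist_norm)
      finally show ?thesis .
    qed
    from Rademacher[OF this] show ?thesis
    proof eventually_elim
      case (elim w)
      show ?case
      proof
        assume w: "w \<in> ball u r"
        obtain D where "(F' has_derivative D) (at w)" using elim by (auto simp: differentiable_def)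
        then have "(F has_derivative D) (at w)"
          by (rule has_derivative_transform_within_open[OF _ open_ball w])
             (auto simp: F'_def closest_point_self)
        then show "F differentiable (at w)" by (auto simp: differentiable_def)
      qed
    qed
  qed
  have "\<exists>r>0. AE w in lborel. w \<in> ball u r \<longrightarrow> F differentiable (at w)" if uO: "u \<in> \<Omega>" for u
  proof -
    obtain r K where "r > 0" "\<forall>x\<in>cball u r. \<forall>y\<in>cball u r. \<bar>F x - F y\<bar> \<le> K * norm (x - y)"
      using assms(2) uO unfolding locally_lipschitz_def by blast
    from ball_AE[OF this] \<open>r > 0\<close> show ?thesis by blast
  qed
  then obtain r where r: "\<And>u. u \<in> \<Omega> \<Longrightarrow> r u > 0"
    "\<And>u. u \<in> \<Omega> \<Longrightarrow> AE w in lborel. w \<in> ball u (r u) \<longrightarrow> F differentiable (at w)" by metis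
  obtain C where C: "C \<subseteq> (\<lambda>u. ball u (r u)) ` \<Omega>" "countable C" "\<Union>C = \<Union>((\<lambda>u. ball u (r u)) ` \<Omega>)"
    by (rule Lindelof[of "(\<lambda>u. ball u (r u)) ` \<Omega>"]) (auto intro: that)
  have "AE w in lborel. \<forall>B\<in>C. w \<in> B \<longrightarrow> F differentiable (at w)"
    using C(1) r(2) by (subst AE_ball_countable[OF C(2)]) auto
  then show ?thesis
  proof eventually_elim
    case (elim w)
    show ?case
    proof
      assume w: "w \<in> \<Omega>"
      have "w \<in> \<Union>C" unfolding C(3) using r(1)[OF w] w by (auto intro!: bexI[of _ w])
      then show "F differentiable (at w)" using elim by blast
    qed
  qed
qed

text \<open>Compactness yields a uniform Lipschitz constant and a uniform admissible shift near the
  support of a test function; this is what \<open>difference_quotient_weak\<close> asks for.\<close>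

lemma locally_lipschitz_weak_gradient:
  fixes F :: "real^'k \<Rightarrow> real"
  assumes \<Omega>: "open \<Omega>" and F: "locally_lipschitz \<Omega> F"
    and G: "AE u in lborel. u \<in> \<Omega> \<longrightarrow> (F has_derivative (\<lambda>h. G u \<bullet> h)) (at u)"
    and m: "(\<lambda>u. indicator \<Omega> u *\<^sub>R G u) \<in> borel_measurable borel"
  shows "weak_gradient_on \<Omega> F G"
proof -
  have cont: "continuous_on \<Omega> F" by (rule locally_lipschitz_continuous[OF \<Omega> F])
  have unif: "\<exists>\<delta>>0. \<exists>K\<ge>0. (\<Union>u\<in>C. cball u \<delta>) \<subseteq> \<Omega> \<and>
      (\<forall>u\<in>C. \<forall>h. norm h \<le> \<delta> \<longrightarrow> \<bar>F (u + h) - F u\<bar> \<le> K * norm h)" if C: "compact C" "C \<subseteq> \<Omega>" for C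
  proof (cases "C = {}")
    case True
    then show ?thesis by (intro exI[of _ 1]) auto
  next
    case False
    obtain r K where r: "\<And>u. u \<in> \<Omega> \<Longrightarrow> r u > 0" "\<And>u. u \<in> \<Omega> \<Longrightarrow> cball u (r u) \<subseteq> \<Omega>"
      and K: "\<And>u x y. u \<in> \<Omega> \<Longrightarrow> x \<in> cball u (r u) \<Longrightarrow> y \<in> cball u (r u) \<Longrightarrow> \<bar>F x - F y\<bar> \<le> K u * norm (x - y)"
      using F unfolding locally_lipschitz_def by metis
    have "C \<subseteq> (\<Union>u\<in>C. ball u (r u / 2))" using r(1) C(2) by force
    then obtain P where P: "P \<subseteq> C" "finite P" "C \<subseteq> (\<Union>u\<in>P. ball u (r u / 2))"
      by (rule compactE_image[OF C(1), rotated]) auto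
    have Pne: "P \<noteq> {}" using P(3) False by auto
    define \<delta> where "\<delta> = Min (r ` P) / 2"
    have \<delta>: "\<delta> > 0" "\<And>p. p \<in> P \<Longrightarrow> \<delta> \<le> r p / 2" using P Pne r(1) C(2) by (auto simp: \<delta>_def)
    define L where "L = Max (insert 0 (K ` P))"
    have L: "L \<ge> 0" "\<And>p. p \<in> P \<Longrightarrow> K p \<le> L" using P(2) by (auto simp: L_def)
    have near: "\<exists>p\<in>P. u \<in> cball p (r p) \<and> (\<forall>h. norm h \<le> \<delta> \<longrightarrow> u + h \<in> cball p (r p))" if uC: "u \<in> C" for u
    proof -
      obtain p where p: "p \<in> P" "dist p u < r p / 2" using P(3) uC by (auto simp: subset_iff)
      have "u + h \<in> cball p (r p)" if "norm h \<le> \<delta>" for h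
      proof -
        have "dist p (u + h) \<le> dist p u + dist u (u + h)" by (rule dist_triangle)
        then show ?thesis using p(2) \<delta>(2)[OF p(1)] that by (simp add: dist_norm)
      qed
      moreover have "u \<in> cball p (r p)" using p zero_le_dist[of p u] unfolding mem_cball by linarith
      ultimately show ?thesis using p(1) by blast
    qed
    show ?thesis
    proof (rule exI[of _ \<delta>], rule conjI[OF \<delta>(1)], rule exI[of _ L], rule conjI[OF L(1)],
        intro conjI ballI allI impI subsetI)
      fix x assume "x \<in> (\<Union>u\<in>C. cball u \<delta>)"
      then obtain u where u: "u \<in> C" "dist u x \<le> \<delta>" by auto
      obtain p where p: "p \<in> P" "\<forall>h. norm h \<le> \<delta> \<longrightarrow> u + h \<in> cball p (r p)" using near[OF u(1)] by blast
      have "norm (x - u) \<le> \<delta>" using u(2) by (simp add: dist_norm norm_minus_commute)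
      then have "u + (x - u) \<in> cball p (r p)" using p(2) by blast
      then have "x \<in> cball p (r p)" by simp
      moreover have "p \<in> \<Omega>" using p(1) P(1) C(2) by blast
      ultimately show "x \<in> \<Omega>" using r(2) by blast
    next
      fix u h :: "real^'k" assume u: "u \<in> C" and h: "norm h \<le> \<delta>"
      obtain p where p: "p \<in> P" "u \<in> cball p (r p)" "\<forall>h. norm h \<le> \<delta> \<longrightarrow> u + h \<in> cball p (r p)" using near[OF u] by blast
      have "\<bar>F (u + h) - F u\<bar> \<le> K p * norm (u + h - u)"
      proof (rule K[of p])
        show "p \<in> \<Omega>" using p(1) P(1) C(2) by blast
        show "u + h \<in> cball p (r p)" using p(3) h by blast
      qed (rule p(2))
      also have "\<dots> \<le> L * norm h" using L(2)[OF p(1)] by (simp add: mult_right_mono)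
      finally show "\<bar>F (u + h) - F u\<bar> \<le> L * norm h" .
    qed
  qed
  have Gb: "\<exists>K\<ge>0. AE u in lborel. u \<in> C \<longrightarrow> norm (G u) \<le> K" if C: "compact C" "C \<subseteq> \<Omega>" for C
  proof -
    obtain \<delta> K where u: "\<delta> > 0" "K \<ge> 0" "\<forall>u\<in>C. \<forall>h. norm h \<le> \<delta> \<longrightarrow> \<bar>F (u + h) - F u\<bar> \<le> K * norm h"
      using unif[OF C] by blast
    have "AE u in lborel. u \<in> C \<longrightarrow> norm (G u) \<le> K"
      using G
    proof eventually_elim
      case (elim u)
      show ?case
      proof
        assume uC: "u \<in> C"
        \<comment> \<open>The derivative is tested in the direction \<open>G u\<close> itself, which
          bounds the square of the norm of \<open>G u\<close> by \<open>K\<close> times the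
          norm.\<close>
        have lim: "(\<lambda>n. \<bar>real (Suc n) * (F (u + (1 / real (Suc n)) *\<^sub>R G u) - F u)\<bar>) \<longlonglongrightarrow> \<bar>G u \<bullet> G u\<bar>"
          using elim C(2) uC by (intro tendsto_rabs derivative_imp_quotient) auto
        have "(\<lambda>n. 1 / real (Suc n) * norm (G u)) \<longlonglongrightarrow> 0"
          using tendsto_mult[OF LIMSEQ_inverse_real_of_nat tendsto_const[of "norm (G u)"]] by (simp add: inverse_eq_divide)
        from order_tendstoD(2)[OF this u(1)] obtain n0 where n0: "\<And>n. n \<ge> n0 \<Longrightarrow> 1 / real (Suc n) * norm (G u) < \<delta>"
          by (auto simp: eventually_sequentially)
        have "\<bar>G u \<bullet> G u\<bar> \<le> K * norm (G u)"
        proof (rule LIMSEQ_le_const2[OF lim], intro exI[of _ n0] allI impI)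
          fix n assume "n \<ge> n0"
          then have "norm ((1 / real (Suc n)) *\<^sub>R G u) \<le> \<delta>" using n0[of n] by (simp del: of_nat_Suc)
          then have "\<bar>F (u + (1 / real (Suc n)) *\<^sub>R G u) - F u\<bar> \<le> K * norm ((1 / real (Suc n)) *\<^sub>R G u)"
            using u(3) uC by blast
          then have "real (Suc n) * \<bar>F (u + (1 / real (Suc n)) *\<^sub>R G u) - F u\<bar> \<le> real (Suc n) * (K * norm ((1 / real (Suc n)) *\<^sub>R G u))"
            by (intro mult_left_mono) auto
          then show "\<bar>real (Suc n) * (F (u + (1 / real (Suc n)) *\<^sub>R G u) - F u)\<bar> \<le> K * norm (G u)"
            by (simp add: abs_mult del: of_nat_Suc)
        qed
        then have "norm (G u) * norm (G u) \<le> K * norm (G u)" by (simp add: dot_square_norm power2_eq_square)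
        then show "norm (G u) \<le> K" using u(2) by (cases "norm (G u) = 0") auto
      qed
    qed
    then show ?thesis using u(2) by blast
  qed
  have mC: "(\<lambda>u. indicator C u *\<^sub>R G u) \<in> borel_measurable borel" if "compact C" "C \<subseteq> \<Omega>" for C
  proof -
    have "(\<lambda>u. indicator C u *\<^sub>R (indicator \<Omega> u *\<^sub>R G u)) \<in> borel_measurable borel"
      by (rule borel_measurable_scaleR[OF _ m]) (use compact_imp_closed[OF that(1)] in auto)
    moreover have "(\<lambda>u. indicator C u *\<^sub>R (indicator \<Omega> u *\<^sub>R G u)) = (\<lambda>u. indicator C u *\<^sub>R G u)"
      using that(2) by (auto simp: indicator_def fun_eq_iff)
    ultimately show ?thesis by simp
  qed
  have intF: "set_integrable lborel C F" if "compact C" "C \<subseteq> \<Omega>" for C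
    unfolding set_integrable_def by (rule borel_integrable_compact[OF that(1) continuous_on_subset[OF cont that(2)]])
  show ?thesis
    unfolding weak_gradient_on_def
  proof (intro conjI allI impI)
    fix C assume C: "compact C" "C \<subseteq> \<Omega>"
    show "set_integrable lborel C F" by (rule intF[OF C])
    obtain K where K: "K \<ge> 0" "AE u in lborel. u \<in> C \<longrightarrow> norm (G u) \<le> K" using Gb[OF C] by blast
    show "set_integrable lborel C G"
      unfolding set_integrable_def
    proof (rule Bochner_Integration.integrable_bound)
      show "integrable lborel (\<lambda>u. K * indicator C u)"
        using emeasure_compact_finite[OF C(1)] compact_imp_closed[OF C(1)]
        by (intro integrable_mult_right integrable_real_indicator) simp_all
      show "AE u in lborel. norm (indicator C u *\<^sub>R G u) \<le> norm (K * indicator C u)"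
        using K(2) by eventually_elim (use K(1) in \<open>auto simp: indicator_def\<close>)
    qed (use mC[OF C] in simp)
  next
    fix \<psi> i assume "test_function \<Omega> \<psi>"
    then obtain C where sm: "smooth_on UNIV \<psi>" and C: "compact C" "C \<subseteq> \<Omega>" "\<And>u. u \<notin> C \<Longrightarrow> \<psi> u = 0"
      by (auto simp: test_function_def)
    obtain \<delta> K where u: "\<delta> > 0" "K \<ge> 0" "(\<Union>u\<in>C. cball u \<delta>) \<subseteq> \<Omega>"
      "\<forall>u\<in>C. \<forall>h. norm h \<le> \<delta> \<longrightarrow> \<bar>F (u + h) - F u\<bar> \<le> K * norm h"
      using unif[OF C(1,2)] by blast
    have "(LINT u|lborel. indicator C u * (G u \<bullet> axis i 1) * \<psi> u) =
      - (LINT u|lborel. indicator C u * F u * frechet_derivative \<psi> (at u) (axis i 1))"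
    proof (rule difference_quotient_weak[OF sm C(1,3) u(1)])
      show "set_integrable lborel Q F" if "compact Q" "Q \<subseteq> (\<Union>u\<in>C. cball u \<delta>)" for Q
        using intF that u(3) by blast
      show "\<bar>F (u + h) - F u\<bar> \<le> K * norm h" if "u \<in> C" "norm h \<le> \<delta>" for u h using u(4) that by blast
      show "AE u in lborel. u \<in> C \<longrightarrow> (\<lambda>n. real (Suc n) * (F (u + (1 / real (Suc n)) *\<^sub>R axis i 1) - F u)) \<longlonglongrightarrow> G u \<bullet> axis i 1"
        using G by eventually_elim (use C(2) derivative_imp_quotient in blast)
      have "(\<lambda>u. (indicator C u *\<^sub>R G u) \<bullet> axis i 1) \<in> borel_measurable borel"
        by (rule borel_measurable_inner[OF mC[OF C(1,2)] borel_measurable_const])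
      then show "(\<lambda>u. indicator C u * (G u \<bullet> axis i 1)) \<in> borel_measurable borel" by simp
    qed
    moreover have "(LINT u:\<Omega>|lborel. F u * frechet_derivative \<psi> (at u) (axis i 1)) =
      (LINT u|lborel. indicator C u * F u * frechet_derivative \<psi> (at u) (axis i 1))"
      unfolding set_lebesgue_integral_def using C(2) test_function_deriv_outside[where \<psi>=\<psi>, OF C(1,3)]
      by (intro Bochner_Integration.integral_cong) (auto simp: indicator_def)
    moreover have "(LINT u:\<Omega>|lborel. G u $ i * \<psi> u) = (LINT u|lborel. indicator C u * (G u \<bullet> axis i 1) * \<psi> u)"
      unfolding set_lebesgue_integral_def using C(2,3)
      by (intro Bochner_Integration.integral_cong) (auto simp: indicator_def inner_axis)
    ultimately show "(LINT u:\<Omega>|lborel. F u * frechet_derivative \<psi> (at u) (axis i 1)) =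
             - (LINT u:\<Omega>|lborel. G u $ i * \<psi> u)" by simp
  qed
qed

section \<open>Weak differentials of Lipschitz functions\<close>

text \<open>\<open>lborel\<close> is not complete, so equality almost everywhere does not transfer
  measurability; it is assumed for \<open>H\<close> in \<open>m\<close>.\<close>

lemma weak_gradient_cong_AE:
  fixes F H :: "real^'k \<Rightarrow> real"
  assumes \<Omega>: "open \<Omega>" and eq: "AE u in lborel. u \<in> \<Omega> \<longrightarrow> F u = H u"
    and m: "(\<lambda>u. indicator \<Omega> u *\<^sub>R H u) \<in> borel_measurable borel"
    and w: "weak_gradient_on \<Omega> F G"
  shows "weak_gradient_on \<Omega> H G"
  unfolding weak_gradient_on_def
proof (intro conjI allI impI)
  fix C assume C: "compact C" "C \<subseteq> \<Omega>"
  then show "set_integrable lborel C G" using w by (auto simp: weak_gradient_on_def)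
  have F: "integrable lborel (\<lambda>u. indicator C u *\<^sub>R F u)"
    using w C by (auto simp: weak_gradient_on_def set_integrable_def)
  have "(\<lambda>u. indicator C u *\<^sub>R (indicator \<Omega> u *\<^sub>R H u)) \<in> borel_measurable borel"
    by (rule borel_measurable_scaleR[OF _ m]) (use compact_imp_closed[OF C(1)] in auto)
  moreover have "(\<lambda>u. indicator C u *\<^sub>R (indicator \<Omega> u *\<^sub>R H u)) = (\<lambda>u. indicator C u *\<^sub>R H u)"
    using C(2) by (auto simp: indicator_def fun_eq_iff)
  ultimately have mC: "(\<lambda>u. indicator C u *\<^sub>R H u) \<in> borel_measurable lborel" by simp
  show "set_integrable lborel C H"
    unfolding set_integrable_def
  proof (rule integrable_cong_AE_imp[OF F mC])
    show "AE u in lborel. indicator C u *\<^sub>R F u = indicator C u *\<^sub>R H u"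
      using eq by eventually_elim (use C(2) in \<open>auto simp: indicator_def\<close>)
  qed
next
  fix \<psi> :: "real^'k \<Rightarrow> real" and i :: 'k assume \<psi>: "test_function \<Omega> \<psi>"
  then obtain C where sm: "smooth_on UNIV \<psi>" and C: "compact C" "C \<subseteq> \<Omega>" "\<And>u. u \<notin> C \<Longrightarrow> \<psi> u = 0"
    by (auto simp: test_function_def)
  have F: "set_integrable lborel C F" using w C by (auto simp: weak_gradient_on_def)
  have dm: "(\<lambda>u. frechet_derivative \<psi> (at u) (axis i 1)) \<in> borel_measurable borel"
    by (intro borel_measurable_continuous_onI smooth_on_UNIV(3)[OF sm])
  have "(LINT u:\<Omega>|lborel. H u * frechet_derivative \<psi> (at u) (axis i 1)) =
    (LINT u:\<Omega>|lborel. F u * frechet_derivative \<psi> (at u) (axis i 1))"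
    unfolding set_lebesgue_integral_def
  proof (rule integral_cong_AE)
    have "(\<lambda>u. (indicator \<Omega> u *\<^sub>R H u) * frechet_derivative \<psi> (at u) (axis i 1)) \<in> borel_measurable borel"
      by (rule borel_measurable_times[OF m dm])
    then show "(\<lambda>u. indicator \<Omega> u *\<^sub>R (H u * frechet_derivative \<psi> (at u) (axis i 1))) \<in> borel_measurable lborel"
      by (simp add: mult.assoc)
    have "(\<lambda>u. (indicator C u *\<^sub>R F u) * frechet_derivative \<psi> (at u) (axis i 1)) \<in> borel_measurable borel"
      using F dm by (intro borel_measurable_times) (auto simp: set_integrable_def)
    moreover have "(\<lambda>u. (indicator C u *\<^sub>R F u) * frechet_derivative \<psi> (at u) (axis i 1)) =
       (\<lambda>u. indicator \<Omega> u *\<^sub>R (F u * frechet_derivative \<psi> (at u) (axis i 1)))"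
      using C(2) test_function_deriv_outside[where \<psi>=\<psi>, OF C(1,3)] by (auto simp: indicator_def fun_eq_iff)
    ultimately show "(\<lambda>u. indicator \<Omega> u *\<^sub>R (F u * frechet_derivative \<psi> (at u) (axis i 1))) \<in> borel_measurable lborel"
      by simp
    show "AE u in lborel. indicator \<Omega> u *\<^sub>R (H u * frechet_derivative \<psi> (at u) (axis i 1)) =
      indicator \<Omega> u *\<^sub>R (F u * frechet_derivative \<psi> (at u) (axis i 1))"
      using eq by eventually_elim (auto simp: indicator_def)
  qed
  then show "(LINT u:\<Omega>|lborel. H u * frechet_derivative \<psi> (at u) (axis i 1)) =
             - (LINT u:\<Omega>|lborel. G u $ i * \<psi> u)"
    using w \<psi> by (auto simp: weak_gradient_on_def)
qed

lemma dot_transpose: "\<xi> \<bullet> (M *v h) = (transpose M *v \<xi>) \<bullet> h" for M :: "real^'n^'m"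
  by (metis dot_lmul_matrix transpose_matrix_vector vector_transpose_matrix)

context closed_manifold begin

lemma chart_derivative_change:
  assumes c: "c \<in> A" "e \<in> A" "p \<in> fst c" "p \<in> fst e"
    and D: "((f \<circ> chart_inv e) has_derivative (\<lambda>h. \<xi> \<bullet> h)) (at (snd e p))"
  shows "((f \<circ> chart_inv c) has_derivative (\<lambda>h. (transpose (transition_jacobian c e p) *v \<xi>) \<bullet> h)) (at (snd c p))"
proof -
  have t: "transition c e (snd c p) = snd e p" using c by (simp add: transition_def)
  have "((f \<circ> chart_inv e) \<circ> transition c e has_derivative
      (\<lambda>h. \<xi> \<bullet> h) \<circ> (*v) (transition_jacobian c e p)) (at (snd c p))"
    by (rule diff_chain_at[OF transition_derivative[OF c]]) (simp add: t D)
  then have "((f \<circ> chart_inv c) has_derivative (\<lambda>h. \<xi> \<bullet> h) \<circ> (*v) (transition_jacobian c e p)) (at (snd c p))"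
  proof (rule has_derivative_transform_within_open[OF _ open_overlap[OF c(1,2)]])
    show "snd c p \<in> snd c ` (fst c \<inter> fst e)" using c by blast
    fix u assume "u \<in> snd c ` (fst c \<inter> fst e)"
    then obtain q where "u = snd c q" "q \<in> fst c" "q \<in> fst e" by blast
    then show "((f \<circ> chart_inv e) \<circ> transition c e) u = (f \<circ> chart_inv c) u"
      using c by (simp add: transition_def)
  qed
  then show ?thesis by (simp add: o_def dot_transpose)
qed

lemma geo_lipschitz_bound:
  assumes "geo_lipschitz {} L F" "L \<ge> 0" "d x y \<le> ennreal a" "a \<ge> 0"
  shows "\<bar>F x - F y\<bar> \<le> L * a"
proof -
  have fin: "d x y < top" using assms(3) ennreal_less_top by (rule order_le_less_trans)
  then have "\<bar>F x - F y\<bar> \<le> L * dr x y" using assms(1) by (simp add: geo_lipschitz_def)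
  also have "\<dots> \<le> L * a" using assms(2,4) by (intro mult_left_mono enn2real_leI assms(3))
  finally show ?thesis .
qed

lemma geo_lipschitz_locally_lipschitz:
  assumes F: "geo_lipschitz {} L F" "L \<ge> 0" and c: "c \<in> A"
  shows "locally_lipschitz (chart_image c) (F \<circ> chart_inv c)"
  unfolding locally_lipschitz_def
proof
  fix u0 assume u0: "u0 \<in> chart_image c"
  define p where "p = chart_inv c u0"
  have p: "p \<in> fst c" "snd c p = u0" using u0 chart_inv_in[OF c] chart_inv[OF c] by (auto simp: p_def)
  obtain r where r: "r > 0" "ball (snd c p) r \<subseteq> chart_image c"
    "\<And>u v. u \<in> ball (snd c p) r \<Longrightarrow> v \<in> ball (snd c p) r \<Longrightarrow>
       d (chart_inv c u) (chart_inv c v) \<le> ennreal ((1 + 1) * nrm c p (v - u))"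
    using local_comparison[OF c p(1) zero_less_one] by metis
  obtain l where l: "l > 0" "\<And>v. nrm c p v \<le> l * norm v" using nrm_equiv[OF c p(1)] by metis
  have sub: "cball u0 (r/2) \<subseteq> ball u0 r" using r(1) by auto
  have "\<bar>(F \<circ> chart_inv c) x - (F \<circ> chart_inv c) y\<bar> \<le> (2 * L * l) * norm (x - y)"
    if xy: "x \<in> cball u0 (r/2)" "y \<in> cball u0 (r/2)" for x y
  proof -
    have b: "x \<in> ball u0 r" "y \<in> ball u0 r" using sub xy by blast+
    have "\<bar>F (chart_inv c x) - F (chart_inv c y)\<bar> \<le> L * (2 * nrm c p (y - x))"
      using r(3)[of x y] b p nrm_nonneg[OF c p(1)] by (intro geo_lipschitz_bound[OF F]) auto
    also have "\<dots> \<le> L * (2 * (l * norm (y - x)))" using F(2) l by (intro mult_left_mono) auto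
    finally show ?thesis by (simp add: mult_ac norm_minus_commute)
  qed
  then show "\<exists>r>0. \<exists>K. cball u0 r \<subseteq> chart_image c \<and> (\<forall>x\<in>cball u0 r. \<forall>y\<in>cball u0 r.
      \<bar>(F \<circ> chart_inv c) x - (F \<circ> chart_inv c) y\<bar> \<le> K * norm (x - y))"
    using r(1,2) sub p(2) by (intro exI[of _ "r/2"] conjI exI[of _ "2 * L * l"]) auto
qed

lemma chart_measurable:
  assumes c: "c \<in> A" and f: "f \<in> borel_measurable borel"
  shows "(\<lambda>u. indicator (chart_image c) u *\<^sub>R (f \<circ> chart_inv c) u :: real) \<in> borel_measurable borel"
proof -
  have "chart_inv c \<in> borel_measurable (restrict_space borel (chart_image c))"
    by (rule borel_measurable_continuous_on_restrict[OF cont_chart_inv[OF c]])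
  then have "f \<circ> chart_inv c \<in> borel_measurable (restrict_space borel (chart_image c))"
    using f by (rule measurable_comp)
  then show ?thesis
    using open_image[OF c] by (subst (asm) borel_measurable_restrict_space_iff) (auto simp: mult.commute)
qed

text \<open>The atlas may be uncountable, so the null set is collected from a finite subatlas; at
  the remaining points the chain rule carries differentiability to every other chart.\<close>

lemma lipschitz_derivative_AE:
  assumes F: "geo_lipschitz {} L F" "L \<ge> 0"
  obtains N \<xi> where "N \<in> null_sets vol"
    "\<And>c p. c \<in> A \<Longrightarrow> p \<in> fst c \<Longrightarrow> p \<notin> N \<Longrightarrow> ((F \<circ> chart_inv c) has_derivative (\<lambda>h. \<xi> c p \<bullet> h)) (at (snd c p))"
proof -
  obtain B where B: "finite B" "B \<subseteq> A" "(\<Union>c\<in>B. fst c) = UNIV" by (rule finite_atlas)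
  have "AE p in vol. p \<in> fst c \<longrightarrow> (F \<circ> chart_inv c) differentiable (at (snd c p))" if c: "c \<in> A" for c
  proof (rule AE_chart_inv[OF c])
    show "AE u in lborel. u \<in> chart_image c \<longrightarrow> F \<circ> chart_inv c differentiable at (snd c (chart_inv c u))"
      using Rademacher_local[OF open_image[OF c] geo_lipschitz_locally_lipschitz[OF F c]]
      by eventually_elim (simp add: chart_inv[OF c])
  qed
  then have "AE p in vol. \<forall>c\<in>B. p \<in> fst c \<longrightarrow> (F \<circ> chart_inv c) differentiable (at (snd c p))"
    using B by (intro AE_finite_allI) auto
  then obtain N where N: "{p \<in> space vol. \<not> (\<forall>c\<in>B. p \<in> fst c \<longrightarrow> (F \<circ> chart_inv c) differentiable (at (snd c p)))} \<subseteq> N"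
    "emeasure vol N = 0" "N \<in> sets vol" by (rule AE_E)
  have ex: "\<exists>\<xi>. ((F \<circ> chart_inv c) has_derivative (\<lambda>h. \<xi> \<bullet> h)) (at (snd c p))"
    if c: "c \<in> A" "p \<in> fst c" "p \<notin> N" for c p
  proof -
    obtain b where b: "b \<in> B" "p \<in> fst b" using B(3) by blast
    then have "(F \<circ> chart_inv b) differentiable (at (snd b p))" using N(1) c(3) by auto
    then obtain D where D: "((F \<circ> chart_inv b) has_derivative D) (at (snd b p))" by (auto simp: differentiable_def)
    define \<zeta> where "\<zeta> = (\<chi> i. D (axis i 1))"
    have "D h = \<zeta> \<bullet> h" for h
    proof -
      have "D (\<Sum>i\<in>UNIV. h $ i *s axis i 1) = (\<Sum>i\<in>UNIV. h $ i * D (axis i 1))"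
        using has_derivative_linear[OF D] by (simp add: linear_sum linear_cmul scalar_mult_eq_scaleR)
      then show ?thesis by (simp add: basis_expansion \<zeta>_def inner_vec_def mult.commute)
    qed
    then have "D = (\<lambda>h. \<zeta> \<bullet> h)" by (rule ext)
    then show ?thesis using chart_derivative_change[OF c(1) _ c(2) b(2), of F \<zeta>] D b(1) B(2) by blast
  qed
  show ?thesis
  proof (rule that[of N "\<lambda>c p. SOME \<xi>. ((F \<circ> chart_inv c) has_derivative (\<lambda>h. \<xi> \<bullet> h)) (at (snd c p))"])
    show "N \<in> null_sets vol" using N by auto
    fix c p assume c: "c \<in> A" "p \<in> fst c" "p \<notin> N"
    show "((F \<circ> chart_inv c) has_derivative (\<lambda>h. (SOME \<xi>. ((F \<circ> chart_inv c) has_derivative (\<lambda>h. \<xi> \<bullet> h)) (at (snd c p))) \<bullet> h)) (at (snd c p))"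
      by (rule someI_ex[OF ex[OF c]])
  qed
qed

lemma lipschitz_weak_differential:
  assumes F: "geo_lipschitz {} L F" "L \<ge> 0"
  obtains N D where "N \<in> null_sets vol" "is_weak_differential A F D"
    "\<And>c p. c \<in> A \<Longrightarrow> p \<in> fst c \<Longrightarrow> p \<notin> N \<Longrightarrow> ((F \<circ> chart_inv c) has_derivative (\<lambda>h. D c p \<bullet> h)) (at (snd c p))"
proof -
  obtain N \<xi> where N: "N \<in> null_sets vol" and \<xi>:
    "\<And>c p. c \<in> A \<Longrightarrow> p \<in> fst c \<Longrightarrow> p \<notin> N \<Longrightarrow> ((F \<circ> chart_inv c) has_derivative (\<lambda>h. \<xi> c p \<bullet> h)) (at (snd c p))"
    by (rule lipschitz_derivative_AE[OF F]) (rule that)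
  \<comment> \<open>Setting the covector to 0 on \<open>N\<close> in all charts at once preserves
    the transformation rule, which is required at every point and not just almost
    everywhere.\<close>
  define D where "D c p = (if p \<in> N then 0 else \<xi> c p)" for c p
  have der: "((F \<circ> chart_inv c) has_derivative (\<lambda>h. D c p \<bullet> h)) (at (snd c p))"
    if "c \<in> A" "p \<in> fst c" "p \<notin> N" for c p using \<xi>[OF that] that by (simp add: D_def)
  have trans: "D c p = transpose (transition_jacobian c e p) *v D e p"
    if c: "c \<in> A" "e \<in> A" "p \<in> fst c" "p \<in> fst e" for c e p
  proof (cases "p \<in> N")
    case False
    have "(\<lambda>h. D c p \<bullet> h) = (\<lambda>h. (transpose (transition_jacobian c e p) *v D e p) \<bullet> h)"
      by (rule has_derivative_unique[OF der[OF c(1,3) False] chart_derivative_change[OF c der[OF c(2,4) False]]])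
    then show ?thesis by (metis inner_commute vector_eq_rdot)
  qed (simp add: D_def)
  have "weak_gradient_on (chart_image c) (F \<circ> chart_inv c) (D c \<circ> chart_inv c)" if c: "c \<in> A" for c
  proof (rule locally_lipschitz_weak_gradient[OF open_image[OF c] geo_lipschitz_locally_lipschitz[OF F c]])
    let ?\<Omega> = "chart_image c" and ?F = "F \<circ> chart_inv c" and ?G = "D c \<circ> chart_inv c"
    have "AE p in vol. p \<notin> N" by (rule AE_not_in[OF N])
    from AE_chart[OF c this] show "AE u in lborel. u \<in> ?\<Omega> \<longrightarrow> (?F has_derivative (\<lambda>h. ?G u \<bullet> h)) (at u)"
    proof eventually_elim
      case (elim u)
      then show ?case using der[OF c chart_inv_in[OF c, of u]] chart_inv[OF c, of u] by auto
    qed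
    have cF: "continuous_on ?\<Omega> ?F"
      by (rule locally_lipschitz_continuous[OF open_image[OF c] geo_lipschitz_locally_lipschitz[OF F c]])
    \<comment> \<open>Extension by zero makes the difference quotients globally defined and
      measurable. At a point of the open chart image the shifted points eventually stay inside, so
      the limit is the derivative of the original function.\<close>
    define F1 where "F1 u = indicator ?\<Omega> u *\<^sub>R ?F u" for u
    have F1: "F1 \<in> borel_measurable borel"
      unfolding F1_def by (rule borel_measurable_continuous_on_indicator[OF _ cF]) (use open_image[OF c] in auto)
    define S where "S = ?\<Omega> - snd c ` (N \<inter> fst c)"
    have "N \<inter> fst c \<in> sets borel" using N open_dom[OF c] by (auto simp: null_sets_def)
    then have S: "S \<in> sets borel"
      using chart_image_sets[OF c, of "N \<inter> fst c"] open_image[OF c] by (auto simp: S_def)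
    have inS: "u \<in> S \<longleftrightarrow> u \<in> ?\<Omega> \<and> chart_inv c u \<notin> N" for u
      using chart_image_eq[OF c, of "N \<inter> fst c"] chart_inv_in[OF c, of u] by (auto simp: S_def)
    show "(\<lambda>u. indicator ?\<Omega> u *\<^sub>R ?G u) \<in> borel_measurable borel"
    proof (subst borel_measurable_euclidean_space, rule ballI)
      fix b :: "real^'k" assume "b \<in> Basis"
      define w where "w n u = indicator S u * (real (Suc n) * (F1 (u + (1 / real (Suc n)) *\<^sub>R b) - F1 u))" for n u
      have "(\<lambda>u. F1 (u + (1 / real (Suc n)) *\<^sub>R b)) \<in> borel_measurable borel" for n
        by (rule measurable_compose[OF _ F1]) (intro borel_measurable_continuous_onI continuous_intros)
      then have wm: "w n \<in> borel_measurable borel" for n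
        unfolding w_def using F1 S by measurable
      show "(\<lambda>u. (indicator ?\<Omega> u *\<^sub>R ?G u) \<bullet> b) \<in> borel_measurable borel"
      proof (rule borel_measurable_LIMSEQ_real[OF _ wm])
        fix u :: "real^'k"
        show "(\<lambda>n. w n u) \<longlonglongrightarrow> (indicator ?\<Omega> u *\<^sub>R ?G u) \<bullet> b"
        proof (cases "u \<in> S")
          case True
          then have u: "u \<in> ?\<Omega>" "chart_inv c u \<notin> N" using inS by auto
          have "(?F has_derivative (\<lambda>h. ?G u \<bullet> h)) (at u)"
            using der[OF c chart_inv_in[OF c u(1)] u(2)] chart_inv[OF c u(1)] by simp
          from derivative_imp_quotient[OF this]
          have lim: "(\<lambda>n. real (Suc n) * (?F (u + (1 / real (Suc n)) *\<^sub>R b) - ?F u)) \<longlonglongrightarrow> ?G u \<bullet> b" .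
          have "(\<lambda>n. u + (1 / real (Suc n)) *\<^sub>R b) \<longlonglongrightarrow> u + 0 *\<^sub>R b"
            using LIMSEQ_inverse_real_of_nat by (intro tendsto_intros) (simp add: inverse_eq_divide)
          then have "\<forall>\<^sub>F n in sequentially. u + (1 / real (Suc n)) *\<^sub>R b \<in> ?\<Omega>"
            using topological_tendstoD[OF _ open_image[OF c]] u(1) by (metis add.right_neutral scaleR_zero_left)
          then have "\<forall>\<^sub>F n in sequentially. real (Suc n) * (?F (u + (1 / real (Suc n)) *\<^sub>R b) - ?F u) = w n u"
            by eventually_elim (use True u in \<open>simp add: w_def F1_def\<close>)
          then have "(\<lambda>n. w n u) \<longlonglongrightarrow> ?G u \<bullet> b" by (rule Lim_transform_eventually[OF lim])
          then show ?thesis using u by simp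
        next
          case False
          then have z: "indicator ?\<Omega> u *\<^sub>R ?G u = 0" using inS[of u] by (auto simp: D_def indicator_def)
          have w0: "w n u = 0" for n using False by (simp add: w_def)
          show ?thesis unfolding z w0 inner_zero_left by (rule tendsto_const)
        qed
      qed
    qed
  qed
  then have "is_weak_differential A F D" using trans unfolding is_weak_differential_def by blast
  then show ?thesis using that N der by blast
qed

text \<open>The converse of \<open>covector_form_bound\<close>: testing with the vector dual to
  \<xi> attains the dual norm.\<close>

lemma covector_bound_dual:
  assumes c: "c \<in> A" "p \<in> fst c" and b: "\<And>h. \<xi> \<bullet> h \<le> a * nrm c p h" and "a \<ge> 0"
  shows "sqrt (\<xi> \<bullet> (matrix_inv (g c p) *v \<xi>)) \<le> a"
proof -
  have "det (g c p) > 0" using metric_pos[OF c] by (intro det_pos_definite)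
  then have inv: "invertible (g c p)" by (simp add: invertible_det_nz)
  define w where "w = matrix_inv (g c p) *v \<xi>"
  have gw: "g c p *v w = \<xi>"
    using someI_ex[OF inv[unfolded invertible_def]] by (simp add: w_def matrix_vector_mul_assoc matrix_inv_def)
  have sq: "\<xi> \<bullet> w = (nrm c p w)\<^sup>2" by (simp add: nrm_square[OF c] gw inner_commute)
  then have "nrm c p w * nrm c p w \<le> a * nrm c p w" using b[of w] by (simp add: power2_eq_square)
  then have "nrm c p w \<le> a" using \<open>a \<ge> 0\<close> nrm_nonneg[OF c, of w] by (cases "nrm c p w = 0") auto
  then show ?thesis using sq nrm_nonneg[OF c, of w] by (simp add: w_def[symmetric])
qed

lemma derivative_bound:
  assumes F: "geo_lipschitz {} L F" "L \<ge> 0" and c: "c \<in> A" "p \<in> fst c"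
    and der: "((F \<circ> chart_inv c) has_derivative (\<lambda>h. \<xi> \<bullet> h)) (at (snd c p))"
  shows "\<xi> \<bullet> h \<le> L * nrm c p h"
proof (rule field_le_epsilon)
  fix e :: real assume "e > 0"
  \<comment> \<open>The factor 1 + \<delta> of the local comparison then increases the bound by less
    than \<open>e\<close>; the summand 1 in the denominator covers the case that
    \<open>L * nrm c p h\<close> vanishes.\<close>
  define \<delta> where "\<delta> = e / (L * nrm c p h + 1)"
  have Ln: "L * nrm c p h \<ge> 0" using F(2) nrm_nonneg[OF c] by simp
  have \<delta>: "\<delta> > 0" using \<open>e > 0\<close> Ln by (simp add: \<delta>_def add_nonneg_pos)
  obtain r where r: "r > 0" "ball (snd c p) r \<subseteq> chart_image c"
    "\<And>u v. u \<in> ball (snd c p) r \<Longrightarrow> v \<in> ball (snd c p) r \<Longrightarrow>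
       d (chart_inv c u) (chart_inv c v) \<le> ennreal ((1 + \<delta>) * nrm c p (v - u))"
    using local_comparison[OF c \<delta>] by metis
  let ?F = "F \<circ> chart_inv c" and ?u = "snd c p"
  have "(\<lambda>n. 1 / real (Suc n) * norm h) \<longlonglongrightarrow> 0"
    using tendsto_mult[OF LIMSEQ_inverse_real_of_nat tendsto_const[of "norm h"]] by (simp add: inverse_eq_divide)
  from order_tendstoD(2)[OF this r(1)] obtain n0 where n0: "\<And>n. n \<ge> n0 \<Longrightarrow> 1 / real (Suc n) * norm h < r"
    by (auto simp: eventually_sequentially)
  have "\<xi> \<bullet> h \<le> L * ((1 + \<delta>) * nrm c p h)"
  proof (rule LIMSEQ_le_const2[OF derivative_imp_quotient[OF der]], intro exI[of _ n0] allI impI)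
    fix n assume n: "n \<ge> n0"
    define s where "s = 1 / real (Suc n)"
    have s: "s > 0" "real (Suc n) = 1 / s" by (simp_all add: s_def)
    have v: "?u + s *\<^sub>R h \<in> ball ?u r" using n0[OF n] s(1) unfolding s_def[symmetric] by (simp add: dist_norm)
    have "\<bar>?F ?u - ?F (?u + s *\<^sub>R h)\<bar> \<le> L * ((1 + \<delta>) * nrm c p (s *\<^sub>R h))"
      using r(3)[OF _ v, of ?u] r(1) \<delta> nrm_nonneg[OF c] by (simp, intro geo_lipschitz_bound[OF F]) auto
    then have "?F (?u + s *\<^sub>R h) - ?F ?u \<le> s * (L * ((1 + \<delta>) * nrm c p h))"
      using s(1) by (simp add: nrm_scaleR abs_le_iff mult_ac)
    then show "real (Suc n) * (?F (?u + (1 / real (Suc n)) *\<^sub>R h) - ?F ?u) \<le> L * ((1 + \<delta>) * nrm c p h)"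
      unfolding s_def[symmetric] s(2) using s(1) by (simp add: pos_divide_le_eq mult.commute)
  qed
  also have "\<dots> = L * nrm c p h + e * (L * nrm c p h / (L * nrm c p h + 1))"
    by (simp add: \<delta>_def algebra_simps)
  also have "\<dots> \<le> L * nrm c p h + e * 1"
    using \<open>e > 0\<close> Ln by (intro add_left_mono mult_left_mono) (auto simp: divide_le_eq_1)
  finally show "\<xi> \<bullet> h \<le> L * nrm c p h + e" by simp
qed

text \<open>Stated for an arbitrary weak differential, since the one in
  \<open>gradient_Linf_norm\<close> is chosen. Uniqueness is used in finitely many charts; as
  \<open>chart_at\<close> may pick a chart outside this finite family, equality is carried over by
  the transformation rule.\<close>

lemma lipschitz_covector_norm:
  assumes F: "geo_lipschitz {} L F" "L \<ge> 0" and D': "is_weak_differential A F D'"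
  shows "AE p in vol. covector_norm A g D' p \<le> L"
proof -
  obtain N D where N: "N \<in> null_sets vol" and D: "is_weak_differential A F D" and der:
    "\<And>c p. c \<in> A \<Longrightarrow> p \<in> fst c \<Longrightarrow> p \<notin> N \<Longrightarrow> ((F \<circ> chart_inv c) has_derivative (\<lambda>h. D c p \<bullet> h)) (at (snd c p))"
    by (rule lipschitz_weak_differential[OF F]) (rule that)
  obtain B where B: "finite B" "B \<subseteq> A" "(\<Union>c\<in>B. fst c) = UNIV" by (rule finite_atlas)
  have "AE p in vol. p \<in> fst c \<longrightarrow> D c p = D' c p" if c: "c \<in> A" for c
  proof (rule AE_chart_inv[OF c])
    have "weak_gradient_on (chart_image c) (F \<circ> chart_inv c) (D c \<circ> chart_inv c)"
      "weak_gradient_on (chart_image c) (F \<circ> chart_inv c) (D' c \<circ> chart_inv c)"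
      using D D' c by (auto simp: is_weak_differential_def)
    from weak_gradient_unique[OF open_image[OF c] this]
    show "AE u in lborel. u \<in> chart_image c \<longrightarrow> D c (chart_inv c u) = D' c (chart_inv c u)" by simp
  qed
  then have "AE p in vol. \<forall>c\<in>B. p \<in> fst c \<longrightarrow> D c p = D' c p" using B by (intro AE_finite_allI) auto
  then show ?thesis
    using AE_not_in[OF N]
  proof eventually_elim
    case (elim p)
    define e where "e = chart_at A p"
    have e: "e \<in> A" "p \<in> fst e" using chart_at[of p] by (auto simp: e_def)
    obtain b where b: "b \<in> B" "p \<in> fst b" using B(3) by blast
    have bA: "b \<in> A" using b B by blast
    have "D' e p = transpose (transition_jacobian e b p) *v D' b p"
      using D' e b bA unfolding is_weak_differential_def by blast
    also have "\<dots> = transpose (transition_jacobian e b p) *v D b p" using elim(1) b by simp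
    also have "\<dots> = D e p" using D e b bA unfolding is_weak_differential_def by (metis IntI)
    finally have eq: "D' e p = D e p" .
    show ?case
      unfolding covector_norm_def Let_def e_def[symmetric] eq
      by (rule covector_bound_dual[OF e _ F(2)]) (rule derivative_bound[OF F e der[OF e elim(2)]])
  qed
qed

end

section \<open>The sup norm and the vector space of essentially bounded functions\<close>

lemma Linf_norm_AE: "AE x in M. ennreal \<bar>f x\<bar> \<le> Linf_norm M f"
  unfolding Linf_norm_def by (rule esssup_AE)

lemma Linf_norm_le: "f \<in> borel_measurable M \<Longrightarrow> AE x in M. ennreal \<bar>f x\<bar> \<le> c \<Longrightarrow> Linf_norm M f \<le> c"
  unfolding Linf_norm_def by (rule esssup_I) auto

lemma Linf_norm_add:
  assumes "f \<in> borel_measurable M" "h \<in> borel_measurable M"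
  shows "Linf_norm M (\<lambda>x. f x + h x) \<le> Linf_norm M f + Linf_norm M h"
proof (rule Linf_norm_le)
  show "AE x in M. ennreal \<bar>f x + h x\<bar> \<le> Linf_norm M f + Linf_norm M h"
    using Linf_norm_AE[of f M] Linf_norm_AE[of h M]
  proof eventually_elim
    case (elim x)
    have "ennreal \<bar>f x + h x\<bar> \<le> ennreal (\<bar>f x\<bar> + \<bar>h x\<bar>)" by (intro ennreal_leI abs_triangle_ineq)
    also have "\<dots> = ennreal \<bar>f x\<bar> + ennreal \<bar>h x\<bar>" by simp
    also have "\<dots> \<le> Linf_norm M f + Linf_norm M h" by (intro add_mono elim)
    finally show ?case .
  qed
qed (use assms in measurable)

lemma Linf_norm_scale_le:
  assumes "f \<in> borel_measurable M" shows "Linf_norm M (\<lambda>x. c * f x) \<le> ennreal \<bar>c\<bar> * Linf_norm M f"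
proof (rule Linf_norm_le)
  show "AE x in M. ennreal \<bar>c * f x\<bar> \<le> ennreal \<bar>c\<bar> * Linf_norm M f"
    using Linf_norm_AE[of f M] by eventually_elim (simp add: abs_mult ennreal_mult mult_left_mono)
qed (use assms in measurable)

lemma Linf_norm_scale:
  assumes f: "f \<in> borel_measurable M" and c: "c \<noteq> 0"
  shows "Linf_norm M (\<lambda>x. c * f x) = ennreal \<bar>c\<bar> * Linf_norm M f"
proof (rule antisym[OF Linf_norm_scale_le[OF f]])
  have "Linf_norm M (\<lambda>x. inverse c * (c * f x)) \<le> ennreal \<bar>inverse c\<bar> * Linf_norm M (\<lambda>x. c * f x)"
    by (rule Linf_norm_scale_le) (use f in measurable)
  then have "Linf_norm M f \<le> ennreal \<bar>inverse c\<bar> * Linf_norm M (\<lambda>x. c * f x)"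
    using c by (simp add: mult.assoc[symmetric])
  then have "ennreal \<bar>c\<bar> * Linf_norm M f \<le> ennreal \<bar>c\<bar> * (ennreal \<bar>inverse c\<bar> * Linf_norm M (\<lambda>x. c * f x))"
    by (rule mult_left_mono) simp
  also have "\<dots> = Linf_norm M (\<lambda>x. c * f x)"
    using c by (simp add: mult.assoc[symmetric] abs_inverse flip: ennreal_mult')
  finally show "ennreal \<bar>c\<bar> * Linf_norm M f \<le> Linf_norm M (\<lambda>x. c * f x)" .
qed

lemma Linf_norm_minus: "Linf_norm M (\<lambda>x. - f x) = Linf_norm M f"
  by (simp add: Linf_norm_def)

lemma Linf_norm_zero: "Linf_norm M (\<lambda>x. 0) = 0"
  using Linf_norm_le[of "\<lambda>x. 0" M 0] by simp

lemma LinfD: "f \<in> Linf M \<Longrightarrow> f \<in> borel_measurable M" "f \<in> Linf M \<Longrightarrow> Linf_norm M f < top"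
  by (auto simp: Linf_def)

lemma Linf_bound:
  assumes "f \<in> Linf M" shows "AE x in M. \<bar>f x\<bar> \<le> enn2real (Linf_norm M f)"
  using Linf_norm_AE[of f M]
proof eventually_elim
  case (elim x)
  then have "enn2real (ennreal \<bar>f x\<bar>) \<le> enn2real (Linf_norm M f)"
    using LinfD(2)[OF assms] by (intro enn2real_mono)
  then show ?case by simp
qed

lemma LinfI:
  assumes "f \<in> borel_measurable M" "AE x in M. \<bar>f x\<bar> \<le> B"
  shows "f \<in> Linf M" "Linf_norm M f \<le> ennreal B"
proof -
  show "Linf_norm M f \<le> ennreal B"
    by (rule Linf_norm_le[OF assms(1)], use assms(2) in eventually_elim) (rule ennreal_leI)
  then show "f \<in> Linf M" using assms(1) ennreal_less_top order_le_less_trans by (fastforce simp: Linf_def)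
qed

lemma Linf_add: "f \<in> Linf M \<Longrightarrow> h \<in> Linf M \<Longrightarrow> (\<lambda>x. f x + h x) \<in> Linf M"
  using Linf_norm_add[of f M h] by (auto simp: Linf_def intro: order_le_less_trans)

lemma Linf_scale: "f \<in> Linf M \<Longrightarrow> (\<lambda>x. c * f x) \<in> Linf M"
  using Linf_norm_scale_le[of f M c] by (auto simp: Linf_def ennreal_mult_less_top intro: order_le_less_trans)

lemma Linf_minus: "f \<in> Linf M \<Longrightarrow> (\<lambda>x. - f x) \<in> Linf M"
  using Linf_scale[of f M "-1"] by simp

lemma Linf_diff: "f \<in> Linf M \<Longrightarrow> h \<in> Linf M \<Longrightarrow> (\<lambda>x. f x - h x) \<in> Linf M"
  using Linf_add[OF _ Linf_minus] by fastforce

text \<open>Integrability over compact sets is the only information on \<open>G\<close>; an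
  exhaustion of \<Omega> by compact sets turns it into measurability.\<close>

lemma weak_gradient_measurable:
  assumes \<Omega>: "open \<Omega>" and w: "weak_gradient_on \<Omega> F G"
  shows "(\<lambda>u. indicator \<Omega> u *\<^sub>R G u) \<in> borel_measurable borel"
proof -
  obtain C where C: "\<And>n. compact (C n)" "\<And>n. C n \<subseteq> \<Omega>" "\<And>n. C n \<subseteq> interior (C (Suc n))" "\<Union>(range C) = \<Omega>"
    by (rule open_Union_compact_subsets[OF \<Omega>]) (rule that)
  have mono: "C m \<subseteq> C n" if "m \<le> n" for m n
    using that by (induction n rule: dec_induct) (use C(3) interior_subset in blast)+
  have m: "(\<lambda>u. indicator (C n) u *\<^sub>R G u) \<in> borel_measurable borel" for n
  proof -
    have "set_integrable lborel (C n) G" using w C(1,2) by (auto simp: weak_gradient_on_def)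
    then show ?thesis by (auto simp: set_integrable_def)
  qed
  show ?thesis
  proof (rule borel_measurable_LIMSEQ_metric[OF m])
    fix u
    have "\<forall>\<^sub>F n in sequentially. indicator (C n) u *\<^sub>R G u = indicator \<Omega> u *\<^sub>R G u"
    proof (cases "u \<in> \<Omega>")
      case True
      then obtain n0 where "u \<in> C n0" using C(4) by blast
      then show ?thesis using mono True unfolding eventually_sequentially
        by (intro exI[of _ n0]) (auto simp: indicator_def)
    next
      case False
      then show ?thesis using C(2) by (intro always_eventually) (auto simp: indicator_def)
    qed
    then show "(\<lambda>n. indicator (C n) u *\<^sub>R G u) \<longlonglongrightarrow> indicator \<Omega> u *\<^sub>R G u" by (rule tendsto_eventually)
  qed
qed

section \<open>W^{1,infinity} as the space of bounded Lipschitz functions\<close>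

context closed_manifold begin

definition dual_nrm :: "('a,'k) chart \<Rightarrow> 'a \<Rightarrow> real^'k \<Rightarrow> real" where
  "dual_nrm c p \<xi> = sqrt (\<xi> \<bullet> (matrix_inv (g c p) *v \<xi>))"

text \<open>The real \<open>sqrt\<close> is negative on negative arguments, so this is not
  automatic; it follows from Cauchy-Schwarz against some nonzero vector.\<close>

lemma dual_nrm_nonneg:
  assumes "c \<in> A" "p \<in> fst c" shows "dual_nrm c p \<xi> \<ge> 0"
proof -
  obtain b :: "real^'k" where "b \<in> Basis" using nonempty_Basis by blast
  then have "b \<noteq> 0" by (rule nonzero_Basis)
  then have "nrm c p b > 0" using metric_pos[OF assms, of b] by (simp add: nrm_def)
  moreover have "0 \<le> dual_nrm c p \<xi> * nrm c p b"
    using covector_form_bound[OF assms, of \<xi> b] by (auto simp: dual_nrm_def intro: order_trans[OF abs_ge_zero])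
  ultimately show ?thesis by (simp add: zero_le_mult_iff)
qed

text \<open>Bounding the dual norm by its supremum characterisation in both directions avoids inverting
  the transformation rule of the metric.\<close>

lemma covector_norm_in_chart:
  assumes D: "is_weak_differential A f D" and c: "c \<in> A" "p \<in> fst c"
  shows "covector_norm A g D p = dual_nrm c p (D c p)"
proof -
  define e where "e = chart_at A p"
  have e: "e \<in> A" "p \<in> fst e" using chart_at[of p] by (auto simp: e_def)
  have le: "dual_nrm c p (D c p) \<le> dual_nrm e p (D e p)" if c: "c \<in> A" "p \<in> fst c" and e: "e \<in> A" "p \<in> fst e" for c e
    unfolding dual_nrm_def[of c p "D c p"]
  proof (rule covector_bound_dual[OF c _ dual_nrm_nonneg[OF e]])
    fix h
    let ?J = "transition_jacobian c e p"
    have "D c p = transpose ?J *v D e p" using D c e unfolding is_weak_differential_def by blast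
    then have "D c p \<bullet> h = D e p \<bullet> (?J *v h)" by (simp add: dot_transpose)
    also have "\<dots> \<le> dual_nrm e p (D e p) * nrm e p (?J *v h)"
      using covector_form_bound[OF e, of "D e p" "?J *v h"] by (simp add: dual_nrm_def)
    also have "nrm e p (?J *v h) = nrm c p h"
      by (simp add: nrm_def metric_form_transform[OF c(1) e(1) c(2) e(2)])
    finally show "D c p \<bullet> h \<le> dual_nrm e p (D e p) * nrm c p h" .
  qed
  have "covector_norm A g D p = dual_nrm e p (D e p)"
    by (simp add: covector_norm_def dual_nrm_def e_def[symmetric])
  also have "\<dots> = dual_nrm c p (D c p)" using le[OF c e] le[OF e c] by simp
  finally show ?thesis .
qed

text \<open>Cramer's rule exhibits the inverse metric as a measurable function of the coordinates.\<close>

lemma covector_norm_measurable: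
  assumes D: "is_weak_differential A f D"
  shows "covector_norm A g D \<in> borel_measurable borel"
proof -
  obtain B where B: "finite B" "B \<subseteq> A" "(\<Union>c\<in>B. fst c) = UNIV" by (rule finite_atlas)
  show ?thesis
  proof (rule measurable_piecewise_restrict[of "fst ` B"])
    show "countable (fst ` B)" using B(1) by (simp add: countable_finite)
    show "space borel \<subseteq> \<Union>(fst ` B)" using B(3) by simp
    show "U \<inter> space borel \<in> sets borel" if "U \<in> fst ` B" for U using that B(2) open_dom by auto
    fix U assume "U \<in> fst ` B"
    then obtain c where c: "c \<in> A" "U = fst c" using B(2) by blast
    let ?\<Omega> = "chart_image c"
    have w: "weak_gradient_on ?\<Omega> (f \<circ> chart_inv c) (D c \<circ> chart_inv c)"
      using D c(1) unfolding is_weak_differential_def by blast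
    define \<xi> where "\<xi> u = indicator ?\<Omega> u *\<^sub>R D c (chart_inv c u)" for u
    define M where "M u = indicator ?\<Omega> u *\<^sub>R g c (chart_inv c u)" for u
    have xm: "\<xi> \<in> borel_measurable borel"
      using weak_gradient_measurable[OF open_image[OF c(1)] w] by (simp add: \<xi>_def[abs_def] o_def)
    have Mm: "M \<in> borel_measurable borel"
      unfolding M_def by (rule borel_measurable_continuous_on_indicator[OF _ metric_cont[OF c(1)]]) (use open_image[OF c(1)] in auto)
    have comp[measurable]: "(\<lambda>u. \<xi> u $ i) \<in> borel_measurable borel" for i
      by (rule borel_measurable_continuous_on[OF linear_continuous_on[OF bounded_linear_vec_nth] xm])
    have Mcomp[measurable]: "(\<lambda>u. M u $ i $ j) \<in> borel_measurable borel" for i j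
      by (rule borel_measurable_continuous_on[OF linear_continuous_on[OF bounded_linear_compose[OF bounded_linear_vec_nth bounded_linear_vec_nth]] Mm])
    define T where "T u = sqrt (\<Sum>k\<in>UNIV. \<xi> u $ k *
       (det ((\<chi> i j. if j = k then \<xi> u $ i else M u $ i $ j) :: real^'k^'k) / det (M u)))" for u
    have Tm: "T \<in> borel_measurable borel"
      unfolding T_def det_def vec_lambda_beta by measurable
    have "T \<circ> snd c \<in> borel_measurable (restrict_space borel (fst c))"
      by (rule measurable_comp[OF borel_measurable_continuous_on_restrict[OF cont_chart[OF c(1)]] Tm])
    moreover have "(T \<circ> snd c) p = covector_norm A g D p" if p: "p \<in> fst c" for p
    proof -
      have u: "snd c p \<in> ?\<Omega>" "chart_inv c (snd c p) = p" using chart_in[OF c(1) p] inv_chart[OF c(1) p] by auto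
      then have x: "\<xi> (snd c p) = D c p" "M (snd c p) = g c p" by (simp_all add: \<xi>_def M_def)
      have det: "det (g c p) > 0" using metric_pos[OF c(1) p] by (intro det_pos_definite)
      then have inv: "invertible (g c p)" by (simp add: invertible_det_nz)
      have "g c p *v (matrix_inv (g c p) *v D c p) = D c p"
        using someI_ex[OF inv[unfolded invertible_def]] by (simp add: matrix_vector_mul_assoc matrix_inv_def)
      then have "matrix_inv (g c p) *v D c p = (\<chi> k. det (\<chi> i j. if j = k then D c p $ i else g c p $ i $ j) / det (g c p))"
        using cramer[of "g c p"] det by simp
      then have "T (snd c p) = dual_nrm c p (D c p)"
        unfolding T_def x dual_nrm_def inner_vec_def by simp
      then show ?thesis using covector_norm_in_chart[OF D c(1) p] by simp
    qed
    ultimately show "covector_norm A g D \<in> borel_measurable (restrict_space borel U)"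
      unfolding c(2) by (subst measurable_cong[of _ _ "T \<circ> snd c"]) (auto simp: space_restrict_space)
  qed
qed

lemma W1infD:
  assumes "f \<in> W1inf A g vol"
  shows "f \<in> Linf vol" "is_weak_differential A f (weak_differential A f)" "gradient_Linf_norm A g vol f < top"
proof -
  show "f \<in> Linf vol" "gradient_Linf_norm A g vol f < top" using assms by (auto simp: W1inf_def)
  have "\<exists>D. is_weak_differential A f D" using assms by (auto simp: W1inf_def)
  then show "is_weak_differential A f (weak_differential A f)" unfolding weak_differential_def by (rule someI_ex)
qed

lemma W1inf_lipschitz:
  assumes f: "f \<in> W1inf A g vol" and L: "gradient_Linf_norm A g vol f \<le> ennreal L" "L \<ge> 0"
  obtains N where "N \<in> null_sets vol" "geo_lipschitz N L f"
proof (rule weak_differential_lipschitz[OF W1infD(2)[OF f] _ L(2)])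
  show "AE p in vol. covector_norm A g (weak_differential A f) p \<le> L"
    using Linf_norm_AE[of "covector_norm A g (weak_differential A f)" vol]
  proof eventually_elim
    case (elim p)
    then have "ennreal \<bar>covector_norm A g (weak_differential A f) p\<bar> \<le> ennreal L"
      using L(1) unfolding gradient_Linf_norm_def by (rule order_trans)
    then show ?case using L(2) by simp
  qed
qed (rule that)

lemma weak_differential_cong_AE:
  assumes f: "f \<in> borel_measurable borel" "h \<in> borel_measurable borel" and eq: "AE p in vol. f p = h p"
    and D: "is_weak_differential A f D"
  shows "is_weak_differential A h D"
proof -
  have "weak_gradient_on (chart_image c) (h \<circ> chart_inv c) (D c \<circ> chart_inv c)" if c: "c \<in> A" for c
  proof (rule weak_gradient_cong_AE[OF open_image[OF c] _ chart_measurable[OF c f(2)]])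
    show "AE u in lborel. u \<in> chart_image c \<longrightarrow> (f \<circ> chart_inv c) u = (h \<circ> chart_inv c) u"
      using AE_chart[OF c eq] by simp
    show "weak_gradient_on (chart_image c) (f \<circ> chart_inv c) (D c \<circ> chart_inv c)"
      using D c unfolding is_weak_differential_def by blast
  qed
  moreover have "\<forall>c\<in>A. \<forall>e\<in>A. \<forall>p\<in>fst c \<inter> fst e. D c p = transpose (transition_jacobian c e p) *v D e p"
    using D unfolding is_weak_differential_def by (rule conjunct2)
  ultimately show ?thesis unfolding is_weak_differential_def by blast
qed

lemma geo_lipschitz_continuous:
  assumes F: "geo_lipschitz {} L F" "L \<ge> 0" shows "continuous_on UNIV F"
  unfolding continuous_on_eq_continuous_at[OF open_UNIV]
proof
  fix p
  show "isCont F p"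
    unfolding isCont_def
  proof (rule tendstoI)
    fix e :: real assume e: "e > 0"
    have pos: "e / (2 * (L + 1)) > 0" using e F(2) by simp
    obtain U where U: "open U" "p \<in> U" "\<And>q. q \<in> U \<Longrightarrow> d p q < ennreal (e / (2 * (L + 1)))"
      by (rule small_neighbourhood[OF pos]) (rule that)
    have "dist (F q) (F p) < e" if q: "q \<in> U" for q
    proof -
      have "\<bar>F p - F q\<bar> \<le> L * (e / (2 * (L + 1)))"
        using U(3)[OF q] pos by (intro geo_lipschitz_bound[OF F]) auto
      also have "\<dots> < e"
      proof -
        have "L * e + e * 2 > 0" using e F(2) by (intro add_nonneg_pos) auto
        then show ?thesis using F(2) by (simp add: field_simps)
      qed
      finally show ?thesis by (simp add: dist_real_def abs_minus_commute)
    qed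
    then show "\<forall>\<^sub>F q in at p. dist (F q) (F p) < e"
      using U(1,2) by (auto simp: eventually_at_topological)
  qed
qed

text \<open>\<open>f\<close> is replaced by an everywhere Lipschitz function equal to it almost
  everywhere (\<open>lipschitz_extension\<close> with defect 0); the two have the same weak
  differentials. Together with \<open>W1inf_lipschitz\<close> this identifies a gradient bound with
  the Lipschitz constant off a null set.\<close>

lemma lipschitz_W1inf:
  assumes f: "f \<in> Linf vol" and N: "N \<in> null_sets vol" "geo_lipschitz N L f" and L: "L \<ge> 0"
  shows "f \<in> W1inf A g vol" "gradient_Linf_norm A g vol f \<le> ennreal L"
proof -
  define b where "b = enn2real (Linf_norm vol f)"
  have "AE x in vol. \<bar>f x\<bar> \<le> b" using Linf_bound[OF f] by (simp add: b_def)
  then obtain Q where Q: "{x \<in> space vol. \<not> \<bar>f x\<bar> \<le> b} \<subseteq> Q" "emeasure vol Q = 0" "Q \<in> sets vol" by (rule AE_E)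
  have NQ: "N \<union> Q \<in> null_sets vol" using N(1) Q(2,3) by (intro null_sets.Un) auto
  obtain F where F: "geo_lipschitz {} L F" "\<And>x. x \<notin> N \<union> Q \<Longrightarrow> \<bar>F x - f x\<bar> \<le> L * 0"
  proof (rule lipschitz_extension[OF NQ, of f b L 0])
    show "\<bar>f x\<bar> \<le> b" if "x \<notin> N \<union> Q" for x using Q(1) that by auto
    show "\<bar>f x - f y\<bar> \<le> L * (dr x y + 0)" if "x \<notin> N \<union> Q" "y \<notin> N \<union> Q" "d x y < top" for x y
      using N(2) that by (simp add: geo_lipschitz_def)
  qed (use L that in auto)
  have eq: "AE p in vol. F p = f p"
    using AE_not_in[OF NQ] by eventually_elim (use F(2) in auto)
  have fm: "f \<in> borel_measurable borel" using LinfD(1)[OF f] by simp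
  have Fm: "F \<in> borel_measurable borel"
    by (rule borel_measurable_continuous_onI[OF geo_lipschitz_continuous[OF F(1) L]])
  obtain N' D where D: "N' \<in> null_sets vol" "is_weak_differential A F D"
    "\<And>c p. c \<in> A \<Longrightarrow> p \<in> fst c \<Longrightarrow> p \<notin> N' \<Longrightarrow> ((F \<circ> chart_inv c) has_derivative (\<lambda>h. D c p \<bullet> h)) (at (snd c p))"
    by (rule lipschitz_weak_differential[OF F(1) L]) (rule that)
  have ex: "is_weak_differential A f D" by (rule weak_differential_cong_AE[OF Fm fm eq D(2)])
  then have W: "is_weak_differential A f (weak_differential A f)"
    unfolding weak_differential_def by (rule someI[of "is_weak_differential A f"])
  have "AE p in vol. f p = F p" using eq by eventually_elim simp
  from weak_differential_cong_AE[OF fm Fm this W]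
  have "AE p in vol. covector_norm A g (weak_differential A f) p \<le> L"
    by (rule lipschitz_covector_norm[OF F(1) L])
  moreover have "covector_norm A g (weak_differential A f) p \<ge> 0" for p
    using chart_at[of p] covector_norm_in_chart[OF W, of "chart_at A p" p] dual_nrm_nonneg by simp
  ultimately have "AE p in vol. ennreal \<bar>covector_norm A g (weak_differential A f) p\<bar> \<le> ennreal L"
    by (auto elim!: eventually_mono intro!: ennreal_leI)
  then show gr: "gradient_Linf_norm A g vol f \<le> ennreal L"
    unfolding gradient_Linf_norm_def by (intro Linf_norm_le) (use covector_norm_measurable[OF W] in simp_all)
  show "f \<in> W1inf A g vol"
    using f ex order_le_less_trans[OF gr ennreal_less_top] by (auto simp: W1inf_def)
qed

end

section \<open>Genus and variational eigenvalues\<close>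

text \<open>Real-valued, so that limits and linear arithmetic apply. On functions of infinite norm
  the value is 0 and carries no information.\<close>

definition Lnorm :: "'a measure \<Rightarrow> ('a \<Rightarrow> real) \<Rightarrow> real" where
  "Lnorm M f = enn2real (Linf_norm M f)"

lemma Lnorm_nonneg [simp]: "Lnorm M f \<ge> 0"
  by (simp add: Lnorm_def)

lemma Linf_norm_eq: "f \<in> Linf M \<Longrightarrow> Linf_norm M f = ennreal (Lnorm M f)"
  by (simp add: Lnorm_def LinfD)

lemma Lnorm_AE: "f \<in> Linf M \<Longrightarrow> AE x in M. \<bar>f x\<bar> \<le> Lnorm M f"
  unfolding Lnorm_def by (rule Linf_bound)

lemma Lnorm_le:
  assumes "f \<in> borel_measurable M" "AE x in M. \<bar>f x\<bar> \<le> B" "B \<ge> 0" shows "Lnorm M f \<le> B"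
  unfolding Lnorm_def by (rule enn2real_leI[OF assms(3) LinfI(2)[OF assms(1,2)]])

lemma Lnorm_less: "f \<in> Linf M \<Longrightarrow> Linf_norm M f < ennreal e \<Longrightarrow> Lnorm M f < e"
  by (simp add: Linf_norm_eq ennreal_less_iff)

lemma Lnorm_add:
  assumes "f \<in> Linf M" "h \<in> Linf M" shows "Lnorm M (\<lambda>x. f x + h x) \<le> Lnorm M f + Lnorm M h"
proof (rule Lnorm_le)
  show "AE x in M. \<bar>f x + h x\<bar> \<le> Lnorm M f + Lnorm M h"
    using Lnorm_AE[OF assms(1)] Lnorm_AE[OF assms(2)] by eventually_elim linarith
qed (use LinfD(1)[OF Linf_add[OF assms]] in auto)

lemma Lnorm_minus: "Lnorm M (\<lambda>x. - f x) = Lnorm M f"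
  by (simp add: Lnorm_def Linf_norm_minus)

lemma Lnorm_scale: "f \<in> borel_measurable M \<Longrightarrow> Lnorm M (\<lambda>x. c * f x) = \<bar>c\<bar> * Lnorm M f"
  by (cases "c = 0") (simp_all add: Lnorm_def Linf_norm_zero Linf_norm_scale enn2real_mult)

lemma Lnorm_commute: "Lnorm M (\<lambda>x. f x - h x) = Lnorm M (\<lambda>x. h x - f x)"
  using Lnorm_minus[of M "\<lambda>x. f x - h x"] by simp

lemma Lnorm_triangle:
  assumes "f \<in> Linf M" "h \<in> Linf M" "k \<in> Linf M"
  shows "Lnorm M (\<lambda>x. f x - k x) \<le> Lnorm M (\<lambda>x. f x - h x) + Lnorm M (\<lambda>x. h x - k x)"
  using Lnorm_add[OF Linf_diff[OF assms(1,2)] Linf_diff[OF assms(2,3)]] by (simp only: add_diff_eq diff_add_cancel)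

lemma Lnorm_diff_ge:
  assumes "f \<in> Linf M" "h \<in> Linf M" shows "\<bar>Lnorm M f - Lnorm M h\<bar> \<le> Lnorm M (\<lambda>x. f x - h x)"
proof -
  have le: "Lnorm M f \<le> Lnorm M (\<lambda>x. f x - h x) + Lnorm M h" if "f \<in> Linf M" "h \<in> Linf M" for f h
    using Lnorm_add[OF Linf_diff[OF that] that(2)] by (simp only: diff_add_cancel)
  show ?thesis using le[OF assms] le[OF assms(2,1)] Lnorm_commute[of M f h] by linarith
qed

text \<open>The neighbourhood filter of \<open>f\<close> within \<open>S\<close> for the sup
  seminorm. It lets the rules for \<open>tendsto\<close> be used for a topology that is a value and
  not a type class instance.\<close>

definition near :: "'a measure \<Rightarrow> ('a \<Rightarrow> real) set \<Rightarrow> ('a \<Rightarrow> real) \<Rightarrow> ('a \<Rightarrow> real) filter" where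
  "near M S f = inf (filtercomap (\<lambda>h. Lnorm M (\<lambda>x. h x - f x)) (nhds 0)) (principal S)"

lemma tendsto_near: "((\<lambda>h. Lnorm M (\<lambda>x. h x - f x)) \<longlongrightarrow> 0) (near M S f)"
  unfolding near_def by (rule tendsto_mono[OF inf_le1 filterlim_filtercomap])

lemma eventually_near_mem: "\<forall>\<^sub>F h in near M S f. h \<in> S"
  unfolding near_def eventually_inf_principal by simp

lemma eventually_nearD:
  assumes "eventually P (near M S f)"
  shows "\<exists>\<delta>>0. \<forall>h\<in>S. Lnorm M (\<lambda>x. h x - f x) < \<delta> \<longrightarrow> P h"
proof -
  obtain Q where Q: "eventually Q (nhds 0)" "\<And>h. Q (Lnorm M (\<lambda>x. h x - f x)) \<Longrightarrow> h \<in> S \<longrightarrow> P h"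
    using assms unfolding near_def eventually_inf_principal eventually_filtercomap by blast
  obtain \<delta> where "\<delta> > 0" "\<And>t. dist t 0 < \<delta> \<Longrightarrow> Q t"
    using Q(1) unfolding eventually_nhds_metric by blast
  then show ?thesis using Q(2) by (intro exI[of _ \<delta>]) (auto simp: dist_real_def)
qed

lemma tendsto_near_Lnorm:
  assumes S: "S \<subseteq> Linf M" and f: "f \<in> Linf M" and k: "k \<in> Linf M"
  shows "((\<lambda>h. Lnorm M (\<lambda>x. h x - k x)) \<longlongrightarrow> Lnorm M (\<lambda>x. f x - k x)) (near M S f)"
proof (rule LIM_zero_cancel, rule tendsto_norm_zero_cancel)
  show "((\<lambda>h. norm (Lnorm M (\<lambda>x. h x - k x) - Lnorm M (\<lambda>x. f x - k x))) \<longlongrightarrow> 0) (near M S f)"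
  proof (rule tendsto_sandwich[OF _ _ tendsto_const tendsto_near])
    show "\<forall>\<^sub>F h in near M S f. norm (Lnorm M (\<lambda>x. h x - k x) - Lnorm M (\<lambda>x. f x - k x)) \<le> Lnorm M (\<lambda>x. h x - f x)"
      using eventually_near_mem
    proof eventually_elim
      case (elim h)
      then have "h \<in> Linf M" using S by blast
      then show ?case
        using Lnorm_diff_ge[OF Linf_diff[OF _ k] Linf_diff[OF f k], of h] by (simp add: algebra_simps)
    qed
  qed simp
qed

section \<open>Closedness, continuity and genus in seminorm topologies\<close>

lemma topspace_seminorm_topology: "topspace (seminorm_topology V N) = V"
proof
  show "topspace (seminorm_topology V N) \<subseteq> V"
    using openin_topspace[of "seminorm_topology V N"] unfolding openin_seminorm_topology by blast
  have "openin (seminorm_topology V N) V" unfolding openin_seminorm_topology by (auto intro: exI[of _ 1])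
  then show "V \<subseteq> topspace (seminorm_topology V N)" by (rule openin_subset)
qed

text \<open>As \<open>N\<close> dominates the sup norm, a set closed under sup-norm limits is closed
  for \<open>N\<close>. In particular no convergence of gradients has to be considered in
  W^{1,infinity}.\<close>

lemma closedin_seminormI:
  assumes C: "C \<subseteq> V" "V \<subseteq> Linf M"
    and diff: "\<And>f h. f \<in> V \<Longrightarrow> h \<in> V \<Longrightarrow> Linf_norm M (\<lambda>x. h x - f x) \<le> N (\<lambda>x. h x - f x)"
    and lim: "\<And>f. f \<in> V \<Longrightarrow> (\<And>e. e > 0 \<Longrightarrow> \<exists>h\<in>C. Lnorm M (\<lambda>x. h x - f x) < e) \<Longrightarrow> f \<in> C"
  shows "closedin (seminorm_topology V N) C"
  unfolding closedin_def topspace_seminorm_topology openin_seminorm_topology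
proof (intro conjI ballI)
  fix f assume f: "f \<in> V - C"
  then obtain e where e: "e > 0" "\<And>h. h \<in> C \<Longrightarrow> \<not> Lnorm M (\<lambda>x. h x - f x) < e" using lim by blast
  have "h \<in> V - C" if h: "h \<in> V" "N (\<lambda>x. h x - f x) < ennreal e" for h
  proof -
    have "Linf_norm M (\<lambda>x. h x - f x) < ennreal e" using diff[of f h] f h by (auto intro: order_le_less_trans)
    then have "Lnorm M (\<lambda>x. h x - f x) < e"
      by (rule Lnorm_less[rotated]) (rule Linf_diff, use C(2) f h(1) in auto)
    then show ?thesis using e(2) h(1) by blast
  qed
  then show "\<exists>e>0. \<forall>h\<in>V. N (\<lambda>x. h x - f x) < ennreal e \<longrightarrow> h \<in> V - C" using e(1) by blast
qed (use C in auto)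

text \<open>A function of seminorm 0 lies in every open set containing the zero function. Admissible
  sets therefore contain only functions of positive seminorm, which can be normalised.\<close>

lemma closed_avoid_zero:
  assumes "closedin (seminorm_topology V N) S" "(\<lambda>_. 0) \<notin> S" "(\<lambda>_. 0) \<in> V" "f \<in> S"
  shows "N f \<noteq> 0"
proof
  assume 0: "N f = 0"
  have "openin (seminorm_topology V N) (V - S)" "S \<subseteq> V"
    using assms(1) unfolding closedin_def topspace_seminorm_topology by auto
  moreover have "(\<lambda>_. 0) \<in> V - S" using assms(2,3) by blast
  ultimately have "\<exists>e>0. \<forall>h\<in>V. N (\<lambda>x. h x - 0) < ennreal e \<longrightarrow> h \<in> V - S"
    unfolding openin_seminorm_topology by (elim conjE) (drule (1) bspec)
  then obtain e where e: "e > 0" "\<forall>h\<in>V. N (\<lambda>x. h x - 0) < ennreal e \<longrightarrow> h \<in> V - S" by blast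
  have "f \<in> V" using assms(4) \<open>S \<subseteq> V\<close> by blast
  from bspec[OF e(2) this] show False using 0 assms(4) e(1) by simp
qed

text \<open>Continuity is checked along sup-norm convergence in the source, which suffices because
  the seminorm \<open>NX\<close> is at least the sup norm. The same criterion thus serves sources in
  both spaces.\<close>

lemma continuous_map_seminorm:
  assumes V: "V \<subseteq> Linf M" and SV: "S \<subseteq> V"
    and diff: "\<And>f h. f \<in> V \<Longrightarrow> h \<in> V \<Longrightarrow> Linf_norm M (\<lambda>x. h x - f x) \<le> NX (\<lambda>x. h x - f x)"
    and T: "\<And>f. f \<in> S \<Longrightarrow> T f \<in> S'" and S': "S' \<subseteq> W"
    and cont: "\<And>f e. f \<in> S \<Longrightarrow> e > 0 \<Longrightarrow> \<forall>\<^sub>F h in near M S f. NY (\<lambda>x. T h x - T f x) < ennreal e"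
  shows "continuous_map (subtopology (seminorm_topology V NX) S) (subtopology (seminorm_topology W NY) S') T"
  unfolding continuous_map
proof (intro conjI allI impI)
  show "T ` topspace (subtopology (seminorm_topology V NX) S) \<subseteq> topspace (subtopology (seminorm_topology W NY) S')"
    using T S' by (auto simp: topspace_seminorm_topology)
  fix U assume "openin (subtopology (seminorm_topology W NY) S') U"
  then obtain U' where U': "openin (seminorm_topology W NY) U'" "U = U' \<inter> S'" by (auto simp: openin_subtopology)
  define P where "P = {f \<in> S. T f \<in> U'}"
  have "\<exists>\<delta>>0. \<forall>h\<in>S. Lnorm M (\<lambda>x. h x - f x) < \<delta> \<longrightarrow> T h \<in> U'" if f: "f \<in> P" for f
  proof -
    obtain e where e: "e > 0" "\<And>h. h \<in> W \<Longrightarrow> NY (\<lambda>x. h x - T f x) < ennreal e \<Longrightarrow> h \<in> U'"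
      using U'(1) f unfolding openin_seminorm_topology P_def by blast
    obtain \<delta> where "\<delta> > 0" "\<And>h. h \<in> S \<Longrightarrow> Lnorm M (\<lambda>x. h x - f x) < \<delta> \<Longrightarrow> NY (\<lambda>x. T h x - T f x) < ennreal e"
      using eventually_nearD[OF cont[OF _ e(1)], of f] f by (auto simp: P_def)
    then show ?thesis using e(2) T S' by blast
  qed
  then obtain \<delta> where \<delta>: "\<And>f. f \<in> P \<Longrightarrow> \<delta> f > 0"
    "\<And>f h. f \<in> P \<Longrightarrow> h \<in> S \<Longrightarrow> Lnorm M (\<lambda>x. h x - f x) < \<delta> f \<Longrightarrow> T h \<in> U'" by metis
  \<comment> \<open>The sup-norm balls are taken in all of \<open>V\<close>, which makes their union
    open in the ambient topology, although \<open>T\<close> is controlled only on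
    \<open>S\<close>.\<close>
  define G where "G = (\<Union>f\<in>P. {h \<in> V. Lnorm M (\<lambda>x. h x - f x) < \<delta> f})"
  have "openin (seminorm_topology V NX) G"
    unfolding openin_seminorm_topology
  proof (intro conjI ballI)
    fix h assume "h \<in> G"
    then obtain f where f: "f \<in> P" "h \<in> V" "Lnorm M (\<lambda>x. h x - f x) < \<delta> f" by (auto simp: G_def)
    let ?e = "\<delta> f - Lnorm M (\<lambda>x. h x - f x)"
    have "h' \<in> G" if h': "h' \<in> V" "NX (\<lambda>x. h' x - h x) < ennreal ?e" for h'
    proof -
      have fV: "f \<in> V" using f(1) SV by (auto simp: P_def)
      have "Linf_norm M (\<lambda>x. h' x - h x) < ennreal ?e" using diff[OF f(2) h'(1)] h'(2) by (rule order_le_less_trans)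
      then have "Lnorm M (\<lambda>x. h' x - h x) < ?e"
        by (rule Lnorm_less[rotated]) (rule Linf_diff, use V f(2) h'(1) in auto)
      then have "Lnorm M (\<lambda>x. h' x - f x) < \<delta> f"
        using Lnorm_triangle[OF subsetD[OF V h'(1)] subsetD[OF V f(2)] subsetD[OF V fV]] by linarith
      then show ?thesis using f(1) h'(1) by (auto simp: G_def)
    qed
    then show "\<exists>e>0. \<forall>h'\<in>V. NX (\<lambda>x. h' x - h x) < ennreal e \<longrightarrow> h' \<in> G"
      using f(3) by (intro exI[of _ ?e]) auto
  qed (auto simp: G_def)
  moreover have "{f \<in> topspace (subtopology (seminorm_topology V NX) S). T f \<in> U} = G \<inter> S"
  proof -
    have "f \<in> G" if f: "f \<in> P" for f
    proof -
      have "Lnorm M (\<lambda>x. f x - f x) = 0" by (simp add: Lnorm_def Linf_norm_zero)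
      then show ?thesis using f \<delta>(1)[OF f] SV by (auto simp: G_def P_def intro!: bexI[of _ f])
    qed
    moreover have "h \<in> P" if h: "h \<in> G" "h \<in> S" for h
    proof -
      obtain f where "f \<in> P" "Lnorm M (\<lambda>x. h x - f x) < \<delta> f" using h(1) by (auto simp: G_def)
      from \<delta>(2)[OF this(1) h(2) this(2)] show ?thesis using h(2) by (simp add: P_def)
    qed
    moreover have "P \<subseteq> S" by (auto simp: P_def)
    ultimately have "P = G \<inter> S" by blast
    moreover have "{f \<in> topspace (subtopology (seminorm_topology V NX) S). T f \<in> U} = P"
    proof -
      have "topspace (subtopology (seminorm_topology V NX) S) = S"
        using SV by (simp add: topspace_seminorm_topology Int_absorb1)
      then show ?thesis using T unfolding U'(2) P_def by blast
    qed
    ultimately show ?thesis by simp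
  qed
  ultimately show "openin (subtopology (seminorm_topology V NX) S) {f \<in> topspace (subtopology (seminorm_topology V NX) S). T f \<in> U}"
    unfolding openin_subtopology by blast
qed

text \<open>An odd map on \<open>S'\<close> composed with \<open>T\<close> is an odd map on
  \<open>S\<close>, so every dimension admissible for \<open>S'\<close> is admissible for
  \<open>S\<close>.\<close>

lemma genus_mono:
  assumes T: "continuous_map (subtopology X S) (subtopology Y S') T"
    and odd: "\<And>f. f \<in> S \<Longrightarrow> T (\<lambda>x. - f x) = (\<lambda>x. - T f x)" and maps: "\<And>f. f \<in> S \<Longrightarrow> T f \<in> S'"
  shows "genus X S \<le> genus Y S'"
  unfolding genus_def
proof (rule INF_superset_mono[OF _ order_refl], safe)
  fix j \<phi>
  assume \<phi>: "continuous_map (subtopology Y S') (subtopology (Euclidean_space j) (- {\<lambda>_. 0})) \<phi>"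
    "\<forall>f\<in>S'. \<phi> (\<lambda>x. - f x) = (\<lambda>i. - \<phi> f i)"
  have "continuous_map (subtopology X S) (subtopology (Euclidean_space j) (- {\<lambda>_. 0})) (\<phi> \<circ> T)"
    by (rule continuous_map_compose[OF T \<phi>(1)])
  moreover have "\<forall>f\<in>S. (\<phi> \<circ> T) (\<lambda>x. - f x) = (\<lambda>i. - (\<phi> \<circ> T) f i)"
    using \<phi>(2) odd maps by simp
  ultimately show "\<exists>\<phi>. continuous_map (subtopology X S) (subtopology (Euclidean_space j) (- {\<lambda>_. 0})) \<phi> \<and>
      (\<forall>f\<in>S. \<phi> (\<lambda>x. - f x) = (\<lambda>i. - \<phi> f i))" by blast
qed

lemma variational_eigenvalue_le:
  assumes "S \<noteq> {}" "closedin X S" "\<And>f. f \<in> S \<Longrightarrow> (\<lambda>x. - f x) \<in> S" "(\<lambda>_. 0) \<notin> S" "enat m \<le> genus X S"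
    "\<And>f. f \<in> S \<Longrightarrow> R f \<le> b"
  shows "variational_eigenvalue X R m \<le> b"
  unfolding variational_eigenvalue_def by (rule INF_lower2[of S]) (use assms in \<open>auto intro: SUP_least\<close>)

lemma variational_eigenvalue_lessE:
  assumes "variational_eigenvalue X R m < b"
  obtains S c where "S \<noteq> {}" "closedin X S" "\<And>f. f \<in> S \<Longrightarrow> (\<lambda>x. - f x) \<in> S" "(\<lambda>_. 0) \<notin> S" "enat m \<le> genus X S"
    "\<And>f. f \<in> S \<Longrightarrow> R f \<le> c" "c < b"
proof -
  from assms obtain S where S: "S \<in> {S. S \<noteq> {} \<and> closedin X S \<and> (\<forall>f\<in>S. (\<lambda>x. - f x) \<in> S) \<and> (\<lambda>_. 0) \<notin> S \<and> enat m \<le> genus X S}"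
    "(SUP f\<in>S. R f) < b" unfolding variational_eigenvalue_def INF_less_iff by blast
  show ?thesis by (rule that[of S "SUP f\<in>S. R f"]) (use S in \<open>auto intro: SUP_upper\<close>)
qed

definition normalise :: "'a measure \<Rightarrow> ('a \<Rightarrow> real) \<Rightarrow> 'a \<Rightarrow> real" where
  "normalise M f = (\<lambda>x. inverse (Lnorm M f) * f x)"

lemma normalise_odd: "normalise M (\<lambda>x. - f x) = (\<lambda>x. - normalise M f x)"
  by (simp add: normalise_def Lnorm_minus)

lemma normalise_Linf:
  assumes f: "f \<in> Linf M" "Lnorm M f > 0"
  shows "normalise M f \<in> Linf M" "Lnorm M (normalise M f) = 1"
  unfolding normalise_def using Linf_scale[OF f(1)] f(2) by (auto simp: Lnorm_scale[OF LinfD(1)[OF f(1)]])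

lemma normalise_diff:
  assumes f: "f \<in> Linf M" "Lnorm M f > 0" and h: "h \<in> Linf M" "Lnorm M h > 0"
  shows "Lnorm M (\<lambda>x. normalise M h x - normalise M f x) \<le> 2 * Lnorm M (\<lambda>x. h x - f x) / Lnorm M h"
proof (rule Lnorm_le)
  have hf: "(\<lambda>x. h x - f x) \<in> Linf M" by (rule Linf_diff[OF h(1) f(1)])
  let ?D = "Lnorm M (\<lambda>x. h x - f x)"
  show "AE x in M. \<bar>normalise M h x - normalise M f x\<bar> \<le> 2 * ?D / Lnorm M h"
    using Lnorm_AE[OF hf] Lnorm_AE[OF f(1)]
  proof eventually_elim
    case (elim x)
    \<comment> \<open>The change of the numerator is separated from the change of the norm. Each
      contributes at most the distance of \<open>h\<close> and \<open>f\<close>, hence the factor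
      2.\<close>
    have "normalise M h x - normalise M f x = ((h x - f x) + (f x / Lnorm M f) * (Lnorm M f - Lnorm M h)) / Lnorm M h"
      using f(2) h(2) by (simp add: normalise_def field_simps)
    moreover have "\<bar>(h x - f x) + (f x / Lnorm M f) * (Lnorm M f - Lnorm M h)\<bar> \<le> ?D + 1 * ?D"
    proof (rule order_trans[OF abs_triangle_ineq add_mono[OF elim(1)]])
      have "\<bar>f x / Lnorm M f\<bar> \<le> 1" using elim(2) f(2) by (simp add: abs_divide)
      moreover have "\<bar>Lnorm M f - Lnorm M h\<bar> \<le> ?D"
        using Lnorm_diff_ge[OF f(1) h(1)] by (simp add: Lnorm_commute[of M f h])
      ultimately show "\<bar>f x / Lnorm M f * (Lnorm M f - Lnorm M h)\<bar> \<le> 1 * ?D"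
        unfolding abs_mult by (intro mult_mono) auto
    qed
    ultimately show ?case using h(2) by (simp add: abs_divide divide_right_mono)
  qed
  show "(\<lambda>x. normalise M h x - normalise M f x) \<in> borel_measurable M"
    by (rule LinfD(1)[OF Linf_diff[OF normalise_Linf(1)[OF h] normalise_Linf(1)[OF f]]])
qed (use h(2) in auto)

lemma normalise_continuous:
  assumes V: "V \<subseteq> Linf M" and S: "S \<subseteq> V" "\<And>f. f \<in> S \<Longrightarrow> Lnorm M f > 0"
    and diff: "\<And>f h. f \<in> V \<Longrightarrow> h \<in> V \<Longrightarrow> Linf_norm M (\<lambda>x. h x - f x) \<le> N (\<lambda>x. h x - f x)"
    and S': "\<And>f. f \<in> S \<Longrightarrow> normalise M f \<in> S'" "S' \<subseteq> Linf M"
  shows "continuous_map (subtopology (seminorm_topology V N) S) (subtopology (Linf_topology M) S') (normalise M)"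
  unfolding Linf_topology_def
proof (rule continuous_map_seminorm[OF V S(1) diff S'])
  fix f and e :: real assume f: "f \<in> S" and e: "e > 0"
  have fL: "f \<in> Linf M" using f S V by blast
  have SL: "S \<subseteq> Linf M" using S V by blast
  have "((\<lambda>h. Lnorm M (\<lambda>x. h x - 0)) \<longlongrightarrow> Lnorm M (\<lambda>x. f x - 0)) (near M S f)"
    by (rule tendsto_near_Lnorm[OF SL fL]) (simp add: Linf_def Linf_norm_zero)
  then have "((\<lambda>h. Lnorm M h) \<longlongrightarrow> Lnorm M f) (near M S f)" by simp
  then have "((\<lambda>h. 2 * Lnorm M (\<lambda>x. h x - f x) / Lnorm M h) \<longlongrightarrow> 2 * 0 / Lnorm M f) (near M S f)"
    using S(2)[OF f] by (intro tendsto_intros tendsto_near) auto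
  then have "\<forall>\<^sub>F h in near M S f. 2 * Lnorm M (\<lambda>x. h x - f x) / Lnorm M h < e"
    by (rule order_tendstoD) (use e in simp)
  then show "\<forall>\<^sub>F h in near M S f. Linf_norm M (\<lambda>x. normalise M h x - normalise M f x) < ennreal e"
    using eventually_near_mem
  proof eventually_elim
    case (elim h)
    then have h: "h \<in> Linf M" "Lnorm M h > 0" using SL S(2) by auto
    have "Lnorm M (\<lambda>x. normalise M h x - normalise M f x) < e"
      using normalise_diff[OF fL S(2)[OF f] h] elim(1) by linarith
    then show ?case
      using Linf_norm_eq[OF Linf_diff[OF normalise_Linf(1)[OF h] normalise_Linf(1)[OF fL S(2)[OF f]]]] e
      by (simp add: ennreal_less_iff)
  qed
qed

section \<open>The limit of the eigenvalues\<close>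

lemma le_of_harmonic_slack:
  fixes a b c :: real assumes "\<And>n. a \<le> b + c / real (Suc n)" shows "a \<le> b"
proof (rule LIMSEQ_le_const)
  have "(\<lambda>n. b + c / real (Suc n)) \<longlonglongrightarrow> b + 0"
    by (intro tendsto_add tendsto_const LIMSEQ_Suc[OF lim_const_over_n])
  then show "(\<lambda>n. b + c / real (Suc n)) \<longlonglongrightarrow> b" by simp
qed (use assms in auto)

text \<open>Fixes one null set for the whole approximating sequence, so that pointwise inequalities
  pass to the limit outside of it.\<close>

lemma Lnorm_limit:
  assumes C: "C \<subseteq> Linf M" and f: "f \<in> Linf M"
    and lim: "\<And>e. e > 0 \<Longrightarrow> \<exists>h\<in>C. Lnorm M (\<lambda>x. h x - f x) < e"
  obtains h Q where "\<And>n. h n \<in> C" "\<And>n. \<bar>Lnorm M (h n) - Lnorm M f\<bar> \<le> 1 / real (Suc n)" "Q \<in> null_sets M"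
    "\<And>n x. x \<in> space M \<Longrightarrow> x \<notin> Q \<Longrightarrow> \<bar>h n x - f x\<bar> \<le> 1 / real (Suc n)"
proof -
  have "\<forall>n. \<exists>h. h \<in> C \<and> Lnorm M (\<lambda>x. h x - f x) < 1 / real (Suc n)"
    using lim[of "1 / real (Suc n)" for n] by auto
  then obtain h where h: "\<And>n. h n \<in> C" "\<And>n. Lnorm M (\<lambda>x. h n x - f x) < 1 / real (Suc n)" by metis
  have hL: "h n \<in> Linf M" for n using h(1) C by blast
  have "AE x in M. \<forall>n. \<bar>h n x - f x\<bar> \<le> 1 / real (Suc n)"
    unfolding AE_all_countable
  proof
    fix n show "AE x in M. \<bar>h n x - f x\<bar> \<le> 1 / real (Suc n)"
      using Lnorm_AE[OF Linf_diff[OF hL[of n] f]] by eventually_elim (use h(2)[of n] in linarith)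
  qed
  then obtain Q where Q: "{x \<in> space M. \<not> (\<forall>n. \<bar>h n x - f x\<bar> \<le> 1 / real (Suc n))} \<subseteq> Q" "emeasure M Q = 0" "Q \<in> sets M"
    by (rule AE_E)
  show ?thesis
  proof (rule that[OF h(1)])
    show "\<bar>Lnorm M (h n) - Lnorm M f\<bar> \<le> 1 / real (Suc n)" for n
      using Lnorm_diff_ge[OF hL[of n] f] h(2)[of n] by linarith
    show "Q \<in> null_sets M" using Q(2,3) by (auto simp: null_sets_def)
    show "\<bar>h n x - f x\<bar> \<le> 1 / real (Suc n)" if "x \<in> space M" "x \<notin> Q" for n x using Q(1) that by blast
  qed
qed

lemma normalise_sub: "normalise M f x - normalise M f y = (f x - f y) / Lnorm M f"
  by (simp add: normalise_def divide_inverse algebra_simps)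

section \<open>From competitors on the manifold to competitors for the graphon\<close>

context closed_manifold begin

lemma AE_pair_off:
  assumes N: "N \<in> null_sets vol" shows "AE (x, y) in vol \<Otimes>\<^sub>M vol. x \<notin> N \<and> y \<notin> N"
proof -
  interpret finite_measure vol by (rule finite_volume)
  have U: "UNIV \<in> sets vol" using sets.top[of vol] by simp
  have "N \<times> UNIV \<union> UNIV \<times> N \<in> null_sets (vol \<Otimes>\<^sub>M vol)"
    by (intro null_sets.Un times_in_null_sets1 times_in_null_sets2 N U)
  from AE_not_in[OF this] show ?thesis by eventually_elim auto
qed

text \<open>The level \<open>K r\<close> corresponds to the Rayleigh quotient \<open>K / r\<^bsup>k-1\<^esup>\<close>.\<close>

definition coarse_sphere :: "real \<Rightarrow> real \<Rightarrow> ('a \<Rightarrow> real) set" where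
  "coarse_sphere r K = {f \<in> Linf vol. Lnorm vol f = 1 \<and>
     (AE (x, y) in vol \<Otimes>\<^sub>M vol. d x y \<le> ennreal r \<longrightarrow> \<bar>f x - f y\<bar> \<le> K * r)}"

lemma coarse_sphere_Linf: "coarse_sphere r K \<subseteq> Linf vol"
  by (auto simp: coarse_sphere_def)

lemma coarse_sphere_minus: "f \<in> coarse_sphere r K \<Longrightarrow> (\<lambda>x. - f x) \<in> coarse_sphere r K"
  by (simp add: coarse_sphere_def Lnorm_minus Linf_minus abs_minus_commute)

lemma coarse_sphere_zero: "(\<lambda>_. 0) \<notin> coarse_sphere r K"
  by (simp add: coarse_sphere_def Lnorm_def Linf_norm_zero)

lemma coarse_sphere_closed: "closedin (Linf_topology vol) (coarse_sphere r K)"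
  unfolding Linf_topology_def
proof (rule closedin_seminormI[OF coarse_sphere_Linf order_refl order_refl])
  fix f assume f: "f \<in> Linf vol" and lim: "\<And>e. e > 0 \<Longrightarrow> \<exists>h\<in>coarse_sphere r K. Lnorm vol (\<lambda>x. h x - f x) < e"
  obtain h Q where h: "\<And>n. h n \<in> coarse_sphere r K" "\<And>n. \<bar>Lnorm vol (h n) - Lnorm vol f\<bar> \<le> 1 / real (Suc n)"
    and Q: "Q \<in> null_sets vol" "\<And>n x. x \<in> space vol \<Longrightarrow> x \<notin> Q \<Longrightarrow> \<bar>h n x - f x\<bar> \<le> 1 / real (Suc n)"
    by (rule Lnorm_limit[OF coarse_sphere_Linf f lim]) (blast, rule that)
  have h1: "Lnorm vol (h n) = 1" "AE (x, y) in vol \<Otimes>\<^sub>M vol. d x y \<le> ennreal r \<longrightarrow> \<bar>h n x - h n y\<bar> \<le> K * r" for n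
    using h(1)[of n] by (auto simp: coarse_sphere_def)
  have "\<bar>1 - Lnorm vol f\<bar> \<le> 0"
    by (rule le_of_harmonic_slack[of _ _ 1]) (use h(2) h1(1) in simp)
  moreover have "AE z in vol \<Otimes>\<^sub>M vol. \<forall>n. d (fst z) (snd z) \<le> ennreal r \<longrightarrow> \<bar>h n (fst z) - h n (snd z)\<bar> \<le> K * r"
    unfolding AE_all_countable using h1(2) by (simp add: case_prod_unfold)
  then have "AE (x, y) in vol \<Otimes>\<^sub>M vol. d x y \<le> ennreal r \<longrightarrow> \<bar>f x - f y\<bar> \<le> K * r"
    using AE_pair_off[OF Q(1)]
  proof eventually_elim
    case (elim z)
    obtain x y where z: "z = (x, y)" by (cases z)
    have "\<bar>f x - f y\<bar> \<le> K * r" if dxy: "d x y \<le> ennreal r"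
    proof (rule le_of_harmonic_slack[of _ _ 2])
      fix n
      have "\<bar>h n x - f x\<bar> \<le> 1 / real (Suc n)" "\<bar>h n y - f y\<bar> \<le> 1 / real (Suc n)" "\<bar>h n x - h n y\<bar> \<le> K * r"
        using elim Q(2) dxy by (auto simp: z)
      moreover have "2 / real (Suc n) = 1 / real (Suc n) + 1 / real (Suc n)" by (simp add: field_simps)
      ultimately show "\<bar>f x - f y\<bar> \<le> K * r + 2 / real (Suc n)" by linarith
    qed
    then show ?case by (simp add: z)
  qed
  ultimately show "f \<in> coarse_sphere r K" using f by (simp add: coarse_sphere_def)
qed

lemma power_card: "(r::real) ^ CARD('k) = r * r ^ (CARD('k) - 1)"
  using zero_less_card_finite[where 'a='k] by (cases "CARD('k)") auto

lemma coarse_sphere_rayleigh: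
  assumes f: "f \<in> coarse_sphere r K" and r: "r > 0" and K: "K \<ge> 0"
  shows "graphon_rayleigh vol (geometric_graphon A g r) f \<le> ennreal (K / r ^ (CARD('k) - 1))"
proof -
  have fL: "f \<in> Linf vol" and f1: "Lnorm vol f = 1"
    and ae: "AE (x, y) in vol \<Otimes>\<^sub>M vol. d x y \<le> ennreal r \<longrightarrow> \<bar>f x - f y\<bar> \<le> K * r"
    using f by (auto simp: coarse_sphere_def)
  have sets: "sets (vol \<Otimes>\<^sub>M vol) = sets (borel \<Otimes>\<^sub>M borel)" by (intro sets_pair_measure_cong sets_vol)
  have [measurable]: "(\<lambda>z. d (fst z) (snd z)) \<in> borel_measurable (borel \<Otimes>\<^sub>M borel)"
    using measurable_dist by (simp add: case_prod_unfold)
  have [measurable]: "f \<in> borel_measurable borel" using LinfD(1)[OF fL] by simp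
  have "(\<lambda>(x, y). ennreal (geometric_graphon A g r x y * \<bar>f x - f y\<bar>)) \<in> borel_measurable (vol \<Otimes>\<^sub>M vol)"
    unfolding measurable_cong_sets[OF sets refl] graphon_eq[OF r] case_prod_unfold by measurable
  moreover have "AE (x, y) in vol \<Otimes>\<^sub>M vol. ennreal (geometric_graphon A g r x y * \<bar>f x - f y\<bar>) \<le> ennreal (K / r ^ (CARD('k) - 1))"
    using ae
  proof eventually_elim
    case (elim z)
    obtain x y where z: "z = (x, y)" by (cases z)
    have "\<bar>f x - f y\<bar> / r ^ CARD('k) \<le> K / r ^ (CARD('k) - 1)" if "d x y \<le> ennreal r"
    proof -
      have "\<bar>f x - f y\<bar> / r ^ CARD('k) \<le> (K * r) / r ^ CARD('k)"
        using elim that r by (intro divide_right_mono) (auto simp: z)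
      also have "\<dots> = K / r ^ (CARD('k) - 1)" using r unfolding power_card by simp
      finally show ?thesis .
    qed
    then show ?case using K r by (auto simp: z graphon_eq[OF r] intro!: ennreal_leI)
  qed
  ultimately have "esssup (vol \<Otimes>\<^sub>M vol) (\<lambda>(x, y). ennreal (geometric_graphon A g r x y * \<bar>f x - f y\<bar>)) \<le> ennreal (K / r ^ (CARD('k) - 1))"
    by (intro esssup_I) (auto simp: case_prod_unfold)
  moreover have "x / 1 = x" for x :: ennreal using ennreal_mult_divide_eq[of 1 x] by simp
  ultimately show ?thesis using Linf_norm_eq[OF fL] f1 by (simp add: graphon_rayleigh_def)
qed

lemma normalise_coarse_sphere:
  assumes f: "f \<in> Linf vol" "Lnorm vol f > 0" and r: "r > 0" and K: "K \<ge> 0"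
    and R: "graphon_rayleigh vol (geometric_graphon A g r) f \<le> ennreal (K / r ^ (CARD('k) - 1))"
  shows "normalise vol f \<in> coarse_sphere r K"
proof -
  let ?E = "esssup (vol \<Otimes>\<^sub>M vol) (\<lambda>(x, y). ennreal (geometric_graphon A g r x y * \<bar>f x - f y\<bar>))"
  have pos: "ennreal (Lnorm vol f) \<noteq> 0" using f(2) by simp
  have "?E = ?E / ennreal (Lnorm vol f) * ennreal (Lnorm vol f)"
    using pos by (simp add: ennreal_divide_times)
  also have "\<dots> \<le> ennreal (K / r ^ (CARD('k) - 1)) * ennreal (Lnorm vol f)"
    using R unfolding graphon_rayleigh_def Linf_norm_eq[OF f(1)] by (rule mult_right_mono) simp
  also have "\<dots> = ennreal (K / r ^ (CARD('k) - 1) * Lnorm vol f)"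
    by (rule ennreal_mult''[symmetric]) simp
  finally have E: "?E \<le> ennreal (K / r ^ (CARD('k) - 1) * Lnorm vol f)" .
  have "AE (x, y) in vol \<Otimes>\<^sub>M vol. d x y \<le> ennreal r \<longrightarrow> \<bar>normalise vol f x - normalise vol f y\<bar> \<le> K * r"
    using esssup_AE[of "\<lambda>(x, y). ennreal (geometric_graphon A g r x y * \<bar>f x - f y\<bar>)" "vol \<Otimes>\<^sub>M vol"]
  proof eventually_elim
    case (elim z)
    obtain x y where z: "z = (x, y)" by (cases z)
    have "\<bar>normalise vol f x - normalise vol f y\<bar> \<le> K * r" if dxy: "d x y \<le> ennreal r"
    proof -
      have "ennreal (\<bar>f x - f y\<bar> / r ^ CARD('k)) \<le> ennreal (K / r ^ (CARD('k) - 1) * Lnorm vol f)"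
        using order_trans[OF elim E] dxy by (simp add: z graphon_eq[OF r])
      then have "\<bar>f x - f y\<bar> / r ^ CARD('k) \<le> K / r ^ (CARD('k) - 1) * Lnorm vol f"
        using K r by (subst (asm) ennreal_le_iff) auto
      then have "\<bar>f x - f y\<bar> \<le> K * r * Lnorm vol f"
        using r unfolding power_card by (simp add: field_simps)
      moreover note normalise_sub[of vol f x y]
      ultimately show ?thesis using f(2) by (simp add: abs_divide pos_divide_le_eq)
    qed
    then show ?case by (simp add: z)
  qed
  then show ?thesis using normalise_Linf[OF f] by (simp add: coarse_sphere_def)
qed

text \<open>A function vanishing almost everywhere need not be the zero function, and its weak
  differential is a choice; this shows that it has seminorm 0 and thus cannot belong to a
  competitor.\<close>

lemma gradient_null:
  assumes "f \<in> Linf vol" "Lnorm vol f = 0" shows "f \<in> W1inf A g vol" "gradient_Linf_norm A g vol f = 0"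
proof -
  have "AE x in vol. f x = 0" using Lnorm_AE[OF assms(1)] by eventually_elim (simp add: assms(2))
  then obtain N where N: "{x \<in> space vol. \<not> f x = 0} \<subseteq> N" "emeasure vol N = 0" "N \<in> sets vol" by (rule AE_E)
  have "f x = 0" if "x \<notin> N" for x using N(1) that by auto
  then have "N \<in> null_sets vol" "geo_lipschitz N 0 f" using N(2,3) by (simp_all add: geo_lipschitz_def null_sets_def)
  from lipschitz_W1inf[OF assms(1) this order_refl]
  show "f \<in> W1inf A g vol" "gradient_Linf_norm A g vol f = 0" by auto
qed

text \<open>No error term arises: a function that is \<open>L\<close>-Lipschitz off a null set
  varies by at most \<open>L * r\<close> over distances up to \<open>r\<close>. The competitor for
  the graphon is the entire \<open>coarse_sphere\<close>, whose genus is at least that of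
  \<open>S\<close> because normalisation maps \<open>S\<close> into it.\<close>

lemma eigenvalue_upper:
  assumes r: "r > 0"
  shows "ennreal (r ^ (CARD('k) - 1)) * graphon_eigenvalue vol (geometric_graphon A g r) m \<le> manifold_eigenvalue A g vol m"
    (is "?a \<le> _")
proof (rule ccontr)
  let ?N = "\<lambda>f. Linf_norm vol f + gradient_Linf_norm A g vol f"
  assume "\<not> ?a \<le> manifold_eigenvalue A g vol m"
  then have less: "variational_eigenvalue (W1inf_topology A g vol)
       (\<lambda>f. gradient_Linf_norm A g vol f / Linf_norm vol f) m < ?a" by (simp add: manifold_eigenvalue_def)
  obtain S c where S: "S \<noteq> {}" "closedin (W1inf_topology A g vol) S" "\<And>f. f \<in> S \<Longrightarrow> (\<lambda>x. - f x) \<in> S" "(\<lambda>_. 0) \<notin> S"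
    "enat m \<le> genus (W1inf_topology A g vol) S" "\<And>f. f \<in> S \<Longrightarrow> gradient_Linf_norm A g vol f / Linf_norm vol f \<le> c" "c < ?a"
    by (rule variational_eigenvalue_lessE[OF less]) (rule that)
  obtain L where L: "c = ennreal L" "L \<ge> 0" using S(7) by (cases c) auto
  have SW: "S \<subseteq> W1inf A g vol"
    using S(2) unfolding W1inf_topology_def closedin_def topspace_seminorm_topology by simp
  have SL: "S \<subseteq> Linf vol" "W1inf A g vol \<subseteq> Linf vol" using SW W1infD(1) by blast+
  have zero: "(\<lambda>_. 0) \<in> W1inf A g vol"
    by (rule gradient_null(1)) (simp_all add: Linf_def Lnorm_def Linf_norm_zero)
  have pos: "Lnorm vol f > 0" if f: "f \<in> S" for f
  proof (rule ccontr)
    assume "\<not> Lnorm vol f > 0"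
    then have 0: "Lnorm vol f = 0" using Lnorm_nonneg[of vol f] by linarith
    have fL: "f \<in> Linf vol" using f SL by blast
    have "?N f = 0" using gradient_null(2)[OF fL 0] Linf_norm_eq[OF fL] 0 by simp
    then show False using closed_avoid_zero[OF S(2)[unfolded W1inf_topology_def] S(4) zero f] by simp
  qed
  have maps: "normalise vol f \<in> coarse_sphere r L" if f: "f \<in> S" for f
  proof -
    have fL: "f \<in> Linf vol" using f SL by blast
    note p = pos[OF f]
    have "gradient_Linf_norm A g vol f = gradient_Linf_norm A g vol f / ennreal (Lnorm vol f) * ennreal (Lnorm vol f)"
      using p by (simp add: ennreal_divide_times)
    also have "\<dots> \<le> ennreal L * ennreal (Lnorm vol f)"
      using S(6)[OF f] unfolding L(1) Linf_norm_eq[OF fL] by (rule mult_right_mono) simp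
    also have "\<dots> = ennreal (L * Lnorm vol f)" by (simp add: ennreal_mult'')
    finally have grad: "gradient_Linf_norm A g vol f \<le> ennreal (L * Lnorm vol f)" .
    obtain N where N: "N \<in> null_sets vol" "geo_lipschitz N (L * Lnorm vol f) f"
      by (rule W1inf_lipschitz[OF subsetD[OF SW f] grad]) (use L(2) in simp, rule that)
    have "AE (x, y) in vol \<Otimes>\<^sub>M vol. d x y \<le> ennreal r \<longrightarrow> \<bar>normalise vol f x - normalise vol f y\<bar> \<le> L * r"
      using AE_pair_off[OF N(1)]
    proof eventually_elim
      case (elim z)
      obtain x y where z: "z = (x, y)" by (cases z)
      have "\<bar>normalise vol f x - normalise vol f y\<bar> \<le> L * r" if dxy: "d x y \<le> ennreal r"
      proof -
        have "dr x y \<le> r" by (rule enn2real_leI) (use dxy r in auto)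
        moreover have "d x y < top" using dxy ennreal_less_top by (rule order_le_less_trans)
        then have "\<bar>f x - f y\<bar> \<le> L * Lnorm vol f * dr x y" using N(2) elim by (simp add: z geo_lipschitz_def)
        moreover have "L * Lnorm vol f * dr x y \<le> L * Lnorm vol f * r"
          using L(2) calculation(1) by (intro mult_left_mono) auto
        moreover note normalise_sub[of vol f x y]
        ultimately show ?thesis using p by (simp add: abs_divide pos_divide_le_eq ac_simps)
      qed
      then show ?case by (simp add: z)
    qed
    then show ?thesis using normalise_Linf[OF fL p] by (simp add: coarse_sphere_def)
  qed
  have cont: "continuous_map (subtopology (W1inf_topology A g vol) S) (subtopology (Linf_topology vol) (coarse_sphere r L)) (normalise vol)"
    unfolding W1inf_topology_def
    by (rule normalise_continuous[OF SL(2) SW pos _ maps coarse_sphere_Linf]) auto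
  have "graphon_eigenvalue vol (geometric_graphon A g r) m \<le> ennreal (L / r ^ (CARD('k) - 1))"
    unfolding graphon_eigenvalue_def
  proof (rule variational_eigenvalue_le[OF _ coarse_sphere_closed coarse_sphere_minus coarse_sphere_zero])
    show "coarse_sphere r L \<noteq> {}" using S(1) maps by blast
    show "enat m \<le> genus (Linf_topology vol) (coarse_sphere r L)"
      by (rule order_trans[OF S(5) genus_mono[OF cont normalise_odd maps]])
    show "graphon_rayleigh vol (geometric_graphon A g r) f \<le> ennreal (L / r ^ (CARD('k) - 1))"
      if "f \<in> coarse_sphere r L" for f by (rule coarse_sphere_rayleigh[OF that r L(2)])
  qed
  then have "?a \<le> ennreal (r ^ (CARD('k) - 1)) * ennreal (L / r ^ (CARD('k) - 1))" by (rule mult_left_mono) simp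
  also have "\<dots> = ennreal L" using r L(2) by (simp flip: ennreal_mult)
  finally show False using S(7) L(1) by simp
qed

end

section \<open>From competitors for the graphon to competitors on the manifold\<close>

context closed_manifold begin

text \<open>The norm is bounded below instead of being fixed, as the approximating map preserves
  norms only up to an error; the lower bound \<open>\<rho>\<close> keeps the Rayleigh quotient at
  most \<open>K / \<rho>\<close>.\<close>

definition lipschitz_shell :: "real \<Rightarrow> real \<Rightarrow> ('a \<Rightarrow> real) set" where
  "lipschitz_shell \<rho> K = {f \<in> Linf vol. \<rho> \<le> Lnorm vol f \<and> (\<exists>N\<in>null_sets vol. geo_lipschitz N K f)}"

lemma lipschitz_shell_W1inf:
  assumes "K \<ge> 0" "f \<in> lipschitz_shell \<rho> K"
  shows "f \<in> W1inf A g vol" "gradient_Linf_norm A g vol f \<le> ennreal K"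
proof -
  obtain N where "f \<in> Linf vol" "N \<in> null_sets vol" "geo_lipschitz N K f"
    using assms(2) by (auto simp: lipschitz_shell_def)
  from lipschitz_W1inf[OF this assms(1)]
  show "f \<in> W1inf A g vol" "gradient_Linf_norm A g vol f \<le> ennreal K" by auto
qed

lemma lipschitz_shell_minus: "f \<in> lipschitz_shell \<rho> K \<Longrightarrow> (\<lambda>x. - f x) \<in> lipschitz_shell \<rho> K"
proof -
  assume f: "f \<in> lipschitz_shell \<rho> K"
  then obtain N where N: "N \<in> null_sets vol" "geo_lipschitz N K f" by (auto simp: lipschitz_shell_def)
  have "\<bar>- f x - - f y\<bar> = \<bar>f x - f y\<bar>" for x y by simp
  then have "geo_lipschitz N K (\<lambda>x. - f x)" using N(2) by (simp only: geo_lipschitz_def)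
  then show ?thesis using f N(1) by (auto simp: lipschitz_shell_def Lnorm_minus Linf_minus)
qed

lemma lipschitz_shell_zero: "\<rho> > 0 \<Longrightarrow> (\<lambda>_. 0) \<notin> lipschitz_shell \<rho> K"
  by (simp add: lipschitz_shell_def Lnorm_def Linf_norm_zero)

lemma lipschitz_shell_closed:
  assumes K: "K \<ge> 0" shows "closedin (W1inf_topology A g vol) (lipschitz_shell \<rho> K)"
  unfolding W1inf_topology_def
proof (rule closedin_seminormI[where M=vol])
  show "lipschitz_shell \<rho> K \<subseteq> W1inf A g vol" using lipschitz_shell_W1inf(1)[OF K] by blast
  show "W1inf A g vol \<subseteq> Linf vol" using W1infD(1) by blast
  fix f assume fW: "f \<in> W1inf A g vol"
    and lim: "\<And>e. e > 0 \<Longrightarrow> \<exists>h\<in>lipschitz_shell \<rho> K. Lnorm vol (\<lambda>x. h x - f x) < e"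
  have f: "f \<in> Linf vol" by (rule W1infD(1)[OF fW])
  have sub: "lipschitz_shell \<rho> K \<subseteq> Linf vol" by (auto simp: lipschitz_shell_def)
  obtain h Q where h: "\<And>n. h n \<in> lipschitz_shell \<rho> K" "\<And>n. \<bar>Lnorm vol (h n) - Lnorm vol f\<bar> \<le> 1 / real (Suc n)"
    and Q: "Q \<in> null_sets vol" "\<And>n x. x \<in> space vol \<Longrightarrow> x \<notin> Q \<Longrightarrow> \<bar>h n x - f x\<bar> \<le> 1 / real (Suc n)"
    by (rule Lnorm_limit[OF sub f lim]) (blast, rule that)
  have "\<exists>N. N \<in> null_sets vol \<and> geo_lipschitz N K (h n)" for n using h(1)[of n] by (auto simp: lipschitz_shell_def)
  then obtain N where N: "\<And>n. N n \<in> null_sets vol" "\<And>n. geo_lipschitz (N n) K (h n)" by metis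
  have ge: "\<rho> \<le> Lnorm vol (h n)" for n using h(1)[of n] by (simp add: lipschitz_shell_def)
  have "\<rho> \<le> Lnorm vol f"
  proof (rule le_of_harmonic_slack)
    show "\<rho> \<le> Lnorm vol f + 1 / real (Suc n)" for n using ge[of n] h(2)[of n] by linarith
  qed
  moreover have "Q \<union> (\<Union>n. N n) \<in> null_sets vol" by (intro null_sets.Un Q(1) null_sets_UN N(1))
  moreover have "geo_lipschitz (Q \<union> (\<Union>n. N n)) K f"
    unfolding geo_lipschitz_def
  proof (intro allI impI)
    fix x y assume xy: "x \<notin> Q \<union> (\<Union>n. N n)" "y \<notin> Q \<union> (\<Union>n. N n)" "d x y < top"
    show "\<bar>f x - f y\<bar> \<le> K * dr x y"
    proof (rule le_of_harmonic_slack[of _ _ 2])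
      fix n
      have "\<bar>h n x - h n y\<bar> \<le> K * dr x y" using N(2)[of n] xy by (auto simp: geo_lipschitz_def)
      moreover have "\<bar>h n x - f x\<bar> \<le> 1 / real (Suc n)" "\<bar>h n y - f y\<bar> \<le> 1 / real (Suc n)"
        using Q(2) xy by auto
      moreover have "2 / real (Suc n) = 1 / real (Suc n) + 1 / real (Suc n)" by (simp add: field_simps)
      ultimately show "\<bar>f x - f y\<bar> \<le> K * dr x y + 2 / real (Suc n)" by linarith
    qed
  qed
  ultimately show "f \<in> lipschitz_shell \<rho> K" using f unfolding lipschitz_shell_def by blast
qed auto

text \<open>The total boundedness behind Arzela-Ascoli: a function is encoded by its rounded values
  at finitely many points, only finitely many codes occur by the uniform bound, and one
  representative per code is kept. Representatives are indices in \<open>C\<close>, so nothing is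
  asked of how \<open>G\<close> depends on them.\<close>

lemma finite_net:
  fixes G :: "'c \<Rightarrow> 'a \<Rightarrow> real"
  assumes G: "\<And>f. f \<in> C \<Longrightarrow> geo_lipschitz {} K (G f)" "\<And>f x. f \<in> C \<Longrightarrow> \<bar>G f x\<bar> \<le> B"
    and e: "e > 0" and K: "K \<ge> 0"
  obtains J where "finite J" "J \<subseteq> C" "\<And>f. f \<in> C \<Longrightarrow> \<exists>j\<in>J. \<forall>x. \<bar>G f x - G j x\<bar> \<le> e"
proof -
  \<comment> \<open>Equal codes give a difference below \<open>e / 2\<close> at the sample points;
    passing to other points costs \<open>K * \<epsilon> \<le> e / 4\<close> for each of the two
    functions.\<close>
  define \<epsilon> where "\<epsilon> = e / (4 * (K + 1))"
  have \<epsilon>: "\<epsilon> > 0" "K * \<epsilon> \<le> e / 4" using e K by (auto simp: \<epsilon>_def field_simps)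
  obtain P where P: "finite P" "UNIV \<subseteq> (\<Union>p\<in>P. {y. d p y < ennreal \<epsilon>})"
  proof (rule compactE_image[OF compact_UNIV, of UNIV "\<lambda>p. {y. d p y < ennreal \<epsilon>}"])
    show "open {y. d p y < ennreal \<epsilon>}" for p by (rule open_geo_ball)
    have "p \<in> {y. d p y < ennreal \<epsilon>}" for p using \<epsilon>(1) by simp
    then show "UNIV \<subseteq> (\<Union>p. {y. d p y < ennreal \<epsilon>})" by blast
  qed (rule that)
  define code where "code f = restrict (\<lambda>p. \<lfloor>G f p / (e/2)\<rfloor>) P" for f
  have "code ` C \<subseteq> Pi\<^sub>E P (\<lambda>_. {\<lfloor>- B / (e/2)\<rfloor>..\<lfloor>B / (e/2)\<rfloor>})"
  proof (rule image_subsetI)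
    fix f assume f: "f \<in> C"
    have "- B \<le> G f p \<and> G f p \<le> B" for p using G(2)[OF f, of p] by linarith
    then have "\<lfloor>G f p / (e/2)\<rfloor> \<in> {\<lfloor>- B / (e/2)\<rfloor>..\<lfloor>B / (e/2)\<rfloor>}" for p
      using e unfolding atLeastAtMost_iff by (intro conjI floor_mono divide_right_mono) auto
    then show "code f \<in> Pi\<^sub>E P (\<lambda>_. {\<lfloor>- B / (e/2)\<rfloor>..\<lfloor>B / (e/2)\<rfloor>})"
      unfolding code_def by (intro restrict_PiE_iff[THEN iffD2] ballI)
  qed
  then have fin: "finite (code ` C)" by (rule finite_subset) (intro finite_PiE P(1), simp)
  obtain J where J: "J \<subseteq> C" "finite J" "code ` C = code ` J"
    using finite_subset_image[OF fin order_refl] by blast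
  show ?thesis
  proof (rule that[OF J(2,1)])
    fix f assume f: "f \<in> C"
    then obtain j where j: "j \<in> J" "code f = code j" using J(3) by blast
    have jC: "j \<in> C" using j(1) J(1) by blast
    have "\<bar>G f x - G j x\<bar> \<le> e" for x
    proof -
      obtain p where p: "p \<in> P" "d p x < ennreal \<epsilon>" using P(2) by blast
      have "\<lfloor>G f p / (e/2)\<rfloor> = \<lfloor>G j p / (e/2)\<rfloor>" using fun_cong[OF j(2), of p] p(1) by (simp add: code_def)
      then have "\<bar>G f p / (e/2) - G j p / (e/2)\<bar> < 1" by linarith
      then have "G f p / (e/2) - G j p / (e/2) < 1" "G j p / (e/2) - G f p / (e/2) < 1" by linarith+
      then have "G f p * 2 < e + G j p * 2" "G j p * 2 < e + G f p * 2" using e by (simp_all add: field_simps)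
      then have "\<bar>G f p - G j p\<bar> < e / 2" unfolding abs_less_iff by linarith
      moreover have "\<bar>G f p - G f x\<bar> \<le> K * \<epsilon>" "\<bar>G j p - G j x\<bar> \<le> K * \<epsilon>"
        using p(2) \<epsilon>(1) by (auto intro!: geo_lipschitz_bound G(1) f jC K)
      ultimately show ?thesis using \<epsilon>(2) by linarith
    qed
    then show "\<exists>j\<in>J. \<forall>x. \<bar>G f x - G j x\<bar> \<le> e" using j(1) by blast
  qed
qed

lemma geo_lipschitz_sum:
  assumes G: "\<And>j. j \<in> J \<Longrightarrow> geo_lipschitz {} K (G j)"
  shows "geo_lipschitz {} ((\<Sum>j\<in>J. \<bar>c j\<bar>) * K) (\<lambda>x. \<Sum>j\<in>J. c j * G j x)"
  unfolding geo_lipschitz_def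
proof (intro allI impI)
  fix x y assume dxy: "d x y < top"
  have "\<bar>(\<Sum>j\<in>J. c j * G j x) - (\<Sum>j\<in>J. c j * G j y)\<bar> = \<bar>\<Sum>j\<in>J. c j * (G j x - G j y)\<bar>"
    by (simp add: sum_subtractf algebra_simps)
  also have "\<dots> \<le> (\<Sum>j\<in>J. \<bar>c j * (G j x - G j y)\<bar>)" by (rule sum_abs)
  also have "\<dots> \<le> (\<Sum>j\<in>J. \<bar>c j\<bar> * (K * dr x y))"
    using G dxy by (intro sum_mono) (auto simp: abs_mult geo_lipschitz_def intro!: mult_left_mono)
  also have "\<dots> = (\<Sum>j\<in>J. \<bar>c j\<bar>) * K * dr x y" by (simp add: sum_distrib_right mult.assoc)
  finally show "\<bar>(\<Sum>j\<in>J. c j * G j x) - (\<Sum>j\<in>J. c j * G j y)\<bar> \<le> (\<Sum>j\<in>J. \<bar>c j\<bar>) * K * dr x y" .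
qed

lemma abs_sum_bound:
  fixes c :: "'c \<Rightarrow> real"
  assumes "\<And>j. j \<in> J \<Longrightarrow> \<bar>t j\<bar> \<le> B"
  shows "\<bar>\<Sum>j\<in>J. c j * t j\<bar> \<le> (\<Sum>j\<in>J. \<bar>c j\<bar>) * B"
proof -
  have "\<bar>\<Sum>j\<in>J. c j * t j\<bar> \<le> (\<Sum>j\<in>J. \<bar>c j * t j\<bar>)" by (rule sum_abs)
  also have "\<dots> \<le> (\<Sum>j\<in>J. \<bar>c j\<bar> * B)" using assms by (intro sum_mono) (auto simp: abs_mult intro!: mult_left_mono)
  also have "\<dots> = (\<Sum>j\<in>J. \<bar>c j\<bar>) * B" by (simp add: sum_distrib_right)
  finally show ?thesis .
qed

text \<open>The points violating the bound form an open set by continuity, and a nonempty open set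
  has positive volume.\<close>

lemma AE_everywhere:
  fixes F :: "'a \<Rightarrow> real"
  assumes "continuous_on UNIV F" "AE x in vol. \<bar>F x\<bar> \<le> B" shows "\<bar>F x\<bar> \<le> B"
proof (rule ccontr)
  assume x: "\<not> \<bar>F x\<bar> \<le> B"
  obtain N where N: "{x \<in> space vol. \<not> \<bar>F x\<bar> \<le> B} \<subseteq> N" "emeasure vol N = 0" "N \<in> sets vol"
    using assms(2) by (rule AE_E)
  have "open {x. B < \<bar>F x\<bar>}"
    by (rule open_Collect_less[OF continuous_on_const continuous_on_rabs[OF assms(1)]])
  then obtain p where "B < \<bar>F p\<bar>" "p \<notin> N"
  proof (rule open_avoid_null)
    show "{x. B < \<bar>F x\<bar>} \<noteq> {}" using x unfolding not_le by blast
    show "N \<in> null_sets vol" using N(2,3) by (simp add: null_sets_def)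
  qed (use that in auto)
  moreover from this have "p \<in> {x \<in> space vol. \<not> \<bar>F x\<bar> \<le> B}" by simp
  ultimately show False using N(1) by blast
qed

text \<open>The defect \<open>2 * r\<close> of \<open>coarse_lipschitz\<close> becomes the error
  \<open>2 * K * r\<close> of the Lipschitz approximation. The bound at every point, obtained by
  continuity, is what \<open>finite_net\<close> requires.\<close>

lemma coarse_sphere_approx:
  assumes f: "f \<in> coarse_sphere r K" and r: "r > 0" and K: "K \<ge> 0"
  obtains F where "geo_lipschitz {} K F" "AE x in vol. \<bar>F x - f x\<bar> \<le> 2 * K * r" "\<And>x. \<bar>F x\<bar> \<le> 1 + 2 * K * r"
proof -
  have fL: "f \<in> Linf vol" and f1: "Lnorm vol f = 1"
    and ae: "AE (x, y) in vol \<Otimes>\<^sub>M vol. d x y \<le> ennreal r \<longrightarrow> \<bar>f x - f y\<bar> \<le> K * r"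
    using f by (auto simp: coarse_sphere_def)
  have bd: "AE x in vol. \<bar>f x\<bar> \<le> 1" using Lnorm_AE[OF fL] by (simp add: f1)
  obtain Q where Q: "{x \<in> space vol. \<not> \<bar>f x\<bar> \<le> 1} \<subseteq> Q" "emeasure vol Q = 0" "Q \<in> sets vol"
    using bd by (rule AE_E)
  obtain N where N: "N \<in> null_sets vol"
    "\<And>x y. x \<notin> N \<Longrightarrow> y \<notin> N \<Longrightarrow> d x y < top \<Longrightarrow> \<bar>f x - f y\<bar> \<le> K * (dr x y + 2 * r)"
    by (rule coarse_lipschitz[OF ae r K]) (rule that)
  have NQ: "N \<union> Q \<in> null_sets vol" using N(1) Q(2,3) by (intro null_sets.Un) auto
  obtain F where F: "geo_lipschitz {} K F" "\<And>x. x \<notin> N \<union> Q \<Longrightarrow> \<bar>F x - f x\<bar> \<le> K * (2 * r)"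
  proof (rule lipschitz_extension[OF NQ, of f 1 K "2 * r"])
    show "\<bar>f x\<bar> \<le> 1" if x: "x \<notin> N \<union> Q" for x using Q(1) x by auto
    show "\<bar>f x - f y\<bar> \<le> K * (dr x y + 2 * r)" if xy: "x \<notin> N \<union> Q" "y \<notin> N \<union> Q" "d x y < top" for x y
      using N(2) xy by blast
  qed (use K r that in auto)
  have close: "AE x in vol. \<bar>F x - f x\<bar> \<le> 2 * K * r"
    using AE_not_in[OF NQ] by eventually_elim (use F(2) in \<open>simp add: ac_simps\<close>)
  then have "AE x in vol. \<bar>F x\<bar> \<le> 1 + 2 * K * r" using bd by eventually_elim linarith
  then show ?thesis by (intro that[OF F(1) close] AE_everywhere geo_lipschitz_continuous[OF F(1) K])
qed


text \<open>\<open>T\<close> averages Lipschitz approximations of the points \<open>j\<close> of a finite net with weights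
  supported in the balls of radius \<open>\<tau>\<close> around \<open>j\<close>, and is then antisymmetrised.\<close>

lemma coarse_sphere_map:
  assumes r: "r > 0" and K: "K \<ge> 0"
  obtains T where
    "continuous_map (subtopology (Linf_topology vol) (coarse_sphere r K))
       (subtopology (W1inf_topology A g vol) (lipschitz_shell (1 - (6 * K + 2) * r) K)) T"
    "\<And>f. T (\<lambda>x. - f x) = (\<lambda>x. - T f x)"
    "\<And>f. f \<in> coarse_sphere r K \<Longrightarrow> T f \<in> lipschitz_shell (1 - (6 * K + 2) * r) K"
proof -
  let ?C = "coarse_sphere r K"
  have "\<forall>f\<in>?C. \<exists>F. geo_lipschitz {} K F \<and> (AE x in vol. \<bar>F x - f x\<bar> \<le> 2 * K * r) \<and> (\<forall>x. \<bar>F x\<bar> \<le> 1 + 2 * K * r)"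
  proof
    fix f assume f: "f \<in> ?C"
    show "\<exists>F. geo_lipschitz {} K F \<and> (AE x in vol. \<bar>F x - f x\<bar> \<le> 2 * K * r) \<and> (\<forall>x. \<bar>F x\<bar> \<le> 1 + 2 * K * r)"
      by (rule coarse_sphere_approx[OF f r K]) blast
  qed
  from bchoice[OF this] obtain G where "\<forall>f\<in>?C. geo_lipschitz {} K (G f) \<and>
    (AE x in vol. \<bar>G f x - f x\<bar> \<le> 2 * K * r) \<and> (\<forall>x. \<bar>G f x\<bar> \<le> 1 + 2 * K * r)" ..
  then have G: "\<And>f. f \<in> ?C \<Longrightarrow> geo_lipschitz {} K (G f)"
    "\<And>f. f \<in> ?C \<Longrightarrow> AE x in vol. \<bar>G f x - f x\<bar> \<le> 2 * K * r" "\<And>f x. f \<in> ?C \<Longrightarrow> \<bar>G f x\<bar> \<le> 1 + 2 * K * r"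
    by simp_all
  obtain J where J: "finite J" "J \<subseteq> ?C" "\<And>f. f \<in> ?C \<Longrightarrow> \<exists>j\<in>J. \<forall>x. \<bar>G f x - G j x\<bar> \<le> r"
    by (rule finite_net[where C="?C" and G=G, OF G(1,3) r K]) (assumption+, rule that)
  \<comment> \<open>Two functions whose approximations differ by at most \<open>r\<close> are
    themselves within \<open>2 * K * r + r + 2 * K * r\<close>. The further \<open>r\<close> makes
    the weight of such a net point strictly positive.\<close>
  define \<tau> where "\<tau> = 4 * K * r + 2 * r"
  define \<theta> where "\<theta> k f = max 0 (\<tau> - Lnorm vol (\<lambda>x. f x - k x))" for k f :: "'a \<Rightarrow> real"
  define w where "w j f = \<theta> j f / (\<Sum>i\<in>J. \<theta> i f)" for j f
  \<comment> \<open>Antisymmetric coefficients make \<open>T\<close> odd although neither the net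
    nor the choice of approximations is symmetric.\<close>
  define c where "c j f = (w j f - w j (\<lambda>x. - f x)) / 2" for j f
  define T where "T f x = (\<Sum>j\<in>J. c j f * G j x)" for f x
  have CL: "?C \<subseteq> Linf vol" by (rule coarse_sphere_Linf)
  have JL: "j \<in> Linf vol" if "j \<in> J" for j using that J(2) CL by blast
  have JC: "j \<in> ?C" if "j \<in> J" for j using that J(2) by blast
  have Jlip: "geo_lipschitz {} K (G j)" "\<And>x. \<bar>G j x\<bar> \<le> 1 + 2 * K * r" "AE x in vol. \<bar>G j x - j x\<bar> \<le> 2 * K * r" if "j \<in> J" for j
    using G JC[OF that] by auto
  have \<theta>0: "\<theta> j f \<ge> 0" for j f by (simp add: \<theta>_def)
  have s_pos: "(\<Sum>i\<in>J. \<theta> i f) > 0" if f: "f \<in> ?C" for f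
  proof -
    obtain j where j: "j \<in> J" "\<And>x. \<bar>G f x - G j x\<bar> \<le> r" using J(3)[OF f] by blast
    have "Lnorm vol (\<lambda>x. f x - j x) \<le> 4 * K * r + r"
    proof (rule Lnorm_le)
      show "(\<lambda>x. f x - j x) \<in> borel_measurable vol" using f CL JL[OF j(1)] by (intro LinfD(1) Linf_diff) auto
      show "AE x in vol. \<bar>f x - j x\<bar> \<le> 4 * K * r + r"
        using G(2)[OF f] Jlip(3)[OF j(1)]
      proof eventually_elim
        case (elim x)
        then show ?case using j(2)[of x] by linarith
      qed
    qed (use r K in auto)
    then have "\<theta> j f > 0" using r by (simp add: \<theta>_def \<tau>_def)
    then show ?thesis using sum_pos2[OF J(1) j(1), of "\<lambda>i. \<theta> i f"] \<theta>0 by simp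
  qed
  have w0: "w j f \<ge> 0" for j f using \<theta>0 by (simp add: w_def sum_nonneg)
  have w1: "(\<Sum>j\<in>J. w j f) = 1" if f: "f \<in> ?C" for f
    using s_pos[OF f] by (simp add: w_def flip: sum_divide_distrib)
  \<comment> \<open>Equal to \<open>2 * K * r + \<tau>\<close>: a net point \<open>j\<close> of
    nonzero weight is within \<open>\<tau>\<close> of \<open>f\<close>, and \<open>G j\<close>
    within \<open>2 * K * r\<close> of \<open>j\<close>.\<close>
  define \<sigma> where "\<sigma> = (6 * K + 2) * r"
  have U: "AE x in vol. \<bar>(\<Sum>j\<in>J. w j f * G j x) - f x\<bar> \<le> \<sigma>" if f: "f \<in> ?C" for f
  proof -
    have "AE x in vol. \<forall>j\<in>J. \<bar>G j x - j x\<bar> \<le> 2 * K * r \<and> \<bar>f x - j x\<bar> \<le> Lnorm vol (\<lambda>x. f x - j x)"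
    proof (rule AE_finite_allI[OF J(1)])
      fix j assume j: "j \<in> J"
      have "(\<lambda>x. f x - j x) \<in> Linf vol" using f CL JL[OF j] by (intro Linf_diff) auto
      from Lnorm_AE[OF this] Jlip(3)[OF j]
      show "AE x in vol. \<bar>G j x - j x\<bar> \<le> 2 * K * r \<and> \<bar>f x - j x\<bar> \<le> Lnorm vol (\<lambda>x. f x - j x)"
        by eventually_elim simp
    qed
    then show ?thesis
    proof eventually_elim
      case (elim x)
      have "(\<Sum>j\<in>J. w j f * G j x) - f x = (\<Sum>j\<in>J. w j f * G j x) - (\<Sum>j\<in>J. w j f) * f x"
        by (simp add: w1[OF f])
      also have "\<dots> = (\<Sum>j\<in>J. w j f * (G j x - f x))"
        by (simp add: sum_distrib_right sum_subtractf right_diff_distrib)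
      finally have "\<bar>(\<Sum>j\<in>J. w j f * G j x) - f x\<bar> \<le> (\<Sum>j\<in>J. \<bar>w j f * (G j x - f x)\<bar>)"
        by (simp add: sum_abs)
      also have "\<dots> \<le> (\<Sum>j\<in>J. w j f * \<sigma>)"
      proof (rule sum_mono)
        fix j assume j: "j \<in> J"
        show "\<bar>w j f * (G j x - f x)\<bar> \<le> w j f * \<sigma>"
        proof (cases "Lnorm vol (\<lambda>x. f x - j x) < \<tau>")
          case True
          have "\<bar>G j x - j x\<bar> \<le> 2 * K * r" "\<bar>f x - j x\<bar> \<le> Lnorm vol (\<lambda>x. f x - j x)" using elim j by auto
          moreover have "\<sigma> = 2 * K * r + \<tau>" by (simp add: \<sigma>_def \<tau>_def algebra_simps)
          ultimately have "\<bar>G j x - f x\<bar> \<le> \<sigma>" using True by linarith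
          then show ?thesis using w0[of j f] by (simp add: abs_mult mult_left_mono)
        qed (simp add: w_def \<theta>_def)
      qed
      also have "\<dots> = \<sigma>" using w1[OF f] by (simp flip: sum_distrib_right)
      finally show ?case .
    qed
  qed
  \<comment> \<open>The estimate \<open>U\<close> for \<open>f\<close> and for its negative shows
    that half the difference of the two averages is within \<sigma> of \<open>f\<close>.\<close>
  have close: "AE x in vol. \<bar>T f x - f x\<bar> \<le> \<sigma>" if f: "f \<in> ?C" for f
    using U[OF f] U[OF coarse_sphere_minus[OF f]]
  proof eventually_elim
    case (elim x)
    have eq: "T f x = ((\<Sum>j\<in>J. w j f * G j x) - (\<Sum>j\<in>J. w j (\<lambda>x. - f x) * G j x)) / 2"
      unfolding T_def c_def sum_subtractf[symmetric] sum_divide_distrib by (rule sum.cong) (auto simp: field_simps)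
    have "\<bar>((u::real) - v) / 2 - z\<bar> \<le> \<sigma>" if "\<bar>u - z\<bar> \<le> \<sigma>" "\<bar>v - - z\<bar> \<le> \<sigma>" for u v z
      using that unfolding abs_le_iff by (auto simp: field_simps)
    from this[OF elim] show ?case unfolding eq .
  qed
  \<comment> \<open>Coefficients of total mass at most 1 keep the Lipschitz constant at
    \<open>K\<close>; the whole loss in the Rayleigh quotient therefore comes from the norm.\<close>
  have csum: "(\<Sum>j\<in>J. \<bar>c j f\<bar>) \<le> 1" if f: "f \<in> ?C" for f
  proof -
    have "\<bar>c j f\<bar> \<le> w j f / 2 + w j (\<lambda>x. - f x) / 2" for j
      using w0[of j f] w0[of j "\<lambda>x. - f x"] by (simp add: c_def)
    then have "(\<Sum>j\<in>J. \<bar>c j f\<bar>) \<le> (\<Sum>j\<in>J. w j f / 2 + w j (\<lambda>x. - f x) / 2)" by (rule sum_mono)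
    also have "\<dots> = 1" using w1[OF f] w1[OF coarse_sphere_minus[OF f]]
      by (simp add: sum.distrib flip: sum_divide_distrib)
    finally show ?thesis .
  qed
  have Bpos: "0 \<le> 1 + 2 * K * r" using K r by simp
  \<comment> \<open>On the span of the finitely many approximations, both parts of the
    W^{1,infinity} norm are controlled by the sum of the absolute coefficients. This reduces
    continuity of \<open>T\<close> to that of the coefficients.\<close>
  have comb: "(\<lambda>x. \<Sum>j\<in>J. a j * G j x) \<in> Linf vol"
      "Linf_norm vol (\<lambda>x. \<Sum>j\<in>J. a j * G j x) \<le> ennreal ((\<Sum>j\<in>J. \<bar>a j\<bar>) * (1 + 2 * K * r))"
      "gradient_Linf_norm A g vol (\<lambda>x. \<Sum>j\<in>J. a j * G j x) \<le> ennreal ((\<Sum>j\<in>J. \<bar>a j\<bar>) * K)"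
      "geo_lipschitz {} ((\<Sum>j\<in>J. \<bar>a j\<bar>) * K) (\<lambda>x. \<Sum>j\<in>J. a j * G j x)" for a
  proof -
    have nn: "0 \<le> (\<Sum>j\<in>J. \<bar>a j\<bar>) * K" using K by (simp add: sum_nonneg)
    show lip: "geo_lipschitz {} ((\<Sum>j\<in>J. \<bar>a j\<bar>) * K) (\<lambda>x. \<Sum>j\<in>J. a j * G j x)"
      by (rule geo_lipschitz_sum[OF Jlip(1)])
    have m: "(\<lambda>x. \<Sum>j\<in>J. a j * G j x) \<in> borel_measurable vol"
      using borel_measurable_continuous_onI[OF geo_lipschitz_continuous[OF lip nn]] by simp
    have b: "AE x in vol. \<bar>\<Sum>j\<in>J. a j * G j x\<bar> \<le> (\<Sum>j\<in>J. \<bar>a j\<bar>) * (1 + 2 * K * r)"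
      by (rule AE_I2, rule abs_sum_bound[OF Jlip(2)])
    show L: "(\<lambda>x. \<Sum>j\<in>J. a j * G j x) \<in> Linf vol" by (rule LinfI(1)[OF m b])
    show "Linf_norm vol (\<lambda>x. \<Sum>j\<in>J. a j * G j x) \<le> ennreal ((\<Sum>j\<in>J. \<bar>a j\<bar>) * (1 + 2 * K * r))" by (rule LinfI(2)[OF m b])
    show "gradient_Linf_norm A g vol (\<lambda>x. \<Sum>j\<in>J. a j * G j x) \<le> ennreal ((\<Sum>j\<in>J. \<bar>a j\<bar>) * K)"
      by (rule lipschitz_W1inf(2)[OF L null_sets.empty_sets lip nn])
  qed
  have maps: "T f \<in> lipschitz_shell (1 - \<sigma>) K" if f: "f \<in> ?C" for f
  proof -
    have fL: "f \<in> Linf vol" using f CL by blast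
    have TL: "T f \<in> Linf vol" using comb(1)[of "\<lambda>j. c j f"] by (simp add: T_def[abs_def])
    have "\<bar>T f x - T f y\<bar> \<le> K * dr x y" if dxy: "d x y < top" for x y
    proof -
      have "\<bar>T f x - T f y\<bar> \<le> (\<Sum>j\<in>J. \<bar>c j f\<bar>) * K * dr x y"
        using comb(4)[of "\<lambda>j. c j f"] dxy by (simp add: geo_lipschitz_def T_def)
      also have "\<dots> \<le> 1 * K * dr x y" using csum[OF f] K by (intro mult_right_mono) auto
      finally show ?thesis by simp
    qed
    then have lip: "geo_lipschitz {} K (T f)" by (simp add: geo_lipschitz_def)
    have "Lnorm vol (\<lambda>x. T f x - f x) \<le> \<sigma>"
      by (rule Lnorm_le[OF LinfD(1)[OF Linf_diff[OF TL fL]] close[OF f]]) (use K r in \<open>simp add: \<sigma>_def\<close>)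
    then have "1 - \<sigma> \<le> Lnorm vol (T f)"
      using Lnorm_diff_ge[OF TL fL] f by (simp add: coarse_sphere_def)
    then show ?thesis using TL lip null_sets.empty_sets[of vol] by (auto simp: lipschitz_shell_def)
  qed
  have "c j (\<lambda>x. - f x) = - c j f" for j f
    by (simp only: c_def minus_minus minus_divide_left minus_diff_eq)
  then have odd: "T (\<lambda>x. - f x) = (\<lambda>x. - T f x)" for f
    by (simp add: T_def fun_eq_iff sum_negf)
  have cont: "continuous_map (subtopology (Linf_topology vol) ?C)
       (subtopology (W1inf_topology A g vol) (lipschitz_shell (1 - \<sigma>) K)) T"
    unfolding Linf_topology_def W1inf_topology_def
  proof (rule continuous_map_seminorm[OF order_refl CL order_refl maps])
    show "lipschitz_shell (1 - \<sigma>) K \<subseteq> W1inf A g vol" using lipschitz_shell_W1inf(1)[OF K] by blast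
    fix f and e :: real assume f: "f \<in> ?C" and e: "e > 0"
    have fL: "f \<in> Linf vol" using f CL by blast
    note t = tendsto_near_Lnorm[OF CL fL]
    have t\<theta>: "((\<lambda>h. \<theta> j h) \<longlongrightarrow> \<theta> j f) (near vol ?C f)" if j: "j \<in> J" for j
      unfolding \<theta>_def by (intro tendsto_intros t JL j)
    have t': "((\<lambda>h. Lnorm vol (\<lambda>x. - h x - j x)) \<longlongrightarrow> Lnorm vol (\<lambda>x. - f x - j x)) (near vol ?C f)" if j: "j \<in> J" for j
    proof -
      have "Lnorm vol (\<lambda>x. h x - - j x) = Lnorm vol (\<lambda>x. - h x - j x)" for h
        using Lnorm_minus[of vol "\<lambda>x. h x - - j x"] by simp
      then show ?thesis using t[OF Linf_minus[OF JL[OF j]]] by simp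
    qed
    have t\<theta>': "((\<lambda>h. \<theta> j (\<lambda>x. - h x)) \<longlongrightarrow> \<theta> j (\<lambda>x. - f x)) (near vol ?C f)" if j: "j \<in> J" for j
      unfolding \<theta>_def by (intro tendsto_intros t' j)
    have tc: "((\<lambda>h. c j h) \<longlongrightarrow> c j f) (near vol ?C f)" if j: "j \<in> J" for j
      unfolding c_def w_def
      using s_pos[OF f] s_pos[OF coarse_sphere_minus[OF f]]
      by (intro tendsto_intros t\<theta> t\<theta>' j) auto
    define \<kappa> where "\<kappa> h = (\<Sum>j\<in>J. \<bar>c j h - c j f\<bar>)" for h
    have "((\<lambda>h. \<kappa> h * (1 + 2 * K * r) + \<kappa> h * K) \<longlongrightarrow> (\<Sum>j\<in>J. \<bar>c j f - c j f\<bar>) * (1 + 2 * K * r) + (\<Sum>j\<in>J. \<bar>c j f - c j f\<bar>) * K) (near vol ?C f)"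
      unfolding \<kappa>_def by (intro tendsto_intros tc)
    then have "\<forall>\<^sub>F h in near vol ?C f. \<kappa> h * (1 + 2 * K * r) + \<kappa> h * K < e"
      by (rule order_tendstoD) (use e in simp)
    then show "\<forall>\<^sub>F h in near vol ?C f. Linf_norm vol (\<lambda>x. T h x - T f x) + gradient_Linf_norm A g vol (\<lambda>x. T h x - T f x) < ennreal e"
    proof eventually_elim
      case (elim h)
      have eq: "(\<lambda>x. T h x - T f x) = (\<lambda>x. \<Sum>j\<in>J. (c j h - c j f) * G j x)"
        by (simp add: T_def fun_eq_iff left_diff_distrib sum_subtractf)
      have k0: "0 \<le> \<kappa> h" by (simp add: \<kappa>_def sum_nonneg)
      have "Linf_norm vol (\<lambda>x. T h x - T f x) + gradient_Linf_norm A g vol (\<lambda>x. T h x - T f x)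
          \<le> ennreal (\<kappa> h * (1 + 2 * K * r)) + ennreal (\<kappa> h * K)"
        unfolding eq \<kappa>_def by (intro add_mono comb)
      also have "\<dots> = ennreal (\<kappa> h * (1 + 2 * K * r) + \<kappa> h * K)"
        using k0 K Bpos by (intro ennreal_plus[symmetric] mult_nonneg_nonneg)
      also have "\<dots> < ennreal e" using elim e by (simp only: ennreal_lessI)
      finally show ?case .
    qed
  qed
  show ?thesis by (rule that[OF cont[unfolded \<sigma>_def] odd maps[unfolded \<sigma>_def]])
qed

text \<open>The strict inequality yields a competitor of level at most
  \<open>K / r ^ (CARD('k) - 1)\<close>. Normalisation and the map of
  \<open>coarse_sphere_map\<close> carry it, oddly and continuously, into a shell on which the
  quotient is at most the stated bound; the shell itself is the competitor.\<close>

lemma eigenvalue_lower: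
  assumes r: "r > 0" and K: "K \<ge> 0" and \<rho>: "0 < 1 - (6 * K + 2) * r"
    and less: "ennreal (r ^ (CARD('k) - 1)) * graphon_eigenvalue vol (geometric_graphon A g r) m < ennreal K"
  shows "manifold_eigenvalue A g vol m \<le> ennreal (K / (1 - (6 * K + 2) * r))"
proof -
  let ?\<rho> = "1 - (6 * K + 2) * r" and ?R = "graphon_rayleigh vol (geometric_graphon A g r)"
  have "variational_eigenvalue (Linf_topology vol) ?R m < ennreal (K / r ^ (CARD('k) - 1))"
  proof (rule ccontr)
    assume "\<not> ?thesis"
    then have "ennreal (r ^ (CARD('k) - 1)) * ennreal (K / r ^ (CARD('k) - 1))
        \<le> ennreal (r ^ (CARD('k) - 1)) * graphon_eigenvalue vol (geometric_graphon A g r) m"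
      unfolding graphon_eigenvalue_def by (intro mult_left_mono) auto
    moreover have "ennreal (r ^ (CARD('k) - 1)) * ennreal (K / r ^ (CARD('k) - 1)) = ennreal K"
      using r K by (simp flip: ennreal_mult)
    ultimately show False using less by simp
  qed
  then obtain S c where S: "S \<noteq> {}" "closedin (Linf_topology vol) S" "\<And>f. f \<in> S \<Longrightarrow> (\<lambda>x. - f x) \<in> S" "(\<lambda>_. 0) \<notin> S"
    "enat m \<le> genus (Linf_topology vol) S" "\<And>f. f \<in> S \<Longrightarrow> ?R f \<le> c" "c < ennreal (K / r ^ (CARD('k) - 1))"
    by (rule variational_eigenvalue_lessE) (rule that)
  have SL: "S \<subseteq> Linf vol"
    using S(2) unfolding Linf_topology_def closedin_def topspace_seminorm_topology by simp
  have pos: "Lnorm vol f > 0" if f: "f \<in> S" for f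
  proof -
    have "Linf_norm vol f \<noteq> 0"
      by (rule closed_avoid_zero[OF S(2)[unfolded Linf_topology_def] S(4) _ f]) (simp add: Linf_def Linf_norm_zero)
    then have "Lnorm vol f \<noteq> 0" using Linf_norm_eq[of f vol] f SL by auto
    then show ?thesis using Lnorm_nonneg[of vol f] by linarith
  qed
  have maps: "normalise vol f \<in> coarse_sphere r K" if f: "f \<in> S" for f
    by (rule normalise_coarse_sphere[OF subsetD[OF SL f] pos[OF f] r K])
      (rule order_trans[OF S(6)[OF f] less_imp_le[OF S(7)]])
  have cont: "continuous_map (subtopology (Linf_topology vol) S) (subtopology (Linf_topology vol) (coarse_sphere r K)) (normalise vol)"
    \<comment> \<open>Only the source topology is unfolded: \<open>normalise_continuous\<close> has
      a seminorm topology in the source but \<open>Linf_topology\<close> in the target.\<close>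
    unfolding Linf_topology_def[of vol, THEN arg_cong, of "\<lambda>X. subtopology X S"]
    by (rule normalise_continuous[OF order_refl SL pos order_refl maps coarse_sphere_Linf])
  obtain T where T: "continuous_map (subtopology (Linf_topology vol) (coarse_sphere r K))
       (subtopology (W1inf_topology A g vol) (lipschitz_shell ?\<rho> K)) T"
    "\<And>f. T (\<lambda>x. - f x) = (\<lambda>x. - T f x)" "\<And>f. f \<in> coarse_sphere r K \<Longrightarrow> T f \<in> lipschitz_shell ?\<rho> K"
    by (rule coarse_sphere_map[OF r K]) (rule that)
  show ?thesis
    unfolding manifold_eigenvalue_def
  proof (rule variational_eigenvalue_le[OF _ lipschitz_shell_closed[OF K] lipschitz_shell_minus lipschitz_shell_zero[OF \<rho>]])
    show "lipschitz_shell ?\<rho> K \<noteq> {}" using S(1) maps T(3) by blast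
    show "enat m \<le> genus (W1inf_topology A g vol) (lipschitz_shell ?\<rho> K)"
      by (rule order_trans[OF order_trans[OF S(5) genus_mono[OF cont normalise_odd maps]] genus_mono[OF T]])
    fix f assume f: "f \<in> lipschitz_shell ?\<rho> K"
    then have fL: "f \<in> Linf vol" and f\<rho>: "?\<rho> \<le> Lnorm vol f" by (auto simp: lipschitz_shell_def)
    have "gradient_Linf_norm A g vol f / Linf_norm vol f \<le> ennreal K / ennreal (Lnorm vol f)"
      unfolding Linf_norm_eq[OF fL] by (rule divide_right_mono_ennreal[OF lipschitz_shell_W1inf(2)[OF K f]])
    also have "\<dots> = ennreal (K / Lnorm vol f)" using K f\<rho> \<rho> by (intro divide_ennreal) auto
    also have "\<dots> \<le> ennreal (K / ?\<rho>)" using K f\<rho> \<rho> by (intro ennreal_leI divide_left_mono mult_pos_pos) auto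
    finally show "gradient_Linf_norm A g vol f / Linf_norm vol f \<le> ennreal (K / ?\<rho>)" .
  qed
qed

lemma eigenvalue_limit:
  "((\<lambda>r. ennreal (r ^ (CARD('k) - 1)) * graphon_eigenvalue vol (geometric_graphon A g r) m)
     \<longlongrightarrow> manifold_eigenvalue A g vol m) (at_right 0)" (is "(?a \<longlongrightarrow> ?lam) _")
proof (rule order_tendstoI)
  fix b assume b: "b < ?lam"
  \<comment> \<open>Two values are inserted below the limit: \<open>b'\<close> is the level
    \<open>K\<close> at which the graphon is tested, and the gap up to \<open>b''\<close> absorbs
    the factor 1 / (1 - (6 K + 2) r). Both are finite even if the limit is infinite.\<close>
  obtain b' where b': "b < b'" "b' < ?lam" using dense[OF b] by blast
  obtain b'' where b'': "b' < b''" "b'' < ?lam" using dense[OF b'(2)] by blast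
  obtain K where K: "b' = ennreal K" "K \<ge> 0" using b'' by (cases b') auto
  obtain L where L: "b'' = ennreal L" "L \<ge> 0" using b'' by (cases b'') auto
  have KL: "K < L" using b''(1) K L by (simp add: ennreal_less_iff)
  have "((\<lambda>r. 1 - (6 * K + 2) * r) \<longlongrightarrow> 1 - (6 * K + 2) * 0) (at_right 0)" by (intro tendsto_intros)
  then have "\<forall>\<^sub>F r in at_right 0. 0 < 1 - (6 * K + 2) * r" by (rule order_tendstoD) simp
  moreover have "((\<lambda>r. K / (1 - (6 * K + 2) * r)) \<longlongrightarrow> K / (1 - (6 * K + 2) * 0)) (at_right 0)"
    by (intro tendsto_intros) simp
  then have "\<forall>\<^sub>F r in at_right 0. K / (1 - (6 * K + 2) * r) < L" by (rule order_tendstoD) (use KL in simp)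
  moreover have "\<forall>\<^sub>F r in at_right 0. (0::real) < r" by (rule eventually_at_right_less)
  ultimately show "\<forall>\<^sub>F r in at_right 0. b < ?a r"
  proof eventually_elim
    case (elim r)
    show ?case
    proof (rule ccontr)
      assume "\<not> b < ?a r"
      then have "?a r < ennreal K" using b'(1) K(1) by (simp add: not_less)
      from eigenvalue_lower[OF elim(3) K(2) elim(1) this]
      have "?lam \<le> ennreal L" by (rule order_trans) (use elim(2) in \<open>simp add: ennreal_leI\<close>)
      then show False using b''(2) L(1) by simp
    qed
  qed
next
  fix b assume b: "?lam < b"
  have "\<forall>\<^sub>F r in at_right 0. (0::real) < r" by (rule eventually_at_right_less)
  then show "\<forall>\<^sub>F r in at_right 0. ?a r < b"
    by eventually_elim (rule order_le_less_trans[OF eigenvalue_upper b])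
qed

end

theorem proposition2p12:
  fixes A :: "('a::{t2_space, second_countable_topology}, 'k::finite) chart set"
    and g :: "('a, 'k) metric_tensor"
    and vol :: "'a measure"
  assumes "closed_riemannian_manifold A g"
    and "riemannian_volume A g vol"
  shows "(\<forall>m\<ge>2. ((\<lambda>r. graphon_packing_radius vol (geometric_graphon A g r) m
                        / ennreal (r ^ (CARD('k) - 1)))
                   \<longlongrightarrow> sphere_packing_radius A g m) (at_right 0)) \<and>
         (\<forall>m\<ge>1. ((\<lambda>r. ennreal (r ^ (CARD('k) - 1))
                        * graphon_eigenvalue vol (geometric_graphon A g r) m)
                   \<longlongrightarrow> manifold_eigenvalue A g vol m) (at_right 0))"
proof -
  interpret closed_manifold A g vol by unfold_locales (rule assms)+
  show ?thesis using packing_limit eigenvalue_limit by blast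
qed

end
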